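(* Let $\Omega\subseteq\mathbb{R}^d$ be a bounded, open, connected set with Lipschitz boundary. Suppose that either (i) $d=2$ and $f\in\mathrm{BV}(\Omega)$, or (ii) $d>2$, $f\in L^\infty(\Omega)\cap\mathrm{BV}(\Omega)$, and there exist $p\in[d,\infty]$ and a constant $C>0$ depending only on the domain (in particular, not on $\alpha,\beta$) such that, for all $\alpha,\beta>0$, the solution $u$ of $$\min_{u\in\mathrm{BV}(\Omega)}\ \frac12\|f-u\|_{L^2(\Omega)}^2+\mathrm{TGV}^2_{\beta,\alpha}(u)\qquad(\ast)$$ satisfies $\|u\|_{L^p(\Omega)}\le C\|f\|_{L^p(\Omega)}$. Then there exist $\alpha^\star,\beta^\star>0$ such that whenever $\alpha>\alpha^\star$ and $\beta>\beta^\star$, the solution of $(\ast)$ is equal to $$f^\star:=\operatorname*{argmin}_{\phi\ \text{affine}}\ \|f-\phi\|_{L^2(\Omega)}^2 .$$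
   Context: For an $\mathbb{R}^\ell$-valued distribution $\mathcal T$ on $\Omega$, the Radon norm is $\|\mathcal T\|_{\mathcal M}=\sup\{\langle \mathcal T,v\rangle: v\in C_c^\infty(\Omega;\mathbb{R}^\ell),\ \|v\|_\infty\le 1\}$ (Euclidean norm pointwise; matrices are identified with vectors). $\mathrm{BV}(\Omega)$ is the space of $u\in L^1(\Omega)$ whose distributional derivative $Du$ is a finite Radon measure. $\mathrm{BD}(\Omega)$ is the space of $w\in L^1(\Omega;\mathbb{R}^d)$ whose symmetrised distributional gradient $\mathcal{E}w=\frac12(Dw+Dw^{T})$ is an $\mathbb{R}^{d\times d}$-valued finite Radon measure. For $\alpha,\beta>0$ and $u\in L^1(\Omega)$, $$\mathrm{TGV}^2_{\beta,\alpha}(u)=\min_{w\in\mathrm{BD}(\Omega)}\alpha\|Du-w\|_{\mathcal M}+\beta\|\mathcal{E}w\|_{\mathcal M}.$$ An affine function is $\phi(x)=c\cdot x+e$ with $c\in\mathbb{R}^d$, $e\in\mathbb{R}$. *)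

theory Defs
  imports "HOL-Analysis.Analysis" "HOL-Probability.Essential_Supremum"
begin

section \<open>Domains with Lipschitz boundary\<close>

text \<open>Near each boundary point, after a rotation of the coordinates, the set is the part of a ball
  lying strictly above the graph of a Lipschitz function. The rotation is encoded by the unit vector
  \<open>n\<close> that becomes the vertical axis, and \<open>\<gamma>\<close> lives on the hyperplane orthogonal to \<open>n\<close>.\<close>

definition lipschitz_boundary :: "'a::euclidean_space set \<Rightarrow> bool" where
  "lipschitz_boundary \<Omega> \<longleftrightarrow>
     (\<forall>x0 \<in> frontier \<Omega>. \<exists>r > 0. \<exists>n \<gamma> L. norm n = 1 \<and> lipschitz_on L {y. y \<bullet> n = 0} \<gamma> \<and>
        \<Omega> \<inter> ball x0 r = {x \<in> ball x0 r. \<gamma> (x - (x \<bullet> n) *\<^sub>R n) < x \<bullet> n})"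

section \<open>Test functions and distributions\<close>

primrec Ck :: "nat \<Rightarrow> ('a::euclidean_space \<Rightarrow> 'b::euclidean_space) \<Rightarrow> bool" where
  "Ck 0 f \<longleftrightarrow> continuous_on UNIV f"
| "Ck (Suc k) f \<longleftrightarrow> (\<forall>x. f differentiable (at x)) \<and>
     (\<forall>b \<in> Basis. Ck k (\<lambda>x. frechet_derivative f (at x) b))"

definition smooth :: "('a::euclidean_space \<Rightarrow> 'b::euclidean_space) \<Rightarrow> bool" where
  "smooth f \<longleftrightarrow> (\<forall>k. Ck k f)"

text \<open>Elements of $C_c^\infty(\Omega; V)$ are taken extended by zero to the whole space.\<close>

definition test_functions :: "'a::euclidean_space set \<Rightarrow> ('a \<Rightarrow> 'b::euclidean_space) set" where
  "test_functions \<Omega> =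
     {v. smooth v \<and> compact (closure {x. v x \<noteq> 0}) \<and> closure {x. v x \<noteq> 0} \<subseteq> \<Omega>}"

text \<open>A distribution with values in \<open>'b\<close> is represented by its action on \<open>'b\<close>-valued test
  functions. For \<open>'b = real^'d^'d\<close>, the inner product and norm are the Frobenius ones, i.e. those
  of the matrix read as a vector.\<close>

type_synonym ('a, 'b) distribution = "('a \<Rightarrow> 'b) \<Rightarrow> real"

definition radon_norm ::
  "'a::euclidean_space set \<Rightarrow> ('a, 'b::euclidean_space) distribution \<Rightarrow> ereal" where
  "radon_norm \<Omega> T = (SUP v \<in> {v \<in> test_functions \<Omega>. \<forall>x. norm (v x) \<le> 1}. ereal (T v))"

text \<open>A finite vector-valued Radon measure on \<open>\<Omega>\<close> is given in its polar form \<open>\<sigma> M\<close>, with \<open>M\<close> a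
  finite positive Borel measure on \<open>\<Omega>\<close> and \<open>\<sigma>\<close> an \<open>M\<close>-integrable vector density. As \<open>\<Omega>\<close> is open in
  a Euclidean space, finite Borel measures on it are automatically Radon.\<close>

definition finite_radon_measure ::
  "'a::euclidean_space set \<Rightarrow> ('a, 'b::euclidean_space) distribution \<Rightarrow> bool" where
  "finite_radon_measure \<Omega> T \<longleftrightarrow>
     (\<exists>M \<sigma>. finite_measure M \<and> sets M = sets (restrict_space borel \<Omega>) \<and> integrable M \<sigma> \<and>
        (\<forall>v \<in> test_functions \<Omega>. T v = (LINT x|M. \<sigma> x \<bullet> v x)))"

definition distr_of_fun ::
  "'a::euclidean_space set \<Rightarrow> ('a \<Rightarrow> 'b::euclidean_space) \<Rightarrow> ('a, 'b) distribution" where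
  "distr_of_fun \<Omega> w v = (LINT x|lebesgue_on \<Omega>. w x \<bullet> v x)"

definition divergence :: "(real^'d \<Rightarrow> real^'d) \<Rightarrow> real^'d \<Rightarrow> real" where
  "divergence v x = (\<Sum>i\<in>UNIV. frechet_derivative v (at x) (axis i 1) $ i)"

definition distr_grad ::
  "(real^'d) set \<Rightarrow> (real^'d \<Rightarrow> real) \<Rightarrow> (real^'d, real^'d) distribution" where
  "distr_grad \<Omega> u v = - (LINT x|lebesgue_on \<Omega>. u x * divergence v x)"

text \<open>Row \<open>i\<close> of \<open>Dw\<close> is the distributional gradient of the \<open>i\<close>-th component of \<open>w\<close>.\<close>

definition distr_jacobian ::
  "(real^'d) set \<Rightarrow> (real^'d \<Rightarrow> real^'d) \<Rightarrow> (real^'d, real^'d^'d) distribution" where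
  "distr_jacobian \<Omega> w V = (\<Sum>i\<in>UNIV. distr_grad \<Omega> (\<lambda>x. w x $ i) (\<lambda>x. V x $ i))"

definition distr_transpose ::
  "(real^'d, real^'d^'d) distribution \<Rightarrow> (real^'d, real^'d^'d) distribution" where
  "distr_transpose T V = T (\<lambda>x. transpose (V x))"

definition distr_sym_grad ::
  "(real^'d) set \<Rightarrow> (real^'d \<Rightarrow> real^'d) \<Rightarrow> (real^'d, real^'d^'d) distribution" where
  "distr_sym_grad \<Omega> w V =
     1 / 2 * (distr_jacobian \<Omega> w V + distr_transpose (distr_jacobian \<Omega> w) V)"

section \<open>Function spaces\<close>

text \<open>Elements of the function spaces are functions, not classes modulo null sets; values outside
  \<open>\<Omega>\<close> are irrelevant.\<close>

definition Lp_norm :: "'a::euclidean_space set \<Rightarrow> ereal \<Rightarrow> ('a \<Rightarrow> real) \<Rightarrow> ereal" where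
  "Lp_norm \<Omega> p u =
     (if p = \<infinity> then esssup (lebesgue_on \<Omega>) (\<lambda>x. ereal \<bar>u x\<bar>)
      else let q = real_of_ereal p;
               I = (\<integral>\<^sup>+ x. ennreal (\<bar>u x\<bar> powr q) \<partial>lebesgue_on \<Omega>)
           in if I = \<infinity> then \<infinity> else ereal (enn2real I powr (1 / q)))"

definition Lp_space :: "'a::euclidean_space set \<Rightarrow> ereal \<Rightarrow> ('a \<Rightarrow> real) set" where
  "Lp_space \<Omega> p = {u. u \<in> borel_measurable (lebesgue_on \<Omega>) \<and> Lp_norm \<Omega> p u < \<infinity>}"

definition BV :: "(real^'d) set \<Rightarrow> (real^'d \<Rightarrow> real) set" where
  "BV \<Omega> = {u. integrable (lebesgue_on \<Omega>) u \<and> finite_radon_measure \<Omega> (distr_grad \<Omega> u)}"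

definition BD :: "(real^'d) set \<Rightarrow> (real^'d \<Rightarrow> real^'d) set" where
  "BD \<Omega> = {w. integrable (lebesgue_on \<Omega>) w \<and> finite_radon_measure \<Omega> (distr_sym_grad \<Omega> w)}"

section \<open>Total generalised variation and the denoising problem\<close>

text \<open>The minimum over \<open>BD \<Omega>\<close> is attained when it is finite, so its value is the infimum.\<close>

definition TGV2 :: "(real^'d) set \<Rightarrow> real \<Rightarrow> real \<Rightarrow> (real^'d \<Rightarrow> real) \<Rightarrow> ereal" where
  "TGV2 \<Omega> \<beta> \<alpha> u =
     (INF w \<in> BD \<Omega>. ereal \<alpha> * radon_norm \<Omega> (\<lambda>v. distr_grad \<Omega> u v - distr_of_fun \<Omega> w v)
                  + ereal \<beta> * radon_norm \<Omega> (distr_sym_grad \<Omega> w))"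

definition TGV_solution ::
  "(real^'d) set \<Rightarrow> (real^'d \<Rightarrow> real) \<Rightarrow> real \<Rightarrow> real \<Rightarrow> (real^'d \<Rightarrow> real) \<Rightarrow> bool" where
  "TGV_solution \<Omega> f \<beta> \<alpha> =
     is_arg_min (\<lambda>u. ereal (1 / 2) * (Lp_norm \<Omega> 2 (\<lambda>x. f x - u x))^2 + TGV2 \<Omega> \<beta> \<alpha> u)
       (\<lambda>u. u \<in> BV \<Omega>)"

definition affine_function :: "('a::euclidean_space \<Rightarrow> real) \<Rightarrow> bool" where
  "affine_function \<phi> \<longleftrightarrow> (\<exists>c e. \<forall>x. \<phi> x = c \<bullet> x + e)"

definition is_best_affine ::
  "'a::euclidean_space set \<Rightarrow> ('a \<Rightarrow> real) \<Rightarrow> ('a \<Rightarrow> real) \<Rightarrow> bool" where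
  "is_best_affine \<Omega> f = is_arg_min (\<lambda>\<phi>. (Lp_norm \<Omega> 2 (\<lambda>x. f x - \<phi> x))^2) affine_function"

end

theory Submission
  imports Defs
begin

text \<open>Let $f^\star$ be the $L^2$-projection of $f$ onto the affine functions, $g = f - f^\star$ and
  $h = u - f^\star$. As $g$ is orthogonal to every affine $A$,
  $\frac12\|f - u\|^2 = \frac12\|g\|^2 - \langle g, u - A\rangle + \frac12\|h\|^2$, so it suffices to find $A$ with
  $|\langle g, u - A\rangle| \le C(\|Du - w\| + \|\mathcal{E}w\|)$, where $C$ does not depend on $u$ and $w$.

  For smooth $u$, $w$ and $e = x - y$ the derivative of $t \mapsto u(y + te) + (1 - t)\, w(y + te) \cdot e$ is
  $(\nabla u - w) \cdot e + (1 - t)\, e \cdot \mathcal{E}w\, e$. Hence $u(x) - u(y) - w(y) \cdot (x - y)$ is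
  controlled by line integrals of $|\nabla u - w| + |\mathcal{E}w|$ without Korn's inequality, and averaging over $y$ in a
  ball $B$ compares $u$ in $L^1$ with an affine function on sets that are star-shaped with respect to $B$. In
  dimension two, integrating along two families of parallel lines improves this to $L^2$. The inequality
  passes to the limit in a mollification, holds near boundary points by the cone property of Lipschitz
  domains, and is propagated to all of $\Omega$ by connectedness.\<close>

section \<open>Test functions and mollifiers\<close>

text \<open>The inequality sets the thresholds: once both parameters exceed C, the functional TGV
  absorbs the term linear in u - A, and the leftover 1/2 ||h||^2 forces h = 0. How strongly u must
  be controlled is dictated by g. A bounded g can be paired with an L1 estimate of u; in the plane g
  is merely square integrable, so an L2 estimate is required there. The weight 1 + |g| lets one
  gluing argument treat both cases.

  The obstacle is that u and w are known only through suprema over test fields with compact support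
  in Omega, and their mollifications inherit the bounds only away from the boundary. Hence each
  estimate is proved for smooth functions on compact star-shaped sets, with constants built from
  bounds on volume and diameter and from a fixed ball, and an exhaustion then reaches the boundary.
  Near a boundary point that ball cannot be centred at the point; it is displaced into Omega along
  the axis of the cone. The affine functions obtained in this way differ from place to place, which
  is why gluing has to compare them on overlaps.\<close>

lemma Ck_SucI:
  assumes "\<And>x. (f has_derivative f' x) (at x)" "\<And>b. b \<in> Basis \<Longrightarrow> Ck k (\<lambda>x. f' x b)"
  shows "Ck (Suc k) f"
proof -
  have "frechet_derivative f (at x) = f' x" for x
    using frechet_derivative_at[OF assms(1)] by simp
  then show ?thesis
    using assms by (auto simp: differentiable_def)
qed

lemma Ck_Suc_has_derivative:
  "Ck (Suc k) f \<Longrightarrow> (f has_derivative frechet_derivative f (at x)) (at x)"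
  by (simp add: frechet_derivative_works)

lemma Ck_Suc_imp: "Ck (Suc k) f \<Longrightarrow> Ck k f"
proof (induction k arbitrary: f)
  case 0
  then show ?case
    by (auto intro!: continuous_at_imp_continuous_on differentiable_imp_continuous_within)
next
  case (Suc k)
  then show ?case by auto
qed

lemma Ck_const: "Ck k (\<lambda>x. c)"
proof (induction k arbitrary: c)
  case (Suc k)
  show ?case by (rule Ck_SucI[where f' = "\<lambda>_ _. 0"]) (auto intro: Suc derivative_eq_intros)
qed auto

lemma Ck_add: "Ck k f \<Longrightarrow> Ck k g \<Longrightarrow> Ck k (\<lambda>x. f x + g x)"
proof (induction k arbitrary: f g)
  case (Suc k)
  show ?case
    by (rule Ck_SucI[OF has_derivative_add[OF Ck_Suc_has_derivative Ck_Suc_has_derivative]])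
       (use Suc in auto)
qed (auto intro: continuous_intros)

lemma Ck_bounded_linear:
  assumes L: "bounded_linear L"
  shows "Ck k f \<Longrightarrow> Ck k (\<lambda>x. L (f x))"
proof (induction k arbitrary: f)
  case 0
  then show ?case by (auto intro: bounded_linear.continuous_on[OF L])
next
  case (Suc k)
  show ?case
    by (rule Ck_SucI[OF bounded_linear.has_derivative[OF L Ck_Suc_has_derivative]])
       (use Suc in auto)
qed

lemma Ck_sum: "(\<And>i. i \<in> I \<Longrightarrow> Ck k (f i)) \<Longrightarrow> Ck k (\<lambda>x. \<Sum>i\<in>I. f i x)"
  by (induction I rule: infinite_finite_induct) (auto intro: Ck_add Ck_const)

lemma smooth_Ck: "smooth f \<Longrightarrow> Ck k f"
  by (simp add: smooth_def)

lemma smooth_continuous: "smooth f \<Longrightarrow> continuous_on UNIV f"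
  by (metis smooth_def Ck.simps(1))

lemma smooth_has_derivative:
  "smooth f \<Longrightarrow> (f has_derivative frechet_derivative f (at x)) (at x)"
  using Ck_Suc_has_derivative smooth_Ck by blast

lemma smooth_bounded_linear: "bounded_linear L \<Longrightarrow> smooth f \<Longrightarrow> smooth (\<lambda>x. L (f x))"
  by (simp add: smooth_def Ck_bounded_linear)

text \<open>\<open>Ck\<close> only iterates derivatives along basis vectors; a general direction
  \<open>h\<close> is reached because the derivative is linear in \<open>h\<close>.\<close>

lemma smooth_derivative:
  assumes "smooth f" shows "smooth (\<lambda>x. frechet_derivative f (at x) h)"
proof -
  have *: "Ck k (\<lambda>x. frechet_derivative f (at x) b)" if "b \<in> Basis" for k b
    using smooth_Ck[OF assms, of "Suc k"] that by simp
  have "frechet_derivative f (at x) h = (\<Sum>b\<in>Basis. (h \<bullet> b) *\<^sub>R frechet_derivative f (at x) b)" for x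
  proof -
    have "linear (frechet_derivative f (at x))"
      using has_derivative_linear smooth_has_derivative[OF assms] by blast
    then show ?thesis
      by (subst (1) euclidean_representation[of h, symmetric], subst linear_sum)
         (auto simp: linear_cmul)
  qed
  then show ?thesis
    by (auto simp: smooth_def intro!: Ck_sum Ck_bounded_linear[OF bounded_linear_scaleR_right] *)
qed

section \<open>Flat exponentials and the standard bump\<close>

definition flat_exp :: "nat \<Rightarrow> real \<Rightarrow> real" where
  "flat_exp n t = (if t > 0 then exp (- 1 / t) / t ^ n else 0)"

text \<open>Only the limit from the right has content: with s = 1/t it becomes s^n / exp s for s
  tending to infinity.\<close>

lemma flat_exp_tendsto_0: "(flat_exp n \<longlongrightarrow> 0) (at 0)"
proof (rule filterlim_split_at)
  show "(flat_exp n \<longlongrightarrow> 0) (at_left 0)"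
    by (rule tendsto_eventually) (auto simp: flat_exp_def eventually_at_left_field intro!: exI[of _ "-1"])
  have "((\<lambda>t. inverse t ^ n / exp (inverse t)) \<longlongrightarrow> (0::real)) (at_right 0)"
    by (rule filterlim_compose[OF tendsto_power_div_exp_0 filterlim_inverse_at_top_right])
  then show "(flat_exp n \<longlongrightarrow> 0) (at_right 0)"
    by (rule Lim_transform_eventually)
       (auto simp: flat_exp_def eventually_at_right_field exp_minus field_simps intro!: exI[of _ 1])
qed

text \<open>Division by powers of t makes the family closed under differentiation, so the smoothness
  of exp (-1/t) across 0 needs no formula for higher derivatives.\<close>

lemma flat_exp_deriv:
  "(flat_exp n has_real_derivative (flat_exp (n+2) t - of_nat n * flat_exp (n+1) t)) (at t)"
proof -
  consider "t < 0" | "t = 0" | "t > 0" by linarith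
  then show ?thesis
  proof cases
    case 1
    have "((\<lambda>_. 0) has_real_derivative 0) (at t)" by simp
    then have "(flat_exp n has_real_derivative 0) (at t)"
      by (rule has_field_derivative_transform_within_open[where S = "{..<0}"])
         (use 1 in \<open>auto simp: flat_exp_def\<close>)
    then show ?thesis using 1 by (simp add: flat_exp_def)
  next
    case 2
    \<comment> \<open>The difference quotient at 0 is \<open>flat_exp (Suc n)\<close> itself, so the
      derivative there is the limit already computed.\<close>
    have "((\<lambda>h. (flat_exp n (0 + h) - flat_exp n 0) / h) \<longlongrightarrow> 0) (at 0)"
      by (rule Lim_transform_eventually[OF flat_exp_tendsto_0[of "Suc n"]])
         (auto simp: flat_exp_def eventually_at intro!: exI[of _ 1])
    then show ?thesis using 2 by (simp add: DERIV_def flat_exp_def)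
  next
    case 3
    have "((\<lambda>t. exp (- 1 / t) / t ^ n) has_real_derivative
            (flat_exp (n+2) t - of_nat n * flat_exp (n+1) t)) (at t)"
    proof (rule DERIV_cong)
      have d: "((\<lambda>t. exp (- 1 / t)) has_real_derivative exp (- 1 / t) * (1 / t^2)) (at t)"
        by (rule DERIV_fun_exp) (use 3 in \<open>auto intro!: derivative_eq_intros simp: power2_eq_square\<close>)
      show "((\<lambda>t. exp (- 1 / t) / t ^ n) has_real_derivative
         (exp (- 1 / t) * (1 / t^2) * t ^ n - exp (- 1 / t) * (of_nat n * t ^ (n - 1))) / (t ^ n * t ^ n)) (at t)"
        using DERIV_divide[OF d DERIV_pow[of n t]] 3 by simp
      show "(exp (- 1 / t) * (1 / t^2) * t ^ n - exp (- 1 / t) * (of_nat n * t ^ (n - 1))) / (t ^ n * t ^ n)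
         = flat_exp (n+2) t - of_nat n * flat_exp (n+1) t"
        using 3 by (cases n) (simp_all add: flat_exp_def field_simps power2_eq_square)
    qed
    then show ?thesis
      by (rule has_field_derivative_transform_within_open[where S = "{0<..}"])
         (use 3 in \<open>auto simp: flat_exp_def\<close>)
  qed
qed

text \<open>For a fixed direction the derivative of a polynomial is again a polynomial. This keeps
  the coefficients of the bump function polynomial under repeated differentiation.\<close>

lemma real_polynomial_function_has_derivative:
  assumes "real_polynomial_function p"
  shows "\<exists>p'. (\<forall>x. (p has_derivative p' x) (at x)) \<and> (\<forall>h. real_polynomial_function (\<lambda>x. p' x h))"
  using assms
proof induction
  case (linear f)
  then show ?case
    by (intro exI[of _ "\<lambda>_. f"]) (auto intro: bounded_linear_imp_has_derivative real_polynomial_function.intros(2))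
next
  case (const c)
  then show ?case by (intro exI[of _ "\<lambda>_ _. 0"]) auto
next
  case (add f g)
  then obtain f' g' where "\<forall>x. (f has_derivative f' x) (at x)" "\<forall>x. (g has_derivative g' x) (at x)"
     "\<forall>h. real_polynomial_function (\<lambda>x. f' x h)" "\<forall>h. real_polynomial_function (\<lambda>x. g' x h)" by auto
  then show ?case
    by (intro exI[of _ "\<lambda>x h. f' x h + g' x h"])
       (intro conjI allI has_derivative_add real_polynomial_function.intros(3); simp)
next
  case (mult f g)
  then obtain f' g' where "\<forall>x. (f has_derivative f' x) (at x)" "\<forall>x. (g has_derivative g' x) (at x)"
     "\<forall>h. real_polynomial_function (\<lambda>x. f' x h)" "\<forall>h. real_polynomial_function (\<lambda>x. g' x h)" by auto
  then show ?case
    by (intro exI[of _ "\<lambda>x h. f x * g' x h + f' x h * g x"])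
       (intro conjI allI has_derivative_mult real_polynomial_function.intros(3)
          real_polynomial_function.intros(4) mult.hyps; simp)
qed

text \<open>A directional derivative of such a product is a sum of three products of the same kind,
  with new polynomials and the exponents \<open>n\<close>, \<open>n + 2\<close> and
  \<open>n + 1\<close>. Hence the induction on \<open>k\<close> generalises over both
  \<open>p\<close> and \<open>n\<close>.\<close>

lemma Ck_poly_flat_exp:
  fixes p :: "'a::euclidean_space \<Rightarrow> real"
  shows "real_polynomial_function p \<Longrightarrow> Ck k (\<lambda>x. p x * flat_exp n (s - x \<bullet> x))"
proof (induction k arbitrary: p n)
  case 0
  then obtain p' where p': "\<And>x. (p has_derivative p' x) (at x)"
    using real_polynomial_function_has_derivative by blast
  have "continuous_on UNIV p"
    using has_derivative_continuous[OF p'] by (simp add: continuous_at_imp_continuous_on)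
  moreover have "continuous_on UNIV (flat_exp n)"
    using DERIV_isCont[OF flat_exp_deriv] by (simp add: continuous_at_imp_continuous_on)
  then have "continuous_on UNIV (\<lambda>x::'a. flat_exp n (s - x \<bullet> x))"
    by (rule continuous_on_compose2) (auto intro!: continuous_intros)
  ultimately show ?case by (simp add: continuous_on_mult)
next
  case (Suc k)
  then obtain p' where p': "\<And>x. (p has_derivative p' x) (at x)"
      and pp': "\<And>h. real_polynomial_function (\<lambda>x. p' x h)"
    using real_polynomial_function_has_derivative by blast
  have lin: "real_polynomial_function (\<lambda>x::'a. x \<bullet> b)" for b
    by (intro real_polynomial_function.intros(1) bounded_linear_inner_left)
  let ?F = "\<lambda>n x. flat_exp n (s - x \<bullet> x)"
  have *: "((\<lambda>x. p x * ?F n x) has_derivative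
     (\<lambda>h. p' x h * ?F n x + (p x * ((- 2) * (x \<bullet> h))) * ?F (n+2) x
        + (p x * (2 * of_nat n * (x \<bullet> h))) * ?F (n+1) x)) (at x)" for x
  proof -
    have q: "((\<lambda>x. s - x \<bullet> x) has_derivative (\<lambda>h. - 2 * (x \<bullet> h))) (at x)"
      by (auto intro!: derivative_eq_intros simp: inner_commute)
    have "(flat_exp n has_derivative (*) (flat_exp (n+2) (s - x \<bullet> x) - of_nat n * flat_exp (n+1) (s - x \<bullet> x)))
      (at (s - x \<bullet> x))"
      using flat_exp_deriv[of n "s - x \<bullet> x"] by (simp add: has_field_derivative_def)
    from has_derivative_mult[OF p' has_derivative_compose[OF q this]]
    show ?thesis
      by (rule has_derivative_eq_rhs) (auto simp: algebra_simps)
  qed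
  show ?case
    by (rule Ck_SucI[OF *]) (intro Ck_add Suc.IH pp' real_polynomial_function.intros(4) Suc.prems lin
       real_polynomial_function.intros(2))
qed

text \<open>The symmetry is there because it makes convolution self-adjoint: a mollified test field
  can be traded for a mollified \<open>u\<close> or \<open>w\<close> with the same kernel.\<close>

definition mollifier :: "real \<Rightarrow> ('a::euclidean_space \<Rightarrow> real) \<Rightarrow> bool" where
  "mollifier e \<rho> \<longleftrightarrow> smooth \<rho> \<and> (\<forall>x. 0 \<le> \<rho> x) \<and> (\<forall>x. e < norm x \<longrightarrow> \<rho> x = 0) \<and>
     (\<forall>x. \<rho> (- x) = \<rho> x) \<and> integrable lborel \<rho> \<and> integral\<^sup>L lborel \<rho> = 1"

lemma integrable_continuous_compact_support:
  fixes f :: "'a::euclidean_space \<Rightarrow> 'b::euclidean_space"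
  assumes "continuous_on UNIV f" "\<And>x. e < norm x \<Longrightarrow> f x = 0"
  shows "integrable lborel f"
proof -
  have "integrable lborel (\<lambda>x. indicator (cball 0 e) x *\<^sub>R f x)"
    by (rule borel_integrable_compact) (auto intro: continuous_on_subset[OF assms(1)])
  moreover have "(\<lambda>x. indicator (cball 0 e) x *\<^sub>R f x) = f"
    using assms(2) by (auto simp: indicator_def fun_eq_iff not_le)
  ultimately show ?thesis by simp
qed

lemma mollifier_exists:
  assumes "e > 0"
  shows "\<exists>\<rho>::'a::euclidean_space \<Rightarrow> real. mollifier e \<rho>"
proof -
  define \<psi> :: "'a \<Rightarrow> real" where "\<psi> x = flat_exp 0 (e^2 - x \<bullet> x)" for x
  have sm: "smooth \<psi>"
    using Ck_poly_flat_exp[OF real_polynomial_function.intros(2), where 'a = 'a, of _ 1 0 "e^2"]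
    by (simp add: smooth_def \<psi>_def[abs_def])
  have nn: "\<psi> x \<ge> 0" for x by (simp add: \<psi>_def flat_exp_def)
  have sq: "x \<bullet> x = (norm x)^2" for x :: 'a by (simp add: power2_norm_eq_inner)
  have out: "\<psi> x = 0" if "e < norm x" for x
  proof -
    have "e^2 \<le> (norm x)^2" using that assms by (intro power_mono) auto
    then show ?thesis by (simp add: \<psi>_def flat_exp_def sq)
  qed
  have even: "\<psi> (- x) = \<psi> x" for x by (simp add: \<psi>_def)
  have pos: "\<psi> x > 0" if "x \<in> ball 0 e" for x
    using that assms by (auto simp: \<psi>_def flat_exp_def sq power_strict_mono)
  have int: "integrable lborel \<psi>"
    by (rule integrable_continuous_compact_support[OF smooth_continuous[OF sm] out])
  \<comment> \<open>Normalisation needs a positive integral. If it vanished, \<psi> would vanish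
    almost everywhere, and the ball on which it is positive would be a null set.\<close>
  have I: "integral\<^sup>L lborel \<psi> > 0"
  proof (rule ccontr)
    assume "\<not> integral\<^sup>L lborel \<psi> > 0"
    then have "integral\<^sup>L lborel \<psi> = 0"
      by (metis integral_nonneg_AE nn always_eventually order_le_less)
    then have "AE x in lborel. \<psi> x = 0"
      using integral_nonneg_eq_0_iff_AE[OF int] nn by auto
    then have "AE x in lborel. x \<notin> ball (0::'a) e"
      by eventually_elim (use pos in force)
    then have "emeasure lborel (ball (0::'a) e) = 0"
      by (subst (asm) AE_iff_null_sets[symmetric]) auto
    then have "measure lborel (ball (0::'a) e) = 0" by (simp add: measure_def)
    moreover have "measure lborel (ball (0::'a) e) > 0"
      using content_ball_pos[OF assms, of "0::'a"] by simp
    ultimately show False by simp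
  qed
  have "mollifier e (\<lambda>x. (1 / integral\<^sup>L lborel \<psi>) * \<psi> x)"
    unfolding mollifier_def
    using I nn out int smooth_bounded_linear[OF bounded_linear_mult_right sm, of "1 / integral\<^sup>L lborel \<psi>"]
      even by auto
  then show ?thesis by blast
qed

section \<open>Convolution\<close>

lemma bounded_continuous_compact_support:
  fixes f :: "'a::euclidean_space \<Rightarrow> 'b::euclidean_space"
  assumes "continuous_on UNIV f" "\<And>x. e < norm x \<Longrightarrow> f x = 0"
  shows "\<exists>M\<ge>0. \<forall>x. norm (f x) \<le> M"
proof -
  have "bounded (f ` cball 0 e)"
    by (intro compact_imp_bounded compact_continuous_image continuous_on_subset[OF assms(1)]) auto
  then obtain M where "\<And>x. x \<in> cball 0 e \<Longrightarrow> norm (f x) \<le> M"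
    unfolding bounded_iff by blast
  then have "norm (f x) \<le> max M 0" for x
    using assms(2)[of x] by (cases "x \<in> cball 0 e") (auto simp: not_le intro: le_max_iff_disj[THEN iffD2])
  then show ?thesis by (metis max.cobounded2)
qed

lemma frechet_derivative_outside_support:
  fixes f :: "'a::real_normed_vector \<Rightarrow> 'b::real_normed_vector"
  assumes "\<And>x. e < norm x \<Longrightarrow> f x = 0" "e < norm x"
  shows "frechet_derivative f (at x) = (\<lambda>h. 0)"
proof -
  have "open {x::'a. e < norm x}"
    by (intro open_Collect_less continuous_intros)
  then have "(f has_derivative (\<lambda>h. 0)) (at x)"
    by (rule has_derivative_transform_within_open[OF has_derivative_const[of 0]])
       (simp_all add: assms)
  then show ?thesis by (metis frechet_derivative_at)
qed

lemma bounded_derivative_compact_support: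
  fixes f :: "'a::euclidean_space \<Rightarrow> 'b::euclidean_space"
  assumes "smooth f" "\<And>x. e < norm x \<Longrightarrow> f x = 0"
  shows "\<exists>M\<ge>0. \<forall>x h. norm (frechet_derivative f (at x) h) \<le> M * norm h"
proof -
  have "\<exists>M\<ge>0. \<forall>x. norm (frechet_derivative f (at x) b) \<le> M" for b
    by (rule bounded_continuous_compact_support[OF smooth_continuous[OF smooth_derivative[OF assms(1)]], of e])
       (simp add: frechet_derivative_outside_support[of e f, OF assms(2)])
  then obtain M where M: "\<And>b. M b \<ge> 0" "\<And>b x. norm (frechet_derivative f (at x) b) \<le> M b"
    by metis
  have "norm (frechet_derivative f (at x) h) \<le> (\<Sum>b\<in>Basis. M b) * norm h" for x h
  proof -
    have lin: "linear (frechet_derivative f (at x))"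
      using has_derivative_linear smooth_has_derivative[OF assms(1)] by blast
    have "frechet_derivative f (at x) h = (\<Sum>b\<in>Basis. (h \<bullet> b) *\<^sub>R frechet_derivative f (at x) b)"
      by (subst (1) euclidean_representation[of h, symmetric], subst linear_sum[OF lin])
         (auto simp: linear_cmul[OF lin])
    also have "norm \<dots> \<le> (\<Sum>b\<in>Basis. norm h * M b)"
      by (intro sum_norm_le) (auto intro!: mult_mono M simp: Basis_le_norm)
    finally show ?thesis by (simp add: sum_distrib_right mult.commute sum_distrib_left)
  qed
  then show ?thesis using M(1) by (metis sum_nonneg)
qed

text \<open>The kernel is left arbitrary because the partial derivatives of a mollifier, which are
  not nonnegative, serve as kernels too.\<close>

definition conv :: "('a::euclidean_space \<Rightarrow> real) \<Rightarrow> ('a \<Rightarrow> 'b::euclidean_space) \<Rightarrow> 'a \<Rightarrow> 'b" where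
  "conv \<rho> v y = (\<integral>x. \<rho> (y - x) *\<^sub>R v x \<partial>lborel)"

lemma integrable_bounded_scaleR:
  fixes v :: "'a::euclidean_space \<Rightarrow> 'b::euclidean_space"
  assumes v: "integrable lborel v" and [measurable]: "\<rho> \<in> borel_measurable borel" and M: "\<And>x. \<bar>\<rho> x\<bar> \<le> M"
  shows "integrable lborel (\<lambda>x. \<rho> x *\<^sub>R v x)"
proof -
  have [measurable]: "v \<in> borel_measurable lborel" using v by auto
  show ?thesis
    by (rule Bochner_Integration.integrable_bound[of lborel "\<lambda>x. M *\<^sub>R v x"])
       (use M v in \<open>auto intro!: mult_right_mono intro: order.trans[OF M abs_ge_self]\<close>)
qed

text \<open>Differentiation under the integral, with all regularity in the kernel. The bound
  \<open>B\<close> on the derivative is also a Lipschitz constant of \<rho>, so the difference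
  quotients with the linear part removed are dominated by the integrable function
  \<open>2 * B * norm (v x)\<close>.\<close>

lemma conv_has_derivative:
  fixes v :: "'a::euclidean_space \<Rightarrow> 'b::euclidean_space"
  assumes \<rho>: "smooth \<rho>" "\<And>x. e < norm x \<Longrightarrow> \<rho> x = 0" and v: "integrable lborel v"
  shows "(conv \<rho> v has_derivative (\<lambda>h. conv (\<lambda>z. frechet_derivative \<rho> (at z) h) v y)) (at y)"
proof -
  define D where "D z = frechet_derivative \<rho> (at z)" for z
  have D: "(\<rho> has_derivative D z) (at z)" for z
    using smooth_has_derivative[OF \<rho>(1)] by (simp add: D_def)
  have lin: "linear (D z)" for z using has_derivative_linear[OF D] .
  obtain B where B: "B \<ge> 0" "\<And>z h. \<bar>D z h\<bar> \<le> B * norm h"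
    using bounded_derivative_compact_support[of \<rho> e, OF \<rho>] by (auto simp: D_def)
  obtain M where M: "\<And>z. \<bar>\<rho> z\<bar> \<le> M"
    using bounded_continuous_compact_support[of \<rho> e, OF smooth_continuous[OF \<rho>(1)] \<rho>(2)] by auto
  have [measurable]: "\<rho> \<in> borel_measurable borel"
    by (intro borel_measurable_continuous_onI smooth_continuous \<rho>)
  have Dm[measurable]: "(\<lambda>z. D z h) \<in> borel_measurable borel" for h
    unfolding D_def by (intro borel_measurable_continuous_onI smooth_continuous smooth_derivative \<rho>)
  have vm[measurable]: "v \<in> borel_measurable lborel" using v by auto
  have i1: "integrable lborel (\<lambda>x. \<rho> (y - x) *\<^sub>R v x)" for y
    by (rule integrable_bounded_scaleR[OF v _ M]) simp
  have i2: "integrable lborel (\<lambda>x. D (y - x) h *\<^sub>R v x)" for y h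
    by (rule integrable_bounded_scaleR[OF v _ B(2)]) simp
  have lip: "\<bar>\<rho> (z + h) - \<rho> z\<bar> \<le> B * norm h" for z h
  proof -
    have "norm (\<rho> (z + h) - \<rho> z) \<le> B * norm (z + h - z)"
      by (rule differentiable_bound[of UNIV \<rho> D]) (use D B in \<open>auto intro!: onorm_le\<close>)
    then show ?thesis by simp
  qed
  show ?thesis
    unfolding has_derivative_at D_def[symmetric]
  proof
    show "bounded_linear (\<lambda>h. conv (\<lambda>z. D z h) v y)"
    proof (rule bounded_linear_intro)
      fix h k show "conv (\<lambda>z. D z (h + k)) v y = conv (\<lambda>z. D z h) v y + conv (\<lambda>z. D z k) v y"
        unfolding conv_def linear_add[OF lin] scaleR_add_left
        by (rule Bochner_Integration.integral_add[OF i2 i2])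
    next
      fix r h show "conv (\<lambda>z. D z (r *\<^sub>R h)) v y = r *\<^sub>R conv (\<lambda>z. D z h) v y"
        unfolding conv_def linear_cmul[OF lin]
        by (simp flip: scaleR_scaleR)
    next
      fix h
      have "norm (conv (\<lambda>z. D z h) v y) \<le> (\<integral>x. norm (D (y - x) h *\<^sub>R v x) \<partial>lborel)"
        unfolding conv_def by (rule integral_norm_bound)
      also have "\<dots> \<le> (\<integral>x. (B * norm h) * norm (v x) \<partial>lborel)"
        by (rule integral_mono[OF integrable_norm[OF i2]]) (use v in \<open>auto intro!: mult_right_mono B\<close>)
      finally show "norm (conv (\<lambda>z. D z h) v y) \<le> norm h * (B * (\<integral>x. norm (v x) \<partial>lborel))"
        by (simp add: mult_ac)
    qed
    show "((\<lambda>h. norm (conv \<rho> v (y + h) - conv \<rho> v y - conv (\<lambda>z. D z h) v y) / norm h) \<longlongrightarrow> 0) (at 0)"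
      \<comment> \<open>Dominated convergence speaks of sequences, so the limit is tested along an
        arbitrary sequence \<open>X\<close> of nonzero increments tending to 0.\<close>
      unfolding tendsto_at_iff_sequentially
    proof (intro allI impI)
      fix X :: "nat \<Rightarrow> 'a" assume X: "\<forall>i. X i \<in> UNIV - {0}" "X \<longlonglongrightarrow> 0"
      define s where "s n x = ((\<rho> (y - x + X n) - \<rho> (y - x) - D (y - x) (X n)) / norm (X n)) *\<^sub>R v x" for n x
      have "(\<lambda>n. \<integral>x. s n x \<partial>lborel) \<longlonglongrightarrow> (\<integral>x. 0 \<partial>(lborel :: 'a measure))"
      proof (rule integral_dominated_convergence[where w = "\<lambda>x. (2 * B) * norm (v x)"])
        show "integrable lborel (\<lambda>x. 2 * B * norm (v x))" using v by auto
        show "AE x in lborel. (\<lambda>i. s i x) \<longlonglongrightarrow> 0"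
        proof (rule AE_I2)
          fix x
          have "((\<lambda>h. norm (\<rho> (y - x + h) - \<rho> (y - x) - D (y - x) h) / norm h) \<longlongrightarrow> 0) (at 0)"
            using D[of "y - x"] by (simp add: has_derivative_at)
          then have "(\<lambda>n. norm (\<rho> (y - x + X n) - \<rho> (y - x) - D (y - x) (X n)) / norm (X n)) \<longlonglongrightarrow> 0"
            using X unfolding tendsto_at_iff_sequentially comp_def by blast
          then have "(\<lambda>n. norm ((\<rho> (y - x + X n) - \<rho> (y - x) - D (y - x) (X n)) / norm (X n))) \<longlonglongrightarrow> 0"
            by simp
          then have "(\<lambda>n. (\<rho> (y - x + X n) - \<rho> (y - x) - D (y - x) (X n)) / norm (X n)) \<longlonglongrightarrow> 0"
            by (rule tendsto_norm_zero_cancel)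
          from tendsto_scaleR[OF this tendsto_const[of "v x"]]
          show "(\<lambda>i. s i x) \<longlonglongrightarrow> 0" by (simp add: s_def)
        qed
        show "AE x in lborel. norm (s i x) \<le> 2 * B * norm (v x)" for i
        proof (rule AE_I2)
          fix x
          have "\<bar>\<rho> (y - x + X i) - \<rho> (y - x) - D (y - x) (X i)\<bar> \<le> 2 * B * norm (X i)"
            using lip[of "y - x" "X i"] B(2)[of "y - x" "X i"] by linarith
          moreover have "norm (X i) > 0" using X by auto
          ultimately have "\<bar>\<rho> (y - x + X i) - \<rho> (y - x) - D (y - x) (X i)\<bar> / norm (X i) \<le> 2 * B"
            by (simp add: pos_divide_le_eq)
          from mult_right_mono[OF this norm_ge_zero[of "v x"]]
          show "norm (s i x) \<le> 2 * B * norm (v x)" by (simp add: s_def)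
        qed
      qed (auto simp: s_def)
      then have "(\<lambda>n. norm (\<integral>x. s n x \<partial>lborel)) \<longlonglongrightarrow> 0"
        by (simp add: tendsto_norm_zero)
      moreover have "norm (\<integral>x. s n x \<partial>lborel) =
          norm (conv \<rho> v (y + X n) - conv \<rho> v y - conv (\<lambda>z. D z (X n)) v y) / norm (X n)" for n
      proof -
        have "(\<integral>x. s n x \<partial>lborel) = (1 / norm (X n)) *\<^sub>R
           (\<integral>x. \<rho> (y + X n - x) *\<^sub>R v x - \<rho> (y - x) *\<^sub>R v x - D (y - x) (X n) *\<^sub>R v x \<partial>lborel)"
          unfolding s_def integral_scaleR_right[symmetric]
          by (intro Bochner_Integration.integral_cong refl)
             (simp only: scaleR_diff_left[symmetric] scaleR_scaleR add_diff_eq diff_add_eq mult_1 times_divide_eq_left)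
        also have "(\<integral>x. \<rho> (y + X n - x) *\<^sub>R v x - \<rho> (y - x) *\<^sub>R v x - D (y - x) (X n) *\<^sub>R v x \<partial>lborel)
           = conv \<rho> v (y + X n) - conv \<rho> v y - conv (\<lambda>z. D z (X n)) v y"
          using i1 i2 by (simp add: conv_def)
        finally show ?thesis by (simp add: divide_inverse mult.commute)
      qed
      ultimately show "((\<lambda>h. norm (conv \<rho> v (y + h) - conv \<rho> v y - conv (\<lambda>z. D z h) v y) / norm h) \<circ> X) \<longlonglongrightarrow> 0"
        by (simp add: comp_def)
    qed
  qed
qed

lemma frechet_derivative_conv:
  fixes v :: "'a::euclidean_space \<Rightarrow> 'b::euclidean_space"
  assumes "smooth \<rho>" "\<And>x. e < norm x \<Longrightarrow> \<rho> x = 0" "integrable lborel v"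
  shows "frechet_derivative (conv \<rho> v) (at y) h = conv (\<lambda>z. frechet_derivative \<rho> (at z) h) v y"
  by (metis frechet_derivative_at[OF conv_has_derivative[OF assms]])

text \<open>The induction generalises over the kernel and keeps \<open>v\<close> fixed: a derivative
  of the convolution is the convolution of the same \<open>v\<close> with a derivative of the
  kernel, which is again smooth and supported in the same ball.\<close>

lemma smooth_conv:
  fixes v :: "'a::euclidean_space \<Rightarrow> 'b::euclidean_space"
  assumes "smooth \<rho>" "\<And>x. e < norm x \<Longrightarrow> \<rho> x = 0" "integrable lborel v"
  shows "smooth (conv \<rho> v)"
proof -
  have "Ck k (conv \<rho> v)" for k
    using assms(1,2)
  proof (induction k arbitrary: \<rho>)
    case 0
    have "isCont (conv \<rho> v) x" for x
      using conv_has_derivative[OF 0 assms(3)] has_derivative_continuous by blast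
    then show ?case by (simp add: continuous_at_imp_continuous_on)
  next
    case (Suc k)
    show ?case
    proof (rule Ck_SucI[OF conv_has_derivative[OF Suc.prems assms(3)]])
      fix b show "Ck k (conv (\<lambda>z. frechet_derivative \<rho> (at z) b) v)"
        by (rule Suc.IH[OF smooth_derivative[OF Suc.prems(1)]])
           (simp add: frechet_derivative_outside_support[of e \<rho>, OF Suc.prems(2)])
    qed auto
  qed
  then show ?thesis by (simp add: smooth_def)
qed

section \<open>Mollification as averaging\<close>

lemma lborel_nn_integral_translation:
  fixes f :: "'a::euclidean_space \<Rightarrow> ennreal"
  assumes [measurable]: "f \<in> borel_measurable borel"
  shows "(\<integral>\<^sup>+x. f (x - y) \<partial>lborel) = integral\<^sup>N lborel f"
proof -
  have "integral\<^sup>N lborel f = integral\<^sup>N (distr lborel borel ((+) (- y))) f"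
    by (simp only: lborel_distr_plus)
  also have "\<dots> = (\<integral>\<^sup>+x. f (- y + x) \<partial>lborel)" by (rule nn_integral_distr) auto
  finally show ?thesis by simp
qed

lemma mollifierD:
  assumes "mollifier e \<rho>"
  shows "smooth \<rho>" "0 \<le> \<rho> x" "e < norm x \<Longrightarrow> \<rho> x = 0" "\<rho> (- x) = \<rho> x" "\<rho> (x - y) = \<rho> (y - x)"
    "\<rho> \<in> borel_measurable borel" "continuous_on UNIV \<rho>"
    "integrable lborel \<rho>" "integral\<^sup>L lborel \<rho> = 1"
    "(\<integral>\<^sup>+x. \<rho> (y - x) \<partial>lborel) = 1" "(\<integral>\<^sup>+x. \<rho> (x - y) \<partial>lborel) = 1"
proof -
  show *: "smooth \<rho>" "0 \<le> \<rho> x" "e < norm x \<Longrightarrow> \<rho> x = 0" "\<rho> (- x) = \<rho> x"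
   "integrable lborel \<rho>" "integral\<^sup>L lborel \<rho> = 1" for x
    using assms by (auto simp: mollifier_def)
  show **: "\<rho> (x - y) = \<rho> (y - x)" for x y using *(4)[of "x - y"] by simp
  show "continuous_on UNIV \<rho>" using * smooth_continuous by blast
  then show [measurable]: "\<rho> \<in> borel_measurable borel" by (rule borel_measurable_continuous_onI)
  have "(\<integral>\<^sup>+x. \<rho> x \<partial>lborel) = 1"
    using *(2,5,6) by (subst nn_integral_eq_integral) auto
  then show "(\<integral>\<^sup>+x. \<rho> (x - y) \<partial>lborel) = 1"
    by (subst lborel_nn_integral_translation) auto
  then show "(\<integral>\<^sup>+x. \<rho> (y - x) \<partial>lborel) = 1"
    by (simp only: **[of y])
qed

lemma conv_integrand_integrable:
  fixes v :: "'a::euclidean_space \<Rightarrow> 'b::euclidean_space"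
  assumes [measurable]: "\<kappa> \<in> borel_measurable borel" and "\<And>z. \<bar>\<kappa> z\<bar> \<le> M" "integrable lborel v"
  shows "integrable lborel (\<lambda>x. \<kappa> (y - x) *\<^sub>R v x)"
  by (rule integrable_bounded_scaleR[OF assms(3), of _ M]) (use assms(2) in auto)

lemma conv_measurable [measurable]:
  fixes v :: "'a::euclidean_space \<Rightarrow> 'b::euclidean_space"
  assumes [measurable]: "\<kappa> \<in> borel_measurable borel" "v \<in> borel_measurable borel"
  shows "conv \<kappa> v \<in> borel_measurable borel"
proof -
  have "(\<lambda>y. \<integral>x. \<kappa> (y - x) *\<^sub>R v x \<partial>lborel) \<in> borel_measurable borel" by measurable
  then show ?thesis by (simp add: conv_def[abs_def])
qed

lemma conv_bounded:
  fixes v :: "'a::euclidean_space \<Rightarrow> 'b::euclidean_space"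
  assumes "\<kappa> \<in> borel_measurable borel" "\<And>z. \<bar>\<kappa> z\<bar> \<le> M" "integrable lborel v"
  shows "norm (conv \<kappa> v y) \<le> M * (\<integral>x. norm (v x) \<partial>lborel)"
proof -
  have "norm (conv \<kappa> v y) \<le> (\<integral>x. norm (\<kappa> (y - x) *\<^sub>R v x) \<partial>lborel)"
    unfolding conv_def by (rule integral_norm_bound)
  also have "\<dots> \<le> (\<integral>x. M * norm (v x) \<partial>lborel)"
    by (rule integral_mono[OF integrable_norm[OF conv_integrand_integrable[OF assms]]])
       (use assms in \<open>auto intro!: mult_right_mono\<close>)
  finally show ?thesis by simp
qed

text \<open>The adjoint of a convolution is the convolution with the reflected kernel, by Fubini. A
  bounded kernel between two integrable functions makes the double integrand integrable. When the
  kernel is a partial derivative this plays the part of an integration by parts.\<close>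

lemma conv_swap:
  fixes u v :: "'a::euclidean_space \<Rightarrow> real"
  assumes [measurable]: "\<kappa> \<in> borel_measurable borel" and M: "\<And>z. \<bar>\<kappa> z\<bar> \<le> M"
    and u: "integrable lborel u" and v: "integrable lborel v"
  shows "(\<integral>y. u y * conv \<kappa> v y \<partial>lborel) = (\<integral>x. v x * conv (\<lambda>z. \<kappa> (- z)) u x \<partial>lborel)"
proof -
  have [measurable]: "u \<in> borel_measurable borel" "v \<in> borel_measurable borel" using u v by auto
  have "M \<ge> 0" using M[of 0] by linarith
  have int1: "integrable lborel (\<lambda>x. u y * (\<kappa> (y - x) * v x))" for y
    using conv_integrand_integrable[OF assms(1) M v, of y] by simp
  have "integrable (lborel \<Otimes>\<^sub>M lborel) (\<lambda>(y, x). u y * (\<kappa> (y - x) * v x))"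
  proof (rule lborel_pair.Fubini_integrable)
    have "integrable lborel (\<lambda>y. \<integral>x. norm (u y * (\<kappa> (y - x) * v x)) \<partial>lborel)"
    proof (rule Bochner_Integration.integrable_bound)
      show "integrable lborel (\<lambda>y. \<bar>u y\<bar> * (M * (\<integral>x. \<bar>v x\<bar> \<partial>lborel)))" using u by auto
      show "AE y in lborel. norm (\<integral>x. norm (u y * (\<kappa> (y - x) * v x)) \<partial>lborel) \<le> norm (\<bar>u y\<bar> * (M * (\<integral>x. \<bar>v x\<bar> \<partial>lborel)))"
      proof (rule AE_I2)
        fix y
        have "(\<integral>x. norm (u y * (\<kappa> (y - x) * v x)) \<partial>lborel) \<le> (\<integral>x. \<bar>u y\<bar> * (M * \<bar>v x\<bar>) \<partial>lborel)"
          by (rule integral_mono[OF integrable_norm[OF int1]])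
             (use v M in \<open>auto simp: abs_mult intro!: mult_left_mono mult_right_mono\<close>)
        moreover have "(\<integral>x. norm (u y * (\<kappa> (y - x) * v x)) \<partial>lborel) \<ge> 0" by simp
        ultimately show "norm (\<integral>x. norm (u y * (\<kappa> (y - x) * v x)) \<partial>lborel) \<le> norm (\<bar>u y\<bar> * (M * (\<integral>x. \<bar>v x\<bar> \<partial>lborel)))"
          by simp
      qed
    qed measurable
    then show "integrable lborel (\<lambda>x. LBINT y. norm (case (x, y) of (y, x) \<Rightarrow> u y * (\<kappa> (y - x) * v x)))"
      by simp
  qed (use int1 in auto)
  from lborel_pair.Fubini_integral[OF this]
  have "(\<integral>x. (\<integral>y. u y * (\<kappa> (y - x) * v x) \<partial>lborel) \<partial>lborel) = (\<integral>y. (\<integral>x. u y * (\<kappa> (y - x) * v x) \<partial>lborel) \<partial>lborel)"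
    by simp
  also have "\<dots> = (\<integral>y. u y * conv \<kappa> v y \<partial>lborel)"
    by (simp add: conv_def)
  also have "(\<lambda>x. \<integral>y. u y * (\<kappa> (y - x) * v x) \<partial>lborel) = (\<lambda>x. v x * conv (\<lambda>z. \<kappa> (- z)) u x)"
  proof
    fix x
    have "(\<integral>y. u y * (\<kappa> (y - x) * v x) \<partial>lborel) = (\<integral>y. v x * (\<kappa> (y - x) * u y) \<partial>lborel)"
      by (simp add: mult_ac)
    also have "\<dots> = v x * conv (\<lambda>z. \<kappa> (- z)) u x" by (simp add: conv_def)
    finally show "(\<integral>y. u y * (\<kappa> (y - x) * v x) \<partial>lborel) = v x * conv (\<lambda>z. \<kappa> (- z)) u x" .
  qed
  finally show ?thesis by simp
qed

lemma mollifier_bounded: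
  assumes "mollifier e \<rho>" shows "\<exists>M. \<forall>z. \<bar>\<rho> z\<bar> \<le> M"
  using bounded_continuous_compact_support[of \<rho> e] mollifierD(3,7)[OF assms] by auto

text \<open>The kernel is a probability density, so averages of vectors from the unit ball stay in
  it. This keeps a mollified field admissible in the supremum that defines
  \<open>radon_norm\<close>.\<close>

lemma conv_norm_le_1:
  fixes v :: "'a::euclidean_space \<Rightarrow> 'b::euclidean_space"
  assumes \<rho>: "mollifier e \<rho>" and v: "integrable lborel v" "\<And>x. norm (v x) \<le> 1"
  shows "norm (conv \<rho> v y) \<le> 1"
proof -
  have [measurable]: "v \<in> borel_measurable borel" using v by auto
  note [measurable] = mollifierD(6)[OF \<rho>]
  have "ennreal (norm (conv \<rho> v y)) \<le> (\<integral>\<^sup>+x. norm (\<rho> (y - x) *\<^sub>R v x) \<partial>lborel)"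
    unfolding conv_def
    by (rule integral_norm_bound_ennreal) (use conv_integrand_integrable mollifier_bounded[OF \<rho>] v mollifierD(6)[OF \<rho>] in blast)
  also have "\<dots> \<le> (\<integral>\<^sup>+x. \<rho> (y - x) \<partial>lborel)"
    using v(2) mollifierD(2)[OF \<rho>] by (intro nn_integral_mono ennreal_leI) (auto simp: mult_left_le)
  also have "\<dots> = 1" by (rule mollifierD(10)[OF \<rho>])
  finally show ?thesis by (simp add: ennreal_le_1)
qed

lemma conv_L1_contraction:
  fixes v :: "'a::euclidean_space \<Rightarrow> 'b::euclidean_space"
  assumes \<rho>: "mollifier e \<rho>" and v: "integrable lborel v"
  shows "(\<integral>\<^sup>+y. norm (conv \<rho> v y) \<partial>lborel) \<le> (\<integral>\<^sup>+y. norm (v y) \<partial>lborel)"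
proof -
  have [measurable]: "v \<in> borel_measurable borel" using v by auto
  note [measurable] = mollifierD(6)[OF \<rho>]
  obtain M where M: "\<And>z. \<bar>\<rho> z\<bar> \<le> M" using mollifier_bounded[OF \<rho>] by auto
  have "(\<integral>\<^sup>+y. norm (conv \<rho> v y) \<partial>lborel) \<le> (\<integral>\<^sup>+y. (\<integral>\<^sup>+x. norm (\<rho> (y - x) *\<^sub>R v x) \<partial>lborel) \<partial>lborel)"
    unfolding conv_def
    by (intro nn_integral_mono integral_norm_bound_ennreal conv_integrand_integrable[OF _ M v]) simp
  also have "\<dots> = (\<integral>\<^sup>+x. (\<integral>\<^sup>+y. norm (\<rho> (y - x) *\<^sub>R v x) \<partial>lborel) \<partial>lborel)"
    by (rule lborel_pair.Fubini') measurable
  also have "\<dots> = (\<integral>\<^sup>+x. (\<integral>\<^sup>+y. ennreal (\<rho> (y - x)) * norm (v x) \<partial>lborel) \<partial>lborel)"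
    using mollifierD(2)[OF \<rho>] by (simp add: ennreal_mult)
  also have "\<dots> = (\<integral>\<^sup>+x. norm (v x) \<partial>lborel)"
    by (subst nn_integral_multc) (auto simp: mollifierD(11)[OF \<rho>])
  finally show ?thesis .
qed

lemma integrable_conv:
  fixes v :: "'a::euclidean_space \<Rightarrow> 'b::euclidean_space"
  assumes \<rho>: "mollifier e \<rho>" and v: "integrable lborel v"
  shows "integrable lborel (conv \<rho> v)"
proof -
  have [measurable]: "v \<in> borel_measurable borel" using v by auto
  note [measurable] = mollifierD(6)[OF \<rho>]
  show ?thesis
    unfolding integrable_iff_bounded
    using conv_L1_contraction[OF assms] v[unfolded integrable_iff_bounded] by (auto intro: le_less_trans)
qed

lemma conv_integral_norm_le:
  fixes v :: "'a::euclidean_space \<Rightarrow> 'b::euclidean_space"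
  assumes \<rho>: "mollifier e \<rho>" and v: "integrable lborel v"
  shows "(\<integral>y. norm (conv \<rho> v y) \<partial>lborel) \<le> (\<integral>y. norm (v y) \<partial>lborel)"
  using conv_L1_contraction[OF assms] integrable_conv[OF assms] v
  by (simp add: nn_integral_eq_integral)

lemma conv_diff:
  fixes u v :: "'a::euclidean_space \<Rightarrow> 'b::euclidean_space"
  assumes \<rho>: "mollifier e \<rho>" and u: "integrable lborel u" and v: "integrable lborel v"
  shows "conv \<rho> (\<lambda>x. u x - v x) y = conv \<rho> u y - conv \<rho> v y"
proof -
  obtain M where M: "\<And>z. \<bar>\<rho> z\<bar> \<le> M" using mollifier_bounded[OF \<rho>] by auto
  note i = conv_integrand_integrable[OF mollifierD(6)[OF \<rho>] M]
  show ?thesis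
    unfolding conv_def scaleR_diff_right
    by (rule Bochner_Integration.integral_diff[OF i[OF u] i[OF v]])
qed

section \<open>Convergence of mollifications in L1\<close>

lemma integrable_compact_support_dense:
  fixes u :: "'a::euclidean_space \<Rightarrow> 'b::euclidean_space"
  assumes u: "integrable lborel u" and "\<eta> > 0"
  shows "\<exists>g R. continuous_on UNIV g \<and> (\<forall>x. R < norm x \<longrightarrow> g x = 0) \<and> (\<integral>x. norm (u x - g x) \<partial>lborel) < \<eta>"
proof -
  have [measurable]: "u \<in> borel_measurable borel" using u by auto
  have "u measurable_on UNIV"
    by (rule lebesgue_measurable_imp_measurable_on) (auto intro: measurable_completion)
  then obtain N g where N: "negligible N" and g: "\<And>n. continuous_on UNIV (g n)"
     and lim: "\<And>x. x \<notin> N \<Longrightarrow> (\<lambda>n. g n x) \<longlonglongrightarrow> u x"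
    unfolding measurable_on_def by auto
  \<comment> \<open>\<open>c k\<close> truncates values by projecting to the nearest point of the
    ball of radius k. It is 1-Lipschitz and fixes 0, so it preserves continuity and does not
    increase norms.\<close>
  define c :: "nat \<Rightarrow> 'b \<Rightarrow> 'b" where "c k = closest_point (cball 0 (real k))" for k
  have c_norm: "norm (c k y) \<le> k" and c_self: "norm y \<le> k \<Longrightarrow> c k y = y" for k y
    using closest_point_in_set[of "cball 0 (real k)" y] closest_point_self[of y "cball 0 (real k)"]
    by (auto simp: c_def)
  have c_lip: "dist (c k y) (c k z) \<le> dist y z" for k y z
    unfolding c_def by (rule closest_point_lipschitz) auto
  have c_le: "norm (c k y) \<le> norm y" for k y
    using c_lip[of k y 0] c_self[of 0 k] by simp
  have c_cont: "continuous_on UNIV (c k)" for k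
    unfolding c_def by (rule continuous_on_closest_point) auto
  \<comment> \<open>A continuous cutoff in space, equal to 1 where the norm of x is at most k - 1
    and to 0 beyond k.\<close>
  define \<theta> :: "nat \<Rightarrow> 'a \<Rightarrow> real" where "\<theta> k x = max 0 (min 1 (real k - norm x))" for k x
  have \<theta>01: "0 \<le> \<theta> k x" "\<theta> k x \<le> 1" for k x by (auto simp: \<theta>_def)
  have \<theta>0: "real k < norm x \<Longrightarrow> \<theta> k x = 0" for k x by (auto simp: \<theta>_def)
  have \<theta>_cont: "continuous_on UNIV (\<theta> k)" for k unfolding \<theta>_def by (intro continuous_intros)
  note [measurable] = borel_measurable_continuous_onI[OF \<theta>_cont] borel_measurable_continuous_onI[OF c_cont]
     borel_measurable_continuous_onI[OF g]
  have AEN: "AE x in lborel. x \<notin> N"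
    using N by (metis AE_not_in completion.AE_iff_null_sets AE_completion_iff negligible_iff_null_sets)
  have "(\<lambda>k. \<integral>x. norm (u x - \<theta> k x *\<^sub>R c k (u x)) \<partial>lborel) \<longlonglongrightarrow> (\<integral>x. 0 \<partial>(lborel::'a measure))"
  proof (rule integral_dominated_convergence[where w = "\<lambda>x. 2 * norm (u x)"])
    show "AE x in lborel. (\<lambda>k. norm (u x - \<theta> k x *\<^sub>R c k (u x))) \<longlonglongrightarrow> 0"
    proof (rule AE_I2, rule tendsto_eventually)
      fix x
      obtain n :: nat where n: "1 + norm x + norm (u x) \<le> n" using real_arch_simple by blast
      show "\<forall>\<^sub>F k in sequentially. norm (u x - \<theta> k x *\<^sub>R c k (u x)) = 0"
      proof (rule eventually_sequentiallyI[of n])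
        fix k assume "n \<le> k"
        then have "1 + norm x + norm (u x) \<le> k" using n by linarith
        then have "\<theta> k x = 1" "c k (u x) = u x" by (auto simp: \<theta>_def intro!: c_self) (smt (verit) norm_ge_zero)+
        then show "norm (u x - \<theta> k x *\<^sub>R c k (u x)) = 0" by simp
      qed
    qed
    show "AE x in lborel. norm (norm (u x - \<theta> k x *\<^sub>R c k (u x))) \<le> 2 * norm (u x)" for k
    proof (rule AE_I2)
      fix x
      have "norm (\<theta> k x *\<^sub>R c k (u x)) \<le> 1 * norm (u x)"
        unfolding norm_scaleR by (intro mult_mono c_le) (use \<theta>01 in auto)
      then show "norm (norm (u x - \<theta> k x *\<^sub>R c k (u x))) \<le> 2 * norm (u x)"
        using norm_triangle_ineq4[of "u x" "\<theta> k x *\<^sub>R c k (u x)"] by simp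
    qed
  qed (use u in auto)
  then have "\<forall>\<^sub>F k in sequentially. (\<integral>x. norm (u x - \<theta> k x *\<^sub>R c k (u x)) \<partial>lborel) < \<eta> / 2"
    using \<open>\<eta> > 0\<close> by (intro order_tendstoD) auto
  then obtain k where k: "(\<integral>x. norm (u x - \<theta> k x *\<^sub>R c k (u x)) \<partial>lborel) < \<eta> / 2"
    by (auto simp: eventually_sequentially)
  have intball: "integrable lborel (\<lambda>x::'a. 2 * real k * indicator (cball 0 (real k)) x)"
    by (intro integrable_mult_right integrable_real_indicator) (use emeasure_bounded_finite[OF bounded_cball[of "0::'a" "real k"]] in auto)
  have bd: "norm (\<theta> k x *\<^sub>R c k y) \<le> real k * indicat_real (cball 0 (real k)) x" for x y
    using \<theta>0[of k x] \<theta>01[of k x] mult_mono[of "\<theta> k x" 1 "norm (c k y)" k] c_norm[of k y]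
    by (auto simp: indicator_def)
  \<comment> \<open>The continuous functions \<open>g n\<close> converge to \<open>u\<close> only
    almost everywhere. After the same truncation and cutoff everything is bounded by k on one ball,
    and dominated convergence upgrades this to convergence in L1.\<close>
  have "(\<lambda>n. \<integral>x. norm (\<theta> k x *\<^sub>R c k (u x) - \<theta> k x *\<^sub>R c k (g n x)) \<partial>lborel) \<longlonglongrightarrow> (\<integral>x. 0 \<partial>(lborel::'a measure))"
  proof (rule integral_dominated_convergence[OF _ _ intball])
    show "AE x in lborel. (\<lambda>n. norm (\<theta> k x *\<^sub>R c k (u x) - \<theta> k x *\<^sub>R c k (g n x))) \<longlonglongrightarrow> 0"
      using AEN
    proof eventually_elim
      case (elim x)
      have "(\<lambda>n. c k (g n x)) \<longlonglongrightarrow> c k (u x)"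
        by (rule continuous_on_tendsto_compose[OF c_cont lim[OF elim]]) auto
      then have "(\<lambda>n. norm (\<theta> k x *\<^sub>R c k (u x) - \<theta> k x *\<^sub>R c k (g n x))) \<longlonglongrightarrow>
          norm (\<theta> k x *\<^sub>R c k (u x) - \<theta> k x *\<^sub>R c k (u x))"
        by (intro tendsto_intros)
      then show ?case by simp
    qed
    show "AE x in lborel. norm (norm (\<theta> k x *\<^sub>R c k (u x) - \<theta> k x *\<^sub>R c k (g n x)))
        \<le> 2 * real k * indicator (cball 0 (real k)) x" for n
    proof (rule AE_I2)
      fix x
      show "norm (norm (\<theta> k x *\<^sub>R c k (u x) - \<theta> k x *\<^sub>R c k (g n x))) \<le> 2 * real k * indicator (cball 0 (real k)) x"
        using norm_triangle_ineq4[of "\<theta> k x *\<^sub>R c k (u x)" "\<theta> k x *\<^sub>R c k (g n x)"] bd[of x "u x"] bd[of x "g n x"]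
        by simp
    qed
  qed auto
  then have "\<forall>\<^sub>F n in sequentially. (\<integral>x. norm (\<theta> k x *\<^sub>R c k (u x) - \<theta> k x *\<^sub>R c k (g n x)) \<partial>lborel) < \<eta> / 2"
    using \<open>\<eta> > 0\<close> by (intro order_tendstoD) auto
  then obtain n where n: "(\<integral>x. norm (\<theta> k x *\<^sub>R c k (u x) - \<theta> k x *\<^sub>R c k (g n x)) \<partial>lborel) < \<eta> / 2"
    by (auto simp: eventually_sequentially)
  have ib: "integrable lborel (\<lambda>x. \<theta> k x *\<^sub>R c k (h x))" if [measurable]: "h \<in> borel_measurable borel" for h :: "'a \<Rightarrow> 'b"
  proof (rule Bochner_Integration.integrable_bound[OF intball])
    have "norm (\<theta> k x *\<^sub>R c k (h x)) \<le> norm (2 * real k * indicat_real (cball 0 (real k)) x)" for x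
      using bd[of x "h x"] by (auto simp: indicator_def split: if_splits)
    then show "AE x in lborel. norm (\<theta> k x *\<^sub>R c k (h x)) \<le> norm (2 * real k * indicat_real (cball 0 (real k)) x)"
      by simp
  qed measurable
  let ?g = "\<lambda>x. \<theta> k x *\<^sub>R c k (g n x)"
  have "continuous_on UNIV ?g"
    by (intro continuous_on_scaleR \<theta>_cont continuous_on_compose2[OF c_cont g]) auto
  moreover have "\<forall>x. real k < norm x \<longrightarrow> ?g x = 0" by (simp add: \<theta>0)
  moreover have "(\<integral>x. norm (u x - ?g x) \<partial>lborel) < \<eta>"
  proof -
    have iU: "integrable lborel (\<lambda>x. \<theta> k x *\<^sub>R c k (u x))" and iG: "integrable lborel ?g" by (auto intro!: ib)
    note J = integrable_norm[OF Bochner_Integration.integrable_diff[OF u iU]]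
             integrable_norm[OF Bochner_Integration.integrable_diff[OF iU iG]]
    have "(\<integral>x. norm (u x - ?g x) \<partial>lborel) \<le>
       (\<integral>x. norm (u x - \<theta> k x *\<^sub>R c k (u x)) + norm (\<theta> k x *\<^sub>R c k (u x) - ?g x) \<partial>lborel)"
    proof (rule integral_mono[OF integrable_norm[OF Bochner_Integration.integrable_diff[OF u iG]] Bochner_Integration.integrable_add[OF J]])
      show "norm (u x - ?g x) \<le> norm (u x - \<theta> k x *\<^sub>R c k (u x)) + norm (\<theta> k x *\<^sub>R c k (u x) - ?g x)" for x
        using norm_triangle_ineq[of "u x - \<theta> k x *\<^sub>R c k (u x)" "\<theta> k x *\<^sub>R c k (u x) - ?g x"] by simp
    qed
    also have "\<dots> = (\<integral>x. norm (u x - \<theta> k x *\<^sub>R c k (u x)) \<partial>lborel) + (\<integral>x. norm (\<theta> k x *\<^sub>R c k (u x) - ?g x) \<partial>lborel)"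
      by (rule Bochner_Integration.integral_add[OF J])
    finally show ?thesis using k n by simp
  qed
  ultimately show ?thesis by blast
qed

lemma conv_tendsto_L1_continuous:
  fixes g :: "'a::euclidean_space \<Rightarrow> 'b::euclidean_space"
  assumes \<rho>: "\<And>n. mollifier (e n) (\<rho> n)" and e: "e \<longlonglongrightarrow> 0"
    and g: "continuous_on UNIV g" "\<And>x. R < norm x \<Longrightarrow> g x = 0"
  shows "(\<lambda>n. \<integral>x. norm (conv (\<rho> n) g x - g x) \<partial>lborel) \<longlonglongrightarrow> 0"
proof -
  have gi: "integrable lborel g" by (rule integrable_continuous_compact_support[OF g])
  have [measurable]: "g \<in> borel_measurable borel" using gi by auto
  note [measurable] = mollifierD(6)[OF \<rho>]
  obtain M where M: "\<And>n z. \<bar>\<rho> n z\<bar> \<le> M n" using mollifier_bounded[OF \<rho>] by metis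
  have ci: "integrable lborel (\<lambda>x. \<rho> n (y - x) *\<^sub>R v x)" if "integrable lborel v" for n y and v :: "'a \<Rightarrow> 'b"
    by (rule conv_integrand_integrable[OF mollifierD(6)[OF \<rho>] M that])
  obtain n0 where n0: "\<And>n. n \<ge> n0 \<Longrightarrow> e n < 1"
    using order_tendstoD(2)[OF e, of 1] by (auto simp: eventually_sequentially)
  obtain B where B: "B \<ge> 0" "\<And>x. norm (g x) \<le> B"
    using bounded_continuous_compact_support[of g R] g by auto
  have diff: "norm (conv (\<rho> n) g y - g y) \<le> \<eta>" if "\<eta> \<ge> 0" and \<eta>: "\<And>x. norm (y - x) \<le> e n \<Longrightarrow> norm (g x - g y) \<le> \<eta>" for \<eta> n y
  proof -
    have i: "integrable lborel (\<lambda>x. \<rho> n (y - x))"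
      using mollifierD(8,6)[OF \<rho>[of n]] mollifierD(10)[OF \<rho>[of n], of y] mollifierD(2)[OF \<rho>]
      unfolding integrable_iff_bounded by auto
    have one: "(\<integral>x. \<rho> n (y - x) \<partial>lborel) = 1"
      using mollifierD(10)[OF \<rho>[of n], of y] mollifierD(2)[OF \<rho>[of n]]
      by (subst (asm) nn_integral_eq_integral[OF i]) auto
    have "conv (\<rho> n) g y - g y = (\<integral>x. \<rho> n (y - x) *\<^sub>R g x \<partial>lborel) - (\<integral>x. \<rho> n (y - x) *\<^sub>R g y \<partial>lborel)"
      by (simp add: conv_def one i)
    also have "\<dots> = (\<integral>x. \<rho> n (y - x) *\<^sub>R g x - \<rho> n (y - x) *\<^sub>R g y \<partial>lborel)"
      by (rule Bochner_Integration.integral_diff[symmetric]) (use ci gi i in auto)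
    also have "norm \<dots> \<le> (\<integral>x. norm (\<rho> n (y - x) *\<^sub>R g x - \<rho> n (y - x) *\<^sub>R g y) \<partial>lborel)"
      by (rule integral_norm_bound)
    also have "\<dots> \<le> (\<integral>x. \<rho> n (y - x) * \<eta> \<partial>lborel)"
    proof (rule integral_mono)
      show "integrable lborel (\<lambda>x. norm (\<rho> n (y - x) *\<^sub>R g x - \<rho> n (y - x) *\<^sub>R g y))"
        using ci[OF gi] i by (intro integrable_norm Bochner_Integration.integrable_diff) auto
      show "norm (\<rho> n (y - x) *\<^sub>R g x - \<rho> n (y - x) *\<^sub>R g y) \<le> \<rho> n (y - x) * \<eta>" for x
        using mollifierD(2)[OF \<rho>[of n], of "y - x"] mollifierD(3)[OF \<rho>[of n], of "y - x"] \<eta>[of x]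
        by (cases "norm (y - x) \<le> e n")
           (auto simp: scaleR_diff_right[symmetric] not_le intro!: mult_left_mono)
    qed (use i in auto)
    also have "\<dots> = \<eta>" using one by simp
    finally show ?thesis .
  qed
  \<comment> \<open>The shift by \<open>n0\<close> puts all radii below 1, so the mollifications
    live in the ball of radius \<open>R + 1\<close>; this is what yields an integrable
    majorant.\<close>
  have "(\<lambda>n. \<integral>x. norm (conv (\<rho> (n + n0)) g x - g x) \<partial>lborel) \<longlonglongrightarrow> (\<integral>x. 0 \<partial>(lborel :: 'a measure))"
  proof (rule integral_dominated_convergence[where w = "\<lambda>x. 2 * B * indicator (cball 0 (R + 1)) x"])
    show "integrable lborel (\<lambda>x::'a. 2 * B * indicator (cball 0 (R + 1)) x)"
      by (intro integrable_mult_right integrable_real_indicator)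
         (use emeasure_bounded_finite[OF bounded_cball[of "0::'a" "R + 1"]] in auto)
    show "AE x in lborel. (\<lambda>n. norm (conv (\<rho> (n + n0)) g x - g x)) \<longlonglongrightarrow> 0"
    proof (rule AE_I2, rule LIMSEQ_I)
      fix x and r :: real assume "0 < r"
      have "isCont g x" using g(1) by (simp add: continuous_on_eq_continuous_at)
      then obtain d where d: "d > 0" "\<And>y. dist y x < d \<Longrightarrow> dist (g y) (g x) < r / 2"
        using \<open>0 < r\<close> unfolding continuous_at_eps_delta by (metis half_gt_zero)
      obtain m where m: "\<And>n. n \<ge> m \<Longrightarrow> e n < d"
        using order_tendstoD(2)[OF e, of d] d(1) by (auto simp: eventually_sequentially)
      have "norm (conv (\<rho> (n + n0)) g x - g x) \<le> r / 2" if "n \<ge> m" for n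
      proof (rule diff)
        fix y assume "norm (x - y) \<le> e (n + n0)"
        then have "dist y x < d" using m[of "n + n0"] that by (simp add: dist_norm norm_minus_commute)
        from d(2)[OF this] show "norm (g y - g x) \<le> r / 2" by (simp add: dist_norm)
      qed (use \<open>0 < r\<close> in auto)
      then have "\<forall>n\<ge>m. norm (norm (conv (\<rho> (n + n0)) g x - g x) - 0) < r"
        using \<open>0 < r\<close> by (simp, smt (verit, best) field_sum_of_halves)
      then show "\<exists>no. \<forall>n\<ge>no. norm (norm (conv (\<rho> (n + n0)) g x - g x) - 0) < r" by blast
    qed
    show "AE x in lborel. norm (norm (conv (\<rho> (n + n0)) g x - g x)) \<le> 2 * B * indicator (cball 0 (R + 1)) x" for n
    proof (rule AE_I2)
      fix x :: 'a
      have "norm (conv (\<rho> (n + n0)) g x - g x) \<le> 2 * B"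
      proof (rule diff)
        show "norm (g y - g x) \<le> 2 * B" for y
          using norm_triangle_ineq4[of "g y" "g x"] B(2)[of y] B(2)[of x] by linarith
      qed (use B in auto)
      moreover have "norm (conv (\<rho> (n + n0)) g x - g x) \<le> 0" if "R + 1 < norm x"
      proof (rule diff)
        fix y assume "norm (x - y) \<le> e (n + n0)"
        then have "norm (x - y) < 1" using n0[of "n + n0"] by simp
        then have "R < norm y" using that norm_triangle_ineq2[of x y] by linarith
        then show "norm (g y - g x) \<le> 0" using g(2)[of x] g(2)[of y] that by simp
      qed auto
      ultimately show "norm (norm (conv (\<rho> (n + n0)) g x - g x)) \<le> 2 * B * indicator (cball 0 (R + 1)) x"
        by (cases "R + 1 < norm x") (auto simp: indicator_def not_less)
    qed
  qed auto
  then have "(\<lambda>n. \<integral>x. norm (conv (\<rho> (n + n0)) g x - g x) \<partial>lborel) \<longlonglongrightarrow> 0" by simp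
  then show ?thesis by (rule LIMSEQ_offset)
qed

text \<open>Three errors of size r/3: approximate \<open>u\<close> by a continuous \<open>g\<close>
  of compact support, mollify \<open>g\<close>, and use that mollification does not increase the L1
  norm of \<open>u - g\<close>.\<close>

lemma conv_tendsto_L1:
  fixes u :: "'a::euclidean_space \<Rightarrow> 'b::euclidean_space"
  assumes \<rho>: "\<And>n. mollifier (e n) (\<rho> n)" and e: "e \<longlonglongrightarrow> 0" and u: "integrable lborel u"
  shows "(\<lambda>n. \<integral>x. norm (conv (\<rho> n) u x - u x) \<partial>lborel) \<longlonglongrightarrow> 0"
proof (rule LIMSEQ_I)
  fix r :: real assume "r > 0"
  then have r3: "r / 3 > 0" by simp
  obtain g R where g: "continuous_on UNIV g" "\<And>x. R < norm x \<Longrightarrow> g x = 0"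
      and ug: "(\<integral>x. norm (u x - g x) \<partial>lborel) < r / 3"
    using integrable_compact_support_dense[OF u r3] by blast
  have gi: "integrable lborel g" by (rule integrable_continuous_compact_support[OF g])
  have cu: "integrable lborel (conv (\<rho> n) v)" if "integrable lborel v" for n and v :: "'a \<Rightarrow> 'b"
    by (rule integrable_conv[OF \<rho> that])
  obtain m where m: "\<And>n. n \<ge> m \<Longrightarrow> (\<integral>x. norm (conv (\<rho> n) g x - g x) \<partial>lborel) < r / 3"
    using order_tendstoD(2)[OF conv_tendsto_L1_continuous[OF \<rho> e g] r3]
    by (auto simp: eventually_sequentially)
  have "norm ((\<integral>x. norm (conv (\<rho> n) u x - u x) \<partial>lborel) - 0) < r" if "n \<ge> m" for n
  proof -
    have d: "conv (\<rho> n) u x - u x = conv (\<rho> n) (\<lambda>x. u x - g x) x + (conv (\<rho> n) g x - g x) - (u x - g x)" for x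
      by (simp add: conv_diff[OF \<rho> u gi])
    have "(\<integral>x. norm (conv (\<rho> n) u x - u x) \<partial>lborel) \<le>
      (\<integral>x. (norm (conv (\<rho> n) (\<lambda>x. u x - g x) x) + norm (conv (\<rho> n) g x - g x)) + norm (u x - g x) \<partial>lborel)"
    proof (rule integral_mono)
      show "norm (conv (\<rho> n) u x - u x) \<le>
          (norm (conv (\<rho> n) (\<lambda>x. u x - g x) x) + norm (conv (\<rho> n) g x - g x)) + norm (u x - g x)" for x
        unfolding d by (meson add_right_mono norm_triangle_ineq norm_triangle_ineq4 order_trans)
    qed (use u gi cu in \<open>auto intro!: integrable_norm Bochner_Integration.integrable_diff Bochner_Integration.integrable_add\<close>)
    also have "\<dots> = (\<integral>x. norm (conv (\<rho> n) (\<lambda>x. u x - g x) x) \<partial>lborel)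
        + (\<integral>x. norm (conv (\<rho> n) g x - g x) \<partial>lborel) + (\<integral>x. norm (u x - g x) \<partial>lborel)"
      using u gi cu
      by (simp add: Bochner_Integration.integral_add Bochner_Integration.integrable_diff integrable_norm)
    also have "\<dots> < r"
      using conv_integral_norm_le[OF \<rho>[of n], of "\<lambda>x. u x - g x"] u gi ug m[OF that]
      by (simp add: Bochner_Integration.integrable_diff)
    finally show ?thesis by simp
  qed
  then show "\<exists>no. \<forall>n\<ge>no. norm ((\<integral>x. norm (conv (\<rho> n) u x - u x) \<partial>lborel) - 0) < r" by blast
qed

section \<open>Mollified gradients\<close>

definition grad :: "(real^'d \<Rightarrow> real) \<Rightarrow> real^'d \<Rightarrow> real^'d" where
  "grad u x = (\<chi> i. frechet_derivative u (at x) (axis i 1))"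

definition sym_grad :: "(real^'d \<Rightarrow> real^'d) \<Rightarrow> real^'d \<Rightarrow> real^'d^'d" where
  "sym_grad w x = (\<chi> i j. (grad (\<lambda>x. w x $ i) x $ j + grad (\<lambda>x. w x $ j) x $ i) / 2)"

lemma conv_bounded_linear:
  fixes v :: "'a::euclidean_space \<Rightarrow> 'b::euclidean_space" and L :: "'b \<Rightarrow> 'c::euclidean_space"
  assumes L: "bounded_linear L" and "\<kappa> \<in> borel_measurable borel" "\<And>z. \<bar>\<kappa> z\<bar> \<le> M" "integrable lborel v"
  shows "conv \<kappa> (\<lambda>x. L (v x)) y = L (conv \<kappa> v y)"
proof -
  have "L (\<integral>x. \<kappa> (y - x) *\<^sub>R v x \<partial>lborel) = (\<integral>x. L (\<kappa> (y - x) *\<^sub>R v x) \<partial>lborel)"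
    by (rule integral_bounded_linear[OF L conv_integrand_integrable[OF assms(2-4)], symmetric])
  then show ?thesis by (simp add: conv_def linear_cmul[OF bounded_linear.linear[OF L]])
qed

text \<open>The partial derivatives of an even function are odd. That sign will cancel the minus
  sign in the definition of the distributional gradient.\<close>

lemma mollifier_partial:
  fixes \<rho> :: "real^'d \<Rightarrow> real"
  assumes \<rho>: "mollifier e \<rho>"
  defines "D \<equiv> \<lambda>i z. frechet_derivative \<rho> (at z) (axis i 1)"
  shows "D i \<in> borel_measurable borel" "\<exists>M. \<forall>z. \<bar>D i z\<bar> \<le> M" "D i (- z) = - D i z"
proof -
  note m = mollifierD[OF \<rho>]
  show "D i \<in> borel_measurable borel"
    unfolding D_def by (intro borel_measurable_continuous_onI smooth_continuous smooth_derivative m)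
  show "\<exists>M. \<forall>z. \<bar>D i z\<bar> \<le> M"
    using bounded_derivative_compact_support[of \<rho> e, OF m(1,3)] unfolding D_def
    by (metis mult.right_neutral norm_axis_1 real_norm_def)
  have d: "(\<rho> has_derivative frechet_derivative \<rho> (at z)) (at z)" for z
    by (rule smooth_has_derivative[OF m(1)])
  have "((\<lambda>x. \<rho> (- x)) has_derivative (\<lambda>h. frechet_derivative \<rho> (at (- z)) (- h))) (at z)"
    by (rule has_derivative_compose[OF _ d]) (auto intro!: derivative_eq_intros)
  then have "frechet_derivative \<rho> (at z) = (\<lambda>h. frechet_derivative \<rho> (at (- z)) (- h))"
    unfolding m(4) by (metis frechet_derivative_at)
  then show "D i (- z) = - D i z"
    unfolding D_def using linear_neg[OF has_derivative_linear[OF d]] by simp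
qed

lemma grad_conv:
  assumes \<rho>: "mollifier e \<rho>" and u: "integrable lborel u"
  shows "grad (conv \<rho> u) x $ i = conv (\<lambda>z. frechet_derivative \<rho> (at z) (axis i 1)) u x"
  unfolding grad_def using frechet_derivative_conv[of \<rho> e u, OF mollifierD(1,3)[OF \<rho>] u] by simp

lemma smooth_conv_mollifier:
  assumes \<rho>: "mollifier e \<rho>" and u: "integrable lborel u"
  shows "smooth (conv \<rho> u)"
  by (rule smooth_conv[of \<rho> e u, OF mollifierD(1,3)[OF \<rho>] u])

lemma continuous_on_grad_smooth: "smooth u \<Longrightarrow> continuous_on UNIV (grad u)"
  unfolding grad_def[abs_def] by (intro continuous_on_vec_lambda smooth_continuous smooth_derivative)

lemma bounded_grad_conv:
  assumes \<rho>: "mollifier e \<rho>" and u: "integrable lborel u"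
  shows "\<exists>M. \<forall>x. norm (grad (conv \<rho> u) x) \<le> M"
proof -
  have "\<exists>M. \<forall>x. \<bar>grad (conv \<rho> u) x $ i\<bar> \<le> M" for i
    using mollifier_partial(1,2)[OF \<rho>, of i] conv_bounded[OF _ _ u] unfolding grad_conv[OF assms] by (metis real_norm_def)
  then obtain M where "\<And>i x. \<bar>grad (conv \<rho> u) x $ i\<bar> \<le> M i" by metis
  then have "norm (grad (conv \<rho> u) x) \<le> (\<Sum>i\<in>UNIV. M i)" for x
    by (intro order_trans[OF norm_le_l1_cart] sum_mono)
  then show ?thesis by blast
qed

lemma integrable_bounded_inner:
  fixes v g :: "'a::euclidean_space \<Rightarrow> 'b::euclidean_space"
  assumes v: "integrable lborel v" and [measurable]: "g \<in> borel_measurable borel" and M: "\<And>x. norm (g x) \<le> M"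
  shows "integrable lborel (\<lambda>x. g x \<bullet> v x)"
proof -
  have [measurable]: "v \<in> borel_measurable borel" using v by auto
  have "norm (g x \<bullet> v x) \<le> norm (M *\<^sub>R v x)" for x
    using Cauchy_Schwarz_ineq2[of "g x" "v x"] mult_right_mono[OF order_trans[OF M[of x] abs_ge_self], of "norm (v x)"] by simp
  then have "AE x in lborel. norm (g x \<bullet> v x) \<le> norm (M *\<^sub>R v x)" by (rule AE_I2)
  then show ?thesis
    by (rule Bochner_Integration.integrable_bound[OF integrable_scaleR_right[OF v], rotated]) measurable
qed

lemma integrable_mult_conv:
  fixes g h :: "'a::euclidean_space \<Rightarrow> real"
  assumes \<kappa>: "\<kappa> \<in> borel_measurable borel" "\<And>z. \<bar>\<kappa> z\<bar> \<le> M"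
    and g: "integrable lborel g" and h: "integrable lborel h"
  shows "integrable lborel (\<lambda>y. g y * conv \<kappa> h y)"
proof -
  have "conv \<kappa> h \<in> borel_measurable borel" using \<kappa> h by (intro conv_measurable) auto
  from integrable_bounded_inner[OF g this conv_bounded[OF \<kappa> h]]
  show ?thesis by (simp add: mult.commute)
qed

text \<open>The distributions are defined by integrals over \<open>lebesgue_on\<close>, whereas
  Fubini and translations are used on \<open>lborel\<close>; for Borel functions that vanish off
  \<Omega> one may pass from one to the other.\<close>

lemma integral_lebesgue_on_eq_lborel:
  fixes f :: "'a::euclidean_space \<Rightarrow> 'b::euclidean_space"
  assumes "\<Omega> \<in> sets borel" "f \<in> borel_measurable borel" "\<And>x. x \<notin> \<Omega> \<Longrightarrow> f x = 0"
  shows "(LINT x|lebesgue_on \<Omega>. f x) = integral\<^sup>L lborel f"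
proof -
  have "(LINT x|lebesgue_on \<Omega>. f x) = (LINT x|lebesgue. indicator \<Omega> x *\<^sub>R f x)"
    using assms(1) by (intro integral_restrict_space) auto
  also have "(\<lambda>x. indicator \<Omega> x *\<^sub>R f x) = f"
    using assms(3) by (auto simp: fun_eq_iff indicator_def)
  finally show ?thesis using assms(2) by (simp add: integral_completion)
qed

text \<open>The divergence of the mollified field falls on the kernel, \<open>conv_swap\<close>
  carries the kernel over to \<open>u\<close>, and oddness of the partial derivatives repairs the
  sign. As \<open>v\<close> is never differentiated, discontinuous fields are allowed, among them
  the one that attains the norm by duality.\<close>

lemma distr_grad_conv:
  fixes u :: "real^'d \<Rightarrow> real"
  assumes "open \<Omega>" and \<rho>: "mollifier e \<rho>" and u: "integrable lborel u" "\<And>x. x \<notin> \<Omega> \<Longrightarrow> u x = 0"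
    and v: "integrable lborel v"
  shows "distr_grad \<Omega> u (conv \<rho> v) = (\<integral>x. grad (conv \<rho> u) x \<bullet> v x \<partial>lborel)"
proof -
  define D where "D i z = frechet_derivative \<rho> (at z) (axis i 1)" for i z
  have D1: "D i \<in> borel_measurable borel" and D3: "D i (- z) = - D i z" for i z
    using mollifier_partial(1,3)[OF \<rho>] by (simp_all add: D_def[abs_def])
  obtain M where M: "\<And>i z. \<bar>D i z\<bar> \<le> M i"
    using mollifier_partial(2)[OF \<rho>] unfolding D_def by metis
  have [measurable]: "u \<in> borel_measurable borel" "v \<in> borel_measurable borel" "\<And>i. D i \<in> borel_measurable borel"
    using u v D1 by auto
  have vi: "integrable lborel (\<lambda>x. v x $ i)" for i
    by (rule integrable_bounded_linear[OF bounded_linear_vec_nth v])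
  have dv: "divergence (conv \<rho> v) y = (\<Sum>i\<in>UNIV. conv (D i) (\<lambda>x. v x $ i) y)" for y
    unfolding divergence_def
    by (intro sum.cong refl)
       (simp add: D_def[abs_def] frechet_derivative_conv[of \<rho> e v, OF mollifierD(1,3)[OF \<rho>] v]
         conv_bounded_linear[OF bounded_linear_vec_nth D1[unfolded D_def[abs_def]] M[unfolded D_def] v])
  have [measurable]: "(\<lambda>x. v x $ i) \<in> borel_measurable borel" for i
    using borel_measurable_integrable[OF vi] by simp
  have [measurable]: "divergence (conv \<rho> v) \<in> borel_measurable borel"
    unfolding dv[abs_def] by measurable
  then have "distr_grad \<Omega> u (conv \<rho> v) = - (\<integral>y. u y * divergence (conv \<rho> v) y \<partial>lborel)"
    unfolding distr_grad_def using assms(1)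
    by (subst integral_lebesgue_on_eq_lborel) (auto simp: u(2))
  also have "\<dots> = - (\<Sum>i\<in>UNIV. \<integral>y. u y * conv (D i) (\<lambda>x. v x $ i) y \<partial>lborel)"
  proof -
    have "integrable lborel (\<lambda>y. u y * conv (D i) (\<lambda>x. v x $ i) y)" for i
      by (rule integrable_mult_conv[OF D1 M u(1) vi])
    then show ?thesis unfolding dv sum_distrib_left
      by (subst Bochner_Integration.integral_sum) auto
  qed
  also have "\<dots> = (\<Sum>i\<in>UNIV. \<integral>x. v x $ i * conv (D i) u x \<partial>lborel)"
  proof -
    have "(\<integral>y. u y * conv (D i) (\<lambda>x. v x $ i) y \<partial>lborel) = - (\<integral>x. v x $ i * conv (D i) u x \<partial>lborel)" for i
      unfolding conv_swap[OF D1 M u(1) vi] D3 by (simp add: conv_def)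
    then show ?thesis by (simp add: sum_negf)
  qed
  also have "\<dots> = (\<integral>x. (\<Sum>i\<in>UNIV. v x $ i * conv (D i) u x) \<partial>lborel)"
  proof -
    have "integrable lborel (\<lambda>x. v x $ i * conv (D i) u x)" for i
      by (rule integrable_mult_conv[OF D1 M vi u(1)])
    then show ?thesis by (subst Bochner_Integration.integral_sum) auto
  qed
  also have "(\<lambda>x. \<Sum>i\<in>UNIV. v x $ i * conv (D i) u x) = (\<lambda>x. grad (conv \<rho> u) x \<bullet> v x)"
    by (simp add: inner_vec_def grad_conv[OF \<rho> u(1)] D_def[abs_def] mult.commute)
  finally show ?thesis .
qed

lemma distr_of_fun_conv:
  fixes w :: "real^'d \<Rightarrow> real^'d"
  assumes "open \<Omega>" and \<rho>: "mollifier e \<rho>" and w: "integrable lborel w" "\<And>x. x \<notin> \<Omega> \<Longrightarrow> w x = 0"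
    and v: "integrable lborel v"
  shows "distr_of_fun \<Omega> w (conv \<rho> v) = (\<integral>x. conv \<rho> w x \<bullet> v x \<partial>lborel)"
proof -
  obtain M where M: "\<And>z. \<bar>\<rho> z\<bar> \<le> M" using mollifier_bounded[OF \<rho>] by auto
  note \<rho>m = mollifierD(6)[OF \<rho>]
  have [measurable]: "w \<in> borel_measurable borel" "v \<in> borel_measurable borel" "\<rho> \<in> borel_measurable borel"
    using w v \<rho>m by auto
  have vi: "integrable lborel (\<lambda>x. v x $ i)" and wi: "integrable lborel (\<lambda>x. w x $ i)" for i
    by (rule integrable_bounded_linear[OF bounded_linear_vec_nth], fact)+
  have int: "integrable lborel (\<lambda>y. g y * conv \<rho> h y)" if "integrable lborel g" "integrable lborel h" for g h :: "real^'d \<Rightarrow> real"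
    by (rule integrable_mult_conv[OF \<rho>m M that])
  have c: "conv \<rho> f x $ i = conv \<rho> (\<lambda>x. f x $ i) x" if "integrable lborel f" for f :: "real^'d \<Rightarrow> real^'d" and i x
    by (rule conv_bounded_linear[OF bounded_linear_vec_nth \<rho>m M that, symmetric])
  have "distr_of_fun \<Omega> w (conv \<rho> v) = (\<integral>y. w y \<bullet> conv \<rho> v y \<partial>lborel)"
    unfolding distr_of_fun_def using assms(1)
    by (subst integral_lebesgue_on_eq_lborel) (auto simp: w(2))
  also have "\<dots> = (\<integral>y. (\<Sum>i\<in>UNIV. w y $ i * conv \<rho> (\<lambda>x. v x $ i) y) \<partial>lborel)"
    by (simp add: inner_vec_def c[OF v])
  also have "\<dots> = (\<Sum>i\<in>UNIV. \<integral>y. w y $ i * conv \<rho> (\<lambda>x. v x $ i) y \<partial>lborel)"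
    by (rule Bochner_Integration.integral_sum) (intro int vi wi)
  also have "\<dots> = (\<Sum>i\<in>UNIV. \<integral>y. v y $ i * conv \<rho> (\<lambda>x. w x $ i) y \<partial>lborel)"
    unfolding conv_swap[OF \<rho>m M wi vi] mollifierD(4)[OF \<rho>] by simp
  also have "\<dots> = (\<integral>y. (\<Sum>i\<in>UNIV. v y $ i * conv \<rho> (\<lambda>x. w x $ i) y) \<partial>lborel)"
    by (rule Bochner_Integration.integral_sum[symmetric]) (intro int vi wi)
  also have "\<dots> = (\<integral>x. conv \<rho> w x \<bullet> v x \<partial>lborel)"
    by (simp add: inner_vec_def c[OF w(1)] mult.commute)
  finally show ?thesis .
qed

lemma bounded_linear_transpose_row: "bounded_linear (\<lambda>A::real^'d^'d. transpose A $ i)"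
proof -
  have "linear (\<lambda>A::real^'d^'d. transpose A $ i)"
    by (rule linearI) (auto simp: transpose_def vec_eq_iff)
  then show ?thesis by (simp add: linear_conv_bounded_linear)
qed

text \<open>The scalar identity is applied to each row of \<open>V\<close> and of its transpose.
  Exchanging the two sums in the transposed part produces the transposed Jacobian, and half the
  total is \<open>sym_grad\<close>.\<close>

lemma distr_sym_grad_conv:
  fixes w :: "real^'d \<Rightarrow> real^'d"
  assumes "open \<Omega>" and \<rho>: "mollifier e \<rho>" and w: "integrable lborel w" "\<And>x. x \<notin> \<Omega> \<Longrightarrow> w x = 0"
    and V: "integrable lborel V"
  shows "distr_sym_grad \<Omega> w (conv \<rho> V) = (\<integral>x. sym_grad (conv \<rho> w) x \<bullet> V x \<partial>lborel)"
proof -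
  obtain M where M: "\<And>z. \<bar>\<rho> z\<bar> \<le> M" using mollifier_bounded[OF \<rho>] by auto
  note \<rho>m = mollifierD(6)[OF \<rho>]
  have wi: "integrable lborel (\<lambda>x. w x $ i)" for i
    by (rule integrable_bounded_linear[OF bounded_linear_vec_nth], fact)
  have Vi: "integrable lborel (\<lambda>x. V x $ i)" for i
    by (rule integrable_bounded_linear[OF bounded_linear_vec_nth], fact)
  have Ti: "integrable lborel (\<lambda>x. transpose (V x) $ i)" for i
    by (rule integrable_bounded_linear[OF bounded_linear_transpose_row], fact)
  have 1: "(\<lambda>x. conv \<rho> V x $ i) = conv \<rho> (\<lambda>x. V x $ i)" for i
    by (rule ext) (rule conv_bounded_linear[OF bounded_linear_vec_nth \<rho>m M V, symmetric])
  have 2: "(\<lambda>x. transpose (conv \<rho> V x) $ i) = conv \<rho> (\<lambda>x. transpose (V x) $ i)" for i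
    by (rule ext) (rule conv_bounded_linear[OF bounded_linear_transpose_row \<rho>m M V, symmetric])
  have 3: "(\<lambda>x. conv \<rho> w x $ i) = conv \<rho> (\<lambda>x. w x $ i)" for i
    by (rule ext) (rule conv_bounded_linear[OF bounded_linear_vec_nth \<rho>m M w(1), symmetric])
  let ?g = "\<lambda>i. grad (conv \<rho> (\<lambda>x. w x $ i))"
  have int: "integrable lborel (\<lambda>x. ?g i x \<bullet> f x)" if "integrable lborel f" for i f
  proof -
    obtain N where N: "\<And>x. norm (?g i x) \<le> N" using bounded_grad_conv[OF \<rho> wi[of i]] by auto
    have "continuous_on UNIV (?g i)"
      by (intro continuous_on_grad_smooth smooth_conv_mollifier[OF \<rho> wi])
    from integrable_bounded_inner[OF that borel_measurable_continuous_onI[OF this] N] show ?thesis .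
  qed
  have "distr_sym_grad \<Omega> w (conv \<rho> V) =
     1 / 2 * ((\<Sum>i\<in>UNIV. \<integral>x. ?g i x \<bullet> V x $ i \<partial>lborel) + (\<Sum>i\<in>UNIV. \<integral>x. ?g i x \<bullet> transpose (V x) $ i \<partial>lborel))"
    unfolding distr_sym_grad_def distr_jacobian_def distr_transpose_def 1 2
    by (subst (1 2) distr_grad_conv[OF assms(1) \<rho> wi]) (auto simp: w(2) Vi Ti)
  also have "\<dots> = 1 / 2 * ((\<integral>x. (\<Sum>i\<in>UNIV. ?g i x \<bullet> V x $ i) \<partial>lborel) + (\<integral>x. (\<Sum>i\<in>UNIV. ?g i x \<bullet> transpose (V x) $ i) \<partial>lborel))"
    by (subst (1 2) Bochner_Integration.integral_sum) (auto intro!: int Vi Ti)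
  also have "\<dots> = (\<integral>x. 1 / 2 * ((\<Sum>i\<in>UNIV. ?g i x \<bullet> V x $ i) + (\<Sum>i\<in>UNIV. ?g i x \<bullet> transpose (V x) $ i)) \<partial>lborel)"
    by (subst Bochner_Integration.integral_mult_right_zero, subst Bochner_Integration.integral_add)
       (auto intro!: Bochner_Integration.integrable_sum int Vi Ti)
  also have "(\<lambda>x. 1 / 2 * ((\<Sum>i\<in>UNIV. ?g i x \<bullet> V x $ i) + (\<Sum>i\<in>UNIV. ?g i x \<bullet> transpose (V x) $ i)))
    = (\<lambda>x. sym_grad (conv \<rho> w) x \<bullet> V x)"
  proof
    fix x
    have "(\<Sum>i\<in>UNIV. ?g i x \<bullet> transpose (V x) $ i) = (\<Sum>i\<in>UNIV. \<Sum>j\<in>UNIV. ?g i x $ j * V x $ j $ i)"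
      by (simp add: inner_vec_def transpose_def)
    also have "\<dots> = (\<Sum>i\<in>UNIV. \<Sum>j\<in>UNIV. ?g j x $ i * V x $ i $ j)" by (rule sum.swap)
    finally have t: "(\<Sum>i\<in>UNIV. ?g i x \<bullet> transpose (V x) $ i) = (\<Sum>i\<in>UNIV. \<Sum>j\<in>UNIV. ?g j x $ i * V x $ i $ j)" .
    show "1 / 2 * ((\<Sum>i\<in>UNIV. ?g i x \<bullet> V x $ i) + (\<Sum>i\<in>UNIV. ?g i x \<bullet> transpose (V x) $ i))
      = sym_grad (conv \<rho> w) x \<bullet> V x"
      unfolding t unfolding inner_vec_def sym_grad_def 3 inner_real_def sum.distrib[symmetric] sum_distrib_left
      by (intro sum.cong refl) (simp add: field_simps)
  qed
  finally show ?thesis .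
qed

section \<open>Duality between Radon norms and mollified fields\<close>

lemma conv_in_test_functions:
  fixes v :: "'a::euclidean_space \<Rightarrow> 'b::euclidean_space"
  assumes \<rho>: "mollifier e \<rho>" and v: "integrable lborel v" "\<And>x. x \<notin> K \<Longrightarrow> v x = 0"
    and K: "compact K" "\<And>x. x \<in> K \<Longrightarrow> cball x e \<subseteq> \<Omega>"
  shows "conv \<rho> v \<in> test_functions \<Omega>"
proof -
  \<comment> \<open>The Minkowski sum of \<open>K\<close> and the closed ball of radius
    \<open>e\<close>: it is compact and contains every point at which the convolution can be
    nonzero.\<close>
  let ?S = "{x + y |x y. x \<in> K \<and> y \<in> cball 0 e}"
  have S: "compact ?S" by (intro compact_sums K compact_cball)
  have sub: "{y. conv \<rho> v y \<noteq> 0} \<subseteq> ?S"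
  proof
    fix y assume "y \<in> {y. conv \<rho> v y \<noteq> 0}"
    have "\<exists>x. \<rho> (y - x) *\<^sub>R v x \<noteq> 0"
    proof (rule ccontr)
      assume "\<not> ?thesis"
      then have "conv \<rho> v y = 0" by (simp add: conv_def del: scaleR_eq_0_iff)
      with \<open>y \<in> {y. conv \<rho> v y \<noteq> 0}\<close> show False by simp
    qed
    then obtain x where "x \<in> K" "norm (y - x) \<le> e"
      using v(2) mollifierD(3)[OF \<rho>] by (metis not_le scaleR_eq_0_iff)
    then have "y = x + (y - x) \<and> x \<in> K \<and> y - x \<in> cball 0 e" by simp
    then show "y \<in> ?S" by blast
  qed
  have "?S \<subseteq> \<Omega>"
    using K(2) by (force simp: dist_norm)
  have cl: "closure {y. conv \<rho> v y \<noteq> 0} \<subseteq> ?S"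
    by (rule closure_minimal[OF sub compact_imp_closed[OF S]])
  have "compact (?S \<inter> closure {y. conv \<rho> v y \<noteq> 0})"
    by (rule compact_Int_closed[OF S closed_closure])
  moreover have "?S \<inter> closure {y. conv \<rho> v y \<noteq> 0} = closure {y. conv \<rho> v y \<noteq> 0}"
    using cl by blast
  ultimately have "compact (closure {y. conv \<rho> v y \<noteq> 0})" by simp
  then show ?thesis
    using subset_trans[OF cl \<open>?S \<subseteq> \<Omega>\<close>] smooth_conv_mollifier[OF \<rho> v(1)]
    by (simp add: test_functions_def)
qed

text \<open>\<open>sgn (G x)\<close> is the field whose pairing with \<open>G\<close> returns the
  norm of \<open>G\<close>. It may be discontinuous; mollifying it produces the admissible test
  field.\<close>

lemma dual_test_field:
  fixes G :: "'a::euclidean_space \<Rightarrow> 'b::euclidean_space"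
  assumes G: "continuous_on UNIV G" and K: "compact K"
  defines "v \<equiv> \<lambda>x. indicator K x *\<^sub>R sgn (G x)"
  shows "integrable lborel v" "\<And>x. norm (v x) \<le> 1" "\<And>x. x \<notin> K \<Longrightarrow> v x = 0"
    "\<And>x. G x \<bullet> v x = indicator K x * norm (G x)"
proof -
  have [measurable]: "G \<in> borel_measurable borel" using G by (rule borel_measurable_continuous_onI)
  have [measurable]: "K \<in> sets borel" using K by (simp add: borel_compact)
  show n: "norm (v x) \<le> 1" for x by (auto simp: v_def norm_sgn indicator_def)
  show z: "x \<notin> K \<Longrightarrow> v x = 0" for x by (auto simp: v_def)
  show "G x \<bullet> v x = indicator K x * norm (G x)" for x
    by (cases "G x = 0") (auto simp: v_def sgn_div_norm dot_square_norm power2_eq_square field_simps)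
  have "integrable lborel (indicat_real K)"
    using emeasure_compact_finite[OF K] by (intro integrable_real_indicator) auto
  then show "integrable lborel v"
  proof (rule Bochner_Integration.integrable_bound)
    have "v = (\<lambda>x. indicator K x *\<^sub>R (inverse (norm (G x)) *\<^sub>R G x))"
      by (auto simp: v_def sgn_div_norm)
    then show "v \<in> borel_measurable lborel" by simp
  qed (use n z in \<open>auto simp: indicator_def\<close>)
qed

text \<open>Testing the distribution with the mollified dual field turns the bound over test fields
  into a bound for the L1 norm over \<open>K\<close> of the mollified density. The margin
  \<open>e\<close> between \<open>K\<close> and the complement of \<Omega> keeps the support of the
  test field inside \<Omega>.\<close>

lemma mollified_grad_bound:
  fixes u :: "real^'d \<Rightarrow> real" and w :: "real^'d \<Rightarrow> real^'d"
  assumes \<Omega>: "open \<Omega>" and \<rho>: "mollifier e \<rho>" and K: "compact K" "\<And>x. x \<in> K \<Longrightarrow> cball x e \<subseteq> \<Omega>"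
    and u: "integrable lborel u" "\<And>x. x \<notin> \<Omega> \<Longrightarrow> u x = 0"
    and w: "integrable lborel w" "\<And>x. x \<notin> \<Omega> \<Longrightarrow> w x = 0"
    and a: "\<And>v. v \<in> test_functions \<Omega> \<Longrightarrow> (\<And>x. norm (v x) \<le> 1) \<Longrightarrow> distr_grad \<Omega> u v - distr_of_fun \<Omega> w v \<le> a"
  shows "(\<integral>x. indicator K x * norm (grad (conv \<rho> u) x - conv \<rho> w x) \<partial>lborel) \<le> a"
proof -
  let ?G = "\<lambda>x. grad (conv \<rho> u) x - conv \<rho> w x"
  have cg: "continuous_on UNIV (grad (conv \<rho> u))" and cw: "continuous_on UNIV (conv \<rho> w)"
    using continuous_on_grad_smooth smooth_continuous smooth_conv_mollifier \<rho> u(1) w(1) by blast+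
  have G: "continuous_on UNIV ?G" by (intro continuous_intros cg cw)
  define v where "v x = indicator K x *\<^sub>R sgn (?G x)" for x
  note v = dual_test_field[OF G K(1), folded v_def]
  obtain M where M: "\<And>x. norm (grad (conv \<rho> u) x) \<le> M" using bounded_grad_conv[OF \<rho> u(1)] by auto
  obtain N where N: "\<And>z. \<bar>\<rho> z\<bar> \<le> N" using mollifier_bounded[OF \<rho>] by auto
  have "(\<integral>x. indicator K x * norm (?G x) \<partial>lborel) = (\<integral>x. ?G x \<bullet> v x \<partial>lborel)"
    by (simp add: v(4))
  also have "\<dots> = (\<integral>x. grad (conv \<rho> u) x \<bullet> v x \<partial>lborel) - (\<integral>x. conv \<rho> w x \<bullet> v x \<partial>lborel)"
    unfolding inner_diff_left
    by (intro Bochner_Integration.integral_diff integrable_bounded_inner[OF v(1) _ M]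
          integrable_bounded_inner[OF v(1) _ conv_bounded[OF mollifierD(6)[OF \<rho>] N w(1)]]
          borel_measurable_continuous_onI cg cw)
  also have "\<dots> = distr_grad \<Omega> u (conv \<rho> v) - distr_of_fun \<Omega> w (conv \<rho> v)"
    using distr_grad_conv[OF \<Omega> \<rho> u v(1)] distr_of_fun_conv[OF \<Omega> \<rho> w v(1)] by simp
  also have "\<dots> \<le> a"
    using conv_in_test_functions[OF \<rho> v(1,3) K] conv_norm_le_1[OF \<rho> v(1,2)] by (intro a)
  finally show ?thesis .
qed

lemma continuous_on_sym_grad_smooth:
  assumes "smooth w" shows "continuous_on UNIV (sym_grad w)"
proof -
  have "smooth (\<lambda>x. w x $ i)" for i
    by (rule smooth_bounded_linear[OF bounded_linear_vec_nth assms])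
  then have "continuous_on UNIV (\<lambda>x. grad (\<lambda>x. w x $ i) x $ j)" for i j
    by (intro continuous_on_component continuous_on_grad_smooth)
  then show ?thesis
    unfolding sym_grad_def[abs_def]
    by (intro continuous_on_vec_lambda continuous_on_divide continuous_on_add continuous_on_const) auto
qed

lemma mollified_sym_grad_bound:
  fixes w :: "real^'d \<Rightarrow> real^'d"
  assumes \<Omega>: "open \<Omega>" and \<rho>: "mollifier e \<rho>" and K: "compact K" "\<And>x. x \<in> K \<Longrightarrow> cball x e \<subseteq> \<Omega>"
    and w: "integrable lborel w" "\<And>x. x \<notin> \<Omega> \<Longrightarrow> w x = 0"
    and b: "\<And>V. V \<in> test_functions \<Omega> \<Longrightarrow> (\<And>x. norm (V x) \<le> 1) \<Longrightarrow> distr_sym_grad \<Omega> w V \<le> b"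
  shows "(\<integral>x. indicator K x * norm (sym_grad (conv \<rho> w) x) \<partial>lborel) \<le> b"
proof -
  let ?G = "sym_grad (conv \<rho> w)"
  have G: "continuous_on UNIV ?G"
    by (intro continuous_on_sym_grad_smooth smooth_conv_mollifier[OF \<rho> w(1)])
  define v where "v x = indicator K x *\<^sub>R sgn (?G x)" for x
  note v = dual_test_field[OF G K(1), folded v_def]
  have "(\<integral>x. indicator K x * norm (?G x) \<partial>lborel) = (\<integral>x. ?G x \<bullet> v x \<partial>lborel)"
    by (simp add: v(4))
  also have "\<dots> = distr_sym_grad \<Omega> w (conv \<rho> v)"
    using distr_sym_grad_conv[OF \<Omega> \<rho> w v(1)] by simp
  also have "\<dots> \<le> b"
    using conv_in_test_functions[OF \<rho> v(1,3) K] conv_norm_le_1[OF \<rho> v(1,2)] by (intro b)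
  finally show ?thesis .
qed

section \<open>A Poincare inequality on star-shaped sets\<close>

lemma nn_integral_affine_le:
  fixes F :: "'a::euclidean_space \<Rightarrow> ennreal"
  assumes [measurable]: "F \<in> borel_measurable borel" and s: "1/2 \<le> s"
  shows "(\<integral>\<^sup>+x. F (z + s *\<^sub>R x) \<partial>lborel) \<le> 2 ^ DIM('a) * integral\<^sup>N lborel F"
proof -
  have "s \<noteq> 0" using s by auto
  have "integral\<^sup>N lborel F = integral\<^sup>N (density (distr lborel borel (\<lambda>x. z + s *\<^sub>R x)) (\<lambda>_. \<bar>s\<bar> ^ DIM('a))) F"
    using lborel_affine[OF \<open>s \<noteq> 0\<close>, of z] by simp
  also have "\<dots> = (\<integral>\<^sup>+x. ennreal (\<bar>s\<bar> ^ DIM('a)) * F (z + s *\<^sub>R x) \<partial>lborel)"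
    by (subst nn_integral_density) (auto simp: nn_integral_distr)
  also have "\<dots> = ennreal (\<bar>s\<bar> ^ DIM('a)) * (\<integral>\<^sup>+x. F (z + s *\<^sub>R x) \<partial>lborel)"
    by (rule nn_integral_cmult) measurable
  finally have eq: "integral\<^sup>N lborel F = ennreal (\<bar>s\<bar> ^ DIM('a)) * (\<integral>\<^sup>+x. F (z + s *\<^sub>R x) \<partial>lborel)" .
  have "1 \<le> (2 * \<bar>s\<bar>) ^ DIM('a)" using s by (intro one_le_power) auto
  then have "1 \<le> ennreal (2 ^ DIM('a)) * ennreal (\<bar>s\<bar> ^ DIM('a))"
    by (simp add: ennreal_mult[symmetric] power_mult_distrib)
  then have "1 * (\<integral>\<^sup>+x. F (z + s *\<^sub>R x) \<partial>lborel) \<le>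
      (ennreal (2 ^ DIM('a)) * ennreal (\<bar>s\<bar> ^ DIM('a))) * (\<integral>\<^sup>+x. F (z + s *\<^sub>R x) \<partial>lborel)"
    by (intro mult_right_mono) auto
  also have "\<dots> = 2 ^ DIM('a) * integral\<^sup>N lborel F"
    by (simp add: eq mult.assoc ennreal_power[symmetric])
  finally show ?thesis by simp
qed

lemma nn_integral_add3:
  fixes f g h :: "'a \<Rightarrow> ennreal"
  assumes "f \<in> borel_measurable M" "g \<in> borel_measurable M" "h \<in> borel_measurable M"
  shows "(\<integral>\<^sup>+x. f x + g x + h x \<partial>M) = integral\<^sup>N M f + integral\<^sup>N M g + integral\<^sup>N M h"
  using assms by (simp add: nn_integral_add)

text \<open>For \<open>t \<le> 1/2\<close> the substitution is made in \<open>y\<close>, for \<open>t \<ge> 1/2\<close> in \<open>x\<close>, so that the Jacobian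
  never drops below \<open>2\<close> to the power of minus the dimension.\<close>

lemma nn_integral_segments_le:
  fixes F :: "'a::euclidean_space \<Rightarrow> ennreal"
  assumes [measurable]: "F \<in> borel_measurable borel" "X \<in> sets borel" "Y \<in> sets borel"
  shows "(\<integral>\<^sup>+x. indicator X x * (\<integral>\<^sup>+y. indicator Y y * (\<integral>\<^sup>+t. indicator {0..1::real} t * F (y + t *\<^sub>R (x - y)) \<partial>lborel) \<partial>lborel) \<partial>lborel)
    \<le> 2 ^ DIM('a) * (emeasure lborel X + emeasure lborel Y) * integral\<^sup>N lborel F"
proof -
  let ?P = "2 ^ DIM('a) * integral\<^sup>N lborel F"
  let ?i1 = "\<lambda>t. indicator {0..1/2::real} t :: ennreal" and ?i2 = "\<lambda>t. indicator {1/2..1::real} t :: ennreal"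
  have half: "(\<integral>\<^sup>+t. ?i1 t * ?P \<partial>lborel) \<le> ?P" "(\<integral>\<^sup>+t. ?i2 t * ?P \<partial>lborel) \<le> ?P"
  proof -
    have "ennreal (1/2) * ?P \<le> ennreal 1 * ?P" by (intro mult_right_mono ennreal_leI) auto
    then show "(\<integral>\<^sup>+t. ?i1 t * ?P \<partial>lborel) \<le> ?P" "(\<integral>\<^sup>+t. ?i2 t * ?P \<partial>lborel) \<le> ?P"
      by (auto simp: nn_integral_multc)
  qed
  have "(\<integral>\<^sup>+x. indicator X x * (\<integral>\<^sup>+y. indicator Y y * (\<integral>\<^sup>+t. indicator {0..1::real} t * F (y + t *\<^sub>R (x - y)) \<partial>lborel) \<partial>lborel) \<partial>lborel)
    = (\<integral>\<^sup>+x. (\<integral>\<^sup>+y. (\<integral>\<^sup>+t. indicator X x * (indicator Y y * (indicator {0..1::real} t * F (y + t *\<^sub>R (x - y)))) \<partial>lborel) \<partial>lborel) \<partial>lborel)"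
    by (simp add: nn_integral_cmult)
  \<comment> \<open>On the half with t at most 1/2 the indicator of \<open>Y\<close> is dropped, so
    that y runs over the whole space and can be substituted; on the other half the indicator of
    \<open>X\<close> is dropped. The indicator that remains supplies the volume factor.\<close>
  also have "\<dots> \<le> (\<integral>\<^sup>+x. (\<integral>\<^sup>+y. (\<integral>\<^sup>+t. indicator X x * (?i1 t * F (y + t *\<^sub>R (x - y))) +
       indicator Y y * (?i2 t * F (y + t *\<^sub>R (x - y))) \<partial>lborel) \<partial>lborel) \<partial>lborel)"
    by (intro nn_integral_mono) (auto simp: indicator_def)
  also have "\<dots> = (\<integral>\<^sup>+x. (\<integral>\<^sup>+y. (\<integral>\<^sup>+t. indicator X x * (?i1 t * F (y + t *\<^sub>R (x - y))) \<partial>lborel) \<partial>lborel) \<partial>lborel)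
     + (\<integral>\<^sup>+x. (\<integral>\<^sup>+y. (\<integral>\<^sup>+t. indicator Y y * (?i2 t * F (y + t *\<^sub>R (x - y))) \<partial>lborel) \<partial>lborel) \<partial>lborel)"
    by (simp add: nn_integral_add)
  also have "(\<integral>\<^sup>+x. (\<integral>\<^sup>+y. (\<integral>\<^sup>+t. indicator X x * (?i1 t * F (y + t *\<^sub>R (x - y))) \<partial>lborel) \<partial>lborel) \<partial>lborel)
     = (\<integral>\<^sup>+x. indicator X x * (\<integral>\<^sup>+t. ?i1 t * (\<integral>\<^sup>+y. F (y + t *\<^sub>R (x - y)) \<partial>lborel) \<partial>lborel) \<partial>lborel)"
    by (subst lborel_pair.Fubini') (auto simp: nn_integral_cmult)
  also have "\<dots> \<le> (\<integral>\<^sup>+x. indicator X x * (\<integral>\<^sup>+t. ?i1 t * ?P \<partial>lborel) \<partial>lborel)"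
  proof (rule nn_integral_mono, rule mult_left_mono, rule nn_integral_mono)
    fix x :: 'a and t :: real
    show "?i1 t * (\<integral>\<^sup>+y. F (y + t *\<^sub>R (x - y)) \<partial>lborel) \<le> ?i1 t * ?P"
    proof (cases "t \<in> {0..1/2}")
      case True
      have "(\<lambda>y. F (y + t *\<^sub>R (x - y))) = (\<lambda>y. F (t *\<^sub>R x + (1 - t) *\<^sub>R y))"
        by (auto simp: algebra_simps)
      then show ?thesis
        using nn_integral_affine_le[of F "1 - t" "t *\<^sub>R x"] True by (auto intro: mult_left_mono)
    qed auto
  qed auto
  also have "\<dots> \<le> (\<integral>\<^sup>+x. indicator X x * ?P \<partial>lborel)"
    by (intro nn_integral_mono mult_left_mono half) auto
  also have "\<dots> = emeasure lborel X * ?P" by (subst nn_integral_multc) auto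
  also have "(\<integral>\<^sup>+x. (\<integral>\<^sup>+y. (\<integral>\<^sup>+t. indicator Y y * (?i2 t * F (y + t *\<^sub>R (x - y))) \<partial>lborel) \<partial>lborel) \<partial>lborel)
     = (\<integral>\<^sup>+y. (\<integral>\<^sup>+x. (\<integral>\<^sup>+t. indicator Y y * (?i2 t * F (y + t *\<^sub>R (x - y))) \<partial>lborel) \<partial>lborel) \<partial>lborel)"
    by (rule lborel_pair.Fubini'[symmetric]) measurable
  also have "\<dots> = (\<integral>\<^sup>+y. indicator Y y * (\<integral>\<^sup>+t. ?i2 t * (\<integral>\<^sup>+x. F (y + t *\<^sub>R (x - y)) \<partial>lborel) \<partial>lborel) \<partial>lborel)"
    by (subst lborel_pair.Fubini') (auto simp: nn_integral_cmult)
  also have "\<dots> \<le> (\<integral>\<^sup>+y. indicator Y y * (\<integral>\<^sup>+t. ?i2 t * ?P \<partial>lborel) \<partial>lborel)"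
  proof (rule nn_integral_mono, rule mult_left_mono, rule nn_integral_mono)
    fix y :: 'a and t :: real
    show "?i2 t * (\<integral>\<^sup>+x. F (y + t *\<^sub>R (x - y)) \<partial>lborel) \<le> ?i2 t * ?P"
    proof (cases "t \<in> {1/2..1}")
      case True
      have "(\<lambda>x. F (y + t *\<^sub>R (x - y))) = (\<lambda>x. F ((1 - t) *\<^sub>R y + t *\<^sub>R x))"
        by (auto simp: algebra_simps)
      then show ?thesis
        using nn_integral_affine_le[of F t "(1 - t) *\<^sub>R y"] True by (auto intro: mult_left_mono)
    qed auto
  qed auto
  also have "\<dots> \<le> (\<integral>\<^sup>+y. indicator Y y * ?P \<partial>lborel)"
    by (intro nn_integral_mono mult_left_mono half) auto
  also have "\<dots> = emeasure lborel Y * ?P" by (subst nn_integral_multc) auto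
  finally show ?thesis
    by (simp add: distrib_right distrib_left mult_ac)
qed

section \<open>Taylor expansion along segments\<close>

lemma ftc_nn_integral_bound:
  fixes \<phi> \<phi>' g :: "real \<Rightarrow> real"
  assumes d: "\<And>t. (\<phi> has_vector_derivative \<phi>' t) (at t within {0..1})"
    and g: "continuous_on {0..1} g" "\<And>t. 0 \<le> g t"
    and b: "\<And>t. 0 \<le> t \<Longrightarrow> t \<le> 1 \<Longrightarrow> \<bar>\<phi>' t\<bar> \<le> g t"
  shows "ennreal \<bar>\<phi> 1 - \<phi> 0\<bar> \<le> (\<integral>\<^sup>+t. indicator {0..1} t * ennreal (g t) \<partial>lborel)"
proof -
  have I: "(\<phi>' has_integral (\<phi> 1 - \<phi> 0)) {0..1}"
    by (rule fundamental_theorem_of_calculus) (auto intro: d)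
  have "norm (integral {0..1} \<phi>') \<le> integral {0..1} g"
    by (rule integral_norm_bound_integral) (use I b in \<open>auto intro: integrable_continuous_real g(1)\<close>)
  then have le: "\<bar>\<phi> 1 - \<phi> 0\<bar> \<le> integral {0..1} g" using integral_unique[OF I] by simp
  have i: "integrable lborel (\<lambda>t. indicator {0..1} t *\<^sub>R g t)"
    by (rule borel_integrable_compact[OF compact_Icc g(1)])
  have "integral {0..1} g = (\<integral>t. indicator {0..1} t *\<^sub>R g t \<partial>lborel)"
    using set_borel_integral_eq_integral(2)[of "{0..1}" g] i
    by (simp add: set_integrable_def set_lebesgue_integral_def)
  also have "ennreal \<dots> = (\<integral>\<^sup>+t. ennreal (indicator {0..1} t *\<^sub>R g t) \<partial>lborel)"
    by (rule nn_integral_eq_integral[OF i, symmetric]) (auto simp: g(2))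
  also have "\<dots> = (\<integral>\<^sup>+t. indicator {0..1} t * ennreal (g t) \<partial>lborel)"
    by (intro nn_integral_cong) (auto simp: indicator_def)
  finally show ?thesis using ennreal_leI[OF le] by simp
qed

text \<open>\<open>p\<close> is the gradient of \<open>u\<close> and \<open>W\<close> the derivative
  of \<open>w\<close>. A single majorant \<open>F\<close> controls \<open>p - w\<close> and the
  quadratic form of \<open>W\<close>; the quadratic form sees only the symmetric part of
  \<open>W\<close>, that is, exactly the symmetrised gradient.\<close>

locale c1_pair =
  fixes u :: "'a::euclidean_space \<Rightarrow> real" and p :: "'a \<Rightarrow> 'a" and w :: "'a \<Rightarrow> 'a" and W :: "'a \<Rightarrow> 'a \<Rightarrow> 'a" and F :: "'a \<Rightarrow> real"
  assumes du: "\<And>x. (u has_derivative (\<lambda>h. p x \<bullet> h)) (at x)"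
    and dw: "\<And>x. (w has_derivative W x) (at x)"
    and cont_p: "continuous_on UNIV p"
    and cont_F: "continuous_on UNIV F"
    and pw: "\<And>x. norm (p x - w x) \<le> F x"
    and Ww: "\<And>x h. \<bar>W x h \<bullet> h\<bar> \<le> F x * (norm h)\<^sup>2"
begin

lemma F_nonneg: "0 \<le> F x"
  using pw[of x] norm_ge_zero order_trans by blast

lemma cont_u: "continuous_on UNIV u" and cont_w: "continuous_on UNIV w"
  using has_derivative_continuous[OF du] has_derivative_continuous[OF dw]
  by (auto simp: continuous_at_imp_continuous_on)

lemma meas [measurable]: "u \<in> borel_measurable borel" "w \<in> borel_measurable borel"
   "p \<in> borel_measurable borel" "F \<in> borel_measurable borel"
  using cont_u cont_w cont_p cont_F by (auto intro: borel_measurable_continuous_onI)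

lemma taylor_segment:
  assumes R: "norm (x - y) \<le> R"
  shows "ennreal \<bar>u x - u y - w y \<bullet> (x - y)\<bar>
    \<le> ennreal (R + R\<^sup>2) * (\<integral>\<^sup>+t. indicator {0..1} t * ennreal (F (y + t *\<^sub>R (x - y))) \<partial>lborel)"
proof -
  define e where "e = x - y"
  define \<phi> where "\<phi> t = u (y + t *\<^sub>R e) + (1 - t) * (w (y + t *\<^sub>R e) \<bullet> e)" for t
  define \<phi>' where "\<phi>' t = (p (y + t *\<^sub>R e) - w (y + t *\<^sub>R e)) \<bullet> e + (1 - t) * (W (y + t *\<^sub>R e) e \<bullet> e)" for t
  have d: "(\<phi> has_vector_derivative \<phi>' t) (at t within {0..1})" for t
  proof -
    have g: "((\<lambda>t. y + t *\<^sub>R e) has_derivative (\<lambda>h. h *\<^sub>R e)) (at t within {0..1})"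
      by (auto intro!: derivative_eq_intros)
    have 1: "((\<lambda>t. u (y + t *\<^sub>R e)) has_derivative (\<lambda>h. p (y + t *\<^sub>R e) \<bullet> (h *\<^sub>R e))) (at t within {0..1})"
      by (rule has_derivative_compose[OF g du])
    have 2: "((\<lambda>t. w (y + t *\<^sub>R e)) has_derivative (\<lambda>h. W (y + t *\<^sub>R e) (h *\<^sub>R e))) (at t within {0..1})"
      by (rule has_derivative_compose[OF g dw])
    have 3: "((\<lambda>t. w (y + t *\<^sub>R e) \<bullet> e) has_derivative (\<lambda>h. W (y + t *\<^sub>R e) (h *\<^sub>R e) \<bullet> e)) (at t within {0..1})"
      by (rule has_derivative_inner_left[OF 2])
    have 4: "((\<lambda>t::real. 1 - t) has_derivative (\<lambda>h. - h)) (at t within {0..1})"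
      by (auto intro!: derivative_eq_intros)
    note lin = linear_cmul[OF has_derivative_linear[OF dw]]
    show ?thesis
      unfolding \<phi>_def[abs_def] has_vector_derivative_def
      by (rule has_derivative_eq_rhs[OF has_derivative_add[OF 1 has_derivative_mult[OF 4 3]]])
         (auto simp: \<phi>'_def lin algebra_simps)
  qed
  have cF: "continuous_on {0..1} (\<lambda>t. F (y + t *\<^sub>R e))"
    by (rule continuous_on_compose2[OF cont_F]) (auto intro!: continuous_intros)
  have e: "norm e \<le> R" using R by (simp add: e_def)
  then have R0: "0 \<le> R + R\<^sup>2" using norm_ge_zero[of e] by (simp del: norm_ge_zero)
  \<comment> \<open>The factor is \<open>R + R\<^sup>2\<close> because \<open>e\<close> enters
    linearly in the term with \<open>p - w\<close> and quadratically in the term with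
    \<open>W\<close>.\<close>
  have "ennreal \<bar>\<phi> 1 - \<phi> 0\<bar> \<le> (\<integral>\<^sup>+t. indicator {0..1} t * ennreal ((R + R\<^sup>2) * F (y + t *\<^sub>R e)) \<partial>lborel)"
  proof (rule ftc_nn_integral_bound[OF d])
    show "continuous_on {0..1} (\<lambda>t. (R + R\<^sup>2) * F (y + t *\<^sub>R e))" by (intro continuous_intros cF)
    show "0 \<le> (R + R\<^sup>2) * F (y + t *\<^sub>R e)" for t using R0 F_nonneg by simp
    fix t :: real assume t: "0 \<le> t" "t \<le> 1"
    have "\<bar>(p (y + t *\<^sub>R e) - w (y + t *\<^sub>R e)) \<bullet> e\<bar> \<le> F (y + t *\<^sub>R e) * R"
      by (rule order_trans[OF Cauchy_Schwarz_ineq2]) (intro mult_mono pw e F_nonneg norm_ge_zero)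
    moreover have "\<bar>(1 - t) * (W (y + t *\<^sub>R e) e \<bullet> e)\<bar> \<le> 1 * (F (y + t *\<^sub>R e) * R\<^sup>2)"
      unfolding abs_mult
    proof (rule mult_mono)
      show "\<bar>W (y + t *\<^sub>R e) e \<bullet> e\<bar> \<le> F (y + t *\<^sub>R e) * R\<^sup>2"
        by (rule order_trans[OF Ww]) (intro mult_left_mono power_mono e F_nonneg norm_ge_zero)
    qed (use t in auto)
    ultimately show "\<bar>\<phi>' t\<bar> \<le> (R + R\<^sup>2) * F (y + t *\<^sub>R e)"
      unfolding \<phi>'_def by (simp add: algebra_simps)
  qed
  \<comment> \<open>The weight 1 - t vanishes at t = 1, so \<open>w\<close> enters only through its
    value at the starting point y.\<close>
  also have "\<phi> 1 - \<phi> 0 = u x - u y - w y \<bullet> (x - y)"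
    by (simp add: \<phi>_def e_def)
  also have "(\<integral>\<^sup>+t. indicator {0..1} t * ennreal ((R + R\<^sup>2) * F (y + t *\<^sub>R e)) \<partial>lborel)
     = ennreal (R + R\<^sup>2) * (\<integral>\<^sup>+t. indicator {0..1} t * ennreal (F (y + t *\<^sub>R e)) \<partial>lborel)"
    unfolding ennreal_mult'[OF R0] mult.left_commute[of _ "ennreal (R + R\<^sup>2)"]
    by (rule nn_integral_cmult) measurable
  finally show ?thesis by (simp add: e_def)
qed

end

section \<open>Averages over the central ball\<close>

definition ball_mean :: "'a::euclidean_space \<Rightarrow> real \<Rightarrow> ('a \<Rightarrow> 'b::euclidean_space) \<Rightarrow> 'b" where
  "ball_mean c r f = (1 / measure lborel (cball c r)) *\<^sub>R (\<integral>y. indicator (cball c r) y *\<^sub>R f y \<partial>lborel)"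

lemma ennreal_mult_le_divide:
  assumes "ennreal b * X \<le> ennreal a * Y" "b > 0" "a \<ge> 0"
  shows "X \<le> ennreal (a / b) * Y"
proof -
  have "X = ennreal (1 / b) * (ennreal b * X)"
    using assms(2) by (simp add: mult.assoc[symmetric] ennreal_mult'[symmetric])
  also have "\<dots> \<le> ennreal (1 / b) * (ennreal a * Y)" by (intro mult_left_mono assms(1)) auto
  also have "\<dots> = ennreal (a / b) * Y"
    using assms(2,3) by (simp add: mult.assoc[symmetric] ennreal_mult'[symmetric])
  finally show ?thesis .
qed

text \<open>An affine function of y with slope of size \<open>norm q\<close> cannot be small on the
  whole ball. Move from \<open>c\<close> by r/2 along q or against it, choosing the side on which
  the change does not cancel the value at \<open>c\<close>; on the ball of radius r/4 about the new
  point the modulus is at least (r/2 - r/4) \<open>norm q\<close>.\<close>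

lemma nn_integral_ball_linear_ge:
  fixes q x c :: "'a::euclidean_space"
  assumes "r > 0"
  shows "ennreal (r / 4 * measure lborel (ball c (r / 4)) * norm q) \<le> (\<integral>\<^sup>+y. indicator (cball c r) y * ennreal \<bar>q \<bullet> (x - y)\<bar> \<partial>lborel)"
proof (cases "q = 0")
  case False
  define e where "e = q /\<^sub>R norm q"
  have qe: "q \<bullet> e = norm q" "norm e = 1"
    using False by (auto simp: e_def dot_square_norm power2_eq_square)
  have "\<exists>c'. norm (c' - c) = r / 2 \<and> (\<forall>z. norm z < r / 4 \<longrightarrow> norm q * (r / 4) \<le> \<bar>q \<bullet> (x - (c' + z))\<bar>)"
  proof -
    have z: "\<bar>q \<bullet> z\<bar> \<le> norm q * (r / 4)" if "norm z < r / 4" for z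
      using Cauchy_Schwarz_ineq2[of q z] mult_left_mono[OF less_imp_le[OF that] norm_ge_zero[of q]] by linarith
    show ?thesis
    proof (cases "q \<bullet> (x - c) \<le> 0")
      case True
      have "norm q * (r / 4) \<le> \<bar>q \<bullet> (x - ((c + (r / 2) *\<^sub>R e) + z))\<bar>" if "norm z < r / 4" for z
      proof -
        have "q \<bullet> (x - ((c + (r / 2) *\<^sub>R e) + z)) = q \<bullet> (x - c) - (r / 2) * norm q - q \<bullet> z"
          by (simp add: inner_diff_right inner_add_right qe)
        moreover have "(r / 2) * norm q = 2 * (norm q * (r / 4))" by simp
        ultimately show ?thesis using z[OF that] True by linarith
      qed
      then show ?thesis using qe assms by (intro exI[of _ "c + (r / 2) *\<^sub>R e"]) auto
    next
      case False
      have "norm q * (r / 4) \<le> \<bar>q \<bullet> (x - ((c - (r / 2) *\<^sub>R e) + z))\<bar>" if "norm z < r / 4" for z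
      proof -
        have "q \<bullet> (x - ((c - (r / 2) *\<^sub>R e) + z)) = q \<bullet> (x - c) + (r / 2) * norm q - q \<bullet> z"
          by (simp add: inner_diff_right inner_add_right qe)
        moreover have "(r / 2) * norm q = 2 * (norm q * (r / 4))" by simp
        ultimately show ?thesis using z[OF that] False by linarith
      qed
      then show ?thesis using qe assms by (intro exI[of _ "c - (r / 2) *\<^sub>R e"]) auto
    qed
  qed
  then obtain c' where c': "norm (c' - c) = r / 2"
     and b: "\<And>z. norm z < r / 4 \<Longrightarrow> norm q * (r / 4) \<le> \<bar>q \<bullet> (x - (c' + z))\<bar>" by blast
  have sub: "y \<in> cball c r" "norm q * (r / 4) \<le> \<bar>q \<bullet> (x - y)\<bar>" if "y \<in> ball c' (r / 4)" for y
  proof -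
    have n: "norm (y - c') < r / 4" using that by (simp add: dist_norm norm_minus_commute)
    then have "norm (y - c) \<le> r / 4 + r / 2"
      using c' norm_triangle_ineq[of "y - c'" "c' - c"] by simp
    then show "y \<in> cball c r" using assms by (simp add: dist_norm norm_minus_commute)
    show "norm q * (r / 4) \<le> \<bar>q \<bullet> (x - y)\<bar>" using b[OF n] by simp
  qed
  have "ennreal (r / 4 * measure lborel (ball c (r / 4)) * norm q) = ennreal (norm q * (r / 4)) * emeasure lborel (ball c' (r / 4))"
    using assms by (simp add: emeasure_ball content_ball ennreal_mult'[symmetric] mult_ac)
  also have "\<dots> = (\<integral>\<^sup>+y. ennreal (norm q * (r / 4)) * indicator (ball c' (r / 4)) y \<partial>lborel)"
    by (subst nn_integral_cmult_indicator) auto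
  also have "\<dots> \<le> (\<integral>\<^sup>+y. indicator (cball c r) y * ennreal \<bar>q \<bullet> (x - y)\<bar> \<partial>lborel)"
  proof (rule nn_integral_mono)
    fix y
    show "ennreal (norm q * (r / 4)) * indicator (ball c' (r / 4)) y \<le> indicator (cball c r) y * ennreal \<bar>q \<bullet> (x - y)\<bar>"
      using sub[of y] by (cases "y \<in> ball c' (r / 4)") (auto intro!: ennreal_leI)
  qed
  finally show ?thesis .
qed auto

text \<open>\<open>R\<close> and \<open>V\<close> are upper bounds rather than the diameter and the
  volume of \<open>K\<close>, so that the same numbers can serve for every compact subset of a
  bounded domain. \<open>S\<close> is the factor of the Taylor estimate times that of the estimate
  over segments, where the two volumes add up to at most 2 V.\<close>

locale star_pair = c1_pair u p w W F
  for u :: "'a::euclidean_space \<Rightarrow> real" and p w W F +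
  fixes K :: "'a set" and c :: 'a and r R V S :: real
  assumes K: "compact K" "cball c r \<subseteq> K" and r: "r > 0"
    and star: "\<And>x y t. x \<in> K \<Longrightarrow> y \<in> cball c r \<Longrightarrow> 0 \<le> t \<Longrightarrow> t \<le> 1 \<Longrightarrow> y + t *\<^sub>R (x - y) \<in> K"
    and diam: "\<And>x y. x \<in> K \<Longrightarrow> y \<in> K \<Longrightarrow> norm (x - y) \<le> R"
    and vol: "emeasure lborel K \<le> ennreal V" "V \<ge> 0"
    and S_eq: "S = (R + R\<^sup>2) * 2 ^ DIM('a) * (2 * V)"
begin

abbreviation "B \<equiv> cball c r"
abbreviation "A x \<equiv> ball_mean c r (\<lambda>y. u y - w y \<bullet> y) + ball_mean c r w \<bullet> x"
abbreviation "\<beta> \<equiv> measure lborel B"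
abbreviation "\<kappa> \<equiv> r / 4 * measure lborel (ball c (r / 4))"
abbreviation "J \<equiv> \<integral>\<^sup>+x. indicator K x * ennreal (F x) \<partial>lborel"

lemma K_meas [measurable]: "K \<in> sets borel"
  using K(1) by (simp add: borel_compact)

lemma B_meas [measurable]: "B \<in> sets borel"
  by simp

lemma \<beta>_pos: "\<beta> > 0" using r by (rule content_cball_pos)

lemma \<kappa>_pos: "\<kappa> > 0" using r content_ball_pos[of "r / 4" c] by simp

lemma R_nonneg: "R \<ge> 0"
  using diam[of c c] subsetD[OF K(2), of c] r by auto

lemma S_nonneg: "S \<ge> 0" using R_nonneg vol(2) by (simp add: S_eq)

lemma vol_B: "emeasure lborel B \<le> ennreal V"
proof -
  have "K \<in> sets lborel" by simp
  from order_trans[OF emeasure_mono[OF K(2) this] vol(1)] show ?thesis .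
qed

text \<open>Segments between the ball and \<open>K\<close> stay in \<open>K\<close>, so
  \<open>F\<close> may be cut off outside \<open>K\<close>. The condition on the unordered pair
  admits both orientations: expansion at a point of the ball and expansion at a point of
  \<open>K\<close>.\<close>

lemma segments_bound:
  assumes "{X, Y} = {K, B}" and XY: "\<And>x y t. x \<in> X \<Longrightarrow> y \<in> Y \<Longrightarrow> 0 \<le> t \<Longrightarrow> t \<le> 1 \<Longrightarrow> y + t *\<^sub>R (x - y) \<in> K"
  shows "(\<integral>\<^sup>+x. indicator X x * (\<integral>\<^sup>+y. indicator Y y * (ennreal (R + R\<^sup>2) * (\<integral>\<^sup>+t. indicator {0..1::real} t * ennreal (F (y + t *\<^sub>R (x - y))) \<partial>lborel)) \<partial>lborel) \<partial>lborel)
    \<le> ennreal S * J"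
proof -
  have [measurable]: "X \<in> sets borel" "Y \<in> sets borel" using assms(1) by (auto simp: doubleton_eq_iff)
  have "emeasure lborel X + emeasure lborel Y \<le> ennreal V + ennreal V"
    using assms(1) vol(1) vol_B by (auto simp: doubleton_eq_iff intro!: add_mono)
  then have v: "emeasure lborel X + emeasure lborel Y \<le> ennreal (2 * V)"
    using vol(2) by (simp flip: ennreal_plus)
  let ?F = "\<lambda>x. indicator K x * ennreal (F x)"
  have "(\<integral>\<^sup>+x. indicator X x * (\<integral>\<^sup>+y. indicator Y y * (ennreal (R + R\<^sup>2) * (\<integral>\<^sup>+t. indicator {0..1::real} t * ennreal (F (y + t *\<^sub>R (x - y))) \<partial>lborel)) \<partial>lborel) \<partial>lborel)
    = (\<integral>\<^sup>+x. indicator X x * (\<integral>\<^sup>+y. indicator Y y * (ennreal (R + R\<^sup>2) * (\<integral>\<^sup>+t. indicator {0..1::real} t * ?F (y + t *\<^sub>R (x - y)) \<partial>lborel)) \<partial>lborel) \<partial>lborel)"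
  proof (intro nn_integral_cong)
    fix x :: 'a
    have "indicator Y y * (ennreal (R + R\<^sup>2) * (\<integral>\<^sup>+t. indicator {0..1::real} t * ennreal (F (y + t *\<^sub>R (x - y))) \<partial>lborel))
       = indicator Y y * (ennreal (R + R\<^sup>2) * (\<integral>\<^sup>+t. indicator {0..1::real} t * ?F (y + t *\<^sub>R (x - y)) \<partial>lborel))" if "x \<in> X" for y
    proof (cases "y \<in> Y")
      case True
      have "indicator {0..1::real} t * ennreal (F (y + t *\<^sub>R (x - y))) = indicator {0..1::real} t * ?F (y + t *\<^sub>R (x - y))" for t
        using XY[OF that True, of t] by (auto simp: indicator_def)
      then show ?thesis by simp
    qed simp
    then show "indicator X x * (\<integral>\<^sup>+y. indicator Y y * (ennreal (R + R\<^sup>2) * (\<integral>\<^sup>+t. indicator {0..1::real} t * ennreal (F (y + t *\<^sub>R (x - y))) \<partial>lborel)) \<partial>lborel)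
     = indicator X x * (\<integral>\<^sup>+y. indicator Y y * (ennreal (R + R\<^sup>2) * (\<integral>\<^sup>+t. indicator {0..1::real} t * ?F (y + t *\<^sub>R (x - y)) \<partial>lborel)) \<partial>lborel)"
      by (cases "x \<in> X") auto
  qed
  also have "\<dots> = ennreal (R + R\<^sup>2) * (\<integral>\<^sup>+x. indicator X x * (\<integral>\<^sup>+y. indicator Y y * (\<integral>\<^sup>+t. indicator {0..1::real} t * ?F (y + t *\<^sub>R (x - y)) \<partial>lborel) \<partial>lborel) \<partial>lborel)"
  proof -
    let ?h = "\<lambda>x y. \<integral>\<^sup>+t. indicator {0..1::real} t * ?F (y + t *\<^sub>R (x - y)) \<partial>lborel"
    have "(\<integral>\<^sup>+y. indicator Y y * (ennreal (R + R\<^sup>2) * ?h x y) \<partial>lborel) = ennreal (R + R\<^sup>2) * (\<integral>\<^sup>+y. indicator Y y * ?h x y \<partial>lborel)" for x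
      unfolding mult.left_commute[of _ "ennreal (R + R\<^sup>2)"] by (rule nn_integral_cmult) measurable
    then show ?thesis
      unfolding mult.left_commute[of _ "ennreal (R + R\<^sup>2)"]
      by (simp only: mult.left_commute[of _ "ennreal (R + R\<^sup>2)"]) (rule nn_integral_cmult, measurable)
  qed
  also have "\<dots> \<le> ennreal (R + R\<^sup>2) * (2 ^ DIM('a) * (emeasure lborel X + emeasure lborel Y) * integral\<^sup>N lborel ?F)"
    by (intro mult_left_mono nn_integral_segments_le) auto
  also have "\<dots> \<le> ennreal (R + R\<^sup>2) * (2 ^ DIM('a) * ennreal (2 * V) * J)"
    by (intro mult_left_mono mult_right_mono v) auto
  also have "\<dots> = ennreal S * J"
    using R_nonneg vol(2) by (simp add: S_eq ennreal_mult' ennreal_power[symmetric] mult.assoc)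
  finally show ?thesis .
qed

lemma ball_integrable:
  fixes f :: "'a \<Rightarrow> 'b::euclidean_space"
  assumes "continuous_on UNIV f"
  shows "integrable lborel (\<lambda>y. indicator B y *\<^sub>R f y)"
  by (rule borel_integrable_compact) (auto intro: continuous_on_subset[OF assms])

text \<open>\<open>A\<close> is the mean over y in the ball of the first-order expansions that send
  x to \<open>u y + w y \<bullet> (x - y)\<close>. Therefore \<open>u - A\<close> is the mean of the
  Taylor remainders.\<close>

lemma diff_A:
  "\<beta> * (u x - A x) = (\<integral>y. indicator B y *\<^sub>R (u x - u y - w y \<bullet> (x - y)) \<partial>lborel)"
proof -
  have i1: "integrable lborel (\<lambda>y. indicator B y *\<^sub>R (u y - w y \<bullet> y))"
    and i2: "integrable lborel (\<lambda>y. indicator B y *\<^sub>R w y)"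
    and i3: "integrable lborel (\<lambda>y. indicator B y *\<^sub>R u x)"
    by (intro ball_integrable continuous_intros cont_u cont_w)+
  have "(\<integral>y. indicator B y *\<^sub>R (u x - u y - w y \<bullet> (x - y)) \<partial>lborel)
     = (\<integral>y. indicator B y *\<^sub>R u x - indicator B y *\<^sub>R (u y - w y \<bullet> y) - (indicator B y *\<^sub>R w y) \<bullet> x \<partial>lborel)"
    by (intro Bochner_Integration.integral_cong) (auto simp: algebra_simps indicator_def)
  also have "\<dots> = (\<integral>y. indicator B y *\<^sub>R u x \<partial>lborel) - (\<integral>y. indicator B y *\<^sub>R (u y - w y \<bullet> y) \<partial>lborel)
      - (\<integral>y. indicator B y *\<^sub>R w y \<partial>lborel) \<bullet> x"
    using i1 i3 integrable_inner_left[OF i2, of x]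
    by (simp only: Bochner_Integration.integral_diff Bochner_Integration.integrable_diff integral_inner_left[OF i2])
  also have "(\<integral>y. indicator B y *\<^sub>R u x \<partial>lborel) = \<beta> * u x" by simp
  finally show ?thesis using \<beta>_pos by (simp add: ball_mean_def algebra_simps)
qed

text \<open>By \<open>diff_A\<close> the deviation from \<open>A\<close> is an average of Taylor
  remainders. Integrating in x leaves \<open>F\<close> integrated along all segments from the ball
  to \<open>K\<close>, which \<open>segments_bound\<close> reduces to \<open>J\<close>.\<close>

lemma poincare_u:
  "(\<integral>\<^sup>+x. indicator K x * ennreal \<bar>u x - A x\<bar> \<partial>lborel) \<le> ennreal (S / \<beta>) * J"
proof (rule ennreal_mult_le_divide[OF _ \<beta>_pos S_nonneg])
  have "ennreal \<beta> * (indicator K x * ennreal \<bar>u x - A x\<bar>) \<le>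
     indicator K x * (\<integral>\<^sup>+y. indicator B y * (ennreal (R + R\<^sup>2) * (\<integral>\<^sup>+t. indicator {0..1::real} t * ennreal (F (y + t *\<^sub>R (x - y))) \<partial>lborel)) \<partial>lborel)" for x
  proof (cases "x \<in> K")
    case True
    have "ennreal \<beta> * ennreal \<bar>u x - A x\<bar> = ennreal (norm (\<beta> * (u x - A x)))"
      using \<beta>_pos by (simp add: abs_mult ennreal_mult'[symmetric])
    also have "\<dots> \<le> (\<integral>\<^sup>+y. norm (indicator B y *\<^sub>R (u x - u y - w y \<bullet> (x - y))) \<partial>lborel)"
      unfolding diff_A
      by (intro integral_norm_bound_ennreal ball_integrable continuous_intros cont_u cont_w)
    also have "\<dots> \<le> (\<integral>\<^sup>+y. indicator B y * (ennreal (R + R\<^sup>2) * (\<integral>\<^sup>+t. indicator {0..1::real} t * ennreal (F (y + t *\<^sub>R (x - y))) \<partial>lborel)) \<partial>lborel)"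
    proof (rule nn_integral_mono)
      fix y
      show "ennreal (norm (indicator B y *\<^sub>R (u x - u y - w y \<bullet> (x - y)))) \<le>
         indicator B y * (ennreal (R + R\<^sup>2) * (\<integral>\<^sup>+t. indicator {0..1::real} t * ennreal (F (y + t *\<^sub>R (x - y))) \<partial>lborel))"
        using taylor_segment[OF diam[OF True, of y]] K(2) by (cases "y \<in> B") auto
    qed
    finally show ?thesis using True by simp
  qed simp
  then have "(\<integral>\<^sup>+x. ennreal \<beta> * (indicator K x * ennreal \<bar>u x - A x\<bar>) \<partial>lborel) \<le>
     (\<integral>\<^sup>+x. indicator K x * (\<integral>\<^sup>+y. indicator B y * (ennreal (R + R\<^sup>2) * (\<integral>\<^sup>+t. indicator {0..1::real} t * ennreal (F (y + t *\<^sub>R (x - y))) \<partial>lborel)) \<partial>lborel) \<partial>lborel)"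
    by (intro nn_integral_mono)
  also have "\<dots> \<le> ennreal S * J"
    by (rule segments_bound) (auto intro: star)
  finally show "ennreal \<beta> * (\<integral>\<^sup>+x. indicator K x * ennreal \<bar>u x - A x\<bar> \<partial>lborel) \<le> ennreal S * J"
    by (simp add: nn_integral_cmult)
qed

text \<open>Up to the error of \<open>taylor_segment\<close>, \<open>(w x - ball_mean c r w) \<bullet> (x - y)\<close> is the difference of the
  values of \<open>u - A\<close> at \<open>x\<close> and \<open>y\<close>. This replaces the Korn inequality.\<close>

lemma poincare_w:
  "(\<integral>\<^sup>+x. indicator K x * ennreal (norm (w x - ball_mean c r w)) \<partial>lborel) \<le> ennreal ((2 * V * (S / \<beta>) + S) / \<kappa>) * J"
proof (rule ennreal_mult_le_divide[OF _ \<kappa>_pos])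
  let ?q = "\<lambda>x. w x - ball_mean c r w" and ?v = "\<lambda>x. u x - A x"
  let ?H = "\<lambda>x y. ennreal (R + R\<^sup>2) * (\<integral>\<^sup>+t. indicator {0..1::real} t * ennreal (F (x + t *\<^sub>R (y - x))) \<partial>lborel)"
  let ?L = "\<integral>\<^sup>+x. indicator K x * ennreal \<bar>?v x\<bar> \<partial>lborel"
  show "0 \<le> 2 * V * (S / \<beta>) + S" using S_nonneg vol(2) \<beta>_pos by simp
  have pt: "ennreal \<kappa> * (indicator K x * ennreal (norm (?q x))) \<le>
      indicator K x * (\<integral>\<^sup>+y. indicator B y * (ennreal \<bar>?v x\<bar> + ennreal \<bar>?v y\<bar> + ?H x y) \<partial>lborel)" for x
  proof (cases "x \<in> K")
    case True
    have "ennreal \<kappa> * ennreal (norm (?q x)) = ennreal (\<kappa> * norm (?q x))"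
      using \<kappa>_pos by (simp add: ennreal_mult'[symmetric])
    \<comment> \<open>The expansions see \<open>?q x\<close> only through its products with x - y;
      averaging over y in the ball recovers the full norm.\<close>
    also have "\<dots> \<le> (\<integral>\<^sup>+y. indicator B y * ennreal \<bar>?q x \<bullet> (x - y)\<bar> \<partial>lborel)"
      by (rule nn_integral_ball_linear_ge[OF r])
    also have "\<dots> \<le> (\<integral>\<^sup>+y. indicator B y * (ennreal \<bar>?v x\<bar> + ennreal \<bar>?v y\<bar> + ?H x y) \<partial>lborel)"
    proof (rule nn_integral_mono)
      fix y
      show "indicator B y * ennreal \<bar>?q x \<bullet> (x - y)\<bar> \<le> indicator B y * (ennreal \<bar>?v x\<bar> + ennreal \<bar>?v y\<bar> + ?H x y)"
      proof (cases "y \<in> B")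
        case yB: True
        have "?q x \<bullet> (x - y) = ?v x - ?v y + (u y - u x - w x \<bullet> (y - x))"
          by (simp add: inner_diff_left inner_diff_right)
        then have "\<bar>?q x \<bullet> (x - y)\<bar> \<le> \<bar>?v x\<bar> + \<bar>?v y\<bar> + \<bar>u y - u x - w x \<bullet> (y - x)\<bar>" by linarith
        then have "ennreal \<bar>?q x \<bullet> (x - y)\<bar> \<le> ennreal (\<bar>?v x\<bar> + \<bar>?v y\<bar> + \<bar>u y - u x - w x \<bullet> (y - x)\<bar>)"
          by (rule ennreal_leI)
        also have "\<dots> = ennreal \<bar>?v x\<bar> + ennreal \<bar>?v y\<bar> + ennreal \<bar>u y - u x - w x \<bullet> (y - x)\<bar>"
          by (simp add: ennreal_plus)
        also have "\<dots> \<le> ennreal \<bar>?v x\<bar> + ennreal \<bar>?v y\<bar> + ?H x y"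
          using yB K(2) True by (intro add_left_mono taylor_segment diam) auto
        finally show ?thesis by (rule mult_left_mono) simp
      qed simp
    qed
    finally show ?thesis using True by simp
  qed simp
  have "ennreal \<kappa> * (\<integral>\<^sup>+x. indicator K x * ennreal (norm (?q x)) \<partial>lborel)
      = (\<integral>\<^sup>+x. ennreal \<kappa> * (indicator K x * ennreal (norm (?q x))) \<partial>lborel)"
    by (rule nn_integral_cmult[symmetric]) measurable
  also have "\<dots> \<le> (\<integral>\<^sup>+x. indicator K x * (\<integral>\<^sup>+y. indicator B y * (ennreal \<bar>?v x\<bar> + ennreal \<bar>?v y\<bar> + ?H x y) \<partial>lborel) \<partial>lborel)"
    by (intro nn_integral_mono pt)
  also have "\<dots> = (\<integral>\<^sup>+x. indicator K x * ((\<integral>\<^sup>+y. indicator B y * ennreal \<bar>?v x\<bar> \<partial>lborel) + (\<integral>\<^sup>+y. indicator B y * ennreal \<bar>?v y\<bar> \<partial>lborel)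
       + (\<integral>\<^sup>+y. indicator B y * ?H x y \<partial>lborel)) \<partial>lborel)"
  proof -
    have "(\<integral>\<^sup>+y. indicator B y * (ennreal \<bar>?v x\<bar> + ennreal \<bar>?v y\<bar> + ?H x y) \<partial>lborel) =
       (\<integral>\<^sup>+y. indicator B y * ennreal \<bar>?v x\<bar> \<partial>lborel) + (\<integral>\<^sup>+y. indicator B y * ennreal \<bar>?v y\<bar> \<partial>lborel)
       + (\<integral>\<^sup>+y. indicator B y * ?H x y \<partial>lborel)" for x
      unfolding distrib_left by (rule nn_integral_add3) simp_all
    then show ?thesis by (simp only:)
  qed
  also have "\<dots> = (\<integral>\<^sup>+x. indicator K x * (\<integral>\<^sup>+y. indicator B y * ennreal \<bar>?v x\<bar> \<partial>lborel) \<partial>lborel)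
      + (\<integral>\<^sup>+x. indicator K x * (\<integral>\<^sup>+y. indicator B y * ennreal \<bar>?v y\<bar> \<partial>lborel) \<partial>lborel)
      + (\<integral>\<^sup>+x. indicator K x * (\<integral>\<^sup>+y. indicator B y * ?H x y \<partial>lborel) \<partial>lborel)"
    unfolding distrib_left by (rule nn_integral_add3) simp_all
  \<comment> \<open>The values of \<open>u - A\<close> at x and at y cost a volume times the L1 norm
    of \<open>u - A\<close> each; the Taylor remainder costs \<open>S\<close>.\<close>
  also have "\<dots> \<le> ennreal V * ?L + ennreal V * ?L + ennreal S * J"
  proof (intro add_mono)
    have "(\<integral>\<^sup>+x. indicator K x * (\<integral>\<^sup>+y. indicator B y * ennreal \<bar>?v x\<bar> \<partial>lborel) \<partial>lborel)
       = (\<integral>\<^sup>+x. emeasure lborel B * (indicator K x * ennreal \<bar>?v x\<bar>) \<partial>lborel)"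
      by (simp add: nn_integral_multc mult_ac)
    also have "\<dots> = emeasure lborel B * ?L" by (rule nn_integral_cmult) measurable
    also have "\<dots> \<le> ennreal V * ?L" by (intro mult_right_mono vol_B) auto
    finally show "(\<integral>\<^sup>+x. indicator K x * (\<integral>\<^sup>+y. indicator B y * ennreal \<bar>?v x\<bar> \<partial>lborel) \<partial>lborel) \<le> ennreal V * ?L" .
    have "(\<integral>\<^sup>+x. indicator K x * (\<integral>\<^sup>+y. indicator B y * ennreal \<bar>?v y\<bar> \<partial>lborel) \<partial>lborel)
       = emeasure lborel K * (\<integral>\<^sup>+y. indicator B y * ennreal \<bar>?v y\<bar> \<partial>lborel)"
      by (subst nn_integral_multc) auto
    also have "\<dots> \<le> ennreal V * ?L"
      using K(2) by (intro mult_mono vol nn_integral_mono) (auto simp: indicator_def)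
    finally show "(\<integral>\<^sup>+x. indicator K x * (\<integral>\<^sup>+y. indicator B y * ennreal \<bar>?v y\<bar> \<partial>lborel) \<partial>lborel) \<le> ennreal V * ?L" .
    have "(\<integral>\<^sup>+x. indicator K x * (\<integral>\<^sup>+y. indicator B y * ?H x y \<partial>lborel) \<partial>lborel)
      = (\<integral>\<^sup>+x. (\<integral>\<^sup>+y. indicator K x * (indicator B y * ?H x y) \<partial>lborel) \<partial>lborel)"
      by (simp add: nn_integral_cmult)
    also have "\<dots> = (\<integral>\<^sup>+y. (\<integral>\<^sup>+x. indicator K x * (indicator B y * ?H x y) \<partial>lborel) \<partial>lborel)"
      by (rule lborel_pair.Fubini'[symmetric]) measurable
    also have "\<dots> = (\<integral>\<^sup>+y. indicator B y * (\<integral>\<^sup>+x. indicator K x * ?H x y \<partial>lborel) \<partial>lborel)"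
      by (subst nn_integral_cmult[symmetric]) (auto simp: mult.left_commute)
    \<comment> \<open>The expansion is now made at points of \<open>K\<close>, so the segments run
      towards the ball; replacing t by 1 - t brings them back to the star-shape condition.\<close>
    also have "\<dots> \<le> ennreal S * J"
    proof (rule segments_bound)
      fix x y :: 'a and t :: real assume "x \<in> B" "y \<in> K" "0 \<le> t" "t \<le> 1"
      then have "x + (1 - t) *\<^sub>R (y - x) \<in> K" by (intro star) auto
      then show "y + t *\<^sub>R (x - y) \<in> K" by (simp add: algebra_simps)
    qed auto
    finally show "(\<integral>\<^sup>+x. indicator K x * (\<integral>\<^sup>+y. indicator B y * ?H x y \<partial>lborel) \<partial>lborel) \<le> ennreal S * J" .
  qed
  also have "\<dots> \<le> ennreal V * (ennreal (S / \<beta>) * J) + ennreal V * (ennreal (S / \<beta>) * J) + ennreal S * J"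
    by (intro add_mono mult_left_mono poincare_u) auto
  also have "\<dots> = ennreal (V * (S / \<beta>) + V * (S / \<beta>) + S) * J"
  proof -
    have "0 \<le> S / \<beta>" using S_nonneg \<beta>_pos by simp
    then show ?thesis using vol(2) S_nonneg
      by (simp only: ennreal_plus ennreal_mult mult_nonneg_nonneg add_nonneg_nonneg distrib_right mult.assoc)
  qed
  also have "V * (S / \<beta>) + V * (S / \<beta>) + S = 2 * V * (S / \<beta>) + S" by simp
  finally show "ennreal \<kappa> * (\<integral>\<^sup>+x. indicator K x * ennreal (norm (?q x)) \<partial>lborel) \<le> ennreal (2 * V * (S / \<beta>) + S) * J" .
qed

end

section \<open>Slicing in the plane\<close>

text \<open>The index type is an arbitrary finite type, so dimension two is expressed by enumerating
  it as \<open>{i, j}\<close>. Lebesgue measure is determined by its values on boxes, and the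
  preimage of a box is a rectangle.\<close>

lemma lborel_eq_distr_plane:
  fixes i j :: "'d::finite"
  assumes UNIV: "UNIV = {i, j}" and "i \<noteq> j"
  shows "(lborel :: (real^'d) measure) = distr (lborel \<Otimes>\<^sub>M lborel) borel (\<lambda>(a, b). a *\<^sub>R axis i 1 + b *\<^sub>R axis j 1)"
proof (rule lborel_eqI)
  let ?\<Phi> = "\<lambda>(a, b). a *\<^sub>R axis i 1 + b *\<^sub>R axis j 1 :: real^'d"
  have Basis: "(Basis :: (real^'d) set) = {axis i 1, axis j 1}"
    using UNIV by (auto simp: Basis_vec_def)
  have ne: "axis i (1::real) \<noteq> axis j 1" using assms(2) by (simp add: axis_eq_axis)
  have ax: "axis j (1::real) $ i = 0" "axis i (1::real) $ j = 0"
    using assms(2) by (auto simp: axis_def)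
  have [measurable]: "?\<Phi> \<in> borel_measurable (lborel \<Otimes>\<^sub>M lborel)" by measurable
  fix l u :: "real^'d" assume lu: "\<And>b. b \<in> Basis \<Longrightarrow> l \<bullet> b \<le> u \<bullet> b"
  have "l $ i \<le> u $ i" "l $ j \<le> u $ j"
    using lu[of "axis i 1"] lu[of "axis j 1"] Basis by (auto simp: inner_axis)
  have "emeasure (distr (lborel \<Otimes>\<^sub>M lborel) borel ?\<Phi>) (box l u)
     = emeasure (lborel \<Otimes>\<^sub>M lborel) (?\<Phi> -` box l u \<inter> space (lborel \<Otimes>\<^sub>M lborel))"
    by (rule emeasure_distr) auto
  also have "?\<Phi> -` box l u \<inter> space (lborel \<Otimes>\<^sub>M lborel) = {l $ i <..< u $ i} \<times> {l $ j <..< u $ j}"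
  proof -
    have "?\<Phi> (a, b) \<in> box l u \<longleftrightarrow> (a, b) \<in> {l $ i <..< u $ i} \<times> {l $ j <..< u $ j}" for a b
    proof -
      have "?\<Phi> (a, b) \<in> box l u \<longleftrightarrow> (\<forall>k\<in>{i, j}. l $ k < ?\<Phi> (a, b) $ k \<and> ?\<Phi> (a, b) $ k < u $ k)"
        unfolding mem_box_cart UNIV[symmetric] by simp
      then show ?thesis by (simp add: ax)
    qed
    then show ?thesis by (auto simp: space_pair_measure)
  qed
  also have "emeasure (lborel \<Otimes>\<^sub>M lborel) \<dots> = emeasure lborel {l $ i <..< u $ i} * emeasure lborel {l $ j <..< u $ j}"
    by (rule lborel.emeasure_pair_measure_Times) auto
  also have "\<dots> = ennreal (\<Prod>b\<in>Basis. (u - l) \<bullet> b)"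
    using \<open>l $ i \<le> u $ i\<close> \<open>l $ j \<le> u $ j\<close> ne
    by (simp add: Basis inner_axis ennreal_mult')
  finally show "emeasure (distr (lborel \<Otimes>\<^sub>M lborel) borel ?\<Phi>) (box l u) = ennreal (\<Prod>b\<in>Basis. (u - l) \<bullet> b)" .
qed simp

lemma nn_integral_real_affine_inverse:
  fixes f :: "real \<Rightarrow> ennreal"
  assumes [measurable]: "f \<in> borel_measurable borel" and "k \<noteq> 0"
  shows "(\<integral>\<^sup>+s. f (t + k * s) \<partial>lborel) = ennreal (1 / \<bar>k\<bar>) * integral\<^sup>N lborel f"
proof -
  have "ennreal (1 / \<bar>k\<bar>) * integral\<^sup>N lborel f = ennreal (1 / \<bar>k\<bar>) * (ennreal \<bar>k\<bar> * (\<integral>\<^sup>+s. f (t + k * s) \<partial>lborel))"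
    by (simp add: nn_integral_real_affine[OF assms(1) assms(2), of t])
  also have "\<dots> = (\<integral>\<^sup>+s. f (t + k * s) \<partial>lborel)"
    using assms(2) by (simp add: mult.assoc[symmetric] ennreal_mult'[symmetric])
  finally show ?thesis ..
qed

text \<open>The parametrisation by s and \<tau> has a determinant of modulus |k| |e1_i|, because
  \<open>e2 - e1\<close> is a multiple of one axis. With \<sigma> = \<tau> - s the coordinate i
  depends on \<sigma> alone, so three substitutions in one variable do the whole change of
  variables.\<close>

lemma nn_integral_oblique_plane:
  fixes G :: "real^'d \<Rightarrow> ennreal"
  assumes UNIV: "UNIV = {i, j}" and "i \<noteq> j" and [measurable]: "G \<in> borel_measurable borel"
    and e1: "e1 $ i \<noteq> 0" and e2: "e2 = e1 + k *\<^sub>R axis j 1" and k: "k \<noteq> 0"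
  shows "(\<integral>\<^sup>+s. (\<integral>\<^sup>+\<tau>. G (z - s *\<^sub>R e1 + \<tau> *\<^sub>R e2) \<partial>lborel) \<partial>lborel) = ennreal (1 / (\<bar>k\<bar> * \<bar>e1 $ i\<bar>)) * integral\<^sup>N lborel G"
proof -
  define H where "H a b = G (a *\<^sub>R axis i 1 + b *\<^sub>R axis j 1)" for a b
  have [measurable]: "case_prod H \<in> borel_measurable (borel \<Otimes>\<^sub>M borel)"
    unfolding H_def by measurable
  have rep: "x = (x $ i) *\<^sub>R axis i 1 + (x $ j) *\<^sub>R axis j 1" for x :: "real^'d"
  proof -
    have "x $ k = ((x $ i) *\<^sub>R axis i 1 + (x $ j) *\<^sub>R axis j 1) $ k" for k
    proof -
      have "k = i \<or> k = j" using UNIV by auto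
      then show ?thesis using \<open>i \<noteq> j\<close> by (auto simp: axis_def)
    qed
    then show ?thesis unfolding vec_eq_iff by blast
  qed
  have GH: "G x = H (x $ i) (x $ j)" for x
    unfolding H_def by (rule arg_cong[OF rep])
  have "integral\<^sup>N lborel G = (\<integral>\<^sup>+p. G (case p of (a, b) \<Rightarrow> a *\<^sub>R axis i 1 + b *\<^sub>R axis j 1) \<partial>(lborel \<Otimes>\<^sub>M lborel))"
    by (subst lborel_eq_distr_plane[OF UNIV \<open>i \<noteq> j\<close>], rule nn_integral_distr) measurable
  also have "\<dots> = (\<integral>\<^sup>+p. case_prod H p \<partial>(lborel \<Otimes>\<^sub>M lborel))"
    by (intro nn_integral_cong) (auto simp: H_def)
  also have "\<dots> = (\<integral>\<^sup>+a. (\<integral>\<^sup>+b. H a b \<partial>lborel) \<partial>lborel)"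
    by (subst lborel.nn_integral_fst[symmetric]) auto
  finally have IG: "integral\<^sup>N lborel G = (\<integral>\<^sup>+a. (\<integral>\<^sup>+b. H a b \<partial>lborel) \<partial>lborel)" .
  let ?f = "\<lambda>\<sigma> \<tau>. H (z $ i + e1 $ i * \<sigma>) ((z $ j + e1 $ j * \<sigma>) + k * \<tau>)"
  have c: "G (z - s *\<^sub>R e1 + \<tau> *\<^sub>R e2) = ?f (\<tau> + (- 1) * s) \<tau>" for s \<tau>
    using \<open>i \<noteq> j\<close> by (simp add: GH e2 axis_def algebra_simps)
  have "(\<integral>\<^sup>+s. (\<integral>\<^sup>+\<tau>. G (z - s *\<^sub>R e1 + \<tau> *\<^sub>R e2) \<partial>lborel) \<partial>lborel)
     = (\<integral>\<^sup>+\<tau>. (\<integral>\<^sup>+s. ?f (\<tau> + (- 1) * s) \<tau> \<partial>lborel) \<partial>lborel)"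
    unfolding c by (rule lborel_pair.Fubini') measurable
  also have "\<dots> = (\<integral>\<^sup>+\<tau>. (\<integral>\<^sup>+\<sigma>. ?f \<sigma> \<tau> \<partial>lborel) \<partial>lborel)"
    by (subst nn_integral_real_affine_inverse) auto
  also have "\<dots> = (\<integral>\<^sup>+\<sigma>. (\<integral>\<^sup>+\<tau>. ?f \<sigma> \<tau> \<partial>lborel) \<partial>lborel)"
    by (rule lborel_pair.Fubini') measurable
  also have "\<dots> = (\<integral>\<^sup>+\<sigma>. ennreal (1 / \<bar>k\<bar>) * (\<integral>\<^sup>+b. H (z $ i + e1 $ i * \<sigma>) b \<partial>lborel) \<partial>lborel)"
    using k by (subst nn_integral_real_affine_inverse) auto
  also have "\<dots> = ennreal (1 / \<bar>k\<bar>) * (\<integral>\<^sup>+\<sigma>. (\<integral>\<^sup>+b. H (z $ i + e1 $ i * \<sigma>) b \<partial>lborel) \<partial>lborel)"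
    by (rule nn_integral_cmult) measurable
  also have "(\<integral>\<^sup>+\<sigma>. (\<integral>\<^sup>+b. H (z $ i + e1 $ i * \<sigma>) b \<partial>lborel) \<partial>lborel) = ennreal (1 / \<bar>e1 $ i\<bar>) * integral\<^sup>N lborel G"
    unfolding IG by (rule nn_integral_real_affine_inverse[OF _ e1]) measurable
  finally show ?thesis
    by (simp add: mult.assoc[symmetric] ennreal_mult'[symmetric])
qed

text \<open>The modulus of \<open>v x\<close> is bounded by a line integral of \<open>G\<close> in
  each of two directions, hence its square by their product, and integration over x decouples the
  product. The directions are arbitrary because the segments must stay inside \<open>K\<close>;
  since \<open>v\<close> need not vanish at their far ends, \<open>G\<close> contains |v| besides
  the gradient. The assumption \<open>plane\<close> holds all that is special to dimension
  two.\<close>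

lemma gagliardo_nirenberg_slices:
  fixes v :: "'a::euclidean_space \<Rightarrow> real" and g :: "'a \<Rightarrow> 'a"
  assumes dv: "\<And>x. (v has_derivative (\<lambda>h. g x \<bullet> h)) (at x)" and g: "continuous_on UNIV g"
    and K: "compact K" and K0: "\<And>x t. x \<in> K0 \<Longrightarrow> 0 \<le> t \<Longrightarrow> t \<le> 1 \<Longrightarrow> x + t *\<^sub>R e1 \<in> K \<and> x + t *\<^sub>R e2 \<in> K"
    and E: "norm e1 \<le> E" "norm e2 \<le> E"
    and plane: "\<And>G z. G \<in> borel_measurable borel \<Longrightarrow>
        (\<integral>\<^sup>+s. (\<integral>\<^sup>+\<tau>. G (z - s *\<^sub>R e1 + \<tau> *\<^sub>R e2) \<partial>lborel) \<partial>lborel) \<le> P * integral\<^sup>N lborel G"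
  defines "G \<equiv> \<lambda>y. indicator K y * ennreal (\<bar>v y\<bar> + E * norm (g y))"
  shows "(\<integral>\<^sup>+x. indicator K0 x * ennreal ((v x)\<^sup>2) \<partial>lborel) \<le> P * (integral\<^sup>N lborel G)\<^sup>2"
proof -
  have "E \<ge> 0" using E(1) norm_ge_zero order_trans by blast
  have "isCont v x" for x using dv has_derivative_continuous by blast
  then have cv: "continuous_on UNIV v" by (simp add: continuous_at_imp_continuous_on)
  have [measurable]: "v \<in> borel_measurable borel" "g \<in> borel_measurable borel" "K \<in> sets borel"
    using cv g K by (auto intro: borel_measurable_continuous_onI simp: borel_compact)
  have [measurable]: "G \<in> borel_measurable borel" unfolding G_def by measurable
  have line: "ennreal \<bar>v x\<bar> \<le> (\<integral>\<^sup>+s. G (x + s *\<^sub>R e) \<partial>lborel)"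
    if e: "\<And>t. 0 \<le> t \<Longrightarrow> t \<le> 1 \<Longrightarrow> x + t *\<^sub>R e \<in> K" "norm e \<le> E" for x e
  proof -
    \<comment> \<open>the factor \<open>1 - t\<close> removes the value at the far end of the segment\<close>
    let ?\<phi> = "\<lambda>t. (1 - t) * v (x + t *\<^sub>R e)"
    let ?\<phi>' = "\<lambda>t. (1 - t) * (g (x + t *\<^sub>R e) \<bullet> e) - v (x + t *\<^sub>R e)"
    let ?h = "\<lambda>t. \<bar>v (x + t *\<^sub>R e)\<bar> + E * norm (g (x + t *\<^sub>R e))"
    have d: "(?\<phi> has_vector_derivative ?\<phi>' t) (at t within {0..1})" for t
    proof -
      have 0: "((\<lambda>t. x + t *\<^sub>R e) has_derivative (\<lambda>h. h *\<^sub>R e)) (at t within {0..1})"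
        by (auto intro!: derivative_eq_intros)
      have 1: "((\<lambda>t. v (x + t *\<^sub>R e)) has_derivative (\<lambda>h. g (x + t *\<^sub>R e) \<bullet> (h *\<^sub>R e))) (at t within {0..1})"
        by (rule has_derivative_compose[OF 0 dv])
      have 2: "((\<lambda>t::real. 1 - t) has_derivative (\<lambda>h. - h)) (at t within {0..1})"
        by (auto intro!: derivative_eq_intros)
      show ?thesis
        unfolding has_vector_derivative_def
        by (rule has_derivative_eq_rhs[OF has_derivative_mult[OF 2 1]]) (auto simp: algebra_simps)
    qed
    have "ennreal \<bar>?\<phi> 1 - ?\<phi> 0\<bar> \<le> (\<integral>\<^sup>+t. indicator {0..1} t * ennreal (?h t) \<partial>lborel)"
    proof (rule ftc_nn_integral_bound[OF d])
      have "continuous_on {0..1} (\<lambda>t. v (x + t *\<^sub>R e))" "continuous_on {0..1} (\<lambda>t. g (x + t *\<^sub>R e))"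
        by (rule continuous_on_compose2[OF cv] continuous_on_compose2[OF g]; auto intro!: continuous_intros)+
      then show "continuous_on {0..1} ?h" by (intro continuous_intros)
      show "0 \<le> ?h t" for t using \<open>E \<ge> 0\<close> by simp
      fix t :: real assume t: "0 \<le> t" "t \<le> 1"
      have "\<bar>g (x + t *\<^sub>R e) \<bullet> e\<bar> \<le> E * norm (g (x + t *\<^sub>R e))"
        by (rule order_trans[OF Cauchy_Schwarz_ineq2]) (use e(2) in \<open>auto intro: mult_right_mono simp: mult.commute[of "norm (g _)"]\<close>)
      then have "\<bar>(1 - t) * (g (x + t *\<^sub>R e) \<bullet> e)\<bar> \<le> 1 * (E * norm (g (x + t *\<^sub>R e)))"
        unfolding abs_mult by (intro mult_mono) (use t in auto)
      then show "\<bar>?\<phi>' t\<bar> \<le> ?h t" by linarith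
    qed
    also have "\<dots> \<le> (\<integral>\<^sup>+s. G (x + s *\<^sub>R e) \<partial>lborel)"
      by (intro nn_integral_mono) (use e(1) in \<open>auto simp: G_def indicator_def\<close>)
    finally show ?thesis by simp
  qed
  have "(\<integral>\<^sup>+x. indicator K0 x * ennreal ((v x)\<^sup>2) \<partial>lborel)
    \<le> (\<integral>\<^sup>+x. (\<integral>\<^sup>+s. (\<integral>\<^sup>+\<tau>. G (x + s *\<^sub>R e1) * G (x + \<tau> *\<^sub>R e2) \<partial>lborel) \<partial>lborel) \<partial>lborel)"
  proof (rule nn_integral_mono)
    fix x
    have "indicator K0 x * ennreal ((v x)\<^sup>2) \<le> (\<integral>\<^sup>+s. G (x + s *\<^sub>R e1) \<partial>lborel) * (\<integral>\<^sup>+\<tau>. G (x + \<tau> *\<^sub>R e2) \<partial>lborel)"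
    proof (cases "x \<in> K0")
      case True
      have "ennreal ((v x)\<^sup>2) = ennreal \<bar>v x\<bar> * ennreal \<bar>v x\<bar>"
        by (simp add: ennreal_mult'[symmetric] power2_eq_square)
      also have "\<dots> \<le> (\<integral>\<^sup>+s. G (x + s *\<^sub>R e1) \<partial>lborel) * (\<integral>\<^sup>+\<tau>. G (x + \<tau> *\<^sub>R e2) \<partial>lborel)"
        using K0[OF True] E by (intro mult_mono line) auto
      finally show ?thesis using True by simp
    qed simp
    also have "\<dots> = (\<integral>\<^sup>+s. (\<integral>\<^sup>+\<tau>. G (x + s *\<^sub>R e1) * G (x + \<tau> *\<^sub>R e2) \<partial>lborel) \<partial>lborel)"
      by (simp add: nn_integral_cmult nn_integral_multc)
    finally show "indicator K0 x * ennreal ((v x)\<^sup>2) \<le> (\<integral>\<^sup>+s. (\<integral>\<^sup>+\<tau>. G (x + s *\<^sub>R e1) * G (x + \<tau> *\<^sub>R e2) \<partial>lborel) \<partial>lborel)" .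
  qed
  also have "\<dots> = (\<integral>\<^sup>+s. (\<integral>\<^sup>+x. (\<integral>\<^sup>+\<tau>. G (x + s *\<^sub>R e1) * G (x + \<tau> *\<^sub>R e2) \<partial>lborel) \<partial>lborel) \<partial>lborel)"
    by (rule lborel_pair.Fubini') measurable
  also have "\<dots> = (\<integral>\<^sup>+s. (\<integral>\<^sup>+\<tau>. (\<integral>\<^sup>+x. G (x + s *\<^sub>R e1) * G (x + \<tau> *\<^sub>R e2) \<partial>lborel) \<partial>lborel) \<partial>lborel)"
    by (rule nn_integral_cong, rule lborel_pair.Fubini') measurable
  \<comment> \<open>Translating x by \<open>s *\<^sub>R e1\<close> frees the first factor from s and
    \<tau>; the second then runs through an oblique parametrisation of the plane.\<close>
  also have "\<dots> = (\<integral>\<^sup>+s. (\<integral>\<^sup>+\<tau>. (\<integral>\<^sup>+x. G x * G (x - s *\<^sub>R e1 + \<tau> *\<^sub>R e2) \<partial>lborel) \<partial>lborel) \<partial>lborel)"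
  proof (rule nn_integral_cong, rule nn_integral_cong)
    fix s \<tau> :: real
    have "(\<integral>\<^sup>+x. G (x + s *\<^sub>R e1) * G (x + \<tau> *\<^sub>R e2) \<partial>lborel) =
       (\<integral>\<^sup>+x. G (x - s *\<^sub>R e1 + s *\<^sub>R e1) * G (x - s *\<^sub>R e1 + \<tau> *\<^sub>R e2) \<partial>lborel)"
      by (rule lborel_nn_integral_translation[symmetric]) measurable
    then show "(\<integral>\<^sup>+x. G (x + s *\<^sub>R e1) * G (x + \<tau> *\<^sub>R e2) \<partial>lborel) =
       (\<integral>\<^sup>+x. G x * G (x - s *\<^sub>R e1 + \<tau> *\<^sub>R e2) \<partial>lborel)" by simp
  qed
  also have "\<dots> = (\<integral>\<^sup>+s. (\<integral>\<^sup>+x. (\<integral>\<^sup>+\<tau>. G x * G (x - s *\<^sub>R e1 + \<tau> *\<^sub>R e2) \<partial>lborel) \<partial>lborel) \<partial>lborel)"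
    by (rule nn_integral_cong, rule lborel_pair.Fubini') measurable
  also have "\<dots> = (\<integral>\<^sup>+x. (\<integral>\<^sup>+s. (\<integral>\<^sup>+\<tau>. G x * G (x - s *\<^sub>R e1 + \<tau> *\<^sub>R e2) \<partial>lborel) \<partial>lborel) \<partial>lborel)"
    by (rule lborel_pair.Fubini') measurable
  also have "\<dots> = (\<integral>\<^sup>+x. G x * (\<integral>\<^sup>+s. (\<integral>\<^sup>+\<tau>. G (x - s *\<^sub>R e1 + \<tau> *\<^sub>R e2) \<partial>lborel) \<partial>lborel) \<partial>lborel)"
    by (simp add: nn_integral_cmult)
  also have "\<dots> \<le> (\<integral>\<^sup>+x. G x * (P * integral\<^sup>N lborel G) \<partial>lborel)"
    by (intro nn_integral_mono mult_left_mono plane) auto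
  also have "\<dots> = P * (integral\<^sup>N lborel G)\<^sup>2"
    by (subst nn_integral_multc) (auto simp: power2_eq_square mult_ac)
  finally show ?thesis .
qed

section \<open>From slices to an L2 estimate\<close>

context star_pair
begin

text \<open>The slicing inequality is applied to \<open>u - A\<close>, whose gradient is
  \<open>p\<close> minus the mean of \<open>w\<close> and hence bounded by \<open>F\<close> plus the
  deviation of \<open>w\<close> from its mean. The L1 norms of the three pieces explain the
  constant: S/\<beta> for \<open>u - A\<close>, E for \<open>F\<close>, and E times the constant of
  \<open>poincare_w\<close> for \<open>w\<close>.\<close>

lemma sobolev_u:
  assumes K0: "K0 \<subseteq> K" "\<And>x t. x \<in> K0 \<Longrightarrow> 0 \<le> t \<Longrightarrow> t \<le> 1 \<Longrightarrow> x + t *\<^sub>R e1 \<in> K \<and> x + t *\<^sub>R e2 \<in> K"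
    and E: "norm e1 \<le> E" "norm e2 \<le> E"
    and plane: "\<And>G z. G \<in> borel_measurable borel \<Longrightarrow>
        (\<integral>\<^sup>+s. (\<integral>\<^sup>+\<tau>. G (z - s *\<^sub>R e1 + \<tau> *\<^sub>R e2) \<partial>lborel) \<partial>lborel) \<le> P * integral\<^sup>N lborel G"
  shows "(\<integral>\<^sup>+x. indicator K0 x * ennreal ((u x - A x)\<^sup>2) \<partial>lborel)
     \<le> P * (ennreal (S / \<beta> + E * (1 + (2 * V * (S / \<beta>) + S) / \<kappa>)) * J)\<^sup>2"
proof -
  let ?w = "ball_mean c r w" and ?G = "\<lambda>y. indicator K y * ennreal (\<bar>u y - A y\<bar> + E * norm (p y - ball_mean c r w))"
  let ?C2 = "(2 * V * (S / \<beta>) + S) / \<kappa>"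
  have "E \<ge> 0" using E(1) norm_ge_zero order_trans by blast
  have C1: "S / \<beta> \<ge> 0" using S_nonneg \<beta>_pos by simp
  then have C2: "?C2 \<ge> 0" using S_nonneg \<kappa>_pos vol(2) by simp
  have "(\<integral>\<^sup>+x. indicator K0 x * ennreal ((u x - A x)\<^sup>2) \<partial>lborel) \<le> P * (integral\<^sup>N lborel ?G)\<^sup>2"
  proof (rule gagliardo_nirenberg_slices[OF _ _ K(1) K0(2) E plane])
    show "((\<lambda>x. u x - A x) has_derivative (\<lambda>h. (p x - ?w) \<bullet> h)) (at x)" for x
      by (rule derivative_eq_intros du refl | simp add: inner_diff_left)+
    show "continuous_on UNIV (\<lambda>x. p x - ?w)" by (intro continuous_intros cont_p)
  qed
  also have "\<dots> \<le> P * (ennreal (S / \<beta> + E * (1 + ?C2)) * J)\<^sup>2"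
  proof (intro mult_left_mono power_mono)
    have "integral\<^sup>N lborel ?G \<le> (\<integral>\<^sup>+y. indicator K y * ennreal \<bar>u y - A y\<bar> + ennreal E * (indicator K y * ennreal (F y))
        + ennreal E * (indicator K y * ennreal (norm (w y - ?w))) \<partial>lborel)"
    proof (rule nn_integral_mono)
      fix y
      have "norm (p y - ?w) \<le> F y + norm (w y - ?w)"
        using norm_triangle_ineq[of "p y - w y" "w y - ?w"] pw[of y] by simp
      then have "\<bar>u y - A y\<bar> + E * norm (p y - ?w) \<le> \<bar>u y - A y\<bar> + E * F y + E * norm (w y - ?w)"
        using mult_left_mono[OF _ \<open>E \<ge> 0\<close>] by (force simp: algebra_simps)
      then have "ennreal (\<bar>u y - A y\<bar> + E * norm (p y - ?w)) \<le> ennreal \<bar>u y - A y\<bar> + ennreal E * ennreal (F y) + ennreal E * ennreal (norm (w y - ?w))"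
        using \<open>E \<ge> 0\<close> F_nonneg by (simp add: ennreal_leI flip: ennreal_mult ennreal_plus)
      then show "?G y \<le> indicator K y * ennreal \<bar>u y - A y\<bar> + ennreal E * (indicator K y * ennreal (F y))
        + ennreal E * (indicator K y * ennreal (norm (w y - ?w)))"
        by (cases "y \<in> K") auto
    qed
    also have "\<dots> = (\<integral>\<^sup>+y. indicator K y * ennreal \<bar>u y - A y\<bar> \<partial>lborel) + ennreal E * J + ennreal E * (\<integral>\<^sup>+y. indicator K y * ennreal (norm (w y - ?w)) \<partial>lborel)"
      by (subst nn_integral_add3) (auto simp: nn_integral_cmult)
    also have "\<dots> \<le> ennreal (S / \<beta>) * J + ennreal E * J + ennreal E * (ennreal ?C2 * J)"
      by (intro add_mono mult_left_mono poincare_u poincare_w) auto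
    also have "\<dots> = ennreal (S / \<beta> + E + E * ?C2) * J"
      using C1 C2 \<open>E \<ge> 0\<close>
      by (simp only: ennreal_plus ennreal_mult mult_nonneg_nonneg add_nonneg_nonneg distrib_right mult.assoc)
    also have "S / \<beta> + E + E * ?C2 = S / \<beta> + E * (1 + ?C2)" by (simp add: algebra_simps)
    finally show "integral\<^sup>N lborel ?G \<le> ennreal (S / \<beta> + E * (1 + ?C2)) * J" .
  qed auto
  finally show ?thesis .
qed

end

section \<open>Passage to the limit\<close>

lemma smooth_has_derivative_grad:
  fixes u :: "real^'d \<Rightarrow> real"
  assumes "smooth u"
  shows "(u has_derivative (\<lambda>h. grad u x \<bullet> h)) (at x)"
proof -
  note d = smooth_has_derivative[OF assms, of x]
  have "frechet_derivative u (at x) h = grad u x \<bullet> h" for h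
  proof -
    have "frechet_derivative u (at x) h = frechet_derivative u (at x) (\<Sum>i\<in>UNIV. (h $ i) *\<^sub>R axis i 1)"
      using basis_expansion[of h] by (simp add: scalar_mult_eq_scaleR)
    also have "\<dots> = (\<Sum>i\<in>UNIV. h $ i * frechet_derivative u (at x) (axis i 1))"
      using has_derivative_linear[OF d] by (simp add: linear_sum linear_cmul)
    finally show ?thesis by (simp add: grad_def inner_vec_def mult.commute)
  qed
  then show ?thesis using d by (metis (no_types, lifting) ext)
qed

text \<open>Symmetrising a matrix does not change its quadratic form. The form is the Frobenius
  product of \<open>sym_grad\<close> with the outer product \<open>H\<close> of \<open>h\<close>
  with itself, whose norm is the square of \<open>norm h\<close>.\<close>

lemma sym_grad_quadratic_form:
  fixes w :: "real^'d \<Rightarrow> real^'d"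
  assumes "smooth w"
  shows "\<bar>frechet_derivative w (at x) h \<bullet> h\<bar> \<le> norm (sym_grad w x) * (norm h)\<^sup>2"
proof -
  have wi: "smooth (\<lambda>x. w x $ i)" for i
    by (rule smooth_bounded_linear[OF bounded_linear_vec_nth assms])
  have comp: "frechet_derivative w (at x) h $ i = grad (\<lambda>x. w x $ i) x \<bullet> h" for i
    by (rule has_derivative_unique[THEN fun_cong, OF
          bounded_linear.has_derivative[OF bounded_linear_vec_nth smooth_has_derivative[OF assms]]
          smooth_has_derivative_grad[OF wi]])
  define H :: "real^'d^'d" where "H = (\<chi> i. h $ i *\<^sub>R h)"
  let ?D = "\<lambda>i j. grad (\<lambda>x. w x $ i) x $ j"
  have "frechet_derivative w (at x) h \<bullet> h = (\<Sum>i\<in>UNIV. \<Sum>j\<in>UNIV. ?D i j * (h $ i * h $ j))"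
    by (simp add: inner_vec_def comp sum_distrib_right sum_distrib_left mult_ac)
  moreover have "\<dots> = (\<Sum>i\<in>UNIV. \<Sum>j\<in>UNIV. ?D j i * (h $ i * h $ j))"
    by (subst sum.swap) (simp add: mult_ac)
  ultimately have "2 * (frechet_derivative w (at x) h \<bullet> h) =
      (\<Sum>i\<in>UNIV. \<Sum>j\<in>UNIV. ?D i j * (h $ i * h $ j)) + (\<Sum>i\<in>UNIV. \<Sum>j\<in>UNIV. ?D j i * (h $ i * h $ j))"
    by linarith
  also have "\<dots> = 2 * (sym_grad w x \<bullet> H)"
    unfolding sum.distrib[symmetric] sum_distrib_left
    by (simp add: inner_vec_def sym_grad_def H_def sum_distrib_left)
       (intro sum.cong refl, simp add: field_simps)
  finally have eq: "frechet_derivative w (at x) h \<bullet> h = sym_grad w x \<bullet> H" by simp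
  have "H \<bullet> H = (h \<bullet> h)\<^sup>2"
    by (simp add: H_def inner_vec_def power2_eq_square sum_distrib_left sum_distrib_right mult_ac)
  then have "norm H = (norm h)\<^sup>2"
    by (metis norm_eq_sqrt_inner power2_norm_eq_inner real_sqrt_unique real_sqrt_ge_0_iff inner_ge_zero zero_le_power2)
  then show ?thesis unfolding eq using Cauchy_Schwarz_ineq2[of "sym_grad w x" H] by simp
qed

text \<open>\<open>a\<close> and \<open>b\<close> bound the Radon norms of $Du - w$ and $\mathcal{E}w$; \<open>u\<close> and \<open>w\<close> are Borel
  representatives extended by zero, so that all integrals can be taken over the whole space.\<close>

definition tgv_bounded :: "(real^'d) set \<Rightarrow> (real^'d \<Rightarrow> real) \<Rightarrow> (real^'d \<Rightarrow> real^'d) \<Rightarrow> real \<Rightarrow> real \<Rightarrow> bool" where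
  "tgv_bounded \<Omega> u w a b \<longleftrightarrow>
     integrable lborel u \<and> (\<forall>x. x \<notin> \<Omega> \<longrightarrow> u x = 0) \<and> integrable lborel w \<and> (\<forall>x. x \<notin> \<Omega> \<longrightarrow> w x = 0) \<and>
     (\<forall>v\<in>test_functions \<Omega>. (\<forall>x. norm (v x) \<le> 1) \<longrightarrow> distr_grad \<Omega> u v - distr_of_fun \<Omega> w v \<le> a) \<and>
     (\<forall>V\<in>test_functions \<Omega>. (\<forall>x. norm (V x) \<le> 1) \<longrightarrow> distr_sym_grad \<Omega> w V \<le> b)"

lemma tgv_boundedD:
  assumes "tgv_bounded \<Omega> u w a b"
  shows "integrable lborel u" "\<And>x. x \<notin> \<Omega> \<Longrightarrow> u x = 0" "integrable lborel w" "\<And>x. x \<notin> \<Omega> \<Longrightarrow> w x = 0"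
     "\<And>v. v \<in> test_functions \<Omega> \<Longrightarrow> (\<And>x. norm (v x) \<le> 1) \<Longrightarrow> distr_grad \<Omega> u v - distr_of_fun \<Omega> w v \<le> a"
     "\<And>V. V \<in> test_functions \<Omega> \<Longrightarrow> (\<And>x. norm (V x) \<le> 1) \<Longrightarrow> distr_sym_grad \<Omega> w V \<le> b"
  using assms unfolding tgv_bounded_def by blast+

text \<open>On the empty compact set the left-hand sides of the mollified bounds are 0.\<close>

lemma tgv_bounded_nonneg:
  fixes u :: "real^'d \<Rightarrow> real"
  assumes "open \<Omega>" "tgv_bounded \<Omega> u w a b"
  shows "a \<ge> 0" "b \<ge> 0"
proof -
  note t = tgv_boundedD[OF assms(2)]
  obtain \<rho> :: "real^'d \<Rightarrow> real" where \<rho>: "mollifier 1 \<rho>" using mollifier_exists[of 1] by auto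
  have "(\<integral>x. indicator {} x * norm (grad (conv \<rho> u) x - conv \<rho> w x) \<partial>lborel) \<le> a"
    by (rule mollified_grad_bound[OF assms(1) \<rho> compact_empty _ t(1-5)]) simp_all
  then show "a \<ge> 0" by simp
  have "(\<integral>x. indicator {} x * norm (sym_grad (conv \<rho> w) x) \<partial>lborel) \<le> b"
    by (rule mollified_sym_grad_bound[OF assms(1) \<rho> compact_empty _ t(3,4,6)]) simp_all
  then show "b \<ge> 0" by simp
qed

text \<open>Taking for \<open>F\<close> the sum of the two densities makes its integral over
  \<open>K\<close> split into the two mollified bounds. The radius \<open>e\<close> has disappeared
  from all constants, which is what permits the limit.\<close>

lemma star_pair_mollified:
  fixes u :: "real^'d \<Rightarrow> real"
  assumes \<Omega>: "open \<Omega>" and t: "tgv_bounded \<Omega> u w a b" and \<rho>: "mollifier e \<rho>"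
    and K: "compact K" "\<And>x. x \<in> K \<Longrightarrow> cball x e \<subseteq> \<Omega>" "cball c r \<subseteq> K" "r > 0"
    and star: "\<And>x y t. x \<in> K \<Longrightarrow> y \<in> cball c r \<Longrightarrow> 0 \<le> t \<Longrightarrow> t \<le> 1 \<Longrightarrow> y + t *\<^sub>R (x - y) \<in> K"
    and diam: "\<And>x y. x \<in> K \<Longrightarrow> y \<in> K \<Longrightarrow> norm (x - y) \<le> R"
    and vol: "emeasure lborel K \<le> ennreal V" "V \<ge> 0"
  defines "F \<equiv> \<lambda>x. norm (grad (conv \<rho> u) x - conv \<rho> w x) + norm (sym_grad (conv \<rho> w) x)"
  shows "star_pair (conv \<rho> u) (grad (conv \<rho> u)) (conv \<rho> w) (\<lambda>x. frechet_derivative (conv \<rho> w) (at x)) F K c r R V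
      ((R + R\<^sup>2) * 2 ^ DIM(real^'d) * (2 * V))"
    "(\<integral>\<^sup>+x. indicator K x * ennreal (F x) \<partial>lborel) \<le> ennreal (a + b)"
proof -
  note tg = tgv_boundedD[OF t]
  have su: "smooth (conv \<rho> u)" and sw: "smooth (conv \<rho> w)"
    using smooth_conv_mollifier[OF \<rho>] tg by auto
  note cg = continuous_on_grad_smooth[OF su] and cs = continuous_on_sym_grad_smooth[OF sw] and cw = smooth_continuous[OF sw]
  have F1: "continuous_on UNIV (\<lambda>x. norm (grad (conv \<rho> u) x - conv \<rho> w x))"
    and F2: "continuous_on UNIV (\<lambda>x. norm (sym_grad (conv \<rho> w) x))"
    by (intro continuous_intros cg cs cw)+
  show "star_pair (conv \<rho> u) (grad (conv \<rho> u)) (conv \<rho> w) (\<lambda>x. frechet_derivative (conv \<rho> w) (at x)) F K c r R V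
      ((R + R\<^sup>2) * 2 ^ DIM(real^'d) * (2 * V))"
  proof
    show "continuous_on UNIV F" unfolding F_def by (intro continuous_intros cg cs cw)
    show "norm (grad (conv \<rho> u) x - conv \<rho> w x) \<le> F x" for x by (simp add: F_def)
    show "\<bar>frechet_derivative (conv \<rho> w) (at x) h \<bullet> h\<bar> \<le> F x * (norm h)\<^sup>2" for x h
      by (rule order_trans[OF sym_grad_quadratic_form[OF sw]]) (simp add: F_def mult_right_mono)
  qed (use su sw cg K star diam vol smooth_has_derivative_grad smooth_has_derivative in auto)
  have i: "integrable lborel (\<lambda>x. indicator K x * f x)" if "continuous_on UNIV f" for f :: "real^'d \<Rightarrow> real"
    using borel_integrable_compact[OF K(1) continuous_on_subset[OF that]] by simp
  have "(\<integral>\<^sup>+x. indicator K x * ennreal (F x) \<partial>lborel) = (\<integral>\<^sup>+x. ennreal (indicator K x * F x) \<partial>lborel)"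
    by (intro nn_integral_cong) (auto simp: indicator_def)
  also have "\<dots> = ennreal (\<integral>x. indicator K x * F x \<partial>lborel)"
    by (rule nn_integral_eq_integral[OF i]) (auto simp: F_def intro!: continuous_intros cg cs cw)
  also have "(\<integral>x. indicator K x * F x \<partial>lborel) =
     (\<integral>x. indicator K x * norm (grad (conv \<rho> u) x - conv \<rho> w x) \<partial>lborel) + (\<integral>x. indicator K x * norm (sym_grad (conv \<rho> w) x) \<partial>lborel)"
    unfolding F_def distrib_left by (rule Bochner_Integration.integral_add[OF i[OF F1] i[OF F2]])
  also have "\<dots> \<le> a + b"
    by (intro add_mono mollified_grad_bound[OF \<Omega> \<rho> K(1,2) tg(1-5)] mollified_sym_grad_bound[OF \<Omega> \<rho> K(1,2) tg(3,4,6)]) auto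
  finally show "(\<integral>\<^sup>+x. indicator K x * ennreal (F x) \<partial>lborel) \<le> ennreal (a + b)"
    by (simp add: ennreal_leI)
qed

section \<open>Limits of integrals and of the affine parts\<close>

lemma ennreal_indicator_mult: "ennreal (indicator X x * z) = indicator X x * ennreal z"
  by (auto simp: indicator_def)

text \<open>Only an upper bound has to survive the limit, so Fatou's lemma suffices.\<close>

lemma nn_integral_le_of_AE_tendsto:
  fixes f :: "'a \<Rightarrow> real"
  assumes [measurable]: "\<And>n. g n \<in> borel_measurable M"
    and lim: "AE x in M. (\<lambda>n. g n x) \<longlonglongrightarrow> f x" and bound: "\<And>n. (\<integral>\<^sup>+x. ennreal (g n x) \<partial>M) \<le> C"
  shows "(\<integral>\<^sup>+x. ennreal (f x) \<partial>M) \<le> C"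
proof -
  have "(\<integral>\<^sup>+x. ennreal (f x) \<partial>M) = (\<integral>\<^sup>+x. liminf (\<lambda>n. ennreal (g n x)) \<partial>M)"
    by (rule nn_integral_cong_AE)
       (use lim in eventually_elim, auto intro!: lim_imp_Liminf[symmetric] tendsto_ennrealI)
  also have "\<dots> \<le> liminf (\<lambda>n. \<integral>\<^sup>+x. ennreal (g n x) \<partial>M)"
    by (rule nn_integral_liminf) measurable
  also have "\<dots> \<le> limsup (\<lambda>n. \<integral>\<^sup>+x. ennreal (g n x) \<partial>M)" by (rule Liminf_le_Limsup) simp
  also have "\<dots> \<le> C" by (rule Limsup_bounded) (simp add: bound)
  finally show ?thesis .
qed

lemma ball_integrable_linear:
  fixes g :: "'a::euclidean_space \<Rightarrow> 'b::euclidean_space" and L :: "'a \<Rightarrow> 'b \<Rightarrow> 'c::euclidean_space"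
  assumes g: "integrable lborel g" and L: "\<And>y v. y \<in> cball c r \<Longrightarrow> norm (L y v) \<le> M * norm v"
       "\<And>g. g \<in> borel_measurable borel \<Longrightarrow> (\<lambda>y. L y (g y)) \<in> borel_measurable borel"
  shows "integrable lborel (\<lambda>y. indicator (cball c r) y *\<^sub>R L y (g y))"
proof (rule Bochner_Integration.integrable_bound)
  have [measurable]: "cball c r \<in> sets borel" by simp
  show "integrable lborel (\<lambda>y. \<bar>M\<bar> *\<^sub>R g y)" using g by auto
  have [measurable]: "(\<lambda>y. L y (g y)) \<in> borel_measurable borel" using g by (intro L(2)) auto
  show "(\<lambda>y. indicator (cball c r) y *\<^sub>R L y (g y)) \<in> borel_measurable lborel" by measurable
  have "norm (indicator (cball c r) y *\<^sub>R L y (g y)) \<le> norm (\<bar>M\<bar> *\<^sub>R g y)" for y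
  proof (cases "y \<in> cball c r")
    case True
    have "norm (L y (g y)) \<le> \<bar>M\<bar> * norm (g y)"
      using L(1)[OF True, of "g y"] mult_right_mono[OF abs_ge_self[of M] norm_ge_zero[of "g y"]] by linarith
    then show ?thesis using True by simp
  qed simp
  then show "AE y in lborel. norm (indicator (cball c r) y *\<^sub>R L y (g y)) \<le> norm (\<bar>M\<bar> *\<^sub>R g y)" by simp
qed

text \<open>The linear maps \<open>L y\<close> cover both kinds of means in the affine
  approximation: the identity for the means of \<open>u\<close> and \<open>w\<close>, and the inner
  product with y for the first moment of \<open>w\<close>.\<close>

lemma ball_mean_tendsto:
  fixes f :: "'a::euclidean_space \<Rightarrow> 'b::euclidean_space"
  assumes fn: "\<And>n. integrable lborel (f_seq n)" and f: "integrable lborel f"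
    and lim: "(\<lambda>n. \<integral>x. norm (f_seq n x - f x) \<partial>lborel) \<longlonglongrightarrow> 0"
    and L: "\<And>y. bounded_linear (L y)" "\<And>y v. y \<in> cball c r \<Longrightarrow> norm (L y v) \<le> M * norm v"
       "\<And>g. g \<in> borel_measurable borel \<Longrightarrow> (\<lambda>y. L y (g y)) \<in> borel_measurable borel"
  shows "(\<lambda>n. ball_mean c r (\<lambda>y. L y (f_seq n y))) \<longlonglongrightarrow> (ball_mean c r (\<lambda>y. L y (f y)) :: 'c::euclidean_space)"
proof -
  note i = ball_integrable_linear[OF _ L(2,3)]
  have "(\<lambda>n. \<integral>y. indicator (cball c r) y *\<^sub>R L y (f_seq n y) \<partial>lborel) \<longlonglongrightarrow> (\<integral>y. indicator (cball c r) y *\<^sub>R L y (f y) \<partial>lborel)"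
  proof (rule LIM_zero_cancel, rule Lim_null_comparison)
    show "(\<lambda>n. \<bar>M\<bar> * (\<integral>x. norm (f_seq n x - f x) \<partial>lborel)) \<longlonglongrightarrow> 0"
      using tendsto_mult_right_zero[OF lim] by simp
    have "norm ((\<integral>y. indicator (cball c r) y *\<^sub>R L y (f_seq n y) \<partial>lborel) - (\<integral>y. indicator (cball c r) y *\<^sub>R L y (f y) \<partial>lborel))
       \<le> \<bar>M\<bar> * (\<integral>x. norm (f_seq n x - f x) \<partial>lborel)" for n
    proof -
      have "(\<integral>y. indicator (cball c r) y *\<^sub>R L y (f_seq n y) \<partial>lborel) - (\<integral>y. indicator (cball c r) y *\<^sub>R L y (f y) \<partial>lborel)
        = (\<integral>y. indicator (cball c r) y *\<^sub>R L y (f_seq n y) - indicator (cball c r) y *\<^sub>R L y (f y) \<partial>lborel)"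
        by (rule Bochner_Integration.integral_diff[OF i[OF fn] i[OF f], symmetric])
      also have "\<dots> = (\<integral>y. indicator (cball c r) y *\<^sub>R L y (f_seq n y - f y) \<partial>lborel)"
        by (intro Bochner_Integration.integral_cong refl)
           (simp add: linear_diff[OF bounded_linear.linear[OF L(1)]] scaleR_diff_right)
      also have "norm \<dots> \<le> (\<integral>y. norm (indicator (cball c r) y *\<^sub>R L y (f_seq n y - f y)) \<partial>lborel)"
        by (rule integral_norm_bound)
      also have "\<dots> \<le> (\<integral>y. \<bar>M\<bar> * norm (f_seq n y - f y) \<partial>lborel)"
      proof (rule integral_mono[OF integrable_norm[OF i]])
        fix y
        show "norm (indicator (cball c r) y *\<^sub>R L y (f_seq n y - f y)) \<le> \<bar>M\<bar> * norm (f_seq n y - f y)"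
        proof (cases "y \<in> cball c r")
          case True
          have "norm (L y (f_seq n y - f y)) \<le> \<bar>M\<bar> * norm (f_seq n y - f y)"
            using L(2)[OF True, of "f_seq n y - f y"] mult_right_mono[OF abs_ge_self[of M] norm_ge_zero[of "f_seq n y - f y"]] by linarith
          then show ?thesis using True by simp
        qed simp
      qed (use fn f in auto)
      finally show ?thesis by simp
    qed
    then show "\<forall>\<^sub>F n in sequentially. norm ((\<integral>y. indicator (cball c r) y *\<^sub>R L y (f_seq n y) \<partial>lborel) - (\<integral>y. indicator (cball c r) y *\<^sub>R L y (f y) \<partial>lborel))
       \<le> \<bar>M\<bar> * (\<integral>x. norm (f_seq n x - f x) \<partial>lborel)" by simp
  qed
  then show ?thesis unfolding ball_mean_def by (intro tendsto_intros)
qed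

lemma ball_mean_diff_inner:
  fixes u :: "'a::euclidean_space \<Rightarrow> real" and w :: "'a \<Rightarrow> 'a"
  assumes u: "integrable lborel u" and w: "integrable lborel w"
  shows "ball_mean c r (\<lambda>y. u y - w y \<bullet> y) = ball_mean c r u - ball_mean c r (\<lambda>y. w y \<bullet> y)"
proof -
  have 1: "integrable lborel (\<lambda>y. indicator (cball c r) y *\<^sub>R u y)"
    by (rule ball_integrable_linear[OF u, of _ _ "\<lambda>y v. v" 1]) auto
  have 2: "integrable lborel (\<lambda>y. indicator (cball c r) y *\<^sub>R (w y \<bullet> y))"
  proof (rule ball_integrable_linear[OF w, of _ _ "\<lambda>y v. v \<bullet> y" "norm c + r"])
    fix y v assume "y \<in> cball c r"
    then have "norm y \<le> norm c + r" using norm_triangle_ineq[of c "y - c"] by (simp add: dist_norm norm_minus_commute)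
    then show "norm (v \<bullet> y) \<le> (norm c + r) * norm v"
      using Cauchy_Schwarz_ineq2[of v y] mult_left_mono[of "norm y" "norm c + r" "norm v"] by (simp add: mult.commute)
  qed (simp add: borel_measurable_inner)
  show ?thesis
    unfolding ball_mean_def scaleR_diff_right
    using 1 2 by (simp only: Bochner_Integration.integral_diff scaleR_diff_right)
qed

lemma ball_mean_tendsto_simple:
  fixes f :: "'a::euclidean_space \<Rightarrow> 'b::euclidean_space"
  assumes fn: "\<And>n. integrable lborel (f_seq n)" and f: "integrable lborel f"
    and lim: "(\<lambda>n. \<integral>x. norm (f_seq n x - f x) \<partial>lborel) \<longlonglongrightarrow> 0"
  shows "(\<lambda>n. ball_mean c r (f_seq n)) \<longlonglongrightarrow> ball_mean c r f"
  using ball_mean_tendsto[of f_seq f "\<lambda>y v. v" c r 1, OF fn f lim bounded_linear_ident] by simp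

lemma ball_mean_tendsto_inner:
  fixes f :: "'a::euclidean_space \<Rightarrow> 'a"
  assumes fn: "\<And>n. integrable lborel (f_seq n)" and f: "integrable lborel f"
    and lim: "(\<lambda>n. \<integral>x. norm (f_seq n x - f x) \<partial>lborel) \<longlonglongrightarrow> 0"
  shows "(\<lambda>n. ball_mean c r (\<lambda>y. f_seq n y \<bullet> y)) \<longlonglongrightarrow> ball_mean c r (\<lambda>y. f y \<bullet> y)"
proof (rule ball_mean_tendsto[of f_seq f "\<lambda>y v. v \<bullet> y" c r "norm c + r", OF fn f lim bounded_linear_inner_left])
  fix y v assume "y \<in> cball c r"
  then have "norm y \<le> norm c + r" using norm_triangle_ineq[of c "y - c"] by (simp add: dist_norm norm_minus_commute)
  then show "norm (v \<bullet> y) \<le> (norm c + r) * norm v"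
    using Cauchy_Schwarz_ineq2[of v y] mult_left_mono[of "norm y" "norm c + r" "norm v"] by (simp add: mult.commute)
qed (simp add: borel_measurable_inner)

text \<open>Convergence in L1 yields convergence almost everywhere only along a subsequence,
  selected by \<open>s\<close>. The ball means converge along the full sequence, hence along
  \<open>s\<close> as well.\<close>

lemma mollified_limit:
  fixes u :: "real^'d \<Rightarrow> real" and w :: "real^'d \<Rightarrow> real^'d"
  assumes u: "integrable lborel u" and w: "integrable lborel w" and "e0 > 0"
  shows "\<exists>e \<rho>. (\<forall>n. mollifier (e n) (\<rho> n) \<and> 0 < e n \<and> e n \<le> e0) \<and>
     (AE x in lborel. (\<lambda>n::nat. conv (\<rho> n) u x) \<longlonglongrightarrow> u x) \<and>
     (\<lambda>n. ball_mean c r (\<lambda>y. conv (\<rho> n) u y - conv (\<rho> n) w y \<bullet> y)) \<longlonglongrightarrow> ball_mean c r (\<lambda>y. u y - w y \<bullet> y) \<and>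
     (\<lambda>n. ball_mean c r (conv (\<rho> n) w)) \<longlonglongrightarrow> ball_mean c r w"
proof -
  define e where "e n = e0 / real (Suc n)" for n
  have e: "0 < e n" "e n \<le> e0" for n using \<open>e0 > 0\<close> by (auto simp: e_def field_simps)
  have "e \<longlonglongrightarrow> 0" using tendsto_mult_right_zero[OF LIMSEQ_inverse_real_of_nat, of e0]
    by (simp add: e_def[abs_def] divide_inverse)
  obtain \<rho> :: "nat \<Rightarrow> real^'d \<Rightarrow> real" where \<rho>: "\<And>n. mollifier (e n) (\<rho> n)"
    using mollifier_exists[OF e(1)] by metis
  have cu: "integrable lborel (conv (\<rho> n) u)" "integrable lborel (conv (\<rho> n) w)" for n
    using integrable_conv[OF \<rho>] u w by auto
  note lu = conv_tendsto_L1[OF \<rho> \<open>e \<longlonglongrightarrow> 0\<close> u] and lw = conv_tendsto_L1[OF \<rho> \<open>e \<longlonglongrightarrow> 0\<close> w]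
  obtain s :: "nat \<Rightarrow> nat" where s: "strict_mono s" "AE x in lborel. (\<lambda>n. conv (\<rho> (s n)) u x - u x) \<longlonglongrightarrow> 0"
    using tendsto_L1_AE_subseq[of lborel "\<lambda>n x. conv (\<rho> n) u x - u x", OF Bochner_Integration.integrable_diff[OF cu(1) u] lu] by blast
  have lus: "(\<lambda>n. \<integral>x. norm (conv (\<rho> (s n)) u x - u x) \<partial>lborel) \<longlonglongrightarrow> 0"
    and lws: "(\<lambda>n. \<integral>x. norm (conv (\<rho> (s n)) w x - w x) \<partial>lborel) \<longlonglongrightarrow> 0"
    using LIMSEQ_subseq_LIMSEQ[OF lu s(1)] LIMSEQ_subseq_LIMSEQ[OF lw s(1)] by (auto simp: comp_def)
  have "AE x in lborel. (\<lambda>n. conv (\<rho> (s n)) u x) \<longlonglongrightarrow> u x"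
    using s(2) by eventually_elim (rule LIM_zero_cancel)
  moreover have "(\<lambda>n. ball_mean c r (\<lambda>y. conv (\<rho> (s n)) u y - conv (\<rho> (s n)) w y \<bullet> y)) \<longlonglongrightarrow> ball_mean c r (\<lambda>y. u y - w y \<bullet> y)"
    unfolding ball_mean_diff_inner[OF cu] ball_mean_diff_inner[OF u w]
    by (intro tendsto_diff ball_mean_tendsto_simple[OF cu(1) u lus] ball_mean_tendsto_inner[OF cu(2) w lws])
  moreover have "(\<lambda>n. ball_mean c r (conv (\<rho> (s n)) w)) \<longlonglongrightarrow> ball_mean c r w"
    by (rule ball_mean_tendsto_simple[OF cu(2) w lws])
  ultimately show ?thesis
    using \<rho> e by (intro exI[of _ "\<lambda>n. e (s n)"] exI[of _ "\<lambda>n. \<rho> (s n)"]) auto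
qed

text \<open>No constant depends on the mollification radius, and the affine functions converge
  because their coefficients are ball means; so both smooth estimates pass to the limit. The second
  conclusion stays open in \<open>K0\<close>, the two directions and \<open>P\<close>, since these
  can be supplied only in dimension two.\<close>

lemma star_estimate:
  fixes u :: "real^'d \<Rightarrow> real"
  assumes \<Omega>: "open \<Omega>" and t: "tgv_bounded \<Omega> u w a b"
    and K: "compact K" "K \<subseteq> \<Omega>" "cball c r \<subseteq> K" "r > 0"
    and star: "\<And>x y t. x \<in> K \<Longrightarrow> y \<in> cball c r \<Longrightarrow> 0 \<le> t \<Longrightarrow> t \<le> 1 \<Longrightarrow> y + t *\<^sub>R (x - y) \<in> K"
    and diam: "\<And>x y. x \<in> K \<Longrightarrow> y \<in> K \<Longrightarrow> norm (x - y) \<le> R"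
    and vol: "emeasure lborel K \<le> ennreal V" "V \<ge> 0"
    and S: "S = (R + R\<^sup>2) * 2 ^ DIM(real^'d) * (2 * V)"
  defines "A \<equiv> \<lambda>x. ball_mean c r (\<lambda>y. u y - w y \<bullet> y) + ball_mean c r w \<bullet> x"
  shows "(\<integral>\<^sup>+x. indicator K x * ennreal \<bar>u x - A x\<bar> \<partial>lborel) \<le> ennreal (S / measure lborel (cball c r)) * ennreal (a + b)" (is ?th1)
    and "\<And>K0 e1 e2 E P. K0 \<in> sets borel \<Longrightarrow> K0 \<subseteq> K \<Longrightarrow>
       (\<And>x t. x \<in> K0 \<Longrightarrow> 0 \<le> t \<Longrightarrow> t \<le> 1 \<Longrightarrow> x + t *\<^sub>R e1 \<in> K \<and> x + t *\<^sub>R e2 \<in> K) \<Longrightarrow>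
       norm e1 \<le> E \<Longrightarrow> norm e2 \<le> E \<Longrightarrow>
       (\<And>G z. G \<in> borel_measurable borel \<Longrightarrow>
        (\<integral>\<^sup>+s. (\<integral>\<^sup>+\<tau>. G (z - s *\<^sub>R e1 + \<tau> *\<^sub>R e2) \<partial>lborel) \<partial>lborel) \<le> P * integral\<^sup>N lborel G) \<Longrightarrow>
       (\<integral>\<^sup>+x. indicator K0 x * ennreal ((u x - A x)\<^sup>2) \<partial>lborel) \<le>
         P * (ennreal (S / measure lborel (cball c r) + E * (1 + (2 * V * (S / measure lborel (cball c r)) + S) / (r / 4 * measure lborel (ball c (r / 4))))) * ennreal (a + b))\<^sup>2"
proof -
  note tg = tgv_boundedD[OF t]
  \<comment> \<open>The room between \<open>K\<close> and the complement of \<Omega>; half of it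
    bounds all mollification radii.\<close>
  obtain e0 where "e0 > 0" and e0: "(\<Union>x\<in>K. ball x e0) \<subseteq> \<Omega>"
    using compact_subset_open_imp_ball_epsilon_subset[OF K(1) \<Omega> K(2)] by blast
  then have "e0 / 2 > 0" by simp
  obtain e \<rho> where e: "\<And>n. mollifier (e n) (\<rho> n)" "\<And>n. 0 < e n" "\<And>n. e n \<le> e0 / 2"
    and lim: "AE x in lborel. (\<lambda>n::nat. conv (\<rho> n) u x) \<longlonglongrightarrow> u x"
     "(\<lambda>n. ball_mean c r (\<lambda>y. conv (\<rho> n) u y - conv (\<rho> n) w y \<bullet> y)) \<longlonglongrightarrow> ball_mean c r (\<lambda>y. u y - w y \<bullet> y)"
     "(\<lambda>n. ball_mean c r (conv (\<rho> n) w)) \<longlonglongrightarrow> ball_mean c r w"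
    using mollified_limit[OF tg(1,3) \<open>e0 / 2 > 0\<close>, of c r] by blast
  have sub: "cball x (e n) \<subseteq> \<Omega>" if "x \<in> K" for x n
  proof -
    have "cball x (e n) \<subseteq> ball x e0" using e(3)[of n] \<open>e0 > 0\<close> by (auto simp: subset_eq)
    then show ?thesis using e0 that by blast
  qed
  let ?F = "\<lambda>n x. norm (grad (conv (\<rho> n) u) x - conv (\<rho> n) w x) + norm (sym_grad (conv (\<rho> n) w) x)"
  let ?A = "\<lambda>n x. ball_mean c r (\<lambda>y. conv (\<rho> n) u y - conv (\<rho> n) w y \<bullet> y) + ball_mean c r (conv (\<rho> n) w) \<bullet> x"
  have sp: "star_pair (conv (\<rho> n) u) (grad (conv (\<rho> n) u)) (conv (\<rho> n) w) (\<lambda>x. frechet_derivative (conv (\<rho> n) w) (at x)) (?F n) K c r R V S" for n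
    unfolding S by (rule star_pair_mollified(1)[OF \<Omega> t e(1) K(1) sub K(3,4) star diam vol])
  have J: "(\<integral>\<^sup>+x. indicator K x * ennreal (?F n x) \<partial>lborel) \<le> ennreal (a + b)" for n
    by (rule star_pair_mollified(2)[OF \<Omega> t e(1) K(1) sub K(3,4) star diam vol])
  have [measurable]: "u \<in> borel_measurable borel" "w \<in> borel_measurable borel" using tg by auto
  note [measurable] = mollifierD(6)[OF e(1)]
  have [measurable]: "K \<in> sets borel" using K(1) by (simp add: borel_compact)
  have Alim: "(\<lambda>n. ?A n x) \<longlonglongrightarrow> A x" for x
    unfolding A_def by (intro tendsto_intros lim)
  note ind = ennreal_indicator_mult
  have "(\<integral>\<^sup>+x. ennreal (indicator K x * \<bar>u x - A x\<bar>) \<partial>lborel) \<le> ennreal (S / measure lborel (cball c r)) * ennreal (a + b)"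
  proof (rule nn_integral_le_of_AE_tendsto)
    show "AE x in lborel. (\<lambda>n. indicator K x * \<bar>conv (\<rho> n) u x - ?A n x\<bar>) \<longlonglongrightarrow> indicator K x * \<bar>u x - A x\<bar>"
      using lim(1) by eventually_elim (intro tendsto_intros Alim)
    show "(\<integral>\<^sup>+x. ennreal (indicator K x * \<bar>conv (\<rho> n) u x - ?A n x\<bar>) \<partial>lborel) \<le> ennreal (S / measure lborel (cball c r)) * ennreal (a + b)" for n
      unfolding ind
      by (rule order_trans[OF star_pair.poincare_u[OF sp]]) (intro mult_left_mono J, simp)
  qed measurable
  then show ?th1 by (simp only: ind)
  fix K0 e1 e2 E P
  assume [measurable]: "K0 \<in> sets borel" and K0: "K0 \<subseteq> K"
    "\<And>x t. x \<in> K0 \<Longrightarrow> 0 \<le> t \<Longrightarrow> t \<le> 1 \<Longrightarrow> x + t *\<^sub>R e1 \<in> K \<and> x + t *\<^sub>R e2 \<in> K"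
    and E: "norm e1 \<le> E" "norm e2 \<le> E"
    and P: "\<And>G z. G \<in> borel_measurable borel \<Longrightarrow>
        (\<integral>\<^sup>+s. (\<integral>\<^sup>+\<tau>. G (z - s *\<^sub>R e1 + \<tau> *\<^sub>R e2) \<partial>lborel) \<partial>lborel) \<le> P * integral\<^sup>N lborel G"
  let ?C = "S / measure lborel (cball c r) + E * (1 + (2 * V * (S / measure lborel (cball c r)) + S) / (r / 4 * measure lborel (ball c (r / 4))))"
  have "(\<integral>\<^sup>+x. ennreal (indicator K0 x * (u x - A x)\<^sup>2) \<partial>lborel) \<le> P * (ennreal ?C * ennreal (a + b))\<^sup>2"
  proof (rule nn_integral_le_of_AE_tendsto)
    show "AE x in lborel. (\<lambda>n. indicator K0 x * (conv (\<rho> n) u x - ?A n x)\<^sup>2) \<longlonglongrightarrow> indicator K0 x * (u x - A x)\<^sup>2"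
      using lim(1) by eventually_elim (intro tendsto_intros Alim)
    show "(\<integral>\<^sup>+x. ennreal (indicator K0 x * (conv (\<rho> n) u x - ?A n x)\<^sup>2) \<partial>lborel) \<le> P * (ennreal ?C * ennreal (a + b))\<^sup>2" for n
      unfolding ind
      by (rule order_trans[OF star_pair.sobolev_u[OF sp K0 E P]])
         (assumption | intro mult_left_mono power_mono J | simp)+
  qed measurable
  then show "(\<integral>\<^sup>+x. indicator K0 x * ennreal ((u x - A x)\<^sup>2) \<partial>lborel) \<le> P * (ennreal ?C * ennreal (a + b))\<^sup>2"
    by (simp only: ind)
qed

section \<open>Local estimates up to the boundary\<close>

text \<open>At an interior point m = 0 works. At a boundary point m = s n: a displacement t (s n +
  z) gains at least t (s - |z|) in height, while the graph rises by at most t L |z|. As (L + 1) |z|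
  stays below s, the moved point remains strictly above the graph.\<close>

lemma lipschitz_boundary_cone:
  fixes \<Omega> :: "'a::euclidean_space set"
  assumes \<Omega>: "open \<Omega>" "lipschitz_boundary \<Omega>" and x0: "x0 \<in> closure \<Omega>"
  shows "\<exists>m \<rho> \<delta>. 0 < \<rho> \<and> 0 < \<delta> \<and>
    (\<forall>x k t. x \<in> \<Omega> \<inter> ball x0 \<delta> \<longrightarrow> norm (k - m) < \<rho> \<longrightarrow> 0 \<le> t \<longrightarrow> t \<le> 1 \<longrightarrow> x + t *\<^sub>R k \<in> \<Omega>)"
proof (cases "x0 \<in> \<Omega>")
  case True
  then obtain e where e: "e > 0" "ball x0 e \<subseteq> \<Omega>" using \<Omega>(1) open_contains_ball by blast
  have "x + t *\<^sub>R k \<in> \<Omega>" if "x \<in> \<Omega> \<inter> ball x0 (e / 2)" "norm (k - 0) < e / 2" "0 \<le> t" "t \<le> 1" for x k t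
  proof -
    have "norm (t *\<^sub>R k) \<le> 1 * norm k" unfolding norm_scaleR using that by (intro mult_right_mono) auto
    then have "dist x0 (x + t *\<^sub>R k) < e"
      using that norm_triangle_ineq4[of "x0 - x" "t *\<^sub>R k"] by (simp add: dist_norm diff_diff_eq)
    then show ?thesis using e(2) by auto
  qed
  then show ?thesis using e(1) by (intro exI[of _ 0] exI[of _ "e / 2"]) auto
next
  case False
  then have "x0 \<in> frontier \<Omega>" using x0 \<Omega>(1) by (simp add: frontier_def interior_open)
  then obtain r n \<gamma> L where r: "r > 0" and n: "norm n = 1" and L: "lipschitz_on L {y. y \<bullet> n = 0} \<gamma>"
    and eq: "\<Omega> \<inter> ball x0 r = {x \<in> ball x0 r. \<gamma> (x - (x \<bullet> n) *\<^sub>R n) < x \<bullet> n}"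
    using \<Omega>(2) unfolding lipschitz_boundary_def by blast
  have "L \<ge> 0" using L lipschitz_on_nonneg by blast
  have nn: "n \<bullet> n = 1" using n by (simp add: dot_square_norm)
  \<comment> \<open>A quarter of r, because the starting point uses up at most \<open>s\<close> and
    the displacement at most \<open>2 * s\<close> of the radius.\<close>
  define s where "s = r / 4"
  define \<rho> where "\<rho> = s / (L + 1)"
  have "s > 0" using r by (simp add: s_def)
  then have \<rho>: "\<rho> > 0" "\<rho> \<le> s" "(L + 1) * \<rho> = s" using \<open>L \<ge> 0\<close> by (auto simp: \<rho>_def field_simps)
  have "x + t *\<^sub>R k \<in> \<Omega>" if x: "x \<in> \<Omega> \<inter> ball x0 s" and k: "norm (k - s *\<^sub>R n) < \<rho>" and t: "0 \<le> t" "t \<le> 1" for x k t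
  proof -
    let ?P = "\<lambda>z. z - (z \<bullet> n) *\<^sub>R n"
    let ?y = "x + t *\<^sub>R k" and ?z = "k - s *\<^sub>R n"
    have "norm k \<le> s + \<rho>"
      using norm_triangle_ineq[of "s *\<^sub>R n" ?z] k n \<open>s > 0\<close> by simp
    moreover have "norm (t *\<^sub>R k) \<le> 1 * norm k" unfolding norm_scaleR using t by (intro mult_right_mono) auto
    ultimately have "dist x0 ?y < r"
      using x r \<rho>(2) norm_triangle_ineq4[of "x0 - x" "t *\<^sub>R k"] by (simp add: dist_norm diff_diff_eq s_def)
    moreover have "\<gamma> (?P ?y) < ?y \<bullet> n"
    proof -
      have "x \<in> ball x0 r" using x r by (simp add: s_def)
      then have gx: "\<gamma> (?P x) < x \<bullet> n" using x eq by blast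
      have Pz: "norm (?P ?z) \<le> norm ?z"
      proof -
        have "(norm (?P z))\<^sup>2 = (norm z)\<^sup>2 - (z \<bullet> n)\<^sup>2" for z
          unfolding power2_norm_eq_inner
          using nn by (simp add: inner_diff_left inner_diff_right inner_commute[of n z] power2_eq_square)
        then have "(norm (?P ?z))\<^sup>2 \<le> (norm ?z)\<^sup>2" by simp
        then show ?thesis by (rule power2_le_imp_le) simp
      qed
      have Pk: "?P k = ?P ?z" using nn by (simp add: inner_diff_left algebra_simps)
      have Py: "?P ?y - ?P x = t *\<^sub>R ?P k" by (simp add: inner_add_left algebra_simps)
      have hyp: "?P z \<in> {y. y \<bullet> n = 0}" for z using nn by (simp add: inner_diff_left)
      have "\<gamma> (?P ?y) - \<gamma> (?P x) \<le> L * norm (?P ?y - ?P x)"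
        using lipschitz_onD[OF L hyp hyp, of ?y x] by (simp add: dist_norm)
      also have "\<dots> = t * (L * norm (?P ?z))" unfolding Py Pk using t by simp
      also have "\<dots> \<le> t * (L * norm ?z)" using Pz t \<open>L \<ge> 0\<close> by (intro mult_left_mono) auto
      also have "\<dots> \<le> t * (s - norm ?z)"
      proof (intro mult_left_mono t)
        have "(L + 1) * norm ?z \<le> s" using mult_left_mono[of "norm ?z" \<rho> "L + 1"] k \<rho>(3) \<open>L \<ge> 0\<close> by simp
        then show "L * norm ?z \<le> s - norm ?z" by (simp add: algebra_simps)
      qed
      also have "\<dots> \<le> t * (k \<bullet> n)"
      proof (intro mult_left_mono t)
        have "\<bar>?z \<bullet> n\<bar> \<le> norm ?z" using Cauchy_Schwarz_ineq2[of ?z n] n by simp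
        moreover have "k \<bullet> n = s + ?z \<bullet> n" using nn by (simp add: inner_diff_left)
        ultimately show "s - norm ?z \<le> k \<bullet> n" by linarith
      qed
      finally show ?thesis using gx by (simp add: inner_add_left)
    qed
    ultimately have "?y \<in> \<Omega> \<inter> ball x0 r" unfolding eq by simp
    then show ?thesis by simp
  qed
  then show ?thesis using \<rho>(1) \<open>s > 0\<close> by blast
qed

lemma nn_integral_exhaustion_le:
  fixes h :: "'a::euclidean_space \<Rightarrow> real"
  assumes h: "h \<in> borel_measurable borel" and K: "\<And>n. K n \<in> sets borel" "\<And>n. K n \<subseteq> U"
    and ex: "\<And>x. x \<in> U \<Longrightarrow> \<exists>N. \<forall>n\<ge>N. x \<in> K (n::nat)"
    and b: "\<And>n. (\<integral>\<^sup>+x. indicator (K n) x * ennreal (h x) \<partial>lborel) \<le> C"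
  shows "(\<integral>\<^sup>+x. indicator U x * ennreal (h x) \<partial>lborel) \<le> C"
proof -
  note [measurable] = h K(1)
  have "(\<integral>\<^sup>+x. ennreal (indicator U x * h x) \<partial>lborel) \<le> C"
  proof (rule nn_integral_le_of_AE_tendsto)
    show "AE x in lborel. (\<lambda>n. indicator (K n) x * h x) \<longlonglongrightarrow> indicator U x * h x"
    proof (rule AE_I2, rule tendsto_eventually)
      fix x
      show "\<forall>\<^sub>F n in sequentially. indicator (K n) x * h x = indicator U x * h x"
      proof (cases "x \<in> U")
        case True
        obtain N where "\<And>n. n \<ge> N \<Longrightarrow> x \<in> K n" using ex[OF True] by blast
        then show ?thesis using True by (intro eventually_sequentiallyI[of N]) simp
      next
        case False
        then have "x \<notin> K n" for n using K(2) by blast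
        then show ?thesis using False by simp
      qed
    qed
  qed (use b in \<open>auto simp: ennreal_indicator_mult\<close>)
  then show ?thesis by (simp only: ennreal_indicator_mult)
qed

text \<open>Two independent directions near \<open>m\<close>: a shift along axis i, if necessary,
  makes that coordinate nonzero, and a further shift along axis j separates the second direction
  from the first. \<open>q\<close> is the reciprocal of the determinant.\<close>

lemma oblique_directions:
  fixes m :: "real^'d"
  assumes "CARD('d) = 2" "\<rho> > 0"
  shows "\<exists>e1 e2 q. norm (e1 - m) \<le> \<rho> \<and> norm (e2 - m) \<le> \<rho> \<and> 0 \<le> q \<and>
    (\<forall>G z. G \<in> borel_measurable borel \<longrightarrow>
      (\<integral>\<^sup>+s. (\<integral>\<^sup>+\<tau>. G (z - s *\<^sub>R e1 + \<tau> *\<^sub>R e2) \<partial>lborel) \<partial>lborel) \<le> ennreal q * integral\<^sup>N lborel G)"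
proof -
  obtain i j :: 'd where ij: "UNIV = {i, j}" "i \<noteq> j" using assms(1) by (auto simp: card_2_iff)
  define e1 where "e1 = (if m $ i = 0 then m + (\<rho> / 2) *\<^sub>R axis i 1 else m)"
  define e2 where "e2 = e1 + (\<rho> / 2) *\<^sub>R axis j 1"
  have "e1 $ i \<noteq> 0" using assms(2) by (simp add: e1_def axis_def)
  moreover have "norm (e1 - m) \<le> \<rho> / 2" using assms(2) by (simp add: e1_def norm_axis_1)
  ultimately have e1: "e1 $ i \<noteq> 0" "norm (e1 - m) \<le> \<rho> / 2" by auto
  have "norm (e2 - m) \<le> norm (e1 - m) + norm ((\<rho> / 2) *\<^sub>R axis j (1::real))"
    unfolding e2_def using norm_triangle_ineq[of "e1 - m" "(\<rho> / 2) *\<^sub>R axis j (1::real)"] by (simp add: algebra_simps)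
  then have e2: "norm (e2 - m) \<le> \<rho>" using e1(2) assms(2) by (simp add: norm_axis_1)
  show ?thesis
    using e1 e2 assms(2) nn_integral_oblique_plane[OF ij _ e1(1) e2_def]
    by (intro exI[of _ e1] exI[of _ e2] exI[of _ "1 / (\<bar>\<rho> / 2\<bar> * \<bar>e1 $ i\<bar>)"]) auto
qed

text \<open>The ball is centred at x0 + m, where the cone carries every point of \<Omega> close to
  x0. Joining a compact piece of \<open>U\<close> to this ball gives a compact star-shaped subset of
  \<Omega>. The constants of \<open>star_estimate\<close> do not depend on the piece, so one
  \<open>C\<close> survives the exhaustion of \<open>U\<close>.\<close>

lemma local_estimate:
  fixes \<Omega> :: "(real^'d) set"
  assumes \<Omega>: "open \<Omega>" "bounded \<Omega>" and \<rho>: "0 < \<rho>" and \<delta>: "\<delta> \<le> \<rho> / 8"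
    and cone: "\<And>x k t. x \<in> \<Omega> \<inter> ball x0 \<delta> \<Longrightarrow> norm (k - m) < \<rho> \<Longrightarrow> 0 \<le> t \<Longrightarrow> t \<le> 1 \<Longrightarrow> x + t *\<^sub>R k \<in> \<Omega>"
  defines "U \<equiv> \<Omega> \<inter> ball x0 \<delta>"
  shows "\<exists>C\<ge>0. \<forall>u w a b. tgv_bounded \<Omega> u w a b \<longrightarrow> (\<exists>\<alpha> \<beta>.
     (\<integral>\<^sup>+x. indicator U x * ennreal \<bar>u x - (\<alpha> + \<beta> \<bullet> x)\<bar> \<partial>lborel) \<le> ennreal (C * (a + b)) \<and>
     (CARD('d) = 2 \<longrightarrow> (\<integral>\<^sup>+x. indicator U x * ennreal ((u x - (\<alpha> + \<beta> \<bullet> x))\<^sup>2) \<partial>lborel) \<le> ennreal ((C * (a + b))\<^sup>2)))"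
proof -
  define c where "c = x0 + m"
  \<comment> \<open>With this radius and \<delta> at most \<rho>/8, a displacement from
    \<open>U\<close> to the ball deviates from \<open>m\<close> by at most 3\<rho>/8, which is
    inside the cone.\<close>
  define r where "r = \<rho> / 4"
  have "r > 0" using \<rho> by (simp add: r_def)
  obtain R' where R': "\<And>x. x \<in> \<Omega> \<Longrightarrow> norm x \<le> R'" using \<Omega>(2) unfolding bounded_iff by blast
  define R where "R = 2 * R'"
  have diam: "norm (x - y) \<le> R" if "x \<in> \<Omega>" "y \<in> \<Omega>" for x y
    using norm_triangle_ineq4[of x y] R'[OF that(1)] R'[OF that(2)] by (simp add: R_def)
  define V where "V = measure lborel \<Omega>"
  have V: "emeasure lborel \<Omega> = ennreal V" "V \<ge> 0"
    using emeasure_bounded_finite[OF \<Omega>(2)] by (auto simp: V_def emeasure_eq_ennreal_measure)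
  define S where "S = (R + R\<^sup>2) * 2 ^ DIM(real^'d) * (2 * V)"
  define B where "B = measure lborel (cball c r)"
  define \<kappa> where "\<kappa> = r / 4 * measure lborel (ball c (r / 4))"
  \<comment> \<open>A deviation of \<rho>/8 from \<open>m\<close> and an offset of \<rho>/8 from x0
    add up to \<open>r\<close>, so translating a point of \<open>U\<close> by \<open>e1\<close> or
    \<open>e2\<close> leads into the ball. Outside dimension two the three values are
    arbitrary.\<close>
  obtain e1 e2 q where e: "CARD('d) = 2 \<Longrightarrow> norm (e1 - m) \<le> \<rho> / 8 \<and> norm (e2 - m) \<le> \<rho> / 8 \<and> 0 \<le> q \<and>
    (\<forall>G z. G \<in> borel_measurable borel \<longrightarrow>
      (\<integral>\<^sup>+s. (\<integral>\<^sup>+\<tau>. G (z - s *\<^sub>R e1 + \<tau> *\<^sub>R e2) \<partial>lborel) \<partial>lborel) \<le> ennreal q * integral\<^sup>N lborel G)"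
    using oblique_directions[of "\<rho> / 8" m] \<rho> by (cases "CARD('d) = 2") auto
  define E where "E = max (norm e1) (norm e2)"
  have B: "B > 0" unfolding B_def using \<open>r > 0\<close> by (rule content_cball_pos)
  have \<kappa>: "\<kappa> > 0" unfolding \<kappa>_def using \<open>r > 0\<close> content_ball_pos[of "r / 4" c] by simp
  \<comment> \<open>The absolute values make the constants nonnegative whatever the values of their
    factors, also where \<open>q\<close> is arbitrary.\<close>
  define C1 where "C1 = \<bar>S / B\<bar>"
  define C2 where "C2 = \<bar>S / B + E * (1 + (2 * V * (S / B) + S) / \<kappa>)\<bar>"
  define C where "C = C1 + sqrt \<bar>q\<bar> * C2"
  have C: "C \<ge> 0" "C1 \<le> C" "sqrt \<bar>q\<bar> * C2 \<le> C" "C1 \<ge> 0" "C2 \<ge> 0" by (auto simp: C_def C1_def C2_def)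
  have "open U" unfolding U_def using \<Omega>(1) by auto
  obtain K0 where K0: "\<And>n. compact (K0 n)" "\<And>n::nat. K0 n \<subseteq> U" "\<And>n. K0 n \<subseteq> interior (K0 (Suc n))" "\<Union> (range K0) = U"
    "\<And>K. compact K \<Longrightarrow> K \<subseteq> U \<Longrightarrow> \<exists>N. \<forall>n\<ge>N. K \<subseteq> K0 n"
    using open_Union_compact_subsets[OF \<open>open U\<close>] by metis
  have ex: "\<exists>N. \<forall>n\<ge>N. x \<in> K0 n" if "x \<in> U" for x using K0(5)[of "{x}"] that by auto
  have K0m: "K0 n \<in> sets borel" for n using K0(1) by (simp add: borel_compact)
  show ?thesis
  proof (rule exI[of _ C], intro conjI allI impI C(1))
    fix u w a b assume t: "tgv_bounded \<Omega> u w a b"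
    note ab = tgv_bounded_nonneg[OF \<Omega>(1) t]
    let ?\<alpha> = "ball_mean c r (\<lambda>y. u y - w y \<bullet> y)" and ?\<beta> = "ball_mean c r w"
    have [measurable]: "u \<in> borel_measurable borel" using tgv_boundedD(1)[OF t] by auto
    have um: "(\<lambda>x. \<bar>u x - (?\<alpha> + ?\<beta> \<bullet> x)\<bar>) \<in> borel_measurable borel" "(\<lambda>x. (u x - (?\<alpha> + ?\<beta> \<bullet> x))\<^sup>2) \<in> borel_measurable borel"
      by measurable
    have main: "(\<integral>\<^sup>+x. indicator (K0 n) x * ennreal \<bar>u x - (?\<alpha> + ?\<beta> \<bullet> x)\<bar> \<partial>lborel) \<le> ennreal (C * (a + b)) \<and>
       (CARD('d) = 2 \<longrightarrow> (\<integral>\<^sup>+x. indicator (K0 n) x * ennreal ((u x - (?\<alpha> + ?\<beta> \<bullet> x))\<^sup>2) \<partial>lborel) \<le> ennreal ((C * (a + b))\<^sup>2))" for n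
    proof (cases "K0 n = {}")
      case False
      let ?f = "\<lambda>(x, y, t). y + t *\<^sub>R (x - y)"
      \<comment> \<open>The join of the compact piece with the ball: compact as a continuous image
        of a compact product.\<close>
      define K where "K = ?f ` (K0 n \<times> cball c r \<times> {0..1::real})"
      have "continuous_on (K0 n \<times> cball c r \<times> {0..1::real}) ?f"
        by (auto simp: split_beta intro!: continuous_intros)
      then have Kc: "compact K"
        unfolding K_def by (intro compact_continuous_image compact_Times K0(1) compact_cball compact_Icc)
      have KI: "y + t *\<^sub>R (x - y) \<in> K" if "x \<in> K0 n" "y \<in> cball c r" "0 \<le> t" "t \<le> 1" for x y t
        unfolding K_def by (rule image_eqI[of _ _ "(x, y, t)"]) (use that in auto)
      have dir: "norm ((y - x) - m) < \<rho>" if "x \<in> K0 n" "y \<in> cball c r" for x y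
      proof -
        have "norm (x0 - x) < \<rho> / 8" using that(1) K0(2) \<delta> by (force simp: U_def dist_norm)
        moreover have "norm (y - c) \<le> \<rho> / 4" using that(2) by (simp add: r_def dist_norm norm_minus_commute)
        moreover have "norm ((y - x) - m) \<le> norm (y - c) + norm (x0 - x)"
          using norm_triangle_ineq[of "y - c" "x0 - x"] by (simp add: c_def algebra_simps)
        ultimately show ?thesis using \<rho> by simp
      qed
      have K\<Omega>: "K \<subseteq> \<Omega>"
      proof
        fix z assume "z \<in> K"
        then obtain x y t where z: "x \<in> K0 n" "y \<in> cball c r" "0 \<le> t" "t \<le> 1" "z = y + t *\<^sub>R (x - y)"
          by (auto simp: K_def)
        have "x + (1 - t) *\<^sub>R (y - x) \<in> \<Omega>"
        proof (rule cone)
          show "x \<in> \<Omega> \<inter> ball x0 \<delta>" using subsetD[OF K0(2) z(1)] by (simp add: U_def)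
          show "norm (y - x - m) < \<rho>" using dir[OF z(1,2)] .
        qed (use z in auto)
        moreover have "x + (1 - t) *\<^sub>R (y - x) = z" unfolding z(5) by (simp add: algebra_simps)
        ultimately show "z \<in> \<Omega>" by simp
      qed
      have BK: "cball c r \<subseteq> K"
      proof
        fix y assume "y \<in> cball c r"
        then show "y \<in> K" using KI[of _ y 0] False by auto
      qed
      have star: "y + t *\<^sub>R (z - y) \<in> K" if z: "z \<in> K" and y: "y \<in> cball c r" and t: "0 \<le> t" "t \<le> 1" for z y t
      proof -
        obtain x y' s where x: "x \<in> K0 n" "y' \<in> cball c r" "0 \<le> s" "s \<le> 1" "z = y' + s *\<^sub>R (x - y')"
          using z by (auto simp: K_def)
        have st: "0 \<le> s * t" "s * t \<le> 1" using x t by (auto simp: mult_le_one)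
        show ?thesis
        proof (cases "s * t = 1")
          case True
          moreover have "s * t \<le> s" "s * t \<le> t" using x t by (auto simp: mult_left_le mult_left_le_one_le)
          ultimately have "s = 1" "t = 1" using x t by linarith+
          then show ?thesis using x y KI[of x y 1] by simp
        next
          case False
          then have st1: "1 - s * t > 0" using st by simp
          \<comment> \<open>The target is a convex combination of y, y' and x in which x has weight
            s t. Normalising the part in y and y' gives y'', which lies in the ball by convexity, so
            the target lies on the segment from y'' to x.\<close>
          define y'' where "y'' = ((1 - t) / (1 - s * t)) *\<^sub>R y + (t * (1 - s) / (1 - s * t)) *\<^sub>R y'"
          have "(1 - t) / (1 - s * t) + t * (1 - s) / (1 - s * t) = 1"
            using st1 by (simp add: add_divide_distrib[symmetric] algebra_simps)
          then have "y'' \<in> cball c r"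
            unfolding y''_def using x t y st1
            by (intro convexD[OF convex_cball]) (auto intro!: divide_nonneg_pos)
          from KI[OF x(1) this st] have "y'' + (s * t) *\<^sub>R (x - y'') \<in> K" .
          moreover have "y'' + (s * t) *\<^sub>R (x - y'') = (1 - s * t) *\<^sub>R y'' + (s * t) *\<^sub>R x"
            by (simp add: algebra_simps)
          moreover have "(1 - s * t) *\<^sub>R y'' = (1 - t) *\<^sub>R y + (t * (1 - s)) *\<^sub>R y'"
            unfolding y''_def using st1 by (simp add: scaleR_add_right)
          moreover have "(1 - t) *\<^sub>R y + (t * (1 - s)) *\<^sub>R y' + (s * t) *\<^sub>R x = y + t *\<^sub>R (z - y)"
            unfolding x(5) by (simp add: algebra_simps)
          ultimately show ?thesis by simp
        qed
      qed
      have vol: "emeasure lborel K \<le> ennreal V"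
        using emeasure_mono[OF K\<Omega>, of lborel] \<Omega>(1) V(1) by simp
      have dK: "norm (x - y) \<le> R" if "x \<in> K" "y \<in> K" for x y using diam K\<Omega> that by blast
      note se = star_estimate[OF \<Omega>(1) t Kc K\<Omega> BK \<open>r > 0\<close> _ _ vol V(2) S_def]
      have K0K: "K0 n \<subseteq> K"
      proof
        fix x assume "x \<in> K0 n"
        then show "x \<in> K" using KI[of x c 1] \<open>r > 0\<close> by simp
      qed
      have "(\<integral>\<^sup>+x. indicator (K0 n) x * ennreal \<bar>u x - (?\<alpha> + ?\<beta> \<bullet> x)\<bar> \<partial>lborel)
         \<le> (\<integral>\<^sup>+x. indicator K x * ennreal \<bar>u x - (?\<alpha> + ?\<beta> \<bullet> x)\<bar> \<partial>lborel)"
        by (intro nn_integral_mono) (use K0K in \<open>auto simp: indicator_def\<close>)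
      also have "\<dots> \<le> ennreal (S / B) * ennreal (a + b)" unfolding B_def by (rule se(1)) (fact star dK)+
      also have "\<dots> \<le> ennreal C1 * ennreal (a + b)" unfolding C1_def by (intro mult_right_mono ennreal_leI abs_ge_self) simp_all
      also have "\<dots> \<le> ennreal (C * (a + b))"
        unfolding ennreal_mult'[OF C(4), symmetric] using ab C by (intro ennreal_leI mult_right_mono) auto
      finally have 1: "(\<integral>\<^sup>+x. indicator (K0 n) x * ennreal \<bar>u x - (?\<alpha> + ?\<beta> \<bullet> x)\<bar> \<partial>lborel) \<le> ennreal (C * (a + b))" .
      have 2: "(\<integral>\<^sup>+x. indicator (K0 n) x * ennreal ((u x - (?\<alpha> + ?\<beta> \<bullet> x))\<^sup>2) \<partial>lborel) \<le> ennreal ((C * (a + b))\<^sup>2)" if "CARD('d) = 2"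
      proof -
        note e' = e[OF that]
        have lines: "x + t *\<^sub>R f \<in> K" if "x \<in> K0 n" "0 \<le> t" "t \<le> 1" "norm (f - m) \<le> \<rho> / 8" for x t f
        proof -
          have "norm (x0 - x) < \<rho> / 8" using that(1) K0(2) \<delta> by (force simp: U_def dist_norm)
          then have "norm ((x + f) - c) \<le> r"
            using norm_triangle_ineq4[of "f - m" "x0 - x"] that(4) by (simp add: c_def r_def algebra_simps)
          then have "x + f \<in> cball c r" by (simp add: dist_norm norm_minus_commute)
          from KI[OF that(1) this, of "1 - t"] that show ?thesis by (simp add: algebra_simps)
        qed
        have "(\<integral>\<^sup>+x. indicator (K0 n) x * ennreal ((u x - (?\<alpha> + ?\<beta> \<bullet> x))\<^sup>2) \<partial>lborel)
           \<le> ennreal q * (ennreal (S / B + E * (1 + (2 * V * (S / B) + S) / \<kappa>)) * ennreal (a + b))\<^sup>2"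
          unfolding B_def \<kappa>_def
        proof (rule se(2)[OF _ _ K0m K0K])
          show "x + t *\<^sub>R e1 \<in> K \<and> x + t *\<^sub>R e2 \<in> K" if "x \<in> K0 n" "0 \<le> t" "t \<le> 1" for x t
            using lines[OF that] e' by blast
        qed (fact star dK | use e' in \<open>simp add: E_def\<close>)+
        also have "\<dots> \<le> ennreal q * (ennreal C2 * ennreal (a + b))\<^sup>2"
          unfolding C2_def by (intro mult_left_mono power_mono mult_right_mono ennreal_leI abs_ge_self) simp_all
        also have "\<dots> = ennreal (q * (C2 * (a + b))\<^sup>2)"
        proof -
          have "0 \<le> C2 * (a + b)" "0 \<le> q" using ab C(5) e' by auto
          then show ?thesis
            by (simp only: ennreal_mult'[OF C(5), symmetric] ennreal_power ennreal_mult')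
        qed
        also have "q * (C2 * (a + b))\<^sup>2 = (sqrt \<bar>q\<bar> * C2 * (a + b))\<^sup>2"
          using e' by (simp add: power_mult_distrib)
        also have "ennreal \<dots> \<le> ennreal ((C * (a + b))\<^sup>2)"
          using C ab by (intro ennreal_leI power_mono mult_right_mono) auto
        finally show ?thesis .
      qed
      show ?thesis using 1 2 by blast
    qed simp
    have "(\<integral>\<^sup>+x. indicator U x * ennreal \<bar>u x - (?\<alpha> + ?\<beta> \<bullet> x)\<bar> \<partial>lborel) \<le> ennreal (C * (a + b))"
      by (rule nn_integral_exhaustion_le[OF um(1) K0m K0(2) ex]) (use main in auto)
    moreover have "(\<integral>\<^sup>+x. indicator U x * ennreal ((u x - (?\<alpha> + ?\<beta> \<bullet> x))\<^sup>2) \<partial>lborel) \<le> ennreal ((C * (a + b))\<^sup>2)" if "CARD('d) = 2"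
      by (rule nn_integral_exhaustion_le[OF um(2) K0m K0(2) ex]) (use main that in auto)
    ultimately show "\<exists>\<alpha> \<beta>. (\<integral>\<^sup>+x. indicator U x * ennreal \<bar>u x - (\<alpha> + \<beta> \<bullet> x)\<bar> \<partial>lborel) \<le> ennreal (C * (a + b)) \<and>
       (CARD('d) = 2 \<longrightarrow> (\<integral>\<^sup>+x. indicator U x * ennreal ((u x - (\<alpha> + \<beta> \<bullet> x))\<^sup>2) \<partial>lborel) \<le> ennreal ((C * (a + b))\<^sup>2))"
      by blast
  qed
qed

section \<open>Gluing\<close>

text \<open>A quantitative form of the equivalence of norms on affine functions. The value at x
  differs from the value at a point y of the ball by at most (R + s) \<open>norm \<beta>\<close>,
  the slope is controlled by the L1 norm through \<open>nn_integral_ball_linear_ge\<close>, and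
  averaging over y gives the constant.\<close>

lemma affine_sup_bound:
  fixes z :: "'a::euclidean_space"
  assumes "s > 0" "R \<ge> 0"
  shows "\<exists>C\<ge>0. \<forall>\<alpha> \<beta> x. norm (x - z) \<le> R \<longrightarrow>
    ennreal \<bar>\<alpha> + \<beta> \<bullet> x\<bar> \<le> ennreal C * (\<integral>\<^sup>+y. indicator (cball z s) y * ennreal \<bar>\<alpha> + \<beta> \<bullet> y\<bar> \<partial>lborel)"
proof -
  define \<kappa> where "\<kappa> = s / 4 * measure lborel (ball z (s / 4))"
  define b where "b = measure lborel (cball z s)"
  have \<kappa>: "\<kappa> > 0" unfolding \<kappa>_def using assms(1) content_ball_pos[of "s / 4" z] by simp
  have b: "b > 0" unfolding b_def using assms(1) by (rule content_cball_pos)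
  have eb: "emeasure lborel (cball z s) = ennreal b"
    unfolding b_def using emeasure_bounded_finite[OF bounded_cball[of z s]]
    by (intro emeasure_eq_ennreal_measure) auto
  define C where "C = (1 + b * (R + s) * (1 / \<kappa>)) / b"
  have Cnn: "0 \<le> 1 + b * (R + s) * (1 / \<kappa>)" using b \<kappa> assms by simp
  have "ennreal \<bar>\<alpha> + \<beta> \<bullet> x\<bar> \<le> ennreal C * (\<integral>\<^sup>+y. indicator (cball z s) y * ennreal \<bar>\<alpha> + \<beta> \<bullet> y\<bar> \<partial>lborel)"
    if x: "norm (x - z) \<le> R" for \<alpha> \<beta> x
  proof -
    let ?I = "\<integral>\<^sup>+y. indicator (cball z s) y * ennreal \<bar>\<alpha> + \<beta> \<bullet> y\<bar> \<partial>lborel"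
    have [measurable]: "cball z s \<in> sets borel" by simp
    have m1: "(\<lambda>y. indicator (cball z s) y * ennreal \<bar>\<alpha> + \<beta> \<bullet> y\<bar>) \<in> borel_measurable lborel"
      by measurable
    have \<beta>: "ennreal (norm \<beta>) \<le> ennreal (1 / \<kappa>) * ?I"
    proof (cases "\<beta> = 0")
      case False
      \<comment> \<open>A zero of the affine function, so that its value at y becomes the product of
        \<beta> with y - x'.\<close>
      define x' where "x' = (- \<alpha> / (\<beta> \<bullet> \<beta>)) *\<^sub>R \<beta>"
      have "\<beta> \<bullet> (x' - y) = - (\<alpha> + \<beta> \<bullet> y)" for y using False by (simp add: x'_def inner_diff_right)
      then have "ennreal (\<kappa> * norm \<beta>) \<le> ?I"
        using nn_integral_ball_linear_ge[OF assms(1), of z \<beta> x'] by (simp only: \<kappa>_def abs_minus_cancel)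
      then have "ennreal \<kappa> * ennreal (norm \<beta>) \<le> ennreal 1 * ?I"
        using \<kappa> by (simp add: ennreal_mult')
      then show ?thesis by (rule ennreal_mult_le_divide) (use \<kappa> in auto)
    qed simp
    have pt: "indicator (cball z s) y * ennreal \<bar>\<alpha> + \<beta> \<bullet> x\<bar> \<le>
        indicator (cball z s) y * ennreal \<bar>\<alpha> + \<beta> \<bullet> y\<bar> + indicator (cball z s) y * (ennreal (R + s) * ennreal (norm \<beta>))" for y
    proof (cases "y \<in> cball z s")
      case True
      have "norm (x - y) \<le> R + s"
        using x True norm_triangle_ineq[of "x - z" "z - y"] by (simp add: dist_norm)
      then have "\<bar>\<beta> \<bullet> (x - y)\<bar> \<le> (R + s) * norm \<beta>"
        using Cauchy_Schwarz_ineq2[of \<beta> "x - y"] mult_left_mono[of "norm (x - y)" "R + s" "norm \<beta>"] by (simp add: mult.commute)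
      then have "\<bar>\<alpha> + \<beta> \<bullet> x\<bar> \<le> \<bar>\<alpha> + \<beta> \<bullet> y\<bar> + (R + s) * norm \<beta>" by (simp add: inner_diff_right)
      then have "ennreal \<bar>\<alpha> + \<beta> \<bullet> x\<bar> \<le> ennreal \<bar>\<alpha> + \<beta> \<bullet> y\<bar> + ennreal (R + s) * ennreal (norm \<beta>)"
        using assms by (simp add: ennreal_leI flip: ennreal_mult ennreal_plus)
      then show ?thesis using True by simp
    qed simp
    have "ennreal b * ennreal \<bar>\<alpha> + \<beta> \<bullet> x\<bar> = (\<integral>\<^sup>+y. indicator (cball z s) y * ennreal \<bar>\<alpha> + \<beta> \<bullet> x\<bar> \<partial>lborel)"
      by (subst nn_integral_multc) (auto simp: eb)
    also have "\<dots> \<le> (\<integral>\<^sup>+y. indicator (cball z s) y * ennreal \<bar>\<alpha> + \<beta> \<bullet> y\<bar> + indicator (cball z s) y * (ennreal (R + s) * ennreal (norm \<beta>)) \<partial>lborel)"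
      by (intro nn_integral_mono pt)
    also have "\<dots> = ?I + (\<integral>\<^sup>+y. indicator (cball z s) y * (ennreal (R + s) * ennreal (norm \<beta>)) \<partial>lborel)"
      by (rule nn_integral_add[OF m1]) auto
    also have "(\<integral>\<^sup>+y. indicator (cball z s) y * (ennreal (R + s) * ennreal (norm \<beta>)) \<partial>lborel) = ennreal b * (ennreal (R + s) * ennreal (norm \<beta>))"
      by (subst nn_integral_multc) (auto simp: eb)
    also have "?I + \<dots> \<le> ?I + ennreal b * (ennreal (R + s) * (ennreal (1 / \<kappa>) * ?I))"
      by (intro add_left_mono mult_left_mono \<beta>) auto
    also have "\<dots> = ennreal (1 + b * (R + s) * (1 / \<kappa>)) * ?I"
    proof -
      have "0 \<le> b" "0 \<le> R + s" "0 \<le> 1 / \<kappa>" using b \<kappa> assms by auto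
      then have e: "ennreal (1 + b * (R + s) * (1 / \<kappa>)) = 1 + ennreal b * (ennreal (R + s) * ennreal (1 / \<kappa>))"
        by (simp only: ennreal_plus ennreal_mult mult_nonneg_nonneg zero_le_one mult.assoc ennreal_1)
      show ?thesis unfolding e by (simp only: distrib_right mult.assoc mult_1)
    qed
    finally show ?thesis unfolding C_def by (rule ennreal_mult_le_divide[OF _ b Cnn])
  qed
  moreover have "C \<ge> 0" unfolding C_def using Cnn b by simp
  ultimately show ?thesis by blast
qed

text \<open>The affine function is a function of the data: a choice made near one point can then be compared
  with the local choices elsewhere.\<close>

definition affine_est :: "(real^'d) set \<Rightarrow> (real^'d \<Rightarrow> ennreal) \<Rightarrow> (real^'d) set \<Rightarrow>
    ((real^'d \<Rightarrow> real) \<Rightarrow> (real^'d \<Rightarrow> real^'d) \<Rightarrow> real \<Rightarrow> real \<Rightarrow> real) \<Rightarrow>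
    ((real^'d \<Rightarrow> real) \<Rightarrow> (real^'d \<Rightarrow> real^'d) \<Rightarrow> real \<Rightarrow> real \<Rightarrow> real^'d) \<Rightarrow> real \<Rightarrow> bool" where
  "affine_est \<Omega> \<omega> U \<alpha> \<beta> C \<longleftrightarrow> C \<ge> 0 \<and> (\<forall>u w a b. tgv_bounded \<Omega> u w a b \<longrightarrow>
     (\<integral>\<^sup>+x. indicator U x * (\<omega> x * ennreal \<bar>u x - (\<alpha> u w a b + \<beta> u w a b \<bullet> x)\<bar>) \<partial>lborel) \<le> ennreal (C * (a + b)))"

lemma affine_est_mono:
  assumes "affine_est \<Omega> \<omega> U \<alpha> \<beta> C" "W \<subseteq> U"
  shows "affine_est \<Omega> \<omega> W \<alpha> \<beta> C"
  unfolding affine_est_def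
proof (intro conjI allI impI)
  show "0 \<le> C" using assms by (simp add: affine_est_def)
  fix u w a b assume t: "tgv_bounded \<Omega> u w a b"
  have "(\<integral>\<^sup>+x. indicator W x * (\<omega> x * ennreal \<bar>u x - (\<alpha> u w a b + \<beta> u w a b \<bullet> x)\<bar>) \<partial>lborel)
    \<le> (\<integral>\<^sup>+x. indicator U x * (\<omega> x * ennreal \<bar>u x - (\<alpha> u w a b + \<beta> u w a b \<bullet> x)\<bar>) \<partial>lborel)"
    using assms(2) by (intro nn_integral_mono) (auto simp: indicator_def)
  also have "\<dots> \<le> ennreal (C * (a + b))" using assms(1) t by (simp add: affine_est_def)
  finally show "(\<integral>\<^sup>+x. indicator W x * (\<omega> x * ennreal \<bar>u x - (\<alpha> u w a b + \<beta> u w a b \<bullet> x)\<bar>) \<partial>lborel) \<le> ennreal (C * (a + b))" .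
qed

lemma affine_est_Un:
  assumes "affine_est \<Omega> \<omega> U \<alpha> \<beta> C" "affine_est \<Omega> \<omega> W \<alpha> \<beta> D" "open \<Omega>"
    and [measurable]: "U \<in> sets borel" "W \<in> sets borel" "\<omega> \<in> borel_measurable borel"
  shows "affine_est \<Omega> \<omega> (U \<union> W) \<alpha> \<beta> (C + D)"
  unfolding affine_est_def
proof (intro conjI allI impI)
  have CD: "0 \<le> C" "0 \<le> D" using assms by (auto simp: affine_est_def)
  then show "0 \<le> C + D" by simp
  fix u w a b assume t: "tgv_bounded \<Omega> u w a b"
  note ab = tgv_bounded_nonneg[OF assms(3) t]
  have [measurable]: "u \<in> borel_measurable borel" using tgv_boundedD(1)[OF t] by auto
  let ?h = "\<lambda>x. \<omega> x * ennreal \<bar>u x - (\<alpha> u w a b + \<beta> u w a b \<bullet> x)\<bar>"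
  have "(\<integral>\<^sup>+x. indicator (U \<union> W) x * ?h x \<partial>lborel) \<le> (\<integral>\<^sup>+x. indicator U x * ?h x + indicator W x * ?h x \<partial>lborel)"
    by (intro nn_integral_mono) (auto simp: indicator_def)
  also have "\<dots> = (\<integral>\<^sup>+x. indicator U x * ?h x \<partial>lborel) + (\<integral>\<^sup>+x. indicator W x * ?h x \<partial>lborel)"
    by (rule nn_integral_add) measurable
  also have "\<dots> \<le> ennreal (C * (a + b)) + ennreal (D * (a + b))"
    using assms(1,2) t by (intro add_mono) (auto simp: affine_est_def)
  also have "\<dots> = ennreal ((C + D) * (a + b))"
    using CD ab by (simp add: distrib_right flip: ennreal_plus)
  finally show "(\<integral>\<^sup>+x. indicator (U \<union> W) x * ?h x \<partial>lborel) \<le> ennreal ((C + D) * (a + b))" .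
qed

lemma affine_est_transfer:
  fixes \<Omega> :: "(real^'d) set"
  assumes U: "affine_est \<Omega> \<omega> U \<alpha> \<beta> C" and W: "affine_est \<Omega> \<omega> W \<alpha>' \<beta>' D"
    and \<Omega>: "open \<Omega>" "bounded \<Omega>" and sub: "U \<subseteq> \<Omega>" "cball p s \<subseteq> U \<inter> W" "s > 0"
    and [measurable]: "U \<in> sets borel" "W \<in> sets borel" "\<omega> \<in> borel_measurable borel"
    and \<omega>: "\<And>x. 1 \<le> \<omega> x" "(\<integral>\<^sup>+x. indicator \<Omega> x * \<omega> x \<partial>lborel) \<le> ennreal M" "M \<ge> 0"
  shows "\<exists>C'. affine_est \<Omega> \<omega> U \<alpha>' \<beta>' C'"
proof -
  have CD: "0 \<le> C" "0 \<le> D" using U W by (auto simp: affine_est_def)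
  obtain R' where R': "\<And>x. x \<in> \<Omega> \<Longrightarrow> norm x \<le> R'" using \<Omega>(2) unfolding bounded_iff by blast
  define R where "R = \<bar>R'\<bar> + norm p"
  have R: "norm (x - p) \<le> R" if "x \<in> \<Omega>" for x
    using norm_triangle_ineq4[of x p] R'[OF that] by (simp add: R_def)
  have "R \<ge> 0" by (simp add: R_def)
  obtain Q where Q: "Q \<ge> 0" "\<And>\<alpha> \<beta> x. norm (x - p) \<le> R \<Longrightarrow>
     ennreal \<bar>\<alpha> + \<beta> \<bullet> x\<bar> \<le> ennreal Q * (\<integral>\<^sup>+y. indicator (cball p s) y * ennreal \<bar>\<alpha> + \<beta> \<bullet> y\<bar> \<partial>lborel)"
    using affine_sup_bound[OF sub(3) \<open>R \<ge> 0\<close>, of p] by blast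
  have [measurable]: "\<Omega> \<in> sets borel" "cball p s \<in> sets borel" using \<Omega> by auto
  define C' where "C' = C + M * (Q * (C + D))"
  have "affine_est \<Omega> \<omega> U \<alpha>' \<beta>' C'"
    unfolding affine_est_def
  proof (intro conjI allI impI)
    show "0 \<le> C'" using CD Q(1) \<omega>(3) by (simp add: C'_def)
    fix u w a b assume t: "tgv_bounded \<Omega> u w a b"
    note ab = tgv_bounded_nonneg[OF \<Omega>(1) t]
    have [measurable]: "u \<in> borel_measurable borel" using tgv_boundedD(1)[OF t] by auto
    define A where "A x = \<alpha> u w a b + \<beta> u w a b \<bullet> x" for x
    define A' where "A' x = \<alpha>' u w a b + \<beta>' u w a b \<bullet> x" for x
    have [measurable]: "A \<in> borel_measurable borel" "A' \<in> borel_measurable borel"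
      unfolding A_def A'_def by measurable
    have diff: "A x - A' x = (\<alpha> u w a b - \<alpha>' u w a b) + (\<beta> u w a b - \<beta>' u w a b) \<bullet> x" for x
      by (simp add: A_def A'_def inner_diff_left)
    let ?N = "ennreal ((C + D) * (a + b))"
    have IU: "(\<integral>\<^sup>+x. indicator U x * (\<omega> x * ennreal \<bar>u x - A x\<bar>) \<partial>lborel) \<le> ennreal (C * (a + b))"
      using U t by (simp add: affine_est_def A_def)
    have IW: "(\<integral>\<^sup>+x. indicator W x * (\<omega> x * ennreal \<bar>u x - A' x\<bar>) \<partial>lborel) \<le> ennreal (D * (a + b))"
      using W t by (simp add: affine_est_def A'_def)
    have pt: "indicator (cball p s) y * ennreal \<bar>A y - A' y\<bar> \<le>
       indicator U y * (\<omega> y * ennreal \<bar>u y - A y\<bar>) + indicator W y * (\<omega> y * ennreal \<bar>u y - A' y\<bar>)" for y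
    proof (cases "y \<in> cball p s")
      case True
      then have yU: "y \<in> U" "y \<in> W" using sub(2) by auto
      have "ennreal \<bar>A y - A' y\<bar> \<le> ennreal (\<bar>u y - A y\<bar> + \<bar>u y - A' y\<bar>)" by (rule ennreal_leI) simp
      also have "\<dots> = 1 * ennreal \<bar>u y - A y\<bar> + 1 * ennreal \<bar>u y - A' y\<bar>" by simp
      also have "\<dots> \<le> \<omega> y * ennreal \<bar>u y - A y\<bar> + \<omega> y * ennreal \<bar>u y - A' y\<bar>"
        by (intro add_mono mult_right_mono \<omega>(1)) auto
      finally show ?thesis using True yU by simp
    qed simp
    have "(\<integral>\<^sup>+y. indicator (cball p s) y * ennreal \<bar>A y - A' y\<bar> \<partial>lborel)
       \<le> (\<integral>\<^sup>+y. indicator U y * (\<omega> y * ennreal \<bar>u y - A y\<bar>) + indicator W y * (\<omega> y * ennreal \<bar>u y - A' y\<bar>) \<partial>lborel)"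
      by (intro nn_integral_mono pt)
    also have "\<dots> = (\<integral>\<^sup>+y. indicator U y * (\<omega> y * ennreal \<bar>u y - A y\<bar>) \<partial>lborel) + (\<integral>\<^sup>+y. indicator W y * (\<omega> y * ennreal \<bar>u y - A' y\<bar>) \<partial>lborel)"
      by (rule nn_integral_add) measurable
    also have "\<dots> \<le> ennreal (C * (a + b)) + ennreal (D * (a + b))" by (intro add_mono IU IW)
    also have "\<dots> = ?N" using CD ab by (simp add: distrib_right flip: ennreal_plus)
    finally have ball: "(\<integral>\<^sup>+y. indicator (cball p s) y * ennreal \<bar>A y - A' y\<bar> \<partial>lborel) \<le> ?N" .
    have sup: "ennreal \<bar>A x - A' x\<bar> \<le> ennreal Q * ?N" if "x \<in> \<Omega>" for x
      using Q(2)[OF R[OF that], of "\<alpha> u w a b - \<alpha>' u w a b" "\<beta> u w a b - \<beta>' u w a b"] ball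
      unfolding diff by (meson mult_left_mono order_trans zero_le)
    have "(\<integral>\<^sup>+x. indicator U x * (\<omega> x * ennreal \<bar>u x - A' x\<bar>) \<partial>lborel)
      \<le> (\<integral>\<^sup>+x. indicator U x * (\<omega> x * ennreal \<bar>u x - A x\<bar>) + (indicator \<Omega> x * \<omega> x) * (ennreal Q * ?N) \<partial>lborel)"
    proof (rule nn_integral_mono)
      fix x
      show "indicator U x * (\<omega> x * ennreal \<bar>u x - A' x\<bar>) \<le> indicator U x * (\<omega> x * ennreal \<bar>u x - A x\<bar>) + (indicator \<Omega> x * \<omega> x) * (ennreal Q * ?N)"
      proof (cases "x \<in> U")
        case True
        then have x\<Omega>: "x \<in> \<Omega>" using sub(1) by auto
        have "ennreal \<bar>u x - A' x\<bar> \<le> ennreal (\<bar>u x - A x\<bar> + \<bar>A x - A' x\<bar>)" by (rule ennreal_leI) simp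
        also have "\<dots> = ennreal \<bar>u x - A x\<bar> + ennreal \<bar>A x - A' x\<bar>" by simp
        also have "\<dots> \<le> ennreal \<bar>u x - A x\<bar> + ennreal Q * ?N" by (intro add_left_mono sup x\<Omega>)
        finally have "\<omega> x * ennreal \<bar>u x - A' x\<bar> \<le> \<omega> x * (ennreal \<bar>u x - A x\<bar> + ennreal Q * ?N)"
          by (rule mult_left_mono) simp
        then show ?thesis using True x\<Omega> by (simp add: distrib_left)
      qed simp
    qed
    also have "\<dots> = (\<integral>\<^sup>+x. indicator U x * (\<omega> x * ennreal \<bar>u x - A x\<bar>) \<partial>lborel) + (\<integral>\<^sup>+x. (indicator \<Omega> x * \<omega> x) * (ennreal Q * ?N) \<partial>lborel)"
      by (rule nn_integral_add) measurable
    also have "(\<integral>\<^sup>+x. (indicator \<Omega> x * \<omega> x) * (ennreal Q * ?N) \<partial>lborel) = (\<integral>\<^sup>+x. indicator \<Omega> x * \<omega> x \<partial>lborel) * (ennreal Q * ?N)"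
      by (rule nn_integral_multc) measurable
    also have "(\<integral>\<^sup>+x. indicator U x * (\<omega> x * ennreal \<bar>u x - A x\<bar>) \<partial>lborel) + \<dots> \<le> ennreal (C * (a + b)) + ennreal M * (ennreal Q * ?N)"
      by (intro add_mono mult_right_mono IU \<omega>(2)) auto
    also have "\<dots> = ennreal (C' * (a + b))"
    proof -
      have nn: "0 \<le> C * (a + b)" "0 \<le> (C + D) * (a + b)" "0 \<le> Q * ((C + D) * (a + b))" "0 \<le> M * (Q * ((C + D) * (a + b)))"
        using CD ab Q(1) \<omega>(3) by auto
      have "C' * (a + b) = C * (a + b) + M * (Q * ((C + D) * (a + b)))" by (simp add: C'_def algebra_simps)
      then show ?thesis using nn Q(1) \<omega>(3) by (simp only: ennreal_plus ennreal_mult)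
    qed
    finally show "(\<integral>\<^sup>+x. indicator U x * (\<omega> x * ennreal \<bar>u x - (\<alpha>' u w a b + \<beta>' u w a b \<bullet> x)\<bar>) \<partial>lborel) \<le> ennreal (C' * (a + b))"
      by (simp add: A'_def)
  qed
  then show ?thesis by blast
qed

text \<open>The affine function is fixed once, near \<open>z\<close>, and the local choices serve
  only as intermediaries in the transfer. Each transfer enlarges the constant in an uncontrolled
  way, so connectedness gives \<open>P\<close> merely point by point; compactness of the closure
  then leaves finitely many constants to add.\<close>

lemma global_estimate:
  fixes \<Omega> :: "(real^'d) set"
  assumes \<Omega>: "open \<Omega>" "bounded \<Omega>" "connected \<Omega>" "\<Omega> \<noteq> {}"
    and [measurable]: "\<omega> \<in> borel_measurable borel"
    and \<omega>: "\<And>x. 1 \<le> \<omega> x" "(\<integral>\<^sup>+x. indicator \<Omega> x * \<omega> x \<partial>lborel) \<le> ennreal M" "M \<ge> 0"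
    and local: "\<And>x0. x0 \<in> closure \<Omega> \<Longrightarrow> \<exists>\<delta>>0. \<exists>\<alpha> \<beta> C. affine_est \<Omega> \<omega> (\<Omega> \<inter> ball x0 \<delta>) \<alpha> \<beta> C"
  shows "\<exists>\<alpha> \<beta> C. affine_est \<Omega> \<omega> \<Omega> \<alpha> \<beta> C"
proof -
  obtain z where z: "z \<in> \<Omega>" using \<Omega>(4) by blast
  obtain \<alpha> \<beta> C0 \<delta>0 where base: "\<delta>0 > 0" "affine_est \<Omega> \<omega> (\<Omega> \<inter> ball z \<delta>0) \<alpha> \<beta> C0"
    using local[of z] z closure_subset by blast
  define P where "P y \<longleftrightarrow> (\<exists>s>0. \<exists>C. affine_est \<Omega> \<omega> (\<Omega> \<inter> ball y s) \<alpha> \<beta> C)" for y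
  have spread: "\<exists>C. affine_est \<Omega> \<omega> (\<Omega> \<inter> ball x0 \<delta>) \<alpha> \<beta> C"
    if p: "p \<in> \<Omega> \<inter> ball x0 \<delta>" "P p" and loc: "affine_est \<Omega> \<omega> (\<Omega> \<inter> ball x0 \<delta>) \<alpha>' \<beta>' C'" for p x0 \<delta> \<alpha>' \<beta>' C'
  proof -
    obtain s C where s: "s > 0" "affine_est \<Omega> \<omega> (\<Omega> \<inter> ball p s) \<alpha> \<beta> C" using p(2) by (auto simp: P_def)
    have "open ((\<Omega> \<inter> ball x0 \<delta>) \<inter> (\<Omega> \<inter> ball p s))" using \<Omega>(1) by auto
    moreover have "p \<in> (\<Omega> \<inter> ball x0 \<delta>) \<inter> (\<Omega> \<inter> ball p s)" using p(1) s(1) by auto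
    ultimately obtain r where "r > 0" "cball p r \<subseteq> (\<Omega> \<inter> ball x0 \<delta>) \<inter> (\<Omega> \<inter> ball p s)"
      using open_contains_cball_eq by blast
    then show ?thesis
      using affine_est_transfer[OF loc s(2) \<Omega>(1,2), of p r M] \<Omega>(1) \<omega> by auto
  qed
  have P: "P y" if "y \<in> \<Omega>" for y
  proof (rule connected_induction_simple[OF \<Omega>(3) z that])
    show "P z" using base by (auto simp: P_def)
    fix x assume "x \<in> \<Omega>"
    then obtain \<delta> \<alpha>' \<beta>' C' where loc: "\<delta> > 0" "affine_est \<Omega> \<omega> (\<Omega> \<inter> ball x \<delta>) \<alpha>' \<beta>' C'"
      using local[of x] closure_subset by blast
    have "P q" if pq: "p \<in> \<Omega> \<inter> ball x \<delta>" "q \<in> \<Omega> \<inter> ball x \<delta>" "P p" for p q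
    proof -
      obtain C where C: "affine_est \<Omega> \<omega> (\<Omega> \<inter> ball x \<delta>) \<alpha> \<beta> C" using spread[OF pq(1,3) loc(2)] by blast
      obtain r where "r > 0" "ball q r \<subseteq> \<Omega> \<inter> ball x \<delta>"
        using pq(2) openE[OF open_Int[OF \<Omega>(1) open_ball]] by blast
      then show ?thesis unfolding P_def using affine_est_mono[OF C] by blast
    qed
    then show "\<exists>T. openin (top_of_set \<Omega>) T \<and> x \<in> T \<and> (\<forall>x\<in>T. \<forall>y\<in>T. P x \<longrightarrow> P y)"
      using \<open>x \<in> \<Omega>\<close> loc(1) openin_open_Int[OF open_ball, of \<Omega> x \<delta>]
      by (metis IntI centre_in_ball)
  qed
  have cover: "\<exists>\<delta>>0. \<exists>C. affine_est \<Omega> \<omega> (\<Omega> \<inter> ball x0 \<delta>) \<alpha> \<beta> C" if x0: "x0 \<in> closure \<Omega>" for x0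
  proof -
    obtain \<delta> \<alpha>' \<beta>' C' where loc: "\<delta> > 0" "affine_est \<Omega> \<omega> (\<Omega> \<inter> ball x0 \<delta>) \<alpha>' \<beta>' C'"
      using local[OF x0] by blast
    \<comment> \<open>A ball about a boundary point meets \<Omega>, and the estimate is transferred
      from a point of the intersection.\<close>
    obtain p where "p \<in> \<Omega>" "dist p x0 < \<delta>" using x0 loc(1) closure_approachable by blast
    then have "p \<in> \<Omega> \<inter> ball x0 \<delta>" by (simp add: dist_commute)
    from spread[OF this P loc(2)] loc(1) \<open>p \<in> \<Omega>\<close> show ?thesis by blast
  qed
  then obtain \<delta> where \<delta>: "\<And>x0. x0 \<in> closure \<Omega> \<Longrightarrow> \<delta> x0 > 0 \<and> (\<exists>C. affine_est \<Omega> \<omega> (\<Omega> \<inter> ball x0 (\<delta> x0)) \<alpha> \<beta> C)"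
    by metis
  have "compact (closure \<Omega>)" using \<Omega>(2) by (simp add: compact_closure)
  then obtain T where T: "T \<subseteq> closure \<Omega>" "finite T" "closure \<Omega> \<subseteq> (\<Union>x\<in>T. ball x (\<delta> x))"
    by (rule compactE_image[of _ "closure \<Omega>" "\<lambda>x. ball x (\<delta> x)"]) (use \<delta> in \<open>auto intro!: bexI centre_in_ball[THEN iffD2]\<close>)
  have "\<exists>C. affine_est \<Omega> \<omega> (\<Union>x\<in>T. \<Omega> \<inter> ball x (\<delta> x)) \<alpha> \<beta> C" if "T \<subseteq> closure \<Omega>"
    using T(2) that
  proof (induction T rule: finite_induct)
    case empty
    have "affine_est \<Omega> \<omega> {} \<alpha> \<beta> 0" by (simp add: affine_est_def)
    then show ?case by auto
  next
    case (insert x T)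
    then obtain C D where "affine_est \<Omega> \<omega> (\<Omega> \<inter> ball x (\<delta> x)) \<alpha> \<beta> C" "affine_est \<Omega> \<omega> (\<Union>x\<in>T. \<Omega> \<inter> ball x (\<delta> x)) \<alpha> \<beta> D"
      using \<delta>[of x] by auto
    moreover have "open (\<Union>x\<in>T. \<Omega> \<inter> ball x (\<delta> x))" "open (\<Omega> \<inter> ball x (\<delta> x))" using \<Omega>(1) by auto
    ultimately show ?case
      using affine_est_Un[of \<Omega> \<omega> "\<Omega> \<inter> ball x (\<delta> x)" \<alpha> \<beta> C "\<Union>x\<in>T. \<Omega> \<inter> ball x (\<delta> x)" D] \<Omega>(1) by auto
  qed
  then obtain C where C: "affine_est \<Omega> \<omega> (\<Union>x\<in>T. \<Omega> \<inter> ball x (\<delta> x)) \<alpha> \<beta> C" using T(1) by blast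
  have "\<Omega> \<subseteq> (\<Union>x\<in>T. \<Omega> \<inter> ball x (\<delta> x))" using T(3) closure_subset by blast
  from affine_est_mono[OF C this] show ?thesis by blast
qed

section \<open>The global inequality\<close>

lemma local_estimate_ex:
  fixes \<Omega> :: "(real^'d) set"
  assumes \<Omega>: "open \<Omega>" "bounded \<Omega>" "lipschitz_boundary \<Omega>" and x0: "x0 \<in> closure \<Omega>"
  shows "\<exists>\<delta>>0. \<exists>C\<ge>0. \<forall>u w a b. tgv_bounded \<Omega> u w a b \<longrightarrow> (\<exists>\<alpha> \<beta>.
     (\<integral>\<^sup>+x. indicator (\<Omega> \<inter> ball x0 \<delta>) x * ennreal \<bar>u x - (\<alpha> + \<beta> \<bullet> x)\<bar> \<partial>lborel) \<le> ennreal (C * (a + b)) \<and>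
     (CARD('d) = 2 \<longrightarrow> (\<integral>\<^sup>+x. indicator (\<Omega> \<inter> ball x0 \<delta>) x * ennreal ((u x - (\<alpha> + \<beta> \<bullet> x))\<^sup>2) \<partial>lborel) \<le> ennreal ((C * (a + b))\<^sup>2)))"
proof -
  obtain m \<rho> \<delta>' where \<rho>: "0 < \<rho>" "0 < \<delta>'" and cone: "\<And>x k t. x \<in> \<Omega> \<inter> ball x0 \<delta>' \<Longrightarrow> norm (k - m) < \<rho> \<Longrightarrow> 0 \<le> t \<Longrightarrow> t \<le> 1 \<Longrightarrow> x + t *\<^sub>R k \<in> \<Omega>"
    using lipschitz_boundary_cone[OF \<Omega>(1,3) x0] by blast
  define \<delta> where "\<delta> = min \<delta>' (\<rho> / 8)"
  have \<delta>: "\<delta> > 0" "\<delta> \<le> \<delta>'" "\<delta> \<le> \<rho> / 8" using \<rho> by (auto simp: \<delta>_def)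
  have "x + t *\<^sub>R k \<in> \<Omega>" if "x \<in> \<Omega> \<inter> ball x0 \<delta>" "norm (k - m) < \<rho>" "0 \<le> t" "t \<le> 1" for x k t
    by (rule cone[OF _ that(2-4)]) (use that(1) \<delta>(2) in auto)
  from local_estimate[OF \<Omega>(1,2) \<rho>(1) \<delta>(3) this] \<delta>(1) show ?thesis by blast
qed

lemma power2_le_imp_le_ennreal:
  fixes x :: ennreal
  assumes "x\<^sup>2 \<le> ennreal (y\<^sup>2)" "y \<ge> 0" shows "x \<le> ennreal y"
proof (cases x)
  case (real r)
  then have "r\<^sup>2 \<le> y\<^sup>2" using assms(1) by (simp add: ennreal_power)
  then show ?thesis using power2_le_imp_le[OF _ assms(2)] real by (simp add: ennreal_leI)
next
  case top
  then show ?thesis using assms(1) by (simp add: power2_eq_square ennreal_mult_top top_unique)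
qed

text \<open>Here the two cases meet. In the plane the Cauchy-Schwarz inequality pairs
  \<open>g\<close> with the local L2 bound; otherwise \<open>g\<close> is bounded by
  \<open>G\<close> and the L1 bound is enough. The summand 1 in the weight keeps it bounded below,
  as the transfer between overlapping sets requires.\<close>

lemma affine_est_local:
  fixes \<Omega> :: "(real^'d) set"
  assumes \<Omega>: "open \<Omega>" "bounded \<Omega>" "lipschitz_boundary \<Omega>" and x0: "x0 \<in> closure \<Omega>"
    and [measurable]: "g \<in> borel_measurable borel" and G: "(\<integral>\<^sup>+x. ennreal ((g x)\<^sup>2) \<partial>lborel) \<le> ennreal (G\<^sup>2)" "G \<ge> 0"
    and g: "CARD('d) = 2 \<or> (\<forall>x. \<bar>g x\<bar> \<le> G)"
  shows "\<exists>\<delta>>0. \<exists>\<alpha> \<beta> C. affine_est \<Omega> (\<lambda>x. 1 + ennreal \<bar>g x\<bar>) (\<Omega> \<inter> ball x0 \<delta>) \<alpha> \<beta> C"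
proof -
  obtain \<delta> C where \<delta>: "\<delta> > 0" and C: "C \<ge> 0" and ex: "\<And>u w a b. tgv_bounded \<Omega> u w a b \<Longrightarrow> (\<exists>\<alpha> \<beta>.
     (\<integral>\<^sup>+x. indicator (\<Omega> \<inter> ball x0 \<delta>) x * ennreal \<bar>u x - (\<alpha> + \<beta> \<bullet> x)\<bar> \<partial>lborel) \<le> ennreal (C * (a + b)) \<and>
     (CARD('d) = 2 \<longrightarrow> (\<integral>\<^sup>+x. indicator (\<Omega> \<inter> ball x0 \<delta>) x * ennreal ((u x - (\<alpha> + \<beta> \<bullet> x))\<^sup>2) \<partial>lborel) \<le> ennreal ((C * (a + b))\<^sup>2)))"
    using local_estimate_ex[OF \<Omega> x0] by blast
  define U where "U = \<Omega> \<inter> ball x0 \<delta>"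
  have [measurable]: "U \<in> sets borel" unfolding U_def using \<Omega>(1) by auto
  define Q where "Q u w a b p \<longleftrightarrow>
     (\<integral>\<^sup>+x. indicator U x * ennreal \<bar>u x - (fst p + snd p \<bullet> x)\<bar> \<partial>lborel) \<le> ennreal (C * (a + b)) \<and>
     (CARD('d) = 2 \<longrightarrow> (\<integral>\<^sup>+x. indicator U x * ennreal ((u x - (fst p + snd p \<bullet> x))\<^sup>2) \<partial>lborel) \<le> ennreal ((C * (a + b))\<^sup>2))"
    for u and w :: "real^'d \<Rightarrow> real^'d" and a b p
  \<comment> \<open>\<alpha> and \<beta> are the components of one chosen pair, since the L1 and the
    L2 bound must hold for the same affine function.\<close>
  define \<alpha> where "\<alpha> u w a b = fst (SOME p. Q u w a b p)" for u w a b
  define \<beta> where "\<beta> u w a b = snd (SOME p. Q u w a b p)" for u w a b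
  have est: "(\<integral>\<^sup>+x. indicator U x * ennreal \<bar>u x - (\<alpha> u w a b + \<beta> u w a b \<bullet> x)\<bar> \<partial>lborel) \<le> ennreal (C * (a + b))"
     "CARD('d) = 2 \<Longrightarrow>
     (\<integral>\<^sup>+x. indicator U x * ennreal ((u x - (\<alpha> u w a b + \<beta> u w a b \<bullet> x))\<^sup>2) \<partial>lborel) \<le> ennreal ((C * (a + b))\<^sup>2)"
    if t: "tgv_bounded \<Omega> u w a b" for u w a b
  proof -
    obtain \<alpha>' \<beta>' where "Q u w a b (\<alpha>', \<beta>')" using ex[OF t] unfolding Q_def U_def fst_conv snd_conv by blast
    then have sel: "Q u w a b (SOME p. Q u w a b p)" by (rule someI)
    have "(\<integral>\<^sup>+x. indicator U x * ennreal \<bar>u x - (fst p + snd p \<bullet> x)\<bar> \<partial>lborel) \<le> ennreal (C * (a + b))"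
      "CARD('d) = 2 \<Longrightarrow> (\<integral>\<^sup>+x. indicator U x * ennreal ((u x - (fst p + snd p \<bullet> x))\<^sup>2) \<partial>lborel) \<le> ennreal ((C * (a + b))\<^sup>2)"
      if "Q u w a b p" for p
      using that by (simp_all add: Q_def)
    note this[OF sel]
    then show "(\<integral>\<^sup>+x. indicator U x * ennreal \<bar>u x - (\<alpha> u w a b + \<beta> u w a b \<bullet> x)\<bar> \<partial>lborel) \<le> ennreal (C * (a + b))"
     "CARD('d) = 2 \<Longrightarrow>
     (\<integral>\<^sup>+x. indicator U x * ennreal ((u x - (\<alpha> u w a b + \<beta> u w a b \<bullet> x))\<^sup>2) \<partial>lborel) \<le> ennreal ((C * (a + b))\<^sup>2)"
      unfolding \<alpha>_def \<beta>_def by blast+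
  qed
  have "affine_est \<Omega> (\<lambda>x. 1 + ennreal \<bar>g x\<bar>) U \<alpha> \<beta> (C + G * C)"
    unfolding affine_est_def
  proof (intro conjI allI impI)
    show "0 \<le> C + G * C" using C G(2) by simp
    fix u w a b assume t: "tgv_bounded \<Omega> u w a b"
    note ab = tgv_bounded_nonneg[OF \<Omega>(1) t]
    have [measurable]: "u \<in> borel_measurable borel" using tgv_boundedD(1)[OF t] by auto
    define h where "h x = indicator U x * ennreal \<bar>u x - (\<alpha> u w a b + \<beta> u w a b \<bullet> x)\<bar>" for x
    have [measurable]: "h \<in> borel_measurable borel" unfolding h_def by measurable
    have h1: "(\<integral>\<^sup>+x. h x \<partial>lborel) \<le> ennreal (C * (a + b))" unfolding h_def by (rule est(1)[OF t])
    have Cab: "0 \<le> C * (a + b)" using C ab by simp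
    have hg: "(\<integral>\<^sup>+x. ennreal \<bar>g x\<bar> * h x \<partial>lborel) \<le> ennreal (G * (C * (a + b)))"
    proof (cases "CARD('d) = 2")
      case True
      have "(\<integral>\<^sup>+x. ennreal \<bar>g x\<bar> * h x \<partial>lborel)\<^sup>2 \<le> (\<integral>\<^sup>+x. (ennreal \<bar>g x\<bar>)\<^sup>2 \<partial>lborel) * (\<integral>\<^sup>+x. (h x)\<^sup>2 \<partial>lborel)"
        by (rule Cauchy_Schwarz_nn_integral) measurable
      also have "(\<lambda>x. (ennreal \<bar>g x\<bar>)\<^sup>2) = (\<lambda>x. ennreal ((g x)\<^sup>2))"
        by (simp add: ennreal_power)
      also have "(\<lambda>x. (h x)\<^sup>2) = (\<lambda>x. indicator U x * ennreal ((u x - (\<alpha> u w a b + \<beta> u w a b \<bullet> x))\<^sup>2))"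
        by (auto simp: h_def indicator_def ennreal_power)
      also have "(\<integral>\<^sup>+x. ennreal ((g x)\<^sup>2) \<partial>lborel) * (\<integral>\<^sup>+x. indicator U x * ennreal ((u x - (\<alpha> u w a b + \<beta> u w a b \<bullet> x))\<^sup>2) \<partial>lborel)
         \<le> ennreal (G\<^sup>2) * ennreal ((C * (a + b))\<^sup>2)"
        by (intro mult_mono G(1) est(2)[OF t True]) auto
      also have "\<dots> = ennreal ((G * (C * (a + b)))\<^sup>2)"
        unfolding power_mult_distrib[of G] by (rule ennreal_mult[symmetric]) auto
      finally show ?thesis by (rule power2_le_imp_le_ennreal) (use G(2) Cab in auto)
    next
      case False
      then have gb: "\<bar>g x\<bar> \<le> G" for x using g by auto
      have "(\<integral>\<^sup>+x. ennreal \<bar>g x\<bar> * h x \<partial>lborel) \<le> (\<integral>\<^sup>+x. ennreal G * h x \<partial>lborel)"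
        by (intro nn_integral_mono mult_right_mono ennreal_leI gb) auto
      also have "\<dots> = ennreal G * (\<integral>\<^sup>+x. h x \<partial>lborel)" by (rule nn_integral_cmult) measurable
      also have "\<dots> \<le> ennreal G * ennreal (C * (a + b))" by (intro mult_left_mono h1) auto
      also have "\<dots> = ennreal (G * (C * (a + b)))" using G(2) by (rule ennreal_mult'[symmetric])
      finally show ?thesis .
    qed
    have "(\<integral>\<^sup>+x. indicator U x * ((1 + ennreal \<bar>g x\<bar>) * ennreal \<bar>u x - (\<alpha> u w a b + \<beta> u w a b \<bullet> x)\<bar>) \<partial>lborel)
       = (\<integral>\<^sup>+x. h x + ennreal \<bar>g x\<bar> * h x \<partial>lborel)"
      by (intro nn_integral_cong) (auto simp: h_def indicator_def distrib_right)
    also have "\<dots> = (\<integral>\<^sup>+x. h x \<partial>lborel) + (\<integral>\<^sup>+x. ennreal \<bar>g x\<bar> * h x \<partial>lborel)"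
      by (rule nn_integral_add) measurable
    also have "\<dots> \<le> ennreal (C * (a + b)) + ennreal (G * (C * (a + b)))" by (intro add_mono h1 hg)
    also have "\<dots> = ennreal (C * (a + b) + G * (C * (a + b)))"
      using Cab G(2) by (intro ennreal_plus[symmetric]) auto
    also have "C * (a + b) + G * (C * (a + b)) = (C + G * C) * (a + b)" by (simp add: algebra_simps)
    finally show "(\<integral>\<^sup>+x. indicator U x * ((1 + ennreal \<bar>g x\<bar>) * ennreal \<bar>u x - (\<alpha> u w a b + \<beta> u w a b \<bullet> x)\<bar>) \<partial>lborel)
       \<le> ennreal ((C + G * C) * (a + b))" .
  qed
  then show ?thesis unfolding U_def using \<delta> by blast
qed

text \<open>The gluing is run with the weight 1 + |g|, and the summand 1 is discarded only at the
  end.\<close>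

lemma tgv_poincare:
  fixes \<Omega> :: "(real^'d) set"
  assumes \<Omega>: "\<Omega> \<noteq> {}" "bounded \<Omega>" "open \<Omega>" "connected \<Omega>" "lipschitz_boundary \<Omega>"
    and [measurable]: "g \<in> borel_measurable borel" and G: "(\<integral>\<^sup>+x. ennreal ((g x)\<^sup>2) \<partial>lborel) \<le> ennreal (G\<^sup>2)" "G \<ge> 0"
    and g: "CARD('d) = 2 \<or> (\<forall>x. \<bar>g x\<bar> \<le> G)"
  shows "\<exists>C\<ge>0. \<forall>u w a b. tgv_bounded \<Omega> u w a b \<longrightarrow> (\<exists>\<alpha> \<beta>.
     (\<integral>\<^sup>+x. indicator \<Omega> x * (ennreal \<bar>g x\<bar> * ennreal \<bar>u x - (\<alpha> + \<beta> \<bullet> x)\<bar>) \<partial>lborel) \<le> ennreal (C * (a + b)))"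
proof -
  let ?\<omega> = "\<lambda>x. 1 + ennreal \<bar>g x\<bar>"
  have [measurable]: "\<Omega> \<in> sets borel" using \<Omega>(3) by auto
  have V: "emeasure lborel \<Omega> = ennreal (measure lborel \<Omega>)"
    using emeasure_bounded_finite[OF \<Omega>(2)] by (intro emeasure_eq_ennreal_measure) auto
  have pt: "indicator \<Omega> x * ?\<omega> x \<le> 2 * indicator \<Omega> x + ennreal ((g x)\<^sup>2)" for x
  proof (cases "x \<in> \<Omega>")
    case True
    \<comment> \<open>This bounds the total mass of the weight over \<Omega> by twice the volume
      plus the square of \<open>G\<close>.\<close>
    have "\<bar>g x\<bar> \<le> 1 + (g x)\<^sup>2"
      using sum_squares_bound[of 1 "\<bar>g x\<bar>"] by (simp add: power2_abs)
    then have "ennreal (1 + \<bar>g x\<bar>) \<le> ennreal (2 + (g x)\<^sup>2)" by (intro ennreal_leI) simp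
    then show ?thesis using True by simp
  qed simp
  have "(\<integral>\<^sup>+x. indicator \<Omega> x * ?\<omega> x \<partial>lborel) \<le> (\<integral>\<^sup>+x. 2 * indicator \<Omega> x + ennreal ((g x)\<^sup>2) \<partial>lborel)"
    by (intro nn_integral_mono pt)
  also have "\<dots> = 2 * emeasure lborel \<Omega> + (\<integral>\<^sup>+x. ennreal ((g x)\<^sup>2) \<partial>lborel)"
    by (subst nn_integral_add) (auto simp: nn_integral_cmult)
  also have "\<dots> \<le> 2 * ennreal (measure lborel \<Omega>) + ennreal (G\<^sup>2)" unfolding V by (intro add_left_mono G(1))
  also have "\<dots> = ennreal (2 * measure lborel \<Omega> + G\<^sup>2)"
    by (simp add: ennreal_mult')
  finally have I: "(\<integral>\<^sup>+x. indicator \<Omega> x * ?\<omega> x \<partial>lborel) \<le> ennreal (2 * measure lborel \<Omega> + G\<^sup>2)" .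
  have "\<exists>\<alpha> \<beta> C. affine_est \<Omega> ?\<omega> \<Omega> \<alpha> \<beta> C"
  proof (rule global_estimate[OF \<Omega>(3,2,4,1) _ _ I])
    show "\<exists>\<delta>>0. \<exists>\<alpha> \<beta> C. affine_est \<Omega> ?\<omega> (\<Omega> \<inter> ball x0 \<delta>) \<alpha> \<beta> C" if "x0 \<in> closure \<Omega>" for x0
      by (rule affine_est_local[OF \<Omega>(3,2,5) that _ G g]) simp
  qed auto
  then obtain \<alpha> \<beta> C where C: "affine_est \<Omega> ?\<omega> \<Omega> \<alpha> \<beta> C" by blast
  have "(\<integral>\<^sup>+x. indicator \<Omega> x * (ennreal \<bar>g x\<bar> * ennreal \<bar>u x - (\<alpha> u w a b + \<beta> u w a b \<bullet> x)\<bar>) \<partial>lborel) \<le> ennreal (C * (a + b))"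
    if "tgv_bounded \<Omega> u w a b" for u w a b
  proof -
    have "(\<integral>\<^sup>+x. indicator \<Omega> x * (ennreal \<bar>g x\<bar> * ennreal \<bar>u x - (\<alpha> u w a b + \<beta> u w a b \<bullet> x)\<bar>) \<partial>lborel)
       \<le> (\<integral>\<^sup>+x. indicator \<Omega> x * (?\<omega> x * ennreal \<bar>u x - (\<alpha> u w a b + \<beta> u w a b \<bullet> x)\<bar>) \<partial>lborel)"
      by (intro nn_integral_mono mult_left_mono mult_right_mono) auto
    also have "\<dots> \<le> ennreal (C * (a + b))" using C that by (simp add: affine_est_def)
    finally show ?thesis .
  qed
  moreover have "C \<ge> 0" using C by (simp add: affine_est_def)
  ultimately show ?thesis by blast
qed

text \<open>Locally \<open>u\<close> differs from an affine function by an L2 function, and affine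
  functions are bounded on \<Omega>. As only finiteness is claimed, a finite cover suffices and the
  local affine functions need not be matched.\<close>

lemma tgv_bounded_L2:
  fixes \<Omega> :: "(real^'d) set"
  assumes \<Omega>: "bounded \<Omega>" "open \<Omega>" "lipschitz_boundary \<Omega>" and t: "tgv_bounded \<Omega> u w a b" and d: "CARD('d) = 2"
  shows "(\<integral>\<^sup>+x. indicator \<Omega> x * ennreal ((u x)\<^sup>2) \<partial>lborel) < \<infinity>"
proof -
  have [measurable]: "\<Omega> \<in> sets borel" using \<Omega>(2) by auto
  have [measurable]: "u \<in> borel_measurable borel" using tgv_boundedD(1)[OF t] by auto
  obtain R where R: "\<And>x. x \<in> \<Omega> \<Longrightarrow> norm x \<le> R" using \<Omega>(1) unfolding bounded_iff by blast
  have "\<exists>\<delta>>0. (\<integral>\<^sup>+x. indicator (\<Omega> \<inter> ball x0 \<delta>) x * ennreal ((u x)\<^sup>2) \<partial>lborel) < \<infinity>" if x0: "x0 \<in> closure \<Omega>" for x0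
  proof -
    obtain \<delta> C \<alpha> \<beta> where \<delta>: "\<delta> > 0" and e: "(\<integral>\<^sup>+x. indicator (\<Omega> \<inter> ball x0 \<delta>) x * ennreal ((u x - (\<alpha> + \<beta> \<bullet> x))\<^sup>2) \<partial>lborel) \<le> ennreal ((C * (a + b))\<^sup>2)"
      using local_estimate_ex[OF \<Omega>(2,1,3) x0] t d by blast
    define U where "U = \<Omega> \<inter> ball x0 \<delta>"
    have [measurable]: "U \<in> sets borel" unfolding U_def using \<Omega>(2) by auto
    define Q where "Q = (\<bar>\<alpha>\<bar> + norm \<beta> * R)\<^sup>2"
    have pt: "indicator U x * ennreal ((u x)\<^sup>2) \<le> 2 * (indicator U x * ennreal ((u x - (\<alpha> + \<beta> \<bullet> x))\<^sup>2)) + ennreal (2 * Q) * indicator \<Omega> x" for x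
    proof (cases "x \<in> U")
      case True
      then have x: "x \<in> \<Omega>" by (simp add: U_def)
      have "\<bar>\<alpha> + \<beta> \<bullet> x\<bar> \<le> \<bar>\<alpha>\<bar> + norm \<beta> * R"
        using Cauchy_Schwarz_ineq2[of \<beta> x] mult_left_mono[OF R[OF x] norm_ge_zero[of \<beta>]] by linarith
      then have "(\<alpha> + \<beta> \<bullet> x)\<^sup>2 \<le> Q"
        unfolding Q_def by (metis abs_ge_zero power2_abs power_mono)
      moreover have "(u x)\<^sup>2 \<le> 2 * (u x - (\<alpha> + \<beta> \<bullet> x))\<^sup>2 + 2 * (\<alpha> + \<beta> \<bullet> x)\<^sup>2"
        using zero_le_power2[of "u x - 2 * (\<alpha> + \<beta> \<bullet> x)"] by (simp add: power2_eq_square algebra_simps)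
      ultimately have "ennreal ((u x)\<^sup>2) \<le> ennreal (2 * (u x - (\<alpha> + \<beta> \<bullet> x))\<^sup>2 + 2 * Q)"
        by (intro ennreal_leI) linarith
      also have "\<dots> = 2 * ennreal ((u x - (\<alpha> + \<beta> \<bullet> x))\<^sup>2) + ennreal (2 * Q)"
        by (simp add: Q_def ennreal_mult')
      finally show ?thesis using True x by simp
    qed simp
    have "(\<integral>\<^sup>+x. indicator U x * ennreal ((u x)\<^sup>2) \<partial>lborel)
      \<le> (\<integral>\<^sup>+x. 2 * (indicator U x * ennreal ((u x - (\<alpha> + \<beta> \<bullet> x))\<^sup>2)) + ennreal (2 * Q) * indicator \<Omega> x \<partial>lborel)"
      by (intro nn_integral_mono pt)
    also have "\<dots> = 2 * (\<integral>\<^sup>+x. indicator U x * ennreal ((u x - (\<alpha> + \<beta> \<bullet> x))\<^sup>2) \<partial>lborel) + ennreal (2 * Q) * emeasure lborel \<Omega>"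
      by (subst nn_integral_add) (auto simp: nn_integral_cmult)
    also have "\<dots> < \<infinity>"
    proof -
      have "(\<integral>\<^sup>+x. indicator U x * ennreal ((u x - (\<alpha> + \<beta> \<bullet> x))\<^sup>2) \<partial>lborel) < \<infinity>"
        using e unfolding U_def by (simp add: le_less_trans)
      then show ?thesis using emeasure_bounded_finite[OF \<Omega>(1)] by (simp add: ennreal_mult_less_top)
    qed
    finally show ?thesis unfolding U_def using \<delta> by blast
  qed
  then obtain \<delta> where \<delta>: "\<And>x0. x0 \<in> closure \<Omega> \<Longrightarrow> \<delta> x0 > 0 \<and> (\<integral>\<^sup>+x. indicator (\<Omega> \<inter> ball x0 (\<delta> x0)) x * ennreal ((u x)\<^sup>2) \<partial>lborel) < \<infinity>"
    by metis
  have "compact (closure \<Omega>)" using \<Omega>(1) by (simp add: compact_closure)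
  then obtain T where T: "T \<subseteq> closure \<Omega>" "finite T" "closure \<Omega> \<subseteq> (\<Union>x\<in>T. ball x (\<delta> x))"
    by (rule compactE_image[of _ "closure \<Omega>" "\<lambda>x. ball x (\<delta> x)"]) (use \<delta> in \<open>auto intro!: bexI centre_in_ball[THEN iffD2]\<close>)
  have [measurable]: "\<Omega> \<inter> ball x (\<delta> x) \<in> sets borel" for x using \<Omega>(2) by auto
  have "(\<integral>\<^sup>+x. indicator \<Omega> x * ennreal ((u x)\<^sup>2) \<partial>lborel) \<le> (\<integral>\<^sup>+x. (\<Sum>z\<in>T. indicator (\<Omega> \<inter> ball z (\<delta> z)) x * ennreal ((u x)\<^sup>2)) \<partial>lborel)"
  proof (rule nn_integral_mono)
    fix x
    show "indicator \<Omega> x * ennreal ((u x)\<^sup>2) \<le> (\<Sum>z\<in>T. indicator (\<Omega> \<inter> ball z (\<delta> z)) x * ennreal ((u x)\<^sup>2))"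
    proof (cases "x \<in> \<Omega>")
      case True
      then obtain z where z: "z \<in> T" "x \<in> \<Omega> \<inter> ball z (\<delta> z)" using T(3) closure_subset by blast
      then have "indicator \<Omega> x * ennreal ((u x)\<^sup>2) = indicator (\<Omega> \<inter> ball z (\<delta> z)) x * ennreal ((u x)\<^sup>2)"
        using True by simp
      also have "\<dots> \<le> (\<Sum>z\<in>T. indicator (\<Omega> \<inter> ball z (\<delta> z)) x * ennreal ((u x)\<^sup>2))"
        by (rule member_le_sum[OF z(1)]) (use T(2) in auto)
      finally show ?thesis .
    qed simp
  qed
  also have "\<dots> = (\<Sum>z\<in>T. \<integral>\<^sup>+x. indicator (\<Omega> \<inter> ball z (\<delta> z)) x * ennreal ((u x)\<^sup>2) \<partial>lborel)"
    by (rule nn_integral_sum) measurable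
  also have "\<dots> < \<infinity>" using \<delta> T(1,2) by (auto simp: ennreal_sum_less_top)
  finally show ?thesis .
qed

section \<open>Borel representatives of Lebesgue measurable functions\<close>

lemma AE_lebesgue_on_iff:
  assumes "open \<Omega>"
  shows "(AE x in lebesgue_on \<Omega>. P x) \<longleftrightarrow> (AE x in lborel. x \<in> \<Omega> \<longrightarrow> P x)"
  using assms by (subst AE_restrict_space_iff) (auto simp: AE_completion_iff)

lemma borel_measurable_lebesgue_on:
  "f \<in> borel_measurable borel \<Longrightarrow> f \<in> borel_measurable (lebesgue_on \<Omega>)"
  by (intro measurable_restrict_space1 measurable_completion) simp

lemma nn_integral_lebesgue_on:
  assumes "open \<Omega>"
  shows "(\<integral>\<^sup>+x. f x \<partial>lebesgue_on \<Omega>) = (\<integral>\<^sup>+x. indicator \<Omega> x * f x \<partial>lborel)"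
  using assms by (subst nn_integral_restrict_space) (auto simp: nn_integral_completion mult.commute)

text \<open>The function is first extended by zero, so that integrals over \<Omega> of the Borel
  representative become integrals over the whole space.\<close>

lemma borel_version_real:
  fixes u :: "'a::euclidean_space \<Rightarrow> real"
  assumes \<Omega>: "open \<Omega>" and u: "u \<in> borel_measurable (lebesgue_on \<Omega>)"
  shows "\<exists>u'. u' \<in> borel_measurable borel \<and> (\<forall>x. x \<notin> \<Omega> \<longrightarrow> u' x = 0) \<and> (AE x in lebesgue_on \<Omega>. u x = u' x)"
proof -
  have "(\<lambda>x. if x \<in> \<Omega> then u x else 0) \<in> borel_measurable lebesgue"
    using u measurable_restrict_space_iff[of \<Omega> lebesgue 0 borel u] \<Omega> by simp
  from completion_ex_borel_measurable_real[OF this]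
  obtain u' where u': "u' \<in> borel_measurable lborel" "AE x in lborel. (if x \<in> \<Omega> then u x else 0) = u' x" by blast
  have [measurable]: "u' \<in> borel_measurable borel" "\<Omega> \<in> sets borel" using u' \<Omega> by auto
  have "AE x in lebesgue_on \<Omega>. u x = indicator \<Omega> x * u' x"
    unfolding AE_lebesgue_on_iff[OF \<Omega>] using u'(2) by eventually_elim auto
  then show ?thesis by (intro exI[of _ "\<lambda>x. indicator \<Omega> x * u' x"]) auto
qed

lemma measurable_vec_nth:
  fixes w :: "'a \<Rightarrow> real^'d"
  assumes "w \<in> borel_measurable M" shows "(\<lambda>x. w x $ i) \<in> borel_measurable M"
  by (rule measurable_compose[OF assms borel_measurable_continuous_onI[OF continuous_on_component[OF continuous_on_id]]])

lemma borel_version_vec: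
  fixes w :: "'a::euclidean_space \<Rightarrow> real^'d"
  assumes \<Omega>: "open \<Omega>" and w: "w \<in> borel_measurable (lebesgue_on \<Omega>)"
  shows "\<exists>w'. w' \<in> borel_measurable borel \<and> (\<forall>x. x \<notin> \<Omega> \<longrightarrow> w' x = 0) \<and> (AE x in lebesgue_on \<Omega>. w x = w' x)"
proof -
  have "(\<lambda>x. w x $ i) \<in> borel_measurable (lebesgue_on \<Omega>)" for i
    using w by (rule measurable_vec_nth)
  then have "\<forall>i. \<exists>v. v \<in> borel_measurable borel \<and> (\<forall>x. x \<notin> \<Omega> \<longrightarrow> v x = 0) \<and> (AE x in lebesgue_on \<Omega>. w x $ i = v x)"
    using borel_version_real[OF \<Omega>] by blast
  then obtain v where v: "\<And>i. v i \<in> borel_measurable borel" "\<And>i x. x \<notin> \<Omega> \<Longrightarrow> v i x = 0" "\<And>i. AE x in lebesgue_on \<Omega>. w x $ i = v i x"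
    by metis
  have "(\<lambda>x. \<chi> i. v i x) \<in> borel_measurable borel"
    by (subst borel_measurable_euclidean_space) (auto simp: Basis_vec_def inner_axis v(1))
  moreover have "AE x in lebesgue_on \<Omega>. \<forall>i. w x $ i = v i x" using v(3) by (simp add: AE_all_countable)
  then have "AE x in lebesgue_on \<Omega>. w x = (\<chi> i. v i x)" by eventually_elim (simp add: vec_eq_iff)
  ultimately show ?thesis using v(2) by (intro exI[of _ "\<lambda>x. \<chi> i. v i x"]) (auto simp: vec_eq_iff)
qed

section \<open>Affine functions as distributions\<close>

lemma test_functionD:
  assumes "v \<in> test_functions \<Omega>"
  shows "smooth v" "\<And>x. x \<notin> \<Omega> \<Longrightarrow> v x = 0" "\<exists>e>0. \<forall>x. e < norm x \<longrightarrow> v x = 0"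
proof -
  have v: "smooth v" "compact (closure {x. v x \<noteq> 0})" "closure {x. v x \<noteq> 0} \<subseteq> \<Omega>"
    using assms by (auto simp: test_functions_def)
  show "smooth v" by fact
  have sub: "v x \<noteq> 0 \<Longrightarrow> x \<in> closure {x. v x \<noteq> 0}" for x
    using closure_subset[of "{x. v x \<noteq> 0}"] by blast
  then show "v x = 0" if "x \<notin> \<Omega>" for x using v(3) that by blast
  obtain b where "b > 0" "\<And>x. x \<in> closure {x. v x \<noteq> 0} \<Longrightarrow> norm x \<le> b"
    using compact_imp_bounded[OF v(2)] unfolding bounded_pos by blast
  then show "\<exists>e>0. \<forall>x. e < norm x \<longrightarrow> v x = 0" using sub by (meson not_less)
qed

lemma test_function_derivative_outside:
  assumes "v \<in> test_functions \<Omega>" "x \<notin> \<Omega>"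
  shows "frechet_derivative v (at x) = (\<lambda>h. 0)"
proof -
  let ?S = "closure {x. v x \<noteq> 0}"
  have "x \<in> - ?S" using assms by (auto simp: test_functions_def)
  moreover have "v y = 0" if "y \<in> - ?S" for y using that closure_subset[of "{x. v x \<noteq> 0}"] by blast
  ultimately have "(v has_derivative (\<lambda>h. 0)) (at x)"
    using has_derivative_transform_within_open[OF has_derivative_const[of 0] open_Compl[OF closed_closure]] by metis
  then show ?thesis by (metis frechet_derivative_at)
qed

lemma test_function_bounded_linear:
  assumes "V \<in> test_functions \<Omega>" "bounded_linear L"
  shows "(\<lambda>x. L (V x)) \<in> test_functions \<Omega>"
proof -
  have V: "smooth V" "compact (closure {x. V x \<noteq> 0})" "closure {x. V x \<noteq> 0} \<subseteq> \<Omega>"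
    using assms by (auto simp: test_functions_def)
  have "L 0 = 0" using assms(2) by (rule linear_simps)
  then have "{x. L (V x) \<noteq> 0} \<subseteq> {x. V x \<noteq> 0}" by (intro Collect_mono) auto
  then have sub: "closure {x. L (V x) \<noteq> 0} \<subseteq> closure {x. V x \<noteq> 0}" by (rule closure_mono)
  then have "closure {x. V x \<noteq> 0} \<inter> closure {x. L (V x) \<noteq> 0} = closure {x. L (V x) \<noteq> 0}" by blast
  then have "compact (closure {x. L (V x) \<noteq> 0})"
    using compact_Int_closed[OF V(2) closed_closure, of "{x. L (V x) \<noteq> 0}"] by simp
  then show ?thesis
    using smooth_bounded_linear[OF assms(2) V(1)] subset_trans[OF sub V(3)] by (simp add: test_functions_def)
qed

lemma continuous_on_divergence:
  assumes "smooth v" shows "continuous_on UNIV (divergence v)"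
  unfolding divergence_def[abs_def]
  by (intro continuous_on_sum continuous_on_component smooth_continuous smooth_derivative assms)

section \<open>Invariance under changes on null sets\<close>

lemma distr_grad_cong_AE:
  assumes u: "u \<in> borel_measurable (lebesgue_on \<Omega>)" and u': "u' \<in> borel_measurable (lebesgue_on \<Omega>)"
    and eq: "AE x in lebesgue_on \<Omega>. u x = u' x" and v: "smooth v"
  shows "distr_grad \<Omega> u v = distr_grad \<Omega> u' v"
proof -
  have [measurable]: "divergence v \<in> borel_measurable (lebesgue_on \<Omega>)"
    by (intro borel_measurable_lebesgue_on borel_measurable_continuous_onI continuous_on_divergence v)
  note [measurable] = u u'
  have "(LINT x|lebesgue_on \<Omega>. u x * divergence v x) = (LINT x|lebesgue_on \<Omega>. u' x * divergence v x)"
    by (rule integral_cong_AE) (measurable, use eq in eventually_elim, simp)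
  then show ?thesis by (simp add: distr_grad_def)
qed

lemma distr_of_fun_cong_AE:
  fixes w w' v :: "'a::euclidean_space \<Rightarrow> 'b::euclidean_space"
  assumes w: "w \<in> borel_measurable (lebesgue_on \<Omega>)" and w': "w' \<in> borel_measurable (lebesgue_on \<Omega>)"
    and eq: "AE x in lebesgue_on \<Omega>. w x = w' x" and v: "smooth v"
  shows "distr_of_fun \<Omega> w v = distr_of_fun \<Omega> w' v"
proof -
  have [measurable]: "v \<in> borel_measurable (lebesgue_on \<Omega>)"
    by (intro borel_measurable_lebesgue_on borel_measurable_continuous_onI smooth_continuous v)
  note [measurable] = w w'
  show ?thesis unfolding distr_of_fun_def
    by (rule integral_cong_AE) (measurable, use eq in eventually_elim, simp)
qed

lemma distr_sym_grad_cong_AE: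
  fixes w w' :: "real^'d \<Rightarrow> real^'d"
  assumes w: "w \<in> borel_measurable (lebesgue_on \<Omega>)" and w': "w' \<in> borel_measurable (lebesgue_on \<Omega>)"
    and eq: "AE x in lebesgue_on \<Omega>. w x = w' x" and V: "smooth V"
  shows "distr_sym_grad \<Omega> w V = distr_sym_grad \<Omega> w' V"
proof -
  have "distr_grad \<Omega> (\<lambda>x. w x $ i) v = distr_grad \<Omega> (\<lambda>x. w' x $ i) v" if "smooth v" for i v
    by (rule distr_grad_cong_AE[OF measurable_vec_nth[OF w] measurable_vec_nth[OF w'] _ that])
       (use eq in eventually_elim, simp)
  moreover have "smooth (\<lambda>x. V x $ i)" "smooth (\<lambda>x. transpose (V x) $ i)" for i
    using smooth_bounded_linear[OF bounded_linear_vec_nth V] smooth_bounded_linear[OF bounded_linear_transpose_row V] by auto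
  ultimately show ?thesis
    by (simp add: distr_sym_grad_def distr_jacobian_def distr_transpose_def)
qed

lemma integrable_lborel_version:
  fixes u u' :: "'a::euclidean_space \<Rightarrow> 'b::euclidean_space"
  assumes \<Omega>: "open \<Omega>" and u: "integrable (lebesgue_on \<Omega>) u"
    and u': "u' \<in> borel_measurable borel" "\<And>x. x \<notin> \<Omega> \<Longrightarrow> u' x = 0" "AE x in lebesgue_on \<Omega>. u x = u' x"
  shows "integrable lborel u'"
proof -
  have "integrable (lebesgue_on \<Omega>) u'"
    using integrable_cong_AE[THEN iffD1, OF _ _ u'(3) u] u borel_measurable_lebesgue_on[OF u'(1)] by auto
  then have "integrable lebesgue (\<lambda>x. indicator \<Omega> x *\<^sub>R u' x)"
    using \<Omega> by (subst (asm) integrable_restrict_space) auto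
  also have "(\<lambda>x. indicator \<Omega> x *\<^sub>R u' x) = u'" using u'(2) by (auto simp: fun_eq_iff indicator_def)
  finally show ?thesis using u'(1) by (simp add: integrable_completion)
qed

text \<open>The distributions do not see null sets, so Borel representatives vanishing off \<Omega>
  inherit the bounds. This is the way from integrable functions on \<Omega> into
  \<open>tgv_bounded\<close>.\<close>

lemma tgv_bounded_version:
  fixes u :: "real^'d \<Rightarrow> real" and w :: "real^'d \<Rightarrow> real^'d"
  assumes \<Omega>: "open \<Omega>" and u: "integrable (lebesgue_on \<Omega>) u" and w: "integrable (lebesgue_on \<Omega>) w"
    and a: "\<And>v. v \<in> test_functions \<Omega> \<Longrightarrow> (\<And>x. norm (v x) \<le> 1) \<Longrightarrow> distr_grad \<Omega> u v - distr_of_fun \<Omega> w v \<le> a"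
    and b: "\<And>V. V \<in> test_functions \<Omega> \<Longrightarrow> (\<And>x. norm (V x) \<le> 1) \<Longrightarrow> distr_sym_grad \<Omega> w V \<le> b"
  shows "\<exists>u' w'. tgv_bounded \<Omega> u' w' a b \<and> (AE x in lebesgue_on \<Omega>. u x = u' x)"
proof -
  obtain u' where u': "u' \<in> borel_measurable borel" "\<And>x. x \<notin> \<Omega> \<Longrightarrow> u' x = 0" "AE x in lebesgue_on \<Omega>. u x = u' x"
    using borel_version_real[OF \<Omega> borel_measurable_integrable[OF u]] by blast
  obtain w' where w': "w' \<in> borel_measurable borel" "\<And>x. x \<notin> \<Omega> \<Longrightarrow> w' x = 0" "AE x in lebesgue_on \<Omega>. w x = w' x"
    using borel_version_vec[OF \<Omega> borel_measurable_integrable[OF w]] by blast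
  have eqs: "distr_grad \<Omega> u' v = distr_grad \<Omega> u v" "distr_of_fun \<Omega> w' v = distr_of_fun \<Omega> w v" if "smooth v" for v
    using distr_grad_cong_AE[OF borel_measurable_integrable[OF u] borel_measurable_lebesgue_on[OF u'(1)] u'(3) that]
      distr_of_fun_cong_AE[OF borel_measurable_integrable[OF w] borel_measurable_lebesgue_on[OF w'(1)] w'(3) that] by auto
  have eqs': "distr_sym_grad \<Omega> w' V = distr_sym_grad \<Omega> w V" if "smooth V" for V
    using distr_sym_grad_cong_AE[OF borel_measurable_integrable[OF w] borel_measurable_lebesgue_on[OF w'(1)] w'(3) that] by auto
  have "tgv_bounded \<Omega> u' w' a b"
    unfolding tgv_bounded_def
  proof (intro conjI ballI allI impI)
    fix v :: "real^'d \<Rightarrow> real^'d" assume v: "v \<in> test_functions \<Omega>" "\<forall>x. norm (v x) \<le> 1"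
    show "distr_grad \<Omega> u' v - distr_of_fun \<Omega> w' v \<le> a"
      unfolding eqs[OF test_functionD(1)[OF v(1)]] using v by (intro a) auto
  next
    fix V :: "real^'d \<Rightarrow> real^'d^'d" assume V: "V \<in> test_functions \<Omega>" "\<forall>x. norm (V x) \<le> 1"
    show "distr_sym_grad \<Omega> w' V \<le> b"
      unfolding eqs'[OF test_functionD(1)[OF V(1)]] using V by (intro b) auto
  qed (use integrable_lborel_version[OF \<Omega> u u'] integrable_lborel_version[OF \<Omega> w w'] u'(2) w'(2) in auto)
  then show ?thesis using u'(3) by blast
qed

section \<open>Integration by parts against affine functions\<close>

lemma lborel_integral_reflect:
  fixes f :: "'a::euclidean_space \<Rightarrow> 'b::euclidean_space"
  assumes [measurable]: "f \<in> borel_measurable borel"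
  shows "(\<integral>x. f (y - x) \<partial>lborel) = integral\<^sup>L lborel f"
proof -
  have "(lborel :: 'a measure) = distr lborel borel (\<lambda>x. y + (- 1) *\<^sub>R x)"
    using lborel_affine[of "- 1 :: real" y] by (simp add: density_1)
  then have "integral\<^sup>L lborel f = integral\<^sup>L (distr lborel borel (\<lambda>x. y + (- 1) *\<^sub>R x)) f" by simp
  also have "\<dots> = (\<integral>x. f (y + (- 1) *\<^sub>R x) \<partial>lborel)" by (rule integral_distr) auto
  finally show ?thesis by simp
qed

text \<open>Integration by parts: near the origin the convolution of \<open>\<rho>\<close> with the reflected affine function is
  itself affine, and its derivative also falls on \<open>\<rho>\<close>.\<close>

lemma integral_derivative_times_affine:
  fixes \<rho> :: "'a::euclidean_space \<Rightarrow> real"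
  assumes \<rho>: "smooth \<rho>" "\<And>x. e < norm x \<Longrightarrow> \<rho> x = 0" and "e > 0"
  shows "(\<integral>z. frechet_derivative \<rho> (at z) h * (\<alpha> + \<beta> \<bullet> z) \<partial>lborel) = - (\<beta> \<bullet> h) * integral\<^sup>L lborel \<rho>"
proof -
  let ?D = "\<lambda>z. frechet_derivative \<rho> (at z) h"
  \<comment> \<open>The reflected affine function, cut off at radius e + 1 to make it integrable.
    For y in the unit ball the kernel only reaches points of norm below e + 1, so the cutoff is
    invisible near the origin.\<close>
  define V where "V x = indicator (cball 0 (e + 1)) x *\<^sub>R (\<alpha> - \<beta> \<bullet> x)" for x
  have V: "integrable lborel V"
    unfolding V_def by (rule borel_integrable_compact) (auto intro!: continuous_intros)
  have cD: "continuous_on UNIV ?D" by (intro smooth_continuous smooth_derivative \<rho>)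
  have D0: "?D x = 0" if "e < norm x" for x using frechet_derivative_outside_support[of e \<rho> x, OF \<rho>(2) that] by simp
  have [measurable]: "\<rho> \<in> borel_measurable borel" "?D \<in> borel_measurable borel"
    by (intro borel_measurable_continuous_onI smooth_continuous[OF \<rho>(1)] cD)+
  have i1: "integrable lborel \<rho>" by (rule integrable_continuous_compact_support[OF smooth_continuous[OF \<rho>(1)] \<rho>(2)])
  have i2: "integrable lborel (\<lambda>z. \<rho> z * (\<beta> \<bullet> z))"
  proof (rule integrable_continuous_compact_support[of _ e])
    show "continuous_on UNIV (\<lambda>z. \<rho> z * (\<beta> \<bullet> z))"
      by (intro continuous_on_mult[OF smooth_continuous[OF \<rho>(1)]] continuous_intros)
  qed (simp add: \<rho>(2))
  have cv: "conv \<rho> V y = (\<alpha> - \<beta> \<bullet> y) * integral\<^sup>L lborel \<rho> + (\<integral>z. \<rho> z * (\<beta> \<bullet> z) \<partial>lborel)" if y: "y \<in> ball 0 1" for y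
  proof -
    have "conv \<rho> V y = (\<integral>x. (\<lambda>z. \<rho> z * (\<alpha> - \<beta> \<bullet> (y - z))) (y - x) \<partial>lborel)"
      unfolding conv_def
    proof (rule Bochner_Integration.integral_cong[OF refl])
      fix x
      show "\<rho> (y - x) *\<^sub>R V x = (\<lambda>z. \<rho> z * (\<alpha> - \<beta> \<bullet> (y - z))) (y - x)"
      proof (cases "norm x \<le> e + 1")
        case False
        then have "e < norm (y - x)" using y norm_triangle_ineq2[of x y] by (simp add: norm_minus_commute)
        then show ?thesis by (simp add: \<rho>(2))
      qed (simp add: V_def)
    qed
    also have "\<dots> = (\<integral>z. \<rho> z * (\<alpha> - \<beta> \<bullet> (y - z)) \<partial>lborel)" by (rule lborel_integral_reflect) measurable
    also have "\<dots> = (\<integral>z. (\<alpha> - \<beta> \<bullet> y) * \<rho> z + \<rho> z * (\<beta> \<bullet> z) \<partial>lborel)"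
      by (intro Bochner_Integration.integral_cong refl) (simp add: algebra_simps)
    also have "\<dots> = (\<alpha> - \<beta> \<bullet> y) * integral\<^sup>L lborel \<rho> + (\<integral>z. \<rho> z * (\<beta> \<bullet> z) \<partial>lborel)"
      using i1 i2 by (subst Bochner_Integration.integral_add) auto
    finally show ?thesis .
  qed
  have "((\<lambda>y. (\<alpha> - \<beta> \<bullet> y) * integral\<^sup>L lborel \<rho> + (\<integral>z. \<rho> z * (\<beta> \<bullet> z) \<partial>lborel)) has_derivative (\<lambda>h. - (\<beta> \<bullet> h) * integral\<^sup>L lborel \<rho>)) (at 0)"
    by (auto intro!: derivative_eq_intros)
  then have "(conv \<rho> V has_derivative (\<lambda>h. - (\<beta> \<bullet> h) * integral\<^sup>L lborel \<rho>)) (at 0)"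
    by (rule has_derivative_transform_within_open[OF _ open_ball[of 0 1]]) (auto simp: cv)
  from has_derivative_unique[OF this conv_has_derivative[of \<rho> e V 0, OF \<rho> V]]
  have "- (\<beta> \<bullet> h) * integral\<^sup>L lborel \<rho> = conv ?D V 0" by (rule fun_cong)
  also have "\<dots> = (\<integral>x. (\<lambda>z. ?D z * (\<alpha> + \<beta> \<bullet> z)) (0 - x) \<partial>lborel)"
    unfolding conv_def
  proof (rule Bochner_Integration.integral_cong[OF refl])
    fix x
    show "?D (0 - x) *\<^sub>R V x = (\<lambda>z. ?D z * (\<alpha> + \<beta> \<bullet> z)) (0 - x)"
      using D0[of "- x"] by (cases "norm x \<le> e + 1") (auto simp: V_def)
  qed
  also have "\<dots> = (\<integral>z. ?D z * (\<alpha> + \<beta> \<bullet> z) \<partial>lborel)" by (rule lborel_integral_reflect) measurable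
  finally show ?thesis by simp
qed

lemma distr_grad_affine:
  fixes v :: "real^'d \<Rightarrow> real^'d"
  assumes \<Omega>: "open \<Omega>" and t: "v \<in> test_functions \<Omega>"
  shows "distr_grad \<Omega> (\<lambda>x. \<alpha> + \<beta> \<bullet> x) v = (\<integral>x. \<beta> \<bullet> v x \<partial>lborel)"
proof -
  note v = test_functionD[OF t]
  obtain e where e: "e > 0" "\<And>x. e < norm x \<Longrightarrow> v x = 0" using v(3) by blast
  have vi: "smooth (\<lambda>x. v x $ i)" for i by (rule smooth_bounded_linear[OF bounded_linear_vec_nth v(1)])
  have vie: "v x $ i = 0" if "e < norm x" for x i using e(2)[OF that] by simp
  have Di: "frechet_derivative v (at x) h $ i = frechet_derivative (\<lambda>x. v x $ i) (at x) h" for x h i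
    using frechet_derivative_at[OF bounded_linear.has_derivative[OF bounded_linear_vec_nth smooth_has_derivative[OF v(1)]]]
    by metis
  let ?d = "\<lambda>i x. frechet_derivative (\<lambda>x. v x $ i) (at x) (axis i 1)"
  have cd: "continuous_on UNIV (?d i)" for i by (intro smooth_continuous smooth_derivative vi)
  have d0: "?d i x = 0" if "e < norm x" for i x
    using frechet_derivative_outside_support[of e "\<lambda>x. v x $ i" x] vie that by simp
  have div: "divergence v x = (\<Sum>i\<in>UNIV. ?d i x)" for x unfolding divergence_def Di ..
  have out: "divergence v x = 0" if "x \<notin> \<Omega>" for x
    unfolding divergence_def by (simp add: test_function_derivative_outside[OF t that])
  have "distr_grad \<Omega> (\<lambda>x. \<alpha> + \<beta> \<bullet> x) v = - (\<integral>x. (\<alpha> + \<beta> \<bullet> x) * divergence v x \<partial>lborel)"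
    unfolding distr_grad_def
    by (subst integral_lebesgue_on_eq_lborel)
       (use \<Omega> out borel_measurable_continuous_onI[OF continuous_on_divergence[OF v(1)]] in auto)
  also have "\<dots> = - (\<Sum>i\<in>UNIV. \<integral>x. ?d i x * (\<alpha> + \<beta> \<bullet> x) \<partial>lborel)"
  proof -
    have "integrable lborel (\<lambda>x. ?d i x * (\<alpha> + \<beta> \<bullet> x))" for i
      by (rule integrable_continuous_compact_support[of _ e]) (auto intro!: continuous_intros cd simp: d0)
    then show ?thesis unfolding div sum_distrib_left
      by (subst Bochner_Integration.integral_sum[symmetric]) (auto simp: mult.commute)
  qed
  also have "\<dots> = (\<Sum>i\<in>UNIV. \<beta> $ i * (\<integral>x. v x $ i \<partial>lborel))"
    by (subst integral_derivative_times_affine[OF vi vie e(1)]) (auto simp: inner_axis sum_negf)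
  also have "\<dots> = (\<integral>x. \<beta> \<bullet> v x \<partial>lborel)"
  proof -
    have "integrable lborel (\<lambda>x. v x $ i)" for i
      by (rule integrable_continuous_compact_support[OF smooth_continuous[OF vi] vie])
    then show ?thesis unfolding inner_vec_def
      by (subst Bochner_Integration.integral_sum) auto
  qed
  finally show ?thesis .
qed

section \<open>Norms and the projection onto affine functions\<close>

text \<open>Squaring removes the root and gives a formula that also covers the infinite case, so the
  fidelity term can be handled before square integrability is known.\<close>

lemma Lp_norm_2_squared:
  "(Lp_norm \<Omega> 2 u)\<^sup>2 = enn2ereal (\<integral>\<^sup>+x. ennreal ((u x)\<^sup>2) \<partial>lebesgue_on \<Omega>)"
proof -
  have I: "(\<integral>\<^sup>+ x. ennreal (\<bar>u x\<bar> powr 2) \<partial>lebesgue_on \<Omega>) = (\<integral>\<^sup>+x. ennreal ((u x)\<^sup>2) \<partial>lebesgue_on \<Omega>)"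
    by (intro nn_integral_cong) (simp add: powr_numeral)
  show ?thesis
  proof (cases "(\<integral>\<^sup>+x. ennreal ((u x)\<^sup>2) \<partial>lebesgue_on \<Omega>)" rule: ennreal_cases)
    case (real r)
    then have "Lp_norm \<Omega> 2 u = ereal (r powr (1 / 2))" by (simp add: Lp_norm_def I Let_def)
    then show ?thesis using real by (simp add: powr_half_sqrt)
  next
    case top
    then have "Lp_norm \<Omega> 2 u = \<infinity>" by (simp add: Lp_norm_def I Let_def)
    then show ?thesis using top by (simp add: power2_eq_square)
  qed
qed

lemma zero_test_function: "(\<lambda>x. 0) \<in> test_functions \<Omega>"
  by (simp add: test_functions_def smooth_def Ck_const)

lemma radon_norm_upper: "v \<in> test_functions \<Omega> \<Longrightarrow> (\<And>x. norm (v x) \<le> 1) \<Longrightarrow> ereal (T v) \<le> radon_norm \<Omega> T"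
  unfolding radon_norm_def by (intro SUP_upper) auto

lemma radon_norm_nonneg: "T (\<lambda>x. 0) = 0 \<Longrightarrow> 0 \<le> radon_norm \<Omega> T"
  using radon_norm_upper[OF zero_test_function, of T \<Omega>] by (simp add: zero_ereal_def)

lemma radon_norm_eq_0:
  assumes "\<And>v. v \<in> test_functions \<Omega> \<Longrightarrow> T v = 0" shows "radon_norm \<Omega> T = 0"
proof (rule antisym)
  show "radon_norm \<Omega> T \<le> 0" unfolding radon_norm_def using assms by (intro SUP_least) (auto simp: zero_ereal_def)
  show "0 \<le> radon_norm \<Omega> T" by (intro radon_norm_nonneg assms zero_test_function)
qed

lemma distr_grad_zero_test:
  fixes u :: "real^'d \<Rightarrow> real"
  shows "distr_grad \<Omega> u (\<lambda>x. 0) = 0"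
proof -
  have "divergence (\<lambda>x::real^'d. 0) x = 0" for x :: "real^'d" by (simp add: divergence_def)
  then show ?thesis by (simp add: distr_grad_def)
qed

lemma distr_sym_grad_zero_test:
  fixes w :: "real^'d \<Rightarrow> real^'d"
  shows "distr_sym_grad \<Omega> w (\<lambda>x. 0) = 0"
proof -
  have "transpose (0::real^'d^'d) = 0" by (simp add: transpose_def vec_eq_iff)
  then show ?thesis by (simp add: distr_sym_grad_def distr_jacobian_def distr_transpose_def distr_grad_zero_test)
qed

lemma distr_sym_grad_const:
  fixes \<beta> :: "real^'d"
  assumes \<Omega>: "open \<Omega>" and V: "V \<in> test_functions \<Omega>"
  shows "distr_sym_grad \<Omega> (\<lambda>x. \<beta>) V = 0"
proof -
  have "distr_grad \<Omega> (\<lambda>x. \<beta> $ i) v = 0" if "v \<in> test_functions \<Omega>" for i v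
    using distr_grad_affine[OF \<Omega> that, of "\<beta> $ i" 0] by simp
  then show ?thesis
    using test_function_bounded_linear[OF V bounded_linear_vec_nth] test_function_bounded_linear[OF V bounded_linear_transpose_row]
    by (simp add: distr_sym_grad_def distr_jacobian_def distr_transpose_def)
qed

section \<open>Least squares by affine functions\<close>

lemma integrable_continuous_lebesgue_on:
  fixes h :: "'a::euclidean_space \<Rightarrow> 'b::euclidean_space"
  assumes \<Omega>: "open \<Omega>" "bounded \<Omega>" and h: "continuous_on UNIV h"
  shows "integrable (lebesgue_on \<Omega>) h"
proof -
  have [measurable]: "h \<in> borel_measurable borel" "\<Omega> \<in> sets borel" "closure \<Omega> \<in> sets borel"
    using h \<Omega>(1) by (auto intro: borel_measurable_continuous_onI)
  have "compact (closure \<Omega>)" using \<Omega>(2) by (simp add: compact_closure)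
  then have "integrable lborel (\<lambda>x. indicator (closure \<Omega>) x *\<^sub>R h x)"
    by (rule borel_integrable_compact) (rule continuous_on_subset[OF h], simp)
  then have "integrable lborel (\<lambda>x. indicator \<Omega> x *\<^sub>R h x)"
    by (rule Bochner_Integration.integrable_bound) (use closure_subset[of \<Omega>] in \<open>auto simp: indicator_def\<close>)
  then show ?thesis using \<Omega>(1) by (subst integrable_restrict_space) (auto simp: integrable_completion)
qed

lemma integrable_mult_of_squares:
  fixes f g :: "'a \<Rightarrow> real"
  assumes [measurable]: "f \<in> borel_measurable M" "g \<in> borel_measurable M"
    and "integrable M (\<lambda>x. (f x)\<^sup>2)" "integrable M (\<lambda>x. (g x)\<^sup>2)"
  shows "integrable M (\<lambda>x. f x * g x)"
proof (rule Bochner_Integration.integrable_bound)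
  show "integrable M (\<lambda>x. (f x)\<^sup>2 + (g x)\<^sup>2)" using assms by auto
  have "\<bar>f x * g x\<bar> \<le> (f x)\<^sup>2 + (g x)\<^sup>2" for x
  proof -
    have "2 * (\<bar>f x\<bar> * \<bar>g x\<bar>) \<le> (f x)\<^sup>2 + (g x)\<^sup>2" using sum_squares_bound[of "\<bar>f x\<bar>" "\<bar>g x\<bar>"] by simp
    moreover have "0 \<le> \<bar>f x\<bar> * \<bar>g x\<bar>" by simp
    ultimately show ?thesis unfolding abs_mult by linarith
  qed
  then show "AE x in M. norm (f x * g x) \<le> norm ((f x)\<^sup>2 + (g x)\<^sup>2)" by simp
qed measurable

text \<open>A nontrivial affine function vanishes at most on a hyperplane, which is a null set,
  whereas a nonempty open set has positive measure. The uniqueness of the affine fit rests on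
  this.\<close>

lemma affine_AE_zero:
  fixes \<Omega> :: "'a::euclidean_space set"
  assumes \<Omega>: "open \<Omega>" "\<Omega> \<noteq> {}" and ae: "AE x in lebesgue_on \<Omega>. \<alpha> + \<beta> \<bullet> x = 0"
  shows "\<alpha> = 0 \<and> \<beta> = 0"
proof (rule ccontr)
  assume ne: "\<not> ?thesis"
  have "negligible {x. \<beta> \<bullet> x = - \<alpha>}" by (rule negligible_hyperplane) (use ne in auto)
  then have "AE x in lebesgue. x \<notin> {x. \<beta> \<bullet> x = - \<alpha>}"
    unfolding negligible_iff_null_sets by (rule AE_not_in)
  then have "AE x in lborel. x \<notin> {x. \<beta> \<bullet> x = - \<alpha>}" by (simp add: AE_completion_iff)
  with ae[unfolded AE_lebesgue_on_iff[OF \<Omega>(1)]] have "AE x in lborel. x \<notin> \<Omega>"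
    by eventually_elim (auto simp: eq_neg_iff_add_eq_0 add.commute)
  then have null: "\<Omega> \<in> null_sets lborel" using \<Omega>(1) by (subst AE_iff_null_sets) auto
  obtain x e where e: "e > 0" "ball x e \<subseteq> \<Omega>" using \<Omega> open_contains_ball by blast
  have "emeasure lborel (ball x e) = 0" using null_sets_subset[OF null _ e(2)] by auto
  then have "measure lborel (ball x e) = 0" by (simp add: measure_def)
  then show False using content_ball_pos[OF e(1), of x] by simp
qed

text \<open>These are the normal equations of least squares, and \<open>G\<close> is the Gram
  operator of the affine functions on \<Omega>. A kernel vector gives an affine function with zero
  L2 norm, which is zero by \<open>affine_AE_zero\<close>.\<close>

lemma affine_projection_exists:
  fixes \<Omega> :: "'a::euclidean_space set"
  assumes \<Omega>: "open \<Omega>" "bounded \<Omega>" "\<Omega> \<noteq> {}" and fm: "f \<in> borel_measurable (lebesgue_on \<Omega>)"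
    and f2: "integrable (lebesgue_on \<Omega>) (\<lambda>x. (f x)\<^sup>2)"
  shows "\<exists>\<alpha> \<beta>. \<forall>a b. (LINT x|lebesgue_on \<Omega>. (f x - (\<alpha> + \<beta> \<bullet> x)) * (a + b \<bullet> x)) = 0"
proof -
  let ?M = "lebesgue_on \<Omega>"
  define \<phi> where "\<phi> p x = fst p + snd p \<bullet> x" for p :: "real \<times> 'a" and x
  have cphi: "continuous_on UNIV (\<phi> p)" for p unfolding \<phi>_def by (intro continuous_intros)
  have i1: "integrable ?M (\<phi> p)" for p by (intro integrable_continuous_lebesgue_on \<Omega> cphi)
  have i2: "integrable ?M (\<lambda>x. \<phi> p x *\<^sub>R x)" for p
    by (intro integrable_continuous_lebesgue_on \<Omega> continuous_intros cphi)
  \<comment> \<open>an injective linear map of a finite-dimensional space into itself is surjective\<close>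
  define G where "G p = (LINT x|?M. \<phi> p x, LINT x|?M. \<phi> p x *\<^sub>R x)" for p
  have add: "\<phi> (p + q) x = \<phi> p x + \<phi> q x" and scl: "\<phi> (c *\<^sub>R p) x = c * \<phi> p x" for p q c x
    by (auto simp: \<phi>_def algebra_simps)
  have "linear G"
    by (rule linearI)
       (auto simp: G_def add scl scaleR_add_left Bochner_Integration.integral_add[OF i1 i1]
          Bochner_Integration.integral_add[OF i2 i2] simp flip: scaleR_scaleR)
  moreover have "inj G"
    unfolding linear_injective_0[OF \<open>linear G\<close>]
  proof (intro allI impI)
    fix p assume "G p = 0"
    then have z: "(LINT x|?M. \<phi> p x) = 0" "(LINT x|?M. \<phi> p x *\<^sub>R x) = 0" by (auto simp: G_def zero_prod_def)
    have i3: "integrable ?M (\<lambda>x. (\<phi> p x)\<^sup>2)"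
      by (intro integrable_continuous_lebesgue_on \<Omega> continuous_intros cphi)
    \<comment> \<open>Expanding one of the two factors expresses the squared norm as the inner
      product of \<open>p\<close> with \<open>G p\<close>.\<close>
    have "(LINT x|?M. (\<phi> p x)\<^sup>2) = (LINT x|?M. fst p * \<phi> p x + snd p \<bullet> (\<phi> p x *\<^sub>R x))"
      by (intro Bochner_Integration.integral_cong refl) (simp add: \<phi>_def power2_eq_square algebra_simps)
    also have "\<dots> = (LINT x|?M. fst p * \<phi> p x) + (LINT x|?M. snd p \<bullet> (\<phi> p x *\<^sub>R x))"
      by (rule Bochner_Integration.integral_add[OF integrable_mult_right[OF i1] integrable_inner_right[OF i2]])
    also have "\<dots> = 0" unfolding integral_mult_right_zero integral_inner_right[OF i2] z by simp
    finally have "AE x in ?M. (\<phi> p x)\<^sup>2 = 0"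
      using integral_nonneg_eq_0_iff_AE[OF i3] by simp
    then have "AE x in ?M. fst p + snd p \<bullet> x = 0" by eventually_elim (simp add: \<phi>_def)
    from affine_AE_zero[OF \<Omega>(1,3) this] show "p = 0" by (simp add: prod_eq_iff)
  qed
  ultimately have "surj G" using linear_inj_imp_surj by blast
  then obtain p where p: "G p = (LINT x|?M. f x, LINT x|?M. f x *\<^sub>R x)" by (metis surjD)
  have f1: "integrable ?M f"
    using integrable_mult_of_squares[OF fm _ f2, of "\<lambda>x. 1"] integrable_continuous_lebesgue_on[OF \<Omega>(1,2), of "\<lambda>x. 1::real"] by simp
  have fx: "integrable ?M (\<lambda>x. f x *\<^sub>R x)"
  proof -
    obtain R where R: "\<And>x. x \<in> \<Omega> \<Longrightarrow> norm x \<le> R" using \<Omega>(2) unfolding bounded_iff by blast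
    have idm: "(\<lambda>x. x) \<in> borel_measurable ?M" by (rule borel_measurable_lebesgue_on) simp
    show ?thesis
    proof (rule Bochner_Integration.integrable_bound)
      show "integrable ?M (\<lambda>x. R * f x)" using f1 by simp
      show "AE x in ?M. norm (f x *\<^sub>R x) \<le> norm (R * f x)"
      proof (rule AE_I2)
        fix x assume "x \<in> space ?M"
        then have "norm x \<le> \<bar>R\<bar>" using R[of x] by (simp add: space_restrict_space)
        then show "norm (f x *\<^sub>R x) \<le> norm (R * f x)" by (simp add: abs_mult mult.commute mult_right_mono)
      qed
    qed (use fm idm in measurable)
  qed
  have "(LINT x|?M. (f x - (fst p + snd p \<bullet> x)) * (a + b \<bullet> x)) = 0" for a b
  proof -
    have "(LINT x|?M. (f x - (fst p + snd p \<bullet> x)) * (a + b \<bullet> x)) =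
      (LINT x|?M. a * (f x - \<phi> p x) + b \<bullet> (f x *\<^sub>R x - \<phi> p x *\<^sub>R x))"
      by (intro Bochner_Integration.integral_cong refl) (simp add: \<phi>_def algebra_simps)
    also have "\<dots> = a * (LINT x|?M. f x - \<phi> p x) + b \<bullet> (LINT x|?M. f x *\<^sub>R x - \<phi> p x *\<^sub>R x)"
      unfolding integral_mult_right_zero[symmetric] integral_inner_right[OF Bochner_Integration.integrable_diff[OF fx i2], symmetric]
      by (intro Bochner_Integration.integral_add integrable_mult_right integrable_inner_right Bochner_Integration.integrable_diff f1 i1 fx i2)
    also have "(LINT x|?M. f x - \<phi> p x) = 0"
      using p by (simp add: G_def Bochner_Integration.integral_diff[OF f1 i1])
    also have "(LINT x|?M. f x *\<^sub>R x - \<phi> p x *\<^sub>R x) = 0"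
      using p by (simp add: G_def Bochner_Integration.integral_diff[OF fx i2])
    finally show ?thesis by simp
  qed
  then show ?thesis by blast
qed

section \<open>Lower bounds for the total generalised variation\<close>

text \<open>The total variation, the integral of the norm of the density, is a bound.\<close>

lemma finite_radon_measure_bound:
  assumes "finite_radon_measure \<Omega> T"
  shows "\<exists>a. \<forall>v\<in>test_functions \<Omega>. (\<forall>x. norm (v x) \<le> 1) \<longrightarrow> T v \<le> a"
proof -
  obtain M \<sigma> where \<sigma>: "integrable M \<sigma>" and T: "\<And>v. v \<in> test_functions \<Omega> \<Longrightarrow> T v = (LINT x|M. \<sigma> x \<bullet> v x)"
    using assms unfolding finite_radon_measure_def by blast
  have "T v \<le> (LINT x|M. norm (\<sigma> x))" if v: "v \<in> test_functions \<Omega>" "\<And>x. norm (v x) \<le> 1" for v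
    unfolding T[OF v(1)]
  proof (rule integral_mono')
    show "\<sigma> x \<bullet> v x \<le> norm (\<sigma> x)" for x
      using norm_cauchy_schwarz[of "\<sigma> x" "v x"] mult_left_mono[OF v(2)[of x] norm_ge_zero[of "\<sigma> x"]] by linarith
  qed (use \<sigma> in auto)
  then show ?thesis by blast
qed

lemma distr_of_fun_zero: "distr_of_fun \<Omega> (\<lambda>x. 0) v = 0"
  by (simp add: distr_of_fun_def)

lemma integrable_square_iff:
  fixes f :: "'a \<Rightarrow> real"
  assumes "f \<in> borel_measurable M"
  shows "integrable M (\<lambda>x. (f x)\<^sup>2) \<longleftrightarrow> (\<integral>\<^sup>+x. ennreal ((f x)\<^sup>2) \<partial>M) < \<infinity>"
  using assms by (simp add: integrable_iff_bounded)

text \<open>\<open>f\<close> together with w = 0 is an admissible pair: \<open>a\<close> bounds the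
  derivative of \<open>f\<close>, and the symmetrised gradient of 0 vanishes. So the planar estimate
  contains the embedding of BV into L2.\<close>

lemma BV_integrable_square:
  fixes f :: "real^'d \<Rightarrow> real"
  assumes \<Omega>: "bounded \<Omega>" "open \<Omega>" "lipschitz_boundary \<Omega>" and f: "f \<in> BV \<Omega>" and d: "CARD('d) = 2"
  shows "integrable (lebesgue_on \<Omega>) (\<lambda>x. (f x)\<^sup>2)"
proof -
  have fi: "integrable (lebesgue_on \<Omega>) f" using f by (simp add: BV_def)
  obtain a where a: "\<And>v. v \<in> test_functions \<Omega> \<Longrightarrow> (\<And>x. norm (v x) \<le> 1) \<Longrightarrow> distr_grad \<Omega> f v \<le> a"
    using finite_radon_measure_bound[of \<Omega> "distr_grad \<Omega> f"] f by (auto simp: BV_def)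
  have "\<exists>u' w'. tgv_bounded \<Omega> u' w' a 0 \<and> (AE x in lebesgue_on \<Omega>. f x = u' x)"
  proof (rule tgv_bounded_version[OF \<Omega>(2) fi, of "\<lambda>x. 0"])
    show "distr_sym_grad \<Omega> (\<lambda>x. 0) V \<le> 0" if "V \<in> test_functions \<Omega>" for V
      using distr_sym_grad_const[OF \<Omega>(2) that, of 0] by simp
  qed (auto simp: distr_of_fun_zero intro: a)
  then obtain u' w' where t: "tgv_bounded \<Omega> u' w' a 0" and eq: "AE x in lebesgue_on \<Omega>. f x = u' x" by blast
  have "(\<integral>\<^sup>+x. ennreal ((f x)\<^sup>2) \<partial>lebesgue_on \<Omega>) = (\<integral>\<^sup>+x. ennreal ((u' x)\<^sup>2) \<partial>lebesgue_on \<Omega>)"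
    by (rule nn_integral_cong_AE) (use eq in eventually_elim, simp)
  also have "\<dots> < \<infinity>"
    unfolding nn_integral_lebesgue_on[OF \<Omega>(2)] by (rule tgv_bounded_L2[OF \<Omega> t d])
  finally show ?thesis using fi by (subst integrable_square_iff) auto
qed

text \<open>This is \<open>tgv_poincare\<close> carried over from Borel functions on the whole space
  to functions on \<Omega> known up to null sets.\<close>

lemma pairing_estimate:
  fixes \<Omega> :: "(real^'d) set"
  assumes \<Omega>: "\<Omega> \<noteq> {}" "bounded \<Omega>" "open \<Omega>" "connected \<Omega>" "lipschitz_boundary \<Omega>"
    and gm: "g \<in> borel_measurable (lebesgue_on \<Omega>)" and g2: "integrable (lebesgue_on \<Omega>) (\<lambda>x. (g x)\<^sup>2)"
    and g: "CARD('d) = 2 \<or> (\<exists>B. AE x in lebesgue_on \<Omega>. \<bar>g x\<bar> \<le> B)"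
  shows "\<exists>C\<ge>0. \<forall>u w a b. integrable (lebesgue_on \<Omega>) u \<longrightarrow> integrable (lebesgue_on \<Omega>) w \<longrightarrow>
     (\<forall>v\<in>test_functions \<Omega>. (\<forall>x. norm (v x) \<le> 1) \<longrightarrow> distr_grad \<Omega> u v - distr_of_fun \<Omega> w v \<le> a) \<longrightarrow>
     (\<forall>V\<in>test_functions \<Omega>. (\<forall>x. norm (V x) \<le> 1) \<longrightarrow> distr_sym_grad \<Omega> w V \<le> b) \<longrightarrow>
     (\<exists>\<alpha> \<beta>. (\<integral>\<^sup>+x. ennreal \<bar>g x * (u x - (\<alpha> + \<beta> \<bullet> x))\<bar> \<partial>lebesgue_on \<Omega>) \<le> ennreal (C * (a + b)))"
proof -
  let ?M = "lebesgue_on \<Omega>"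
  obtain g' where g': "g' \<in> borel_measurable borel" "\<And>x. x \<notin> \<Omega> \<Longrightarrow> g' x = 0" "AE x in ?M. g x = g' x"
    using borel_version_real[OF \<Omega>(3) gm] by blast
  obtain B where B: "CARD('d) = 2 \<or> (AE x in ?M. \<bar>g x\<bar> \<le> B)" using g by blast
  \<comment> \<open>One number that dominates the L2 norm of \<open>g\<close> as well as its
    essential bound.\<close>
  define G where "G = max (sqrt (LINT x|?M. (g x)\<^sup>2)) B"
  have G: "G \<ge> 0" "B \<le> G" "(LINT x|?M. (g x)\<^sup>2) \<le> G\<^sup>2"
  proof -
    have "sqrt (LINT x|?M. (g x)\<^sup>2) \<ge> 0" by simp
    then show "G \<ge> 0" unfolding G_def by (rule max.coboundedI1)
    show "B \<le> G" by (simp add: G_def)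
    have "(sqrt (LINT x|?M. (g x)\<^sup>2))\<^sup>2 \<le> G\<^sup>2" by (intro power_mono) (auto simp: G_def)
    then show "(LINT x|?M. (g x)\<^sup>2) \<le> G\<^sup>2" by simp
  qed
  \<comment> \<open>Outside dimension two the representative is clipped to the interval from -G to
    G. This turns the almost sure bound into a bound at every point and changes it only on a null
    set.\<close>
  define h where "h x = (if CARD('d) = 2 then g' x else max (- G) (min G (g' x)))" for x
  have hm: "h \<in> borel_measurable borel" unfolding h_def using g'(1) by measurable
  have h0: "h x = 0" if "x \<notin> \<Omega>" for x using g'(2)[OF that] G(1) by (simp add: h_def)
  have hg: "AE x in ?M. g x = h x"
  proof (cases "CARD('d) = 2")
    case False
    then have "AE x in ?M. \<bar>g x\<bar> \<le> B" using B by blast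
    with g'(3) show ?thesis by eventually_elim (use G(2) False in \<open>auto simp: h_def\<close>)
  qed (use g'(3) in \<open>simp add: h_def\<close>)
  have hG: "(\<integral>\<^sup>+x. ennreal ((h x)\<^sup>2) \<partial>lborel) \<le> ennreal (G\<^sup>2)"
  proof -
    have "(\<integral>\<^sup>+x. ennreal ((h x)\<^sup>2) \<partial>lborel) = (\<integral>\<^sup>+x. ennreal ((h x)\<^sup>2) \<partial>?M)"
      unfolding nn_integral_lebesgue_on[OF \<Omega>(3)]
      by (intro nn_integral_cong) (use h0 in \<open>auto simp: indicator_def\<close>)
    also have "\<dots> = (\<integral>\<^sup>+x. ennreal ((g x)\<^sup>2) \<partial>?M)"
      by (rule nn_integral_cong_AE) (use hg in eventually_elim, simp)
    also have "\<dots> = ennreal (LINT x|?M. (g x)\<^sup>2)" by (rule nn_integral_eq_integral[OF g2]) simp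
    also have "\<dots> \<le> ennreal (G\<^sup>2)" by (rule ennreal_leI[OF G(3)])
    finally show ?thesis .
  qed
  have hb: "CARD('d) = 2 \<or> (\<forall>x. \<bar>h x\<bar> \<le> G)" using G(1) by (auto simp: h_def)
  obtain C where C: "C \<ge> 0" and est: "\<And>u w a b. tgv_bounded \<Omega> u w a b \<Longrightarrow> (\<exists>\<alpha> \<beta>.
     (\<integral>\<^sup>+x. indicator \<Omega> x * (ennreal \<bar>h x\<bar> * ennreal \<bar>u x - (\<alpha> + \<beta> \<bullet> x)\<bar>) \<partial>lborel) \<le> ennreal (C * (a + b)))"
    using tgv_poincare[OF \<Omega> hm hG G(1) hb] by blast
  show ?thesis
  proof (rule exI[of _ C], intro conjI allI impI C)
    fix u w a b
    assume u: "integrable ?M u" and w: "integrable ?M w"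
      and a: "\<forall>v\<in>test_functions \<Omega>. (\<forall>x. norm (v x) \<le> 1) \<longrightarrow> distr_grad \<Omega> u v - distr_of_fun \<Omega> w v \<le> a"
      and b: "\<forall>V\<in>test_functions \<Omega>. (\<forall>x. norm (V x) \<le> 1) \<longrightarrow> distr_sym_grad \<Omega> w V \<le> b"
    have "\<exists>u' w'. tgv_bounded \<Omega> u' w' a b \<and> (AE x in ?M. u x = u' x)"
      by (rule tgv_bounded_version[OF \<Omega>(3) u w]) (use a b in auto)
    then obtain u' w' where t: "tgv_bounded \<Omega> u' w' a b" and eq: "AE x in ?M. u x = u' x" by blast
    obtain \<alpha> \<beta> where e: "(\<integral>\<^sup>+x. indicator \<Omega> x * (ennreal \<bar>h x\<bar> * ennreal \<bar>u' x - (\<alpha> + \<beta> \<bullet> x)\<bar>) \<partial>lborel) \<le> ennreal (C * (a + b))"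
      using est[OF t] by blast
    have "(\<integral>\<^sup>+x. ennreal \<bar>g x * (u x - (\<alpha> + \<beta> \<bullet> x))\<bar> \<partial>?M) = (\<integral>\<^sup>+x. ennreal \<bar>h x\<bar> * ennreal \<bar>u' x - (\<alpha> + \<beta> \<bullet> x)\<bar> \<partial>?M)"
      by (rule nn_integral_cong_AE) (use hg eq in eventually_elim, simp add: abs_mult ennreal_mult')
    also have "\<dots> \<le> ennreal (C * (a + b))" unfolding nn_integral_lebesgue_on[OF \<Omega>(3)] by (rule e)
    finally show "\<exists>\<alpha> \<beta>. (\<integral>\<^sup>+x. ennreal \<bar>g x * (u x - (\<alpha> + \<beta> \<bullet> x))\<bar> \<partial>?M) \<le> ennreal (C * (a + b))" by blast
  qed
qed

section \<open>Affine functions have zero energy\<close>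

lemma integrable_affine_AE:
  fixes \<Omega> :: "(real^'d) set"
  assumes \<Omega>: "open \<Omega>" "bounded \<Omega>" and eq: "AE x in lebesgue_on \<Omega>. u x = \<alpha> + \<beta> \<bullet> x"
  shows "integrable (lebesgue_on \<Omega>) u"
proof -
  let ?M = "lebesgue_on \<Omega>"
  have i: "integrable ?M (\<lambda>x. \<alpha> + \<beta> \<bullet> x)" by (intro integrable_continuous_lebesgue_on \<Omega> continuous_intros)
  \<comment> \<open>Measurability of \<open>u\<close> comes from the completeness of Lebesgue
    measure: extended by zero, \<open>u\<close> agrees almost everywhere with a measurable
    function.\<close>
  have "(\<lambda>x. if x \<in> \<Omega> then \<alpha> + \<beta> \<bullet> x else 0) \<in> borel_measurable lebesgue"
    using borel_measurable_integrable[OF i] measurable_restrict_space_iff[of \<Omega> lebesgue 0 borel "\<lambda>x. \<alpha> + \<beta> \<bullet> x"] \<Omega>(1) by simp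
  moreover have "AE x in lebesgue. (if x \<in> \<Omega> then \<alpha> + \<beta> \<bullet> x else 0) = (if x \<in> \<Omega> then u x else 0)"
    using eq[unfolded AE_lebesgue_on_iff[OF \<Omega>(1)]] unfolding AE_completion_iff by eventually_elim auto
  ultimately have "(\<lambda>x. if x \<in> \<Omega> then u x else 0) \<in> borel_measurable lebesgue" by (rule borel_measurable_AE)
  then have "u \<in> borel_measurable ?M"
    using measurable_restrict_space_iff[of \<Omega> lebesgue 0 borel u] \<Omega>(1) by simp
  then show ?thesis
    using integrable_cong_AE[OF _ borel_measurable_integrable[OF i] eq] i by blast
qed

lemma distr_grad_affine_AE:
  fixes \<Omega> :: "(real^'d) set"
  assumes \<Omega>: "open \<Omega>" "bounded \<Omega>" and eq: "AE x in lebesgue_on \<Omega>. u x = \<alpha> + \<beta> \<bullet> x" and v: "v \<in> test_functions \<Omega>"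
  shows "distr_grad \<Omega> u v = (\<integral>x. \<beta> \<bullet> v x \<partial>lborel)"
proof -
  have "distr_grad \<Omega> u v = distr_grad \<Omega> (\<lambda>x. \<alpha> + \<beta> \<bullet> x) v"
    by (rule distr_grad_cong_AE[OF borel_measurable_integrable[OF integrable_affine_AE[OF \<Omega> eq]]
          borel_measurable_lebesgue_on eq test_functionD(1)[OF v]]) simp
  then show ?thesis using distr_grad_affine[OF \<Omega>(1) v] by simp
qed

lemma finite_radon_measure_density:
  fixes T :: "(real^'d, 'b::euclidean_space) distribution"
  assumes \<Omega>: "open \<Omega>" "bounded \<Omega>" and T: "\<And>v. v \<in> test_functions \<Omega> \<Longrightarrow> T v = (\<integral>x. \<beta> \<bullet> v x \<partial>lborel)"
  shows "finite_radon_measure \<Omega> T"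
  unfolding finite_radon_measure_def
proof (intro exI[of _ "restrict_space lborel \<Omega>"] exI[of _ "\<lambda>x. \<beta>"] conjI ballI)
  have s: "\<Omega> \<inter> space lborel \<in> sets lborel" using \<Omega>(1) by simp
  show fin: "finite_measure (restrict_space lborel \<Omega>)"
    by (rule finite_measureI)
       (use emeasure_bounded_finite[OF \<Omega>(2)] \<Omega>(1) in \<open>simp add: emeasure_restrict_space space_restrict_space\<close>)
  show "sets (restrict_space lborel \<Omega>) = sets (restrict_space borel \<Omega>)"
    by (rule sets_restrict_space_cong) simp
  show "integrable (restrict_space lborel \<Omega>) (\<lambda>x. \<beta>)"
    using fin by (rule finite_measure.integrable_const)
  fix v :: "real^'d \<Rightarrow> 'b" assume v: "v \<in> test_functions \<Omega>"
  have "(LINT x|restrict_space lborel \<Omega>. \<beta> \<bullet> v x) = (\<integral>x. indicator \<Omega> x *\<^sub>R (\<beta> \<bullet> v x) \<partial>lborel)"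
    by (rule integral_restrict_space[OF s])
  also have "\<dots> = (\<integral>x. \<beta> \<bullet> v x \<partial>lborel)"
    by (intro Bochner_Integration.integral_cong refl) (use test_functionD(2)[OF v] in \<open>auto simp: indicator_def\<close>)
  finally show "T v = (LINT x|restrict_space lborel \<Omega>. \<beta> \<bullet> v x)" using T[OF v] by simp
qed

lemma const_in_BD:
  fixes \<Omega> :: "(real^'d) set"
  assumes \<Omega>: "open \<Omega>" "bounded \<Omega>" shows "(\<lambda>x. \<beta>) \<in> BD \<Omega>"
proof -
  have "finite_radon_measure \<Omega> (distr_sym_grad \<Omega> (\<lambda>x. \<beta>))"
    by (rule finite_radon_measure_density[OF \<Omega>, of _ 0]) (simp add: distr_sym_grad_const[OF \<Omega>(1)])
  then show ?thesis
    by (simp add: BD_def integrable_continuous_lebesgue_on[OF \<Omega>])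
qed

lemma TGV2_nonneg:
  fixes u :: "real^'d \<Rightarrow> real"
  assumes "\<alpha> > 0" "\<beta> > 0" shows "0 \<le> TGV2 \<Omega> \<beta> \<alpha> u"
  unfolding TGV2_def
proof (rule INF_greatest)
  fix w :: "real^'d \<Rightarrow> real^'d"
  have "0 \<le> radon_norm \<Omega> (\<lambda>v. distr_grad \<Omega> u v - distr_of_fun \<Omega> w v)"
    by (rule radon_norm_nonneg) (simp add: distr_grad_zero_test distr_of_fun_def)
  moreover have "0 \<le> radon_norm \<Omega> (distr_sym_grad \<Omega> w)"
    by (rule radon_norm_nonneg) (rule distr_sym_grad_zero_test)
  ultimately show "0 \<le> ereal \<alpha> * radon_norm \<Omega> (\<lambda>v. distr_grad \<Omega> u v - distr_of_fun \<Omega> w v) + ereal \<beta> * radon_norm \<Omega> (distr_sym_grad \<Omega> w)"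
    using assms by (intro add_nonneg_nonneg ereal_0_le_mult) auto
qed

text \<open>The gradient \<open>c\<close> itself, as a constant field, is a competitor for which
  both Radon norms vanish.\<close>

lemma affine_AE_BV_TGV2:
  fixes \<Omega> :: "(real^'d) set"
  assumes \<Omega>: "open \<Omega>" "bounded \<Omega>" and eq: "AE x in lebesgue_on \<Omega>. u x = e + c \<bullet> x" and "\<alpha> > 0" "\<beta> > 0"
  shows "u \<in> BV \<Omega>" "TGV2 \<Omega> \<beta> \<alpha> u = 0"
proof -
  note d = distr_grad_affine_AE[OF \<Omega> eq]
  show "u \<in> BV \<Omega>"
    using integrable_affine_AE[OF \<Omega> eq] finite_radon_measure_density[OF \<Omega> d] by (simp add: BV_def)
  have "distr_of_fun \<Omega> (\<lambda>x. c) v = (\<integral>x. c \<bullet> v x \<partial>lborel)" if v: "v \<in> test_functions \<Omega>" for v :: "real^'d \<Rightarrow> real^'d"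
    unfolding distr_of_fun_def
    by (rule integral_lebesgue_on_eq_lborel)
       (use \<Omega>(1) test_functionD(2)[OF v] borel_measurable_continuous_onI[OF smooth_continuous[OF test_functionD(1)[OF v]]] in auto)
  then have "radon_norm \<Omega> (\<lambda>v. distr_grad \<Omega> u v - distr_of_fun \<Omega> (\<lambda>x. c) v) = 0"
    using d by (intro radon_norm_eq_0) simp
  moreover have "radon_norm \<Omega> (distr_sym_grad \<Omega> (\<lambda>x. c)) = 0"
    by (rule radon_norm_eq_0) (rule distr_sym_grad_const[OF \<Omega>(1)])
  ultimately have "TGV2 \<Omega> \<beta> \<alpha> u \<le> 0"
    unfolding TGV2_def using const_in_BD[OF \<Omega>, of c] by (intro INF_lower2[of "\<lambda>x. c"]) auto
  then show "TGV2 \<Omega> \<beta> \<alpha> u = 0" using TGV2_nonneg[OF assms(4,5)] by (intro antisym)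
qed

text \<open>For each \<open>w\<close> the two Radon norms, when finite, are the best choices of
  \<open>a\<close> and \<open>b\<close>; as \<open>C\<close> is at most either parameter, C (a + b)
  is at most the weighted sum. If one of them is infinite, so is the weighted sum, because the
  parameters are positive.\<close>

lemma TGV2_ge_pairing:
  fixes \<Omega> :: "(real^'d) set"
  assumes u: "integrable (lebesgue_on \<Omega>) u" and C: "C \<ge> 0" "C \<le> \<alpha>" "C \<le> \<beta>" "\<alpha> > 0" "\<beta> > 0"
    and est: "\<And>w a b. integrable (lebesgue_on \<Omega>) w \<Longrightarrow>
      (\<And>v. v \<in> test_functions \<Omega> \<Longrightarrow> (\<And>x. norm (v x) \<le> 1) \<Longrightarrow> distr_grad \<Omega> u v - distr_of_fun \<Omega> w v \<le> a) \<Longrightarrow>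
      (\<And>V. V \<in> test_functions \<Omega> \<Longrightarrow> (\<And>x. norm (V x) \<le> 1) \<Longrightarrow> distr_sym_grad \<Omega> w V \<le> b) \<Longrightarrow> P \<le> C * (a + b)"
  shows "ereal P \<le> TGV2 \<Omega> \<beta> \<alpha> u"
  unfolding TGV2_def
proof (rule INF_greatest)
  fix w :: "real^'d \<Rightarrow> real^'d" assume w: "w \<in> BD \<Omega>"
  let ?T = "\<lambda>v. distr_grad \<Omega> u v - distr_of_fun \<Omega> w v"
  let ?r1 = "radon_norm \<Omega> ?T" and ?r2 = "radon_norm \<Omega> (distr_sym_grad \<Omega> w)"
  have r1: "0 \<le> ?r1" by (rule radon_norm_nonneg) (simp add: distr_grad_zero_test distr_of_fun_def)
  have r2: "0 \<le> ?r2" by (rule radon_norm_nonneg) (rule distr_sym_grad_zero_test)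
  show "ereal P \<le> ereal \<alpha> * ?r1 + ereal \<beta> * ?r2"
  proof (cases "?r1 = \<infinity> \<or> ?r2 = \<infinity>")
    case True
    then have eq: "ereal \<alpha> * ?r1 + ereal \<beta> * ?r2 = \<infinity>"
      using C(4,5) r1 r2 by auto
    show ?thesis unfolding eq by simp
  next
    case False
    then obtain a b where ab: "?r1 = ereal a" "?r2 = ereal b" using r1 r2 by (cases ?r1; cases ?r2) auto
    then have ab0: "0 \<le> a" "0 \<le> b" using r1 r2 by auto
    have "P \<le> C * (a + b)"
    proof (rule est)
      show "integrable (lebesgue_on \<Omega>) w" using w by (simp add: BD_def)
      show "?T v \<le> a" if "v \<in> test_functions \<Omega>" "\<And>x. norm (v x) \<le> 1" for v
        using radon_norm_upper[of v \<Omega> ?T, OF that] ab(1) by simp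
      show "distr_sym_grad \<Omega> w V \<le> b" if "V \<in> test_functions \<Omega>" "\<And>x. norm (V x) \<le> 1" for V
        using radon_norm_upper[of V \<Omega> "distr_sym_grad \<Omega> w", OF that] ab(2) by simp
    qed
    also have "\<dots> \<le> \<alpha> * a + \<beta> * b"
      using mult_right_mono[OF C(2) ab0(1)] mult_right_mono[OF C(3) ab0(2)] by (simp add: distrib_left)
    finally show ?thesis by (simp add: ab)
  qed
qed

section \<open>Completing the square\<close>

lemma Lp_norm_2_squared_real:
  assumes "integrable (lebesgue_on \<Omega>) (\<lambda>x. (h x)\<^sup>2)"
  shows "(Lp_norm \<Omega> 2 h)\<^sup>2 = ereal (LINT x|lebesgue_on \<Omega>. (h x)\<^sup>2)"
  unfolding Lp_norm_2_squared
  by (subst nn_integral_eq_integral[OF assms]) auto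

lemma integrable_diff_square:
  fixes f g :: "'a \<Rightarrow> real"
  assumes "f \<in> borel_measurable M" "g \<in> borel_measurable M"
    and "integrable M (\<lambda>x. (f x)\<^sup>2)" "integrable M (\<lambda>x. (g x)\<^sup>2)"
  shows "integrable M (\<lambda>x. (f x - g x)\<^sup>2)"
proof -
  have "integrable M (\<lambda>x. (f x)\<^sup>2 - 2 * (f x * g x) + (g x)\<^sup>2)"
    using integrable_mult_of_squares[OF assms] assms(3,4) by auto
  then show ?thesis by (simp add: power2_diff algebra_simps)
qed

lemma integral_add_square:
  fixes g k :: "'a \<Rightarrow> real"
  assumes "g \<in> borel_measurable M" "k \<in> borel_measurable M"
    and "integrable M (\<lambda>x. (g x)\<^sup>2)" "integrable M (\<lambda>x. (k x)\<^sup>2)"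
  shows "(LINT x|M. (g x + k x)\<^sup>2) = (LINT x|M. (g x)\<^sup>2) + 2 * (LINT x|M. g x * k x) + (LINT x|M. (k x)\<^sup>2)"
proof -
  note gk = integrable_mult_of_squares[OF assms]
  have "(LINT x|M. (g x + k x)\<^sup>2) = (LINT x|M. (g x)\<^sup>2 + 2 * (g x * k x) + (k x)\<^sup>2)"
    by (intro Bochner_Integration.integral_cong refl) (simp add: power2_sum)
  also have "\<dots> = (LINT x|M. (g x)\<^sup>2) + 2 * (LINT x|M. g x * k x) + (LINT x|M. (k x)\<^sup>2)"
    using assms(3,4) gk by simp
  finally show ?thesis .
qed

text \<open>Members of BV are functions and not classes, so a minimiser is determined only up to
  null sets, whereas an affine function is determined by its values almost everywhere on \<Omega>.
  Hence one equivalence ends in an equality and the other in an equality almost everywhere.\<close>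

lemma tgv_solution_iff_best_affine:
  fixes \<Omega> :: "(real^'d) set"
  assumes \<Omega>: "\<Omega> \<noteq> {}" "bounded \<Omega>" "open \<Omega>" "connected \<Omega>" "lipschitz_boundary \<Omega>"
    and fm: "f \<in> borel_measurable (lebesgue_on \<Omega>)" and f2: "integrable (lebesgue_on \<Omega>) (\<lambda>x. (f x)\<^sup>2)"
    and fb: "CARD('d) = 2 \<or> (\<exists>B. AE x in lebesgue_on \<Omega>. \<bar>f x\<bar> \<le> B)"
  shows "\<exists>fstar. (\<forall>\<phi>. is_best_affine \<Omega> f \<phi> \<longleftrightarrow> \<phi> = fstar) \<and>
           (\<exists>\<alpha>s>0. \<exists>\<beta>s>0. \<forall>\<alpha>>\<alpha>s. \<forall>\<beta>>\<beta>s. \<forall>u.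
              TGV_solution \<Omega> f \<beta> \<alpha> u \<longleftrightarrow> (AE x in lebesgue_on \<Omega>. u x = fstar x))"
proof -
  let ?M = "lebesgue_on \<Omega>"
  obtain e c where orth0: "\<And>a b. (LINT x|?M. (f x - (e + c \<bullet> x)) * (a + b \<bullet> x)) = 0"
    using affine_projection_exists[OF \<Omega>(3,2,1) fm f2] by blast
  define fstar where "fstar x = e + c \<bullet> x" for x
  define g where "g x = f x - fstar x" for x
  have aff_m: "(\<lambda>x. a + b \<bullet> x) \<in> borel_measurable ?M" for a b
    by (rule borel_measurable_lebesgue_on) simp
  have aff_2: "integrable ?M (\<lambda>x. (a + b \<bullet> x)\<^sup>2)" for a b
    by (intro integrable_continuous_lebesgue_on \<Omega> continuous_intros)
  have orth: "(LINT x|?M. g x * (a + b \<bullet> x)) = 0" for a b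
    using orth0[of a b] by (simp add: g_def fstar_def)
  have gm: "g \<in> borel_measurable ?M"
    unfolding g_def fstar_def by (intro borel_measurable_diff fm aff_m)
  have g2: "integrable ?M (\<lambda>x. (g x)\<^sup>2)"
    unfolding g_def fstar_def by (intro integrable_diff_square fm aff_m f2 aff_2)
  let ?G = "LINT x|?M. (g x)\<^sup>2"

  \<comment> \<open>Pythagoras: \<open>g\<close> is orthogonal to affine functions, so the cross
    term vanishes and the distance to an affine function splits.\<close>
  have dist_affine: "(Lp_norm \<Omega> 2 (\<lambda>x. f x - \<phi> x))\<^sup>2 = ereal (?G + (LINT x|?M. ((e - a) + (c - b) \<bullet> x)\<^sup>2))"
    if \<phi>: "\<And>x. \<phi> x = a + b \<bullet> x" for \<phi> a b
  proof -
    have eq: "f x - \<phi> x = g x + ((e - a) + (c - b) \<bullet> x)" for x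
      by (simp add: g_def fstar_def \<phi> inner_diff_left)
    have i: "integrable ?M (\<lambda>x. (f x - \<phi> x)\<^sup>2)"
      unfolding \<phi> by (intro integrable_diff_square fm aff_m f2 aff_2)
    show ?thesis
      unfolding Lp_norm_2_squared_real[OF i] unfolding eq
      using integral_add_square[OF gm aff_m g2 aff_2, of "e - a" "c - b"] by (simp add: orth)
  qed
  have dist_star: "(Lp_norm \<Omega> 2 (\<lambda>x. f x - fstar x))\<^sup>2 = ereal ?G"
    unfolding dist_affine[of fstar e c, OF fstar_def] by simp

  have aff_star: "affine_function fstar"
    unfolding affine_function_def fstar_def by (metis add.commute)
  have best: "is_best_affine \<Omega> f \<phi> \<longleftrightarrow> \<phi> = fstar" for \<phi>
  proof
    assume "is_best_affine \<Omega> f \<phi>"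
    then have "affine_function \<phi>" and min: "\<not> (Lp_norm \<Omega> 2 (\<lambda>x. f x - fstar x))\<^sup>2 < (Lp_norm \<Omega> 2 (\<lambda>x. f x - \<phi> x))\<^sup>2"
      using aff_star unfolding is_best_affine_def is_arg_min_def by blast+
    then obtain a b where \<phi>: "\<And>x. \<phi> x = a + b \<bullet> x"
      unfolding affine_function_def by (metis add.commute)
    have "(LINT x|?M. ((e - a) + (c - b) \<bullet> x)\<^sup>2) \<le> 0" using min unfolding dist_affine[OF \<phi>] dist_star by simp
    moreover have "0 \<le> (LINT x|?M. ((e - a) + (c - b) \<bullet> x)\<^sup>2)" by simp
    ultimately have "(LINT x|?M. ((e - a) + (c - b) \<bullet> x)\<^sup>2) = 0" by linarith
    then have "AE x in ?M. ((e - a) + (c - b) \<bullet> x)\<^sup>2 = 0"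
      using integral_nonneg_eq_0_iff_AE[OF aff_2] by simp
    then have "AE x in ?M. (e - a) + (c - b) \<bullet> x = 0" by eventually_elim simp
    from affine_AE_zero[OF \<Omega>(3,1) this] show "\<phi> = fstar" by (auto simp: \<phi> fstar_def)
  next
    assume "\<phi> = fstar"
    moreover have "\<not> (Lp_norm \<Omega> 2 (\<lambda>x. f x - \<psi> x))\<^sup>2 < (Lp_norm \<Omega> 2 (\<lambda>x. f x - fstar x))\<^sup>2" if aff: "affine_function \<psi>" for \<psi>
    proof -
      obtain a b where \<psi>: "\<And>x. \<psi> x = a + b \<bullet> x"
        using aff unfolding affine_function_def by (metis add.commute)
      show ?thesis unfolding dist_affine[OF \<psi>] dist_star by (simp add: not_less)
    qed
    ultimately show "is_best_affine \<Omega> f \<phi>" unfolding is_best_affine_def is_arg_min_def using aff_star by blast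
  qed

  have gb: "CARD('d) = 2 \<or> (\<exists>B. AE x in ?M. \<bar>g x\<bar> \<le> B)"
  proof (cases "CARD('d) = 2")
    case False
    then obtain B where B: "AE x in ?M. \<bar>f x\<bar> \<le> B" using fb by blast
    obtain R where R: "\<And>x. x \<in> \<Omega> \<Longrightarrow> norm x \<le> R" using \<Omega>(2) unfolding bounded_iff by blast
    have "\<bar>fstar x\<bar> \<le> \<bar>e\<bar> + norm c * R" if "x \<in> \<Omega>" for x
      using Cauchy_Schwarz_ineq2[of c x] mult_left_mono[OF R[OF that] norm_ge_zero[of c]] unfolding fstar_def by linarith
    then have "AE x in ?M. \<bar>fstar x\<bar> \<le> \<bar>e\<bar> + norm c * R" by (intro AE_I2) (simp add: space_restrict_space)
    with B have "AE x in ?M. \<bar>g x\<bar> \<le> B + (\<bar>e\<bar> + norm c * R)"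
      by eventually_elim (simp add: g_def)
    then show ?thesis by blast
  qed simp
  obtain C where C: "C \<ge> 0" and pair: "\<And>u w a b. integrable ?M u \<Longrightarrow> integrable ?M w \<Longrightarrow>
     (\<forall>v\<in>test_functions \<Omega>. (\<forall>x. norm (v x) \<le> 1) \<longrightarrow> distr_grad \<Omega> u v - distr_of_fun \<Omega> w v \<le> a) \<Longrightarrow>
     (\<forall>V\<in>test_functions \<Omega>. (\<forall>x. norm (V x) \<le> 1) \<longrightarrow> distr_sym_grad \<Omega> w V \<le> b) \<Longrightarrow>
     (\<exists>\<alpha> \<beta>. (\<integral>\<^sup>+x. ennreal \<bar>g x * (u x - (\<alpha> + \<beta> \<bullet> x))\<bar> \<partial>?M) \<le> ennreal (C * (a + b)))"
    using pairing_estimate[OF \<Omega> gm g2 gb] by blast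

  let ?J = "\<lambda>\<alpha> \<beta> u. ereal (1 / 2) * (Lp_norm \<Omega> 2 (\<lambda>x. f x - u x))\<^sup>2 + TGV2 \<Omega> \<beta> \<alpha> u"
  \<comment> \<open>The energy of \<open>fstar\<close> is a lower bound, and reaching it forces the
    squared norm of u - fstar to vanish. The second part is what gives uniqueness.\<close>
  have lower: "?J \<alpha> \<beta> u \<ge> ereal (?G / 2) \<and> (?J \<alpha> \<beta> u \<le> ereal (?G / 2) \<longrightarrow> (AE x in ?M. u x = fstar x))"
    if u: "u \<in> BV \<Omega>" and \<alpha>\<beta>: "\<alpha> > C + 1" "\<beta> > C + 1" for u \<alpha> \<beta>
  proof (cases "integrable ?M (\<lambda>x. (f x - u x)\<^sup>2)")
    case False
    have ui: "integrable ?M u" using u by (simp add: BV_def)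
    have "(\<integral>\<^sup>+x. ennreal ((f x - u x)\<^sup>2) \<partial>?M) = \<infinity>"
      using False integrable_square_iff[OF borel_measurable_diff[OF fm borel_measurable_integrable[OF ui]]]
      by (simp flip: top.not_eq_extremum)
    then have "(Lp_norm \<Omega> 2 (\<lambda>x. f x - u x))\<^sup>2 = \<infinity>" unfolding Lp_norm_2_squared by simp
    moreover have "0 \<le> TGV2 \<Omega> \<beta> \<alpha> u" using \<alpha>\<beta> C by (intro TGV2_nonneg) auto
    ultimately have J: "?J \<alpha> \<beta> u = \<infinity>" by auto
    show ?thesis unfolding J by simp
  next
    case True
    have ui: "integrable ?M u" using u by (simp add: BV_def)
    note um = borel_measurable_integrable[OF ui]
    define h where "h x = u x - fstar x" for x
    have hm: "h \<in> borel_measurable ?M" unfolding h_def fstar_def by (intro borel_measurable_diff um aff_m)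
    \<comment> \<open>The integrand is the square of \<open>h\<close>. So \<open>h\<close> is square
      integrable although \<open>u\<close> is a priori only integrable.\<close>
    have "integrable ?M (\<lambda>x. (g x - (f x - u x))\<^sup>2)"
      by (intro integrable_diff_square gm g2 True borel_measurable_diff fm um)
    then have h2: "integrable ?M (\<lambda>x. (h x)\<^sup>2)" by (simp add: g_def h_def)
    have gh: "integrable ?M (\<lambda>x. g x * h x)" by (rule integrable_mult_of_squares[OF gm hm g2 h2])
    have "(LINT x|?M. (f x - u x)\<^sup>2) = (LINT x|?M. (g x + - h x)\<^sup>2)" by (simp add: g_def h_def)
    also have "\<dots> = ?G - 2 * (LINT x|?M. g x * h x) + (LINT x|?M. (h x)\<^sup>2)"
      by (subst integral_add_square) (use gm hm g2 h2 in auto)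
    finally have sq: "(LINT x|?M. (f x - u x)\<^sup>2) = ?G - 2 * (LINT x|?M. g x * h x) + (LINT x|?M. (h x)\<^sup>2)" .
    have tgv: "ereal (LINT x|?M. g x * h x) \<le> TGV2 \<Omega> \<beta> \<alpha> u"
    proof (rule TGV2_ge_pairing[OF ui C])
      fix w a b
      assume w: "integrable ?M w"
        and a: "\<And>v. v \<in> test_functions \<Omega> \<Longrightarrow> (\<And>x. norm (v x) \<le> 1) \<Longrightarrow> distr_grad \<Omega> u v - distr_of_fun \<Omega> w v \<le> a"
        and b: "\<And>V. V \<in> test_functions \<Omega> \<Longrightarrow> (\<And>x. norm (V x) \<le> 1) \<Longrightarrow> distr_sym_grad \<Omega> w V \<le> b"
      have ab: "0 \<le> a" "0 \<le> b"
        using a[OF zero_test_function] b[OF zero_test_function]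
        by (simp_all add: distr_grad_zero_test distr_sym_grad_zero_test distr_of_fun_def)
      obtain \<alpha>' \<beta>' where e': "(\<integral>\<^sup>+x. ennreal \<bar>g x * (u x - (\<alpha>' + \<beta>' \<bullet> x))\<bar> \<partial>?M) \<le> ennreal (C * (a + b))"
        using pair[OF ui w] a b by blast
      have k: "integrable ?M (\<lambda>x. g x * ((e - \<alpha>') + (c - \<beta>') \<bullet> x))"
        by (rule integrable_mult_of_squares[OF gm aff_m g2 aff_2])
      \<comment> \<open>By orthogonality the affine function supplied by the pairing estimate may be
        replaced by \<open>fstar\<close> without changing the pairing with \<open>g\<close>.\<close>
      have eq: "g x * (u x - (\<alpha>' + \<beta>' \<bullet> x)) = g x * h x + g x * ((e - \<alpha>') + (c - \<beta>') \<bullet> x)" for x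
        by (simp add: h_def fstar_def algebra_simps)
      have "(LINT x|?M. g x * (u x - (\<alpha>' + \<beta>' \<bullet> x))) = (LINT x|?M. g x * h x)"
        unfolding eq using gh k by (simp add: orth)
      moreover have i: "integrable ?M (\<lambda>x. g x * (u x - (\<alpha>' + \<beta>' \<bullet> x)))"
        unfolding eq by (rule Bochner_Integration.integrable_add[OF gh k])
      have "ennreal (norm (LINT x|?M. g x * (u x - (\<alpha>' + \<beta>' \<bullet> x)))) \<le> ennreal (C * (a + b))"
        using integral_norm_bound_ennreal[OF i] e' by simp
      then have "\<bar>LINT x|?M. g x * (u x - (\<alpha>' + \<beta>' \<bullet> x))\<bar> \<le> C * (a + b)"
        using C ab by (simp add: ennreal_le_iff)
      ultimately show "(LINT x|?M. g x * h x) \<le> C * (a + b)" by linarith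
    qed (use \<alpha>\<beta> C in auto)
    \<comment> \<open>The pairing of \<open>g\<close> with \<open>h\<close>, which the expanded
      square contributes with a minus sign, is returned by the lower bound for
      \<open>TGV2\<close>.\<close>
    have "ereal (?G / 2 + (LINT x|?M. (h x)\<^sup>2) / 2) = ereal ((LINT x|?M. (f x - u x)\<^sup>2) / 2) + ereal (LINT x|?M. g x * h x)"
      by (simp add: sq field_simps)
    also have "\<dots> \<le> ?J \<alpha> \<beta> u"
      unfolding Lp_norm_2_squared_real[OF True] using tgv by (intro add_mono) auto
    finally have J: "ereal (?G / 2 + (LINT x|?M. (h x)\<^sup>2) / 2) \<le> ?J \<alpha> \<beta> u" .
    have nn: "0 \<le> (LINT x|?M. (h x)\<^sup>2)" by simp
    have "ereal (?G / 2) \<le> ereal (?G / 2 + (LINT x|?M. (h x)\<^sup>2) / 2)" using nn by simp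
    then have 1: "ereal (?G / 2) \<le> ?J \<alpha> \<beta> u" using J by (rule order_trans)
    have 2: "AE x in ?M. u x = fstar x" if "?J \<alpha> \<beta> u \<le> ereal (?G / 2)"
    proof -
      have "ereal (?G / 2 + (LINT x|?M. (h x)\<^sup>2) / 2) \<le> ereal (?G / 2)" using J that by (rule order_trans)
      then have "(LINT x|?M. (h x)\<^sup>2) = 0" using nn by simp
      then have "AE x in ?M. (h x)\<^sup>2 = 0" using integral_nonneg_eq_0_iff_AE[OF h2] by simp
      then show ?thesis by eventually_elim (simp add: h_def)
    qed
    show ?thesis using 1 2 by blast
  qed

  have attained: "u \<in> BV \<Omega> \<and> ?J \<alpha> \<beta> u = ereal (?G / 2)"
    if "AE x in ?M. u x = fstar x" "\<alpha> > 0" "\<beta> > 0" for u \<alpha> \<beta>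
  proof -
    have "(\<integral>\<^sup>+x. ennreal ((f x - u x)\<^sup>2) \<partial>?M) = (\<integral>\<^sup>+x. ennreal ((f x - fstar x)\<^sup>2) \<partial>?M)"
      by (rule nn_integral_cong_AE) (use that(1) in eventually_elim, simp)
    then have "(Lp_norm \<Omega> 2 (\<lambda>x. f x - u x))\<^sup>2 = ereal ?G"
      using dist_star by (simp only: Lp_norm_2_squared)
    then show ?thesis
      using affine_AE_BV_TGV2[OF \<Omega>(3,2) that(1)[unfolded fstar_def] that(2,3)] by simp
  qed

  have sol: "TGV_solution \<Omega> f \<beta> \<alpha> u \<longleftrightarrow> (AE x in ?M. u x = fstar x)" if \<alpha>\<beta>: "\<alpha> > C + 1" "\<beta> > C + 1" for u \<alpha> \<beta>
  proof
    have pos: "\<alpha> > 0" "\<beta> > 0" using \<alpha>\<beta> C by auto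
    {
      assume "TGV_solution \<Omega> f \<beta> \<alpha> u"
      then have u: "u \<in> BV \<Omega>" and min: "\<And>y. y \<in> BV \<Omega> \<Longrightarrow> \<not> ?J \<alpha> \<beta> y < ?J \<alpha> \<beta> u"
        unfolding TGV_solution_def is_arg_min_def by blast+
      have "?J \<alpha> \<beta> u \<le> ereal (?G / 2)"
        using attained[of fstar \<alpha> \<beta>] min[of fstar] pos by (simp add: not_less)
      then show "AE x in ?M. u x = fstar x" using lower[OF u \<alpha>\<beta>] by blast
    next
      assume "AE x in ?M. u x = fstar x"
      from attained[OF this pos] have u: "u \<in> BV \<Omega>" "?J \<alpha> \<beta> u = ereal (?G / 2)" by auto
      have "\<not> ?J \<alpha> \<beta> y < ?J \<alpha> \<beta> u" if "y \<in> BV \<Omega>" for y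
        using lower[OF that \<alpha>\<beta>] unfolding u(2) by (simp add: not_less)
      then show "TGV_solution \<Omega> f \<beta> \<alpha> u"
        unfolding TGV_solution_def is_arg_min_def using u(1) by blast
    }
  qed
  \<comment> \<open>The thresholds are taken to be C + 1 so that they are positive even if C =
    0.\<close>
  have "C + 1 > 0" using C by simp
  then show ?thesis using best sol by blast
qed

lemma Lp_infinity_AE_bound:
  assumes "f \<in> Lp_space \<Omega> \<infinity>"
  shows "f \<in> borel_measurable (lebesgue_on \<Omega>)" "\<exists>B. AE x in lebesgue_on \<Omega>. \<bar>f x\<bar> \<le> B"
proof -
  show "f \<in> borel_measurable (lebesgue_on \<Omega>)" using assms by (simp add: Lp_space_def)
  have "esssup (lebesgue_on \<Omega>) (\<lambda>x. ereal \<bar>f x\<bar>) < \<infinity>" using assms by (simp add: Lp_space_def Lp_norm_def)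
  then have "esssup (lebesgue_on \<Omega>) (\<lambda>x. ereal \<bar>f x\<bar>) \<noteq> \<infinity>" by (rule less_imp_neq)
  then obtain n :: nat where n: "esssup (lebesgue_on \<Omega>) (\<lambda>x. ereal \<bar>f x\<bar>) < ereal n"
    unfolding less_PInf_Ex_of_nat by (elim exE)
  have "AE x in lebesgue_on \<Omega>. \<bar>f x\<bar> \<le> real n"
    using esssup_AE[where M = "lebesgue_on \<Omega>" and f = "\<lambda>x. ereal \<bar>f x\<bar>"]
  proof eventually_elim
    case (elim x)
    then have "ereal \<bar>f x\<bar> \<le> ereal n" using n by (meson less_imp_le order_trans)
    then show ?case by simp
  qed
  then show "\<exists>B. AE x in lebesgue_on \<Omega>. \<bar>f x\<bar> \<le> B" by blast
qed

lemma bounded_AE_integrable_square: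
  fixes f :: "'a::euclidean_space \<Rightarrow> real"
  assumes \<Omega>: "open \<Omega>" "bounded \<Omega>" and fm: "f \<in> borel_measurable (lebesgue_on \<Omega>)" and B: "AE x in lebesgue_on \<Omega>. \<bar>f x\<bar> \<le> B"
  shows "integrable (lebesgue_on \<Omega>) (\<lambda>x. (f x)\<^sup>2)"
proof (rule Bochner_Integration.integrable_bound)
  show "integrable (lebesgue_on \<Omega>) (\<lambda>x. B\<^sup>2)" by (intro integrable_continuous_lebesgue_on \<Omega> continuous_intros)
  show "AE x in lebesgue_on \<Omega>. norm ((f x)\<^sup>2) \<le> norm (B\<^sup>2)"
    using B
  proof eventually_elim
    case (elim x)
    then show ?case using power_mono[OF elim abs_ge_zero, of 2] by simp
  qed
qed (use fm in measurable)

theorem proposition6: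
  fixes \<Omega> :: "(real^'d) set" and f :: "real^'d \<Rightarrow> real"
  assumes "\<Omega> \<noteq> {}" "bounded \<Omega>" "open \<Omega>" "connected \<Omega>" "lipschitz_boundary \<Omega>"
    and "(CARD('d) = 2 \<and> f \<in> BV \<Omega>) \<or>
         (CARD('d) > 2 \<and> f \<in> Lp_space \<Omega> \<infinity> \<inter> BV \<Omega> \<and>
          (\<exists>p C. ereal (real CARD('d)) \<le> p \<and> (0::real) < C \<and>
             (\<forall>\<alpha>>0. \<forall>\<beta>>0. \<forall>u. TGV_solution \<Omega> f \<beta> \<alpha> u \<longrightarrow>
                Lp_norm \<Omega> p u \<le> ereal C * Lp_norm \<Omega> p f)))"
  shows "\<exists>fstar. (\<forall>\<phi>. is_best_affine \<Omega> f \<phi> \<longleftrightarrow> \<phi> = fstar) \<and>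
           (\<exists>\<alpha>s>0. \<exists>\<beta>s>0. \<forall>\<alpha>>\<alpha>s. \<forall>\<beta>>\<beta>s. \<forall>u.
              TGV_solution \<Omega> f \<beta> \<alpha> u \<longleftrightarrow> (AE x in lebesgue_on \<Omega>. u x = fstar x))"
proof (rule tgv_solution_iff_best_affine[OF assms(1-5)])
  \<comment> \<open>In both branches \<open>f\<close> is square integrable: in the plane by the
    embedding of BV, otherwise because a bounded function on a bounded domain is.\<close>
  consider "CARD('d) = 2" "f \<in> BV \<Omega>" | "f \<in> Lp_space \<Omega> \<infinity>" using assms(6) by blast
  then have "f \<in> borel_measurable (lebesgue_on \<Omega>) \<and> integrable (lebesgue_on \<Omega>) (\<lambda>x. (f x)\<^sup>2) \<and>
    (CARD('d) = 2 \<or> (\<exists>B. AE x in lebesgue_on \<Omega>. \<bar>f x\<bar> \<le> B))"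
  proof cases
    case 1
    then show ?thesis using BV_integrable_square[OF assms(2,3,5)] by (auto simp: BV_def)
  next
    case 2
    from Lp_infinity_AE_bound[OF 2] show ?thesis using bounded_AE_integrable_square[OF assms(3,2)] by blast
  qed
  then show "f \<in> borel_measurable (lebesgue_on \<Omega>)" "integrable (lebesgue_on \<Omega>) (\<lambda>x. (f x)\<^sup>2)"
    "CARD('d) = 2 \<or> (\<exists>B. AE x in lebesgue_on \<Omega>. \<bar>f x\<bar> \<le> B)" by auto
qed

end
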